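(* Let $A$ be a chain algebra over $k$, let $\Lambda V\to A$ be a free model of $A$ (a surjective quasi-isomorphism of chain algebras with $\Lambda V$ free), and let $M(\Lambda V)$ be the double mixed complex of $\Gamma$-differential forms of $\Lambda V$. Then there are spectral sequences $$E^2_{p,q}=HH^{q}_{p+q}(M(\Lambda V))\Rightarrow \widehat{HH}_{p+q}(A),\qquad {E'}^2_{p,q}=HC^{q}_{p+q}(M(\Lambda V))\Rightarrow \widehat{HC}_{p+q}(A).$$ Furthermore, for the Hodge filtration, $E^\infty_{p,q}=\widehat{HH}{}^{q}_{p+q}(A)$ and ${E'}^\infty_{p,q}=\widehat{HC}{}^{q}_{p+q}(A)$.
   Context: Fix a commutative unital ground ring $k$. **Chain algebras.** A chain algebra is a unital $k$-algebra $A=\bigoplus_{n\ge0}A_n$, graded, with a differential $\partial:A_n\to A_{n-1}$, $\partial^2=0$, $\partial(ab)=\partial(a)b+(-1)^{|a|}a\partial(b)$, which is strictly graded commutative: $ba=(-1)^{|a||b|}ab$, and $a^2=0$ for $|a|$ odd. It is called free if, as a graded algebra, it is the graded symmetric algebra $\Lambda V$ (polynomial on even generators, exterior on odd generators) of some free non-negatively graded $k$-module $V$; no condition is imposed on $\partial$. A model of $A$ is a surjective quasi-isomorphism of chain algebras $\Lambda V\to A$ with $\Lambda V$ free; every $A$ has one. **Double mixed complexes.** A double mixed complex is a bigraded module $M_{p,q}$ ($p,q\ge 0$) with $k$-linear maps $D:M_{p,q}\to M_{p,q-1}$, $\partial:M_{p,q}\to M_{p-1,q}$, $B:M_{p,q}\to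 M_{p,q+1}$ satisfying $0=D^2=B^2=\partial^2=D\partial+\partial D=B\partial+\partial B=DB+BD$. Its Hochschild homology $HH_*(M)$ is the homology of the total complex of the double complex $(M_{*,*},D,\partial)$. Its cyclic homology $HC_*(M)$ is the homology of the total complex of the double complex $M'_{p,q}=\bigoplus_{i=0}^{q}M_{p-i,q-i}$ with vertical boundary $D$ and horizontal boundary $B+\partial$ ($B$ sends the $i$-th summand to the $(i-1)$-st, and is zero on the $i=0$ summand). Filtering these double complexes by columns gives spectral sequences $E_{p,q}\Rightarrow HH_{p+q}(M)$ with $E^1_{p,q}=H_q(M_{p,*},D)$, and $E'_{p,q}\Rightarrow HC_{p+q}(M)$ with ${E'}^1_{p,q}=H_q(M'_{p,*},D)$. Put $HH_n^p(M):=E^\infty_{n-p,p}$ and $HC_n^p(M):={E'}^\infty_{n-p,p}$. **Cyclic mixed complex.** For a chain algebra $A$, $C(A)$ is the double mixed complex $C_{p,q}(A)=(A\otimes(A/k)^{\otimes q})_p$ (the subscript is the internal degree coming from $A$), with $D=b$ the Hochschild boundary, $B$ the Connes operator, and $\partial$ the boundary induced by that of $A$ (multiplied by $(-1)^q$), all with the usual Koszul signs. **Shukla homology.** $\widehat{HH}_n(A):=HH_n(C(\Lambda V))$ and $\widehat{HC}_n(A):=HC_n(C(\Lambda V))$ for a model $\Lambda V\to A$, as filtered modules with the column filtration just described (the Hodge filtration); they do not depend on the chosen model up to natural isomorphism. The layers of the filtration are $\widehat{HH}{}_n^p(A):=HH_n^p(C(\Lambda V))$ and $\widehat{HC}{}_n^p(A):=HC_n^p(C(\Lambda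 V))$. **$\Gamma$-differential forms.** For a free graded module $W$, $\Gamma(W)=\Lambda(W_{odd})\otimes\Gamma(W_{even})$, where $\Gamma(W_{even})$ is the divided power algebra. It has a basis of monomials $v_{i_1}\cdots v_{i_r}\gamma^{q_1}(v_{j_1})\cdots\gamma^{q_s}(v_{j_s})$ with distinct basis elements $v_i$ odd, $v_j$ even; $\Gamma^q(W)$ is spanned by those with $r+q_1+\dots+q_s=q$. Let $dV$ be $V$ shifted by one, $dV_n=V_{n-1}$. A $\gamma$-derivation is a graded derivation $\theta$ with $\theta(\gamma^n(x))=\gamma^{n-1}(x)\theta(x)$. On $\Lambda V\otimes\Gamma(dV)$ let $d$ be the $\gamma$-derivation of degree $+1$ with $v\mapsto dv$, $dv\mapsto 0$, and let $\delta$ be the $\gamma$-derivation of degree $-1$ with $\delta(a)=\partial(a)$ for $a\in\Lambda V$ and $\delta(dv)=-d(\partial v)$. $M(\Lambda V)$ is the double mixed complex with $M(\Lambda V)_{p,q}$ the part of $\Lambda V\otimes\Gamma^q(dV)$ of internal degree $p$, i.e. of total degree $p+q$ (so $dv$ has internal degree $|v|$), with $0$ as the $D$ boundary, $\delta$ as the $\partial$ boundary and $d$ as the $B$ boundary. *)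

theory Defs
  imports "HOL.Modules" "HOL-Library.Poly_Mapping" "HOL-Library.Function_Algebras"

begin

section \<open>Subquotients\<close>

text \<open>
  All homology modules are subquotients of the module carried by some type, and a \<open>k\<close>-module is
  represented throughout by a pair \<open>(Z, N)\<close> of submodules \<open>N \<subseteq> Z\<close>, standing for \<open>Z/N\<close>.  A linear map
  \<open>Z/N \<rightarrow> Z'/N'\<close> is represented by a function on representatives which is linear modulo \<open>N'\<close>; by
  choice of representatives, every linear map between the quotients arises in this way.
\<close>

type_synonym 'a subquot = "'a set \<times> 'a set"

definition subquotient :: "('k::comm_ring_1 \<Rightarrow> 'a::ab_group_add \<Rightarrow> 'a) \<Rightarrow> 'a subquot \<Rightarrow> bool" where
  "subquotient s Q \<longleftrightarrow> module.subspace s (fst Q) \<and> module.subspace s (snd Q) \<and> snd Q \<subseteq> fst Q"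

definition sq_hom ::
  "('k::comm_ring_1 \<Rightarrow> 'a::ab_group_add \<Rightarrow> 'a) \<Rightarrow> ('k \<Rightarrow> 'b::ab_group_add \<Rightarrow> 'b)
    \<Rightarrow> ('a \<Rightarrow> 'b) \<Rightarrow> 'a subquot \<Rightarrow> 'b subquot \<Rightarrow> bool" where
  "sq_hom s t \<phi> Q R \<longleftrightarrow>
     (\<forall>x\<in>fst Q. \<phi> x \<in> fst R) \<and> (\<forall>x\<in>snd Q. \<phi> x \<in> snd R) \<and>
     (\<forall>x\<in>fst Q. \<forall>y\<in>fst Q. \<phi> (x + y) - (\<phi> x + \<phi> y) \<in> snd R) \<and>
     (\<forall>c. \<forall>x\<in>fst Q. \<phi> (s c x) - t c (\<phi> x) \<in> snd R)"

definition sq_iso ::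
  "('k::comm_ring_1 \<Rightarrow> 'a::ab_group_add \<Rightarrow> 'a) \<Rightarrow> ('k \<Rightarrow> 'b::ab_group_add \<Rightarrow> 'b)
    \<Rightarrow> ('a \<Rightarrow> 'b) \<Rightarrow> 'a subquot \<Rightarrow> 'b subquot \<Rightarrow> bool" where
  "sq_iso s t \<phi> Q R \<longleftrightarrow> sq_hom s t \<phi> Q R \<and>
     (\<forall>x\<in>fst Q. \<phi> x \<in> snd R \<longrightarrow> x \<in> snd Q) \<and>
     (\<forall>y\<in>fst R. \<exists>x\<in>fst Q. y - \<phi> x \<in> snd R)"

definition sq_isomorphic ::
  "('k::comm_ring_1 \<Rightarrow> 'a::ab_group_add \<Rightarrow> 'a) \<Rightarrow> ('k \<Rightarrow> 'b::ab_group_add \<Rightarrow> 'b)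
    \<Rightarrow> 'a subquot \<Rightarrow> 'b subquot \<Rightarrow> bool" where
  "sq_isomorphic s t Q R \<longleftrightarrow> (\<exists>\<phi>. sq_iso s t \<phi> Q R)"


section \<open>First quadrant spectral sequences\<close>

text \<open>
  Pages \<open>E r p q\<close> with \<open>p, q \<ge> 0\<close>; the modules outside the first quadrant are zero and are not
  represented.  The differential \<open>d r p q\<close> goes from \<open>(p, q)\<close> to \<open>(p - r, q + r - 1)\<close>, and is only
  considered for \<open>r \<le> p\<close>.
\<close>

definition ss_homology ::
  "(nat \<Rightarrow> nat \<Rightarrow> nat \<Rightarrow> 'e::ab_group_add subquot) \<Rightarrow> (nat \<Rightarrow> nat \<Rightarrow> nat \<Rightarrow> 'e \<Rightarrow> 'e)
    \<Rightarrow> nat \<Rightarrow> nat \<Rightarrow> nat \<Rightarrow> 'e subquot" where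
  "ss_homology E d r p q =
     ({x \<in> fst (E r p q). r \<le> p \<longrightarrow> d r p q x \<in> snd (E r (p - r) (q + r - 1))},
      (if r \<le> q + 1
       then {x \<in> fst (E r p q). \<exists>y\<in>fst (E r (p + r) (q + 1 - r)).
               x - d r (p + r) (q + 1 - r) y \<in> snd (E r p q)}
       else snd (E r p q)))"

definition spectral_sequence ::
  "('k::comm_ring_1 \<Rightarrow> 'e::ab_group_add \<Rightarrow> 'e) \<Rightarrow> nat
    \<Rightarrow> (nat \<Rightarrow> nat \<Rightarrow> nat \<Rightarrow> 'e subquot) \<Rightarrow> (nat \<Rightarrow> nat \<Rightarrow> nat \<Rightarrow> 'e \<Rightarrow> 'e) \<Rightarrow> bool" where
  "spectral_sequence s r0 E d \<longleftrightarrow> module s \<and> r0 \<ge> 1 \<and>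
     (\<forall>r\<ge>r0. \<forall>p q. subquotient s (E r p q)) \<and>
     (\<forall>r\<ge>r0. \<forall>p q. r \<le> p \<longrightarrow> sq_hom s s (d r p q) (E r p q) (E r (p - r) (q + r - 1))) \<and>
     (\<forall>r\<ge>r0. \<forall>p q. 2 * r \<le> p \<longrightarrow>
        (\<forall>x\<in>fst (E r p q). d r (p - r) (q + r - 1) (d r p q x)
            \<in> snd (E r (p - 2 * r) (q + 2 * r - 2)))) \<and>
     (\<forall>r\<ge>r0. \<forall>p q. sq_isomorphic s s (ss_homology E d r p q) (E (Suc r) p q))"

text \<open>
  In a first quadrant spectral sequence the module at \<open>(p, q)\<close> is stationary, up to isomorphism,
  for \<open>r > max p (q + 1)\<close>, and \<open>E\<^sup>\<infinity>\<close> is the stationary value: the following says that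
  \<open>E\<^sup>\<infinity>\<close> at \<open>(p, q)\<close> is isomorphic to \<open>Q\<close>.
\<close>

definition ss_infinity ::
  "('k::comm_ring_1 \<Rightarrow> 'e::ab_group_add \<Rightarrow> 'e) \<Rightarrow> (nat \<Rightarrow> nat \<Rightarrow> nat \<Rightarrow> 'e subquot)
    \<Rightarrow> ('k \<Rightarrow> 'h::ab_group_add \<Rightarrow> 'h) \<Rightarrow> nat \<Rightarrow> nat \<Rightarrow> 'h subquot \<Rightarrow> bool" where
  "ss_infinity s E t p q Q \<longleftrightarrow> (\<exists>r1. \<forall>r\<ge>r1. sq_isomorphic s t (E r p q) Q)"

text \<open>
  Convergence to the modules \<open>H n\<close> filtered by \<open>F p n\<close>; the steps of the filtration are given by
  their preimages in \<open>fst (H n)\<close>, so that \<open>F (-1) n = snd (H n)\<close> is the zero step.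
\<close>

definition ss_converges ::
  "('k::comm_ring_1 \<Rightarrow> 'e::ab_group_add \<Rightarrow> 'e) \<Rightarrow> (nat \<Rightarrow> nat \<Rightarrow> nat \<Rightarrow> 'e subquot)
    \<Rightarrow> ('k \<Rightarrow> 'h::ab_group_add \<Rightarrow> 'h) \<Rightarrow> (nat \<Rightarrow> 'h subquot) \<Rightarrow> (int \<Rightarrow> nat \<Rightarrow> 'h set) \<Rightarrow> bool" where
  "ss_converges s E t H F \<longleftrightarrow> module t \<and>
     (\<forall>n. subquotient t (H n) \<and> F (- 1) n = snd (H n) \<and> F (int n) n = fst (H n)) \<and>
     (\<forall>p n. module.subspace t (F p n) \<and> F p n \<subseteq> F (p + 1) n) \<and>
     (\<forall>p q. ss_infinity s E t p q (F (int p) (p + q), F (int p - 1) (p + q)))"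


section \<open>Double complexes and the column filtration\<close>

text \<open>
  Double complexes in the first quadrant, with \<open>vert p q : M(p,q) \<rightarrow> M(p,q-1)\<close> used for \<open>q \<ge> 1\<close> only
  and \<open>horiz p q : M(p,q) \<rightarrow> M(p-1,q)\<close> used for \<open>p \<ge> 1\<close> only.
\<close>

record ('k, 'm) double_complex =
  dc_scale :: "'k \<Rightarrow> 'm \<Rightarrow> 'm"
  dc_obj :: "nat \<Rightarrow> nat \<Rightarrow> 'm subquot"
  vert :: "nat \<Rightarrow> nat \<Rightarrow> 'm \<Rightarrow> 'm"
  horiz :: "nat \<Rightarrow> nat \<Rightarrow> 'm \<Rightarrow> 'm"

text \<open>
  A chain of degree \<open>n\<close> in the total complex has components \<open>x p \<in> M(p, n - p)\<close>.
  Because the module itself is a subquotient, chains come with the submodule \<open>tot_rel\<close> of those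
  representing \<open>0\<close>.
\<close>

definition tot_scale :: "('k, 'm::ab_group_add) double_complex \<Rightarrow> 'k \<Rightarrow> (nat \<Rightarrow> 'm) \<Rightarrow> (nat \<Rightarrow> 'm)" where
  "tot_scale X c x = (\<lambda>p. dc_scale X c (x p))"

definition tot :: "('k, 'm::ab_group_add) double_complex \<Rightarrow> nat \<Rightarrow> (nat \<Rightarrow> 'm) set" where
  "tot X n = {x. (\<forall>p\<le>n. x p \<in> fst (dc_obj X p (n - p))) \<and> (\<forall>p>n. x p = 0)}"

definition tot_rel :: "('k, 'm::ab_group_add) double_complex \<Rightarrow> nat \<Rightarrow> (nat \<Rightarrow> 'm) set" where
  "tot_rel X n = {x. (\<forall>p\<le>n. x p \<in> snd (dc_obj X p (n - p))) \<and> (\<forall>p>n. x p = 0)}"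

definition tot_d :: "('k, 'm::ab_group_add) double_complex \<Rightarrow> nat \<Rightarrow> (nat \<Rightarrow> 'm) \<Rightarrow> (nat \<Rightarrow> 'm)" where
  "tot_d X n x = (\<lambda>p. if p < n
      then vert X p (n - p) (x p) + horiz X (Suc p) (n - Suc p) (x (Suc p)) else 0)"

definition tot_cycles :: "('k, 'm::ab_group_add) double_complex \<Rightarrow> nat \<Rightarrow> (nat \<Rightarrow> 'm) set" where
  "tot_cycles X n = {x \<in> tot X n. tot_d X n x \<in> tot_rel X (n - 1)}"

definition tot_boundaries :: "('k, 'm::ab_group_add) double_complex \<Rightarrow> nat \<Rightarrow> (nat \<Rightarrow> 'm) set" where
  "tot_boundaries X n =
     {x \<in> tot X n. \<exists>y\<in>tot X (Suc n). x - tot_d X (Suc n) y \<in> tot_rel X n}"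

definition tot_homology :: "('k, 'm::ab_group_add) double_complex \<Rightarrow> nat \<Rightarrow> (nat \<Rightarrow> 'm) subquot" where
  "tot_homology X n = (tot_cycles X n, tot_boundaries X n)"

definition col :: "('k, 'm::ab_group_add) double_complex \<Rightarrow> int \<Rightarrow> nat \<Rightarrow> (nat \<Rightarrow> 'm) set" where
  "col X p n = {x \<in> tot X n. \<forall>i. p < int i \<longrightarrow> x i = 0}"

definition col_homology_filtration ::
  "('k, 'm::ab_group_add) double_complex \<Rightarrow> int \<Rightarrow> nat \<Rightarrow> (nat \<Rightarrow> 'm) set" where
  "col_homology_filtration X p n =
     {x \<in> tot_cycles X n. \<exists>y \<in> tot_cycles X n \<inter> col X p n. x - y \<in> tot_boundaries X n}"

text \<open>
  The spectral sequence of the column filtration \<open>F\<close>, with every page a subquotient of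
  \<open>F\<^sub>p / F\<^sub>p\<^sub>-\<^sub>1\<close>: \<open>Z\<^sup>r\<close> and \<open>B\<^sup>r\<close> are the images in \<open>F\<^sub>p / F\<^sub>p\<^sub>-\<^sub>1\<close> of
  \<open>{x \<in> F\<^sub>p. d x \<in> F\<^sub>p\<^sub>-\<^sub>r}\<close> and of \<open>F\<^sub>p \<inter> d F\<^sub>p\<^sub>+\<^sub>r\<^sub>-\<^sub>1\<close>; then
  \<open>E\<^sup>r = Z\<^sup>r / B\<^sup>r\<close> and \<open>E\<^sup>\<infinity> = (\<Inter>r. Z\<^sup>r) / (\<Union>r. B\<^sup>r)\<close>.
\<close>

definition col_Z :: "('k, 'm::ab_group_add) double_complex \<Rightarrow> nat \<Rightarrow> int \<Rightarrow> nat \<Rightarrow> (nat \<Rightarrow> 'm) set" where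
  "col_Z X r p n = {x \<in> col X p n. \<exists>w \<in> col X (p - 1) n. \<exists>u \<in> col X (p - int r) (n - 1).
      tot_d X n (x - w) - u \<in> tot_rel X (n - 1)}"

definition col_B :: "('k, 'm::ab_group_add) double_complex \<Rightarrow> nat \<Rightarrow> int \<Rightarrow> nat \<Rightarrow> (nat \<Rightarrow> 'm) set" where
  "col_B X r p n = {x \<in> col X p n. \<exists>w \<in> col X (p - 1) n. \<exists>y \<in> col X (p + int r - 1) (Suc n).
      x - w - tot_d X (Suc n) y \<in> tot_rel X n}"

definition col_page ::
  "('k, 'm::ab_group_add) double_complex \<Rightarrow> nat \<Rightarrow> nat \<Rightarrow> nat \<Rightarrow> (nat \<Rightarrow> 'm) subquot" where
  "col_page X r p q = (col_Z X r (int p) (p + q), col_B X r (int p) (p + q))"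

definition col_infinity ::
  "('k, 'm::ab_group_add) double_complex \<Rightarrow> nat \<Rightarrow> nat \<Rightarrow> (nat \<Rightarrow> 'm) subquot" where
  "col_infinity X p q = (\<Inter>r. fst (col_page X r p q), \<Union>r. snd (col_page X r p q))"


section \<open>Double mixed complexes\<close>

record ('k, 'm) mixed_complex =
  mx_scale :: "'k \<Rightarrow> 'm \<Rightarrow> 'm"
  mx_obj :: "nat \<Rightarrow> nat \<Rightarrow> 'm subquot"
  mx_D :: "'m \<Rightarrow> 'm"
  mx_del :: "'m \<Rightarrow> 'm"
  mx_B :: "'m \<Rightarrow> 'm"

text \<open>
  Maps leaving the first quadrant are zero by convention, whatever the three functions do there;
  hence the separate clause for \<open>DB + BD = 0\<close> on \<open>M(p,0)\<close>.
\<close>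

definition double_mixed_complex :: "('k::comm_ring_1, 'm::ab_group_add) mixed_complex \<Rightarrow> bool" where
  "double_mixed_complex M \<longleftrightarrow>
     (let s = mx_scale M; Q = mx_obj M; D = mx_D M; \<delta> = mx_del M; B = mx_B M in
      module s \<and> (\<forall>p q. subquotient s (Q p q)) \<and>
      (\<forall>p q. sq_hom s s D (Q p (Suc q)) (Q p q)) \<and>
      (\<forall>p q. sq_hom s s \<delta> (Q (Suc p) q) (Q p q)) \<and>
      (\<forall>p q. sq_hom s s B (Q p q) (Q p (Suc q))) \<and>
      (\<forall>p q. \<forall>x\<in>fst (Q p (q + 2)). D (D x) \<in> snd (Q p q)) \<and>
      (\<forall>p q. \<forall>x\<in>fst (Q (p + 2) q). \<delta> (\<delta> x) \<in> snd (Q p q)) \<and>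
      (\<forall>p q. \<forall>x\<in>fst (Q p q). B (B x) \<in> snd (Q p (q + 2))) \<and>
      (\<forall>p q. \<forall>x\<in>fst (Q (Suc p) (Suc q)). D (\<delta> x) + \<delta> (D x) \<in> snd (Q p q)) \<and>
      (\<forall>p q. \<forall>x\<in>fst (Q (Suc p) q). B (\<delta> x) + \<delta> (B x) \<in> snd (Q p (Suc q))) \<and>
      (\<forall>p q. \<forall>x\<in>fst (Q p (Suc q)). D (B x) + B (D x) \<in> snd (Q p (Suc q))) \<and>
      (\<forall>p. \<forall>x\<in>fst (Q p 0). D (B x) \<in> snd (Q p 0)))"

definition HH_complex :: "('k, 'm::ab_group_add) mixed_complex \<Rightarrow> ('k, 'm) double_complex" where
  "HH_complex M = \<lparr> dc_scale = mx_scale M, dc_obj = mx_obj M,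
     vert = (\<lambda>p q. mx_D M), horiz = (\<lambda>p q. mx_del M) \<rparr>"

text \<open>
  An element of \<open>M'(p,q)\<close> is a family \<open>y\<close> with \<open>y i \<in> M(p-i, q-i)\<close> for \<open>i \<le> min p q\<close>, summands with a
  negative index being zero.
\<close>

definition HC_complex :: "('k, 'm::ab_group_add) mixed_complex \<Rightarrow> ('k, nat \<Rightarrow> 'm) double_complex" where
  "HC_complex M = \<lparr>
     dc_scale = (\<lambda>c y i. mx_scale M c (y i)),
     dc_obj = (\<lambda>p q.
       ({y. (\<forall>i\<le>min p q. y i \<in> fst (mx_obj M (p - i) (q - i))) \<and> (\<forall>i>min p q. y i = 0)},
        {y. (\<forall>i\<le>min p q. y i \<in> snd (mx_obj M (p - i) (q - i))) \<and> (\<forall>i>min p q. y i = 0)})),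
     vert = (\<lambda>p q y i. if i \<le> p \<and> i < q then mx_D M (y i) else 0),
     horiz = (\<lambda>p q y i. if i < p \<and> i \<le> q
        then mx_del M (y i) + (if i < q then mx_B M (y (Suc i)) else 0) else 0) \<rparr>"

definition HH :: "('k, 'm::ab_group_add) mixed_complex \<Rightarrow> nat \<Rightarrow> (nat \<Rightarrow> 'm) subquot" where
  "HH M n = tot_homology (HH_complex M) n"

definition HC :: "('k, 'm::ab_group_add) mixed_complex \<Rightarrow> nat \<Rightarrow> (nat \<Rightarrow> nat \<Rightarrow> 'm) subquot" where
  "HC M n = tot_homology (HC_complex M) n"

definition HH_layer :: "('k, 'm::ab_group_add) mixed_complex \<Rightarrow> nat \<Rightarrow> nat \<Rightarrow> (nat \<Rightarrow> 'm) subquot" where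
  "HH_layer M n p = (if p \<le> n then col_infinity (HH_complex M) (n - p) p else ({0}, {0}))"

definition HC_layer :: "('k, 'm::ab_group_add) mixed_complex \<Rightarrow> nat \<Rightarrow> nat \<Rightarrow> (nat \<Rightarrow> nat \<Rightarrow> 'm) subquot" where
  "HC_layer M n p = (if p \<le> n then col_infinity (HC_complex M) (n - p) p else ({0}, {0}))"

abbreviation HH_scale :: "('k, 'm::ab_group_add) mixed_complex \<Rightarrow> 'k \<Rightarrow> (nat \<Rightarrow> 'm) \<Rightarrow> (nat \<Rightarrow> 'm)" where
  "HH_scale M \<equiv> tot_scale (HH_complex M)"

abbreviation HC_scale :: "('k, 'm::ab_group_add) mixed_complex \<Rightarrow> 'k \<Rightarrow> (nat \<Rightarrow> nat \<Rightarrow> 'm) \<Rightarrow> (nat \<Rightarrow> nat \<Rightarrow> 'm)" where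
  "HC_scale M \<equiv> tot_scale (HC_complex M)"


section \<open>Chain algebras and models\<close>

record ('k, 'a) chain_alg =
  smul :: "'k \<Rightarrow> 'a \<Rightarrow> 'a"
  grade :: "nat \<Rightarrow> 'a set"
  bdry :: "'a \<Rightarrow> 'a"

definition sgn_pow :: "nat \<Rightarrow> 'a \<Rightarrow> 'a::ab_group_add" where
  "sgn_pow n a = (if even n then a else - a)"

definition is_decomposition :: "('k, 'a::ab_group_add) chain_alg \<Rightarrow> 'a \<Rightarrow> (nat \<Rightarrow> 'a) \<Rightarrow> bool" where
  "is_decomposition A a f \<longleftrightarrow>
     (\<forall>n. f n \<in> grade A n) \<and> finite {n. f n \<noteq> 0} \<and> a = (\<Sum>n | f n \<noteq> 0. f n)"

text \<open>The sort \<open>{ring, monoid_mult}\<close> is \<open>ring_1\<close> without \<open>0 \<noteq> 1\<close>: the zero algebra is allowed.\<close>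

locale chain_algebra =
  fixes A :: "('k::comm_ring_1, 'a::{ring, monoid_mult}) chain_alg"
  assumes smul_module: "module (smul A)"
    and smul_mult_left: "smul A c a * b = smul A c (a * b)"
    and smul_mult_right: "a * smul A c b = smul A c (a * b)"
    and grade_subspace: "module.subspace (smul A) (grade A n)"
    and grade_direct: "\<exists>!f. is_decomposition A a f"
    and grade_one: "1 \<in> grade A 0"
    and grade_mult: "a \<in> grade A m \<Longrightarrow> b \<in> grade A n \<Longrightarrow> a * b \<in> grade A (m + n)"
    and bdry_hom: "module_hom (smul A) (smul A) (bdry A)"
    and bdry_grade: "a \<in> grade A (Suc n) \<Longrightarrow> bdry A a \<in> grade A n"
    and bdry_grade_0: "a \<in> grade A 0 \<Longrightarrow> bdry A a = 0"
    and bdry_bdry: "bdry A (bdry A a) = 0"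
    and leibniz: "a \<in> grade A m \<Longrightarrow> bdry A (a * b) = bdry A a * b + sgn_pow m (a * bdry A b)"
    and graded_commute: "a \<in> grade A m \<Longrightarrow> b \<in> grade A n \<Longrightarrow> b * a = sgn_pow (m * n) (a * b)"
    and odd_square: "odd m \<Longrightarrow> a \<in> grade A m \<Longrightarrow> a * a = 0"

text \<open>
  A homogeneous basis of \<open>V\<close> is given by \<open>gen x\<close> of degree \<open>dg x\<close>, for \<open>x \<in> X\<close>.  The linear order on
  the index type only serves to fix the order of the factors in monomials.
\<close>

definition monomials :: "'x set \<Rightarrow> ('x \<Rightarrow> nat) \<Rightarrow> ('x \<Rightarrow>\<^sub>0 nat) set" where
  "monomials X dg = {e. Poly_Mapping.keys e \<subseteq> X \<and>
     (\<forall>x. odd (dg x) \<longrightarrow> Poly_Mapping.lookup e x \<le> 1)}"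

definition monomial :: "('x::linorder \<Rightarrow> 'a::monoid_mult) \<Rightarrow> ('x \<Rightarrow>\<^sub>0 nat) \<Rightarrow> 'a" where
  "monomial gen e =
     prod_list (map (\<lambda>x. gen x ^ Poly_Mapping.lookup e x) (sorted_list_of_set (Poly_Mapping.keys e)))"

locale free_chain_algebra = chain_algebra L
  for L :: "('k::comm_ring_1, 'l::{ring, monoid_mult}) chain_alg" +
  fixes X :: "'x::linorder set" and dg :: "'x \<Rightarrow> nat" and gen :: "'x \<Rightarrow> 'l"
  assumes gen_grade: "x \<in> X \<Longrightarrow> gen x \<in> grade L (dg x)"
    and monomials_inj: "inj_on (monomial gen) (monomials X dg)"
    and monomials_independent: "\<not> module.dependent (smul L) (monomial gen ` monomials X dg)"
    and monomials_span: "module.span (smul L) (monomial gen ` monomials X dg) = UNIV"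

definition chain_homology :: "('k, 'a::ab_group_add) chain_alg \<Rightarrow> nat \<Rightarrow> 'a subquot" where
  "chain_homology A n = ({a \<in> grade A n. bdry A a = 0}, bdry A ` grade A (Suc n))"

locale chain_algebra_hom = L: chain_algebra L + A: chain_algebra A
  for L :: "('k::comm_ring_1, 'l::{ring, monoid_mult}) chain_alg"
    and A :: "('k, 'a::{ring, monoid_mult}) chain_alg" +
  fixes \<pi> :: "'l \<Rightarrow> 'a"
  assumes hom_linear: "module_hom (smul L) (smul A) \<pi>"
    and hom_mult: "\<pi> (a * b) = \<pi> a * \<pi> b"
    and hom_one: "\<pi> 1 = 1"
    and hom_grade: "a \<in> grade L n \<Longrightarrow> \<pi> a \<in> grade A n"
    and hom_bdry: "\<pi> (bdry L a) = bdry A (\<pi> a)"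

locale free_model = free_chain_algebra L X dg gen + chain_algebra_hom L A \<pi>
  for L :: "('k::comm_ring_1, 'l::{ring, monoid_mult}) chain_alg"
    and X :: "'x::linorder set" and dg gen
    and A :: "('k, 'a::{ring, monoid_mult}) chain_alg" and \<pi> +
  assumes surjective: "surj \<pi>"
    and quasi_iso: "sq_iso (smul L) (smul A) \<pi> (chain_homology L n) (chain_homology A n)"


section \<open>The cyclic mixed complex\<close>

text \<open>
  \<open>C(p,q)\<close>, the part of degree \<open>p\<close> of the tensor product of \<open>A\<close> with \<open>q\<close> copies of \<open>A/k\<close>, is presented
  by generators and relations.  The generators are the pure tensors of homogeneous elements, given
  as lists of pairs (degree, element); the relations express multilinearity and the vanishing of
  tensors with a factor from \<open>k\<close> at a position other than the first.
\<close>

type_synonym 'a tensor = "(nat \<times> 'a) list"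

definition fscale :: "'k::comm_ring_1 \<Rightarrow> ('b \<Rightarrow>\<^sub>0 'k) \<Rightarrow> ('b \<Rightarrow>\<^sub>0 'k)" where
  "fscale c = Poly_Mapping.map (\<lambda>a. c * a)"

definition lin_extend :: "('b \<Rightarrow> ('c \<Rightarrow>\<^sub>0 'k)) \<Rightarrow> ('b \<Rightarrow>\<^sub>0 'k::comm_ring_1) \<Rightarrow> ('c \<Rightarrow>\<^sub>0 'k)" where
  "lin_extend \<phi> f = (\<Sum>x\<in>Poly_Mapping.keys f. fscale (Poly_Mapping.lookup f x) (\<phi> x))"

definition tdeg :: "'a tensor \<Rightarrow> nat" where
  "tdeg xs = sum_list (map fst xs)"

definition tensors :: "('k, 'a) chain_alg \<Rightarrow> nat \<Rightarrow> nat \<Rightarrow> 'a tensor set" where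
  "tensors A p q =
     {xs. length xs = Suc q \<and> tdeg xs = p \<and> (\<forall>(n, a)\<in>set xs. a \<in> grade A n)}"

definition tensor_relations ::
  "('k::comm_ring_1, 'a::{ring, monoid_mult}) chain_alg \<Rightarrow> nat \<Rightarrow> nat \<Rightarrow> ('a tensor \<Rightarrow>\<^sub>0 'k) set" where
  "tensor_relations A p q =
     {Poly_Mapping.single (xs @ (n, a + b) # ys) 1
        - Poly_Mapping.single (xs @ (n, a) # ys) 1 - Poly_Mapping.single (xs @ (n, b) # ys) 1
        | xs ys n a b. xs @ (n, a) # ys \<in> tensors A p q \<and> xs @ (n, b) # ys \<in> tensors A p q} \<union>
     {Poly_Mapping.single (xs @ (n, smul A c a) # ys) 1 - Poly_Mapping.single (xs @ (n, a) # ys) c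
        | xs ys n a c. xs @ (n, a) # ys \<in> tensors A p q} \<union>
     {Poly_Mapping.single (xs @ (0, smul A c 1) # ys) 1
        | xs ys c. xs \<noteq> [] \<and> xs @ (0, smul A c 1) # ys \<in> tensors A p q}"

definition hochschild_b :: "'a::{ring, monoid_mult} tensor \<Rightarrow> ('a tensor \<Rightarrow>\<^sub>0 'k::comm_ring_1)" where
  "hochschild_b xs = (let q = length xs - 1 in if q = 0 then 0 else
     (\<Sum>i<q. Poly_Mapping.single
        (take i xs @ (fst (xs ! i) + fst (xs ! Suc i), snd (xs ! i) * snd (xs ! Suc i))
           # drop (i + 2) xs) ((- 1) ^ i))
     + Poly_Mapping.single
        ((fst (xs ! q) + fst (xs ! 0), snd (xs ! q) * snd (xs ! 0)) # butlast (tl xs))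
        ((- 1) ^ (q + fst (xs ! q) * tdeg (take q xs))))"

definition connes_B :: "'a::{ring, monoid_mult} tensor \<Rightarrow> ('a tensor \<Rightarrow>\<^sub>0 'k::comm_ring_1)" where
  "connes_B xs = (let q = length xs - 1 in
     \<Sum>i\<le>q. Poly_Mapping.single ((0, 1) # drop i xs @ take i xs)
        ((- 1) ^ (i * q + tdeg (take i xs) * tdeg (drop i xs))))"

definition tensor_bdry ::
  "('k, 'a) chain_alg \<Rightarrow> 'a::{ring, monoid_mult} tensor \<Rightarrow> ('a tensor \<Rightarrow>\<^sub>0 'k::comm_ring_1)" where
  "tensor_bdry A xs = (let q = length xs - 1 in
     \<Sum>i | i \<le> q \<and> fst (xs ! i) > 0.
        Poly_Mapping.single (xs[i := (fst (xs ! i) - 1, bdry A (snd (xs ! i)))])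
          ((- 1) ^ (q + tdeg (take i xs))))"

definition cyclic_complex ::
  "('k::comm_ring_1, 'a::{ring, monoid_mult}) chain_alg \<Rightarrow> ('k, 'a tensor \<Rightarrow>\<^sub>0 'k) mixed_complex" where
  "cyclic_complex A = \<lparr>
     mx_scale = fscale,
     mx_obj = (\<lambda>p q. ({f. Poly_Mapping.keys f \<subseteq> tensors A p q},
                       module.span fscale (tensor_relations A p q))),
     mx_D = lin_extend hochschild_b,
     mx_del = lin_extend (tensor_bdry A),
     mx_B = lin_extend connes_B \<rparr>"


section \<open>Shukla homology\<close>

text \<open>
  Shukla homology of a chain algebra is computed from a model; here \<open>L\<close> is the source of the model.
\<close>

definition Shukla_HH ::
  "('k::comm_ring_1, 'l::{ring, monoid_mult}) chain_alg \<Rightarrow> nat \<Rightarrow> (nat \<Rightarrow> 'l tensor \<Rightarrow>\<^sub>0 'k) subquot" where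
  "Shukla_HH L n = HH (cyclic_complex L) n"

definition Shukla_HC ::
  "('k::comm_ring_1, 'l::{ring, monoid_mult}) chain_alg \<Rightarrow> nat \<Rightarrow> (nat \<Rightarrow> nat \<Rightarrow> 'l tensor \<Rightarrow>\<^sub>0 'k) subquot" where
  "Shukla_HC L n = HC (cyclic_complex L) n"

definition Hodge_filtration_HH ::
  "('k::comm_ring_1, 'l::{ring, monoid_mult}) chain_alg \<Rightarrow> int \<Rightarrow> nat \<Rightarrow> (nat \<Rightarrow> 'l tensor \<Rightarrow>\<^sub>0 'k) set" where
  "Hodge_filtration_HH L = col_homology_filtration (HH_complex (cyclic_complex L))"

definition Hodge_filtration_HC ::
  "('k::comm_ring_1, 'l::{ring, monoid_mult}) chain_alg \<Rightarrow> int \<Rightarrow> nat \<Rightarrow> (nat \<Rightarrow> nat \<Rightarrow> 'l tensor \<Rightarrow>\<^sub>0 'k) set" where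
  "Hodge_filtration_HC L = col_homology_filtration (HC_complex (cyclic_complex L))"

definition Shukla_HH_layer ::
  "('k::comm_ring_1, 'l::{ring, monoid_mult}) chain_alg \<Rightarrow> nat \<Rightarrow> nat \<Rightarrow> (nat \<Rightarrow> 'l tensor \<Rightarrow>\<^sub>0 'k) subquot" where
  "Shukla_HH_layer L n p = HH_layer (cyclic_complex L) n p"

definition Shukla_HC_layer ::
  "('k::comm_ring_1, 'l::{ring, monoid_mult}) chain_alg \<Rightarrow> nat \<Rightarrow> nat \<Rightarrow> (nat \<Rightarrow> nat \<Rightarrow> 'l tensor \<Rightarrow>\<^sub>0 'k) subquot" where
  "Shukla_HC_layer L n p = HC_layer (cyclic_complex L) n p"


section \<open>Gamma-differential forms\<close>

text \<open>
  \<open>\<Lambda>V \<otimes> \<Gamma>(dV)\<close> is the free \<open>\<Lambda>V\<close>-module on the monomials of \<open>\<Gamma>(dV)\<close>.  The exponent \<open>e\<close> encodes the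
  product of the \<open>\<gamma>\<^sup>e\<^sup>x(dx)\<close>, where \<open>ex\<close> is the exponent of \<open>x\<close>, with the factors in increasing
  order of \<open>x\<close>.  As \<open>dx\<close> has degree \<open>dg x + 1\<close>, it is an exterior generator when \<open>dg x\<close> is even.
\<close>

type_synonym ('x, 'l) forms = "('x \<Rightarrow>\<^sub>0 nat) \<Rightarrow>\<^sub>0 'l"

definition gamma_monomials :: "'x set \<Rightarrow> ('x \<Rightarrow> nat) \<Rightarrow> ('x \<Rightarrow>\<^sub>0 nat) set" where
  "gamma_monomials X dg = {e. Poly_Mapping.keys e \<subseteq> X \<and>
     (\<forall>x. even (dg x) \<longrightarrow> Poly_Mapping.lookup e x \<le> 1)}"

definition gamma_weight :: "('x \<Rightarrow>\<^sub>0 nat) \<Rightarrow> nat" where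
  "gamma_weight e = (\<Sum>x\<in>Poly_Mapping.keys e. Poly_Mapping.lookup e x)"

definition gamma_internal :: "('x \<Rightarrow> nat) \<Rightarrow> ('x \<Rightarrow>\<^sub>0 nat) \<Rightarrow> nat" where
  "gamma_internal dg e = (\<Sum>x\<in>Poly_Mapping.keys e. Poly_Mapping.lookup e x * dg x)"

definition forms :: "('k, 'l::zero) chain_alg \<Rightarrow> 'x set \<Rightarrow> ('x \<Rightarrow> nat) \<Rightarrow> nat \<Rightarrow> nat \<Rightarrow> ('x, 'l) forms set" where
  "forms L X dg p q = {\<omega>. \<forall>e\<in>Poly_Mapping.keys \<omega>. e \<in> gamma_monomials X dg \<and> gamma_weight e = q \<and>
     (\<exists>n. n + gamma_internal dg e = p \<and> Poly_Mapping.lookup \<omega> e \<in> grade L n)}"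

definition forms_total :: "('k, 'l::zero) chain_alg \<Rightarrow> 'x set \<Rightarrow> ('x \<Rightarrow> nat) \<Rightarrow> nat \<Rightarrow> ('x, 'l) forms set" where
  "forms_total L X dg n = {\<omega>. \<forall>e\<in>Poly_Mapping.keys \<omega>. e \<in> gamma_monomials X dg \<and>
     (\<exists>m. m + gamma_internal dg e + gamma_weight e = n \<and> Poly_Mapping.lookup \<omega> e \<in> grade L m)}"

definition all_forms :: "'x set \<Rightarrow> ('x \<Rightarrow> nat) \<Rightarrow> ('x, 'l::zero) forms set" where
  "all_forms X dg = {\<omega>. Poly_Mapping.keys \<omega> \<subseteq> gamma_monomials X dg}"

definition forms_scale :: "('k, 'l::zero) chain_alg \<Rightarrow> 'k \<Rightarrow> ('x, 'l) forms \<Rightarrow> ('x, 'l) forms" where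
  "forms_scale L c = Poly_Mapping.map (smul L c)"

text \<open>
  The product of two monomials of \<open>\<Gamma>(dV)\<close> is a multiple of the monomial with the exponents added:
  \<open>\<gamma>\<^sup>i(w) \<gamma>\<^sup>j(w) = (i + j choose i) \<gamma>\<^sup>i\<^sup>+\<^sup>j(w)\<close>, \<open>w\<^sup>2 = 0\<close> for \<open>w\<close> odd, and a sign for every
  transposition of odd factors.
\<close>

definition gamma_coeff :: "('x::linorder \<Rightarrow> nat) \<Rightarrow> ('x \<Rightarrow>\<^sub>0 nat) \<Rightarrow> ('x \<Rightarrow>\<^sub>0 nat) \<Rightarrow> int" where
  "gamma_coeff dg e f =
     (if \<exists>x. even (dg x) \<and> Poly_Mapping.lookup e x + Poly_Mapping.lookup f x > 1 then 0
      else (- 1) ^ card {(x, y). x \<in> Poly_Mapping.keys e \<and> y \<in> Poly_Mapping.keys f \<and>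
                           even (dg x) \<and> even (dg y) \<and> y < x}
         * (\<Prod>x\<in>Poly_Mapping.keys e \<union> Poly_Mapping.keys f.
              int ((Poly_Mapping.lookup e x + Poly_Mapping.lookup f x) choose Poly_Mapping.lookup e x)))"

text \<open>\<open>a \<mapsto> (-1)\<^sup>n\<^sup>|\<^sup>a\<^sup>| a\<close>, extended linearly from homogeneous elements.\<close>

definition koszul_twist :: "('k, 'l::ab_group_add) chain_alg \<Rightarrow> nat \<Rightarrow> 'l \<Rightarrow> 'l" where
  "koszul_twist L n a = (let f = (THE f. is_decomposition L a f) in
     \<Sum>m | f m \<noteq> 0. sgn_pow (n * m) (f m))"

definition forms_mult ::
  "('k::comm_ring_1, 'l::{ring, monoid_mult}) chain_alg \<Rightarrow> ('x::linorder \<Rightarrow> nat)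
    \<Rightarrow> ('x, 'l) forms \<Rightarrow> ('x, 'l) forms \<Rightarrow> ('x, 'l) forms" where
  "forms_mult L dg u v =
     (\<Sum>e\<in>Poly_Mapping.keys u. \<Sum>f\<in>Poly_Mapping.keys v. Poly_Mapping.single (e + f)
        (smul L (of_int (gamma_coeff dg e f))
          (Poly_Mapping.lookup u e *
             koszul_twist L (gamma_internal dg e + gamma_weight e) (Poly_Mapping.lookup v f))))"

definition form_of :: "'l::zero \<Rightarrow> ('x, 'l) forms" where
  "form_of a = Poly_Mapping.single 0 a"

definition gamma_d :: "nat \<Rightarrow> 'x \<Rightarrow> ('x, 'l::{ring, monoid_mult}) forms" where
  "gamma_d n x = Poly_Mapping.single (Poly_Mapping.single x n) 1"

definition gamma_derivation ::
  "('k::comm_ring_1, 'l::{ring, monoid_mult}) chain_alg \<Rightarrow> 'x::linorder set \<Rightarrow> ('x \<Rightarrow> nat)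
    \<Rightarrow> int \<Rightarrow> (('x, 'l) forms \<Rightarrow> ('x, 'l) forms) \<Rightarrow> bool" where
  "gamma_derivation L X dg t \<theta> \<longleftrightarrow>
     (\<forall>u\<in>all_forms X dg. \<forall>v\<in>all_forms X dg. \<theta> (u + v) = \<theta> u + \<theta> v) \<and>
     (\<forall>c. \<forall>u\<in>all_forms X dg. \<theta> (forms_scale L c u) = forms_scale L c (\<theta> u)) \<and>
     (\<forall>n. \<forall>u\<in>forms_total L X dg n.
        if int n + t \<ge> 0 then \<theta> u \<in> forms_total L X dg (nat (int n + t)) else \<theta> u = 0) \<and>
     (\<forall>n. \<forall>u\<in>forms_total L X dg n. \<forall>v\<in>all_forms X dg.
        \<theta> (forms_mult L dg u v) =
          forms_mult L dg (\<theta> u) v + sgn_pow (nat \<bar>t\<bar> * n) (forms_mult L dg u (\<theta> v))) \<and>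
     (\<forall>x\<in>X. odd (dg x) \<longrightarrow> (\<forall>n\<ge>1.
        \<theta> (gamma_d n x) = forms_mult L dg (gamma_d (n - 1) x) (\<theta> (gamma_d 1 x))))"

text \<open>On \<open>all_forms X dg\<close> the maps \<open>d\<close> and \<open>\<delta>\<close> are uniquely determined by these conditions.\<close>

definition is_forms_d ::
  "('k::comm_ring_1, 'l::{ring, monoid_mult}) chain_alg \<Rightarrow> 'x::linorder set \<Rightarrow> ('x \<Rightarrow> nat) \<Rightarrow> ('x \<Rightarrow> 'l)
    \<Rightarrow> (('x, 'l) forms \<Rightarrow> ('x, 'l) forms) \<Rightarrow> bool" where
  "is_forms_d L X dg gen d \<longleftrightarrow> gamma_derivation L X dg 1 d \<and>
     (\<forall>x\<in>X. d (form_of (gen x)) = gamma_d 1 x \<and> d (gamma_d 1 x) = 0)"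

definition is_forms_delta ::
  "('k::comm_ring_1, 'l::{ring, monoid_mult}) chain_alg \<Rightarrow> 'x::linorder set \<Rightarrow> ('x \<Rightarrow> nat) \<Rightarrow> ('x \<Rightarrow> 'l)
    \<Rightarrow> (('x, 'l) forms \<Rightarrow> ('x, 'l) forms) \<Rightarrow> (('x, 'l) forms \<Rightarrow> ('x, 'l) forms) \<Rightarrow> bool" where
  "is_forms_delta L X dg gen d \<delta> \<longleftrightarrow> gamma_derivation L X dg (- 1) \<delta> \<and>
     (\<forall>a. \<delta> (form_of a) = form_of (bdry L a)) \<and>
     (\<forall>x\<in>X. \<delta> (gamma_d 1 x) = - d (form_of (bdry L (gen x))))"

definition forms_complex ::
  "('k::comm_ring_1, 'l::{ring, monoid_mult}) chain_alg \<Rightarrow> 'x::linorder set \<Rightarrow> ('x \<Rightarrow> nat)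
    \<Rightarrow> (('x, 'l) forms \<Rightarrow> ('x, 'l) forms) \<Rightarrow> (('x, 'l) forms \<Rightarrow> ('x, 'l) forms)
    \<Rightarrow> ('k, ('x, 'l) forms) mixed_complex" where
  "forms_complex L X dg d \<delta> = \<lparr>
     mx_scale = forms_scale L,
     mx_obj = (\<lambda>p q. (forms L X dg p q, {0})),
     mx_D = (\<lambda>\<omega>. 0),
     mx_del = \<delta>,
     mx_B = d \<rparr>"

end

(*
  The column filtration of the double complexes of the cyclic mixed complex C of LV gives the spectral
  sequences, from their second page on; what has to be identified is the second page.  It depends only on
  the vertical homology of C, the Hochschild homology of the graded algebra LV without its differential,
  with the operators induced there.  By the Hochschild-Kostant-Rosenberg theorem this homology is the
  module of Gamma-forms, embedded in C by mapping a gamma^e to the signed sum of a (x) x1 (x) ... (x) xq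
  over all distinct orderings x1, ..., xq of the letters of e.

  That this map is an isomorphism is seen on normal forms.  After expansion in monomials, C has a basis of
  words m0 (x) m1 (x) ... (x) mq.  Splitting the first factor of degree at least two, after a decreasing
  run of single letters, into its smallest letter and the rest matches all words in pairs, except for the
  words m0 (x) x1 (x) ... (x) xq with x1, ..., xq decreasing.  The boundary of a split word is, up to sign,
  the unsplit word plus smaller words, so the unmatched words are a basis of the homology.

  The map commutes with the operators only up to Hochschild boundaries.  On the chains of C the form da
  acts by inserting a in all places, which is a derivation in a only up to the boundary of the insertion
  of a (x) c; hence the insertion of a is homologous to that of the letters in da.
*)
theory Submission
  imports Defs
begin

text \<open>The comparison map from forms to Hochschild chains commutes with \<open>mx_del\<close>
  and \<open>mx_B\<close> only up to vertical boundaries. It is therefore no map of double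
  complexes, and no comparison theorem for filtered complexes applies to it. It does give an
  isomorphism on vertical homology compatible with the operators induced there, and this is enough
  for the second pages. On forms the vertical differential is zero, so their own column spectral
  sequence stops at the second page; this is why layers, which are terms at infinity, can occur as
  the second page for the cyclic complex. Chains are given by generators and relations. Instead of
  forming signed sums of tensors, every operator acts on functionals; the expansion in normal words
  is a universal functional whose kernel is the span of the relations, so identities modulo
  relations become identities of functionals. Divided powers occur because the symmetrisation runs
  over distinct orderings, each counted once; no integer has to be inverted, and the matching of
  words has leading coefficients 1 or -1 over any ground ring.\<close>

abbreviation dcZ where "dcZ X p q \<equiv> fst (dc_obj X p q)"
abbreviation dcN where "dcN X p q \<equiv> snd (dc_obj X p q)"
abbreviation mxZ where "mxZ M p q \<equiv> fst (mx_obj M p q)"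
abbreviation mxN where "mxN M p q \<equiv> snd (mx_obj M p q)"
abbreviation keys where "keys \<equiv> Poly_Mapping.keys"
abbreviation lookup where "lookup \<equiv> Poly_Mapping.lookup"
abbreviation wt where "wt \<equiv> gamma_weight"
abbreviation single where "single \<equiv> Poly_Mapping.single"

section \<open>Subquotients\<close>

text \<open>Boundaries, \<open>col_B\<close> and the steps of the filtration on homology all have
  this shape: elements congruent modulo \<open>R\<close> to a correction from \<open>W\<close> plus
  an image under \<open>D\<close>. The cases arise with \<open>W\<close> zero or \<open>D\<close>
  the identity.\<close>

lemma subspace_modulo:
  assumes s: "module s" "module.subspace s A" "module.subspace s W" "module.subspace s C" "module.subspace s R"
    and D: "\<And>c y z. y \<in> C \<Longrightarrow> z \<in> C \<Longrightarrow> D (s c y + z) = s c (D y) + D z"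
  shows "module.subspace s {x \<in> A. \<exists>w\<in>W. \<exists>y\<in>C. x - w - D y \<in> R}" (is "module.subspace s ?S")
proof -
  interpret module s by (rule s)
  note sub = subspace_add subspace_scale subspace_0
  have z: "0 \<in> ?S" using D[of 0 0 1] s(2-5)[THEN subspace_0] by (auto intro!: bexI[of _ 0])
  have l: "s c x + x' \<in> ?S" if xx: "x \<in> ?S" "x' \<in> ?S" for c x x'
  proof -
    obtain w y w' y' where *: "w \<in> W" "w' \<in> W" "y \<in> C" "y' \<in> C" "x \<in> A" "x' \<in> A" "x - w - D y \<in> R" "x' - w' - D y' \<in> R" using xx by blast
    have "s c x + x' - (s c w + w') - D (s c y + y') = s c (x - w - D y) + (x' - w' - D y')"
      unfolding D[OF *(3,4)] by (simp add: scale_right_diff_distrib)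
    also have "\<dots> \<in> R" using * s by (intro sub)
    finally show ?thesis using * s by (blast intro: sub)
  qed
  show ?thesis
  proof (rule subspaceI[OF z])
    show "x + y \<in> ?S" if "x \<in> ?S" "y \<in> ?S" for x y using l[OF that, of 1] by simp
    show "s c x \<in> ?S" if "x \<in> ?S" for c x using l[OF that z, of c] by simp
  qed
qed

lemma sq_iso_id: assumes "module s" "subquotient s Q" shows "sq_iso s s (\<lambda>x. x) Q Q"
proof -
  have "0 \<in> snd Q" using assms module.subspace_0 unfolding subquotient_def by blast
  then show ?thesis using assms(2) unfolding sq_iso_def sq_hom_def subquotient_def by auto (metis cancel_comm_monoid_add_class.diff_cancel)
qed

text \<open>A map of subquotients is additive only modulo relations, so a chosen section
  \<open>\<psi>\<close> is controlled only through its images under \<open>\<phi>\<close>. The fact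
  \<open>diff\<close> turns agreement of images modulo \<open>snd R\<close> into agreement modulo
  \<open>snd Q\<close>; additivity and scaling of \<open>\<psi>\<close> are reduced to it.\<close>

lemma sq_isomorphic_sym: assumes "module s" "module t" "subquotient s Q" "subquotient t R" "sq_iso s t \<phi> Q R" shows "sq_isomorphic t s R Q"
proof -
  interpret s: module s by fact
  interpret t: module t by fact
  have Q: "s.subspace (fst Q)" "s.subspace (snd Q)" "snd Q \<subseteq> fst Q"
    and R: "t.subspace (fst R)" "t.subspace (snd R)" "snd R \<subseteq> fst R" using assms by (auto simp: subquotient_def)
  define \<psi> where "\<psi> y = (SOME x. x \<in> fst Q \<and> y - \<phi> x \<in> snd R)" for y
  have \<psi>: "\<psi> y \<in> fst Q \<and> y - \<phi> (\<psi> y) \<in> snd R" if "y \<in> fst R" for y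
    unfolding \<psi>_def by (rule someI_ex) (use that assms(5) in \<open>auto simp: sq_iso_def\<close>)
  then have \<psi>1: "\<psi> y \<in> fst Q" and \<psi>2: "y - \<phi> (\<psi> y) \<in> snd R" if "y \<in> fst R" for y using that by auto
  have hom: "\<phi> x \<in> fst R" "x \<in> fst Q \<Longrightarrow> \<phi> (s c x) - t c (\<phi> x) \<in> snd R"
    "\<And>y. y \<in> fst Q \<Longrightarrow> \<phi> (x + y) - (\<phi> x + \<phi> y) \<in> snd R" if "x \<in> fst Q" for x c
    using assms(5) that by (auto simp: sq_iso_def sq_hom_def)
  have rel: "\<phi> x \<in> snd R" if "x \<in> snd Q" for x using assms(5) that by (auto simp: sq_iso_def sq_hom_def)
  have inj: "x \<in> snd Q" if "x \<in> fst Q" "\<phi> x \<in> snd R" for x using assms(5) that by (auto simp: sq_iso_def)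
  \<comment> \<open>\<open>\<phi>\<close> need not send negatives to negatives on representatives,
    but it sends 0 to a relation, and this suffices modulo \<open>snd R\<close>.\<close>
  have neg: "\<phi> (- x) + \<phi> x \<in> snd R" if "x \<in> fst Q" for x proof -
    have "\<phi> (x + - x) - (\<phi> x + \<phi> (- x)) \<in> snd R" using hom(3)[OF that, of "- x"] s.subspace_neg[OF Q(1) that] by simp
    moreover have "\<phi> (x + - x) \<in> snd R" using rel[of 0] s.subspace_0[OF Q(2)] by simp
    ultimately have "\<phi> (x + - x) - (\<phi> (x + - x) - (\<phi> x + \<phi> (- x))) \<in> snd R" using t.subspace_diff[OF R(2)] by blast
    then show ?thesis by (simp add: add.commute)
  qed
  have diff: "x - y \<in> snd Q" if "x \<in> fst Q" "y \<in> fst Q" "\<phi> x - \<phi> y \<in> snd R" for x y proof (rule inj)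
    have ny: "- y \<in> fst Q" using s.subspace_neg[OF Q(1)] that by blast
    show "x - y \<in> fst Q" using s.subspace_diff[OF Q(1)] that by blast
    have "(\<phi> (x + - y) - (\<phi> x + \<phi> (- y))) + (\<phi> x - \<phi> y) + (\<phi> (- y) + \<phi> y) \<in> snd R"
      by (intro t.subspace_add[OF R(2)] hom(3) that ny neg)
    then show "\<phi> (x - y) \<in> snd R" by (simp add: algebra_simps)
  qed
  have "sq_iso t s \<psi> R Q" unfolding sq_iso_def sq_hom_def proof (intro conjI ballI allI impI)
    fix y assume "y \<in> fst R" then show "\<psi> y \<in> fst Q" using \<psi> by blast
  next
    fix y assume y: "y \<in> snd R"
    then have *: "\<psi> y \<in> fst Q" "y - \<phi> (\<psi> y) \<in> snd R" using \<psi> R by blast+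
    have "y - (y - \<phi> (\<psi> y)) \<in> snd R" using t.subspace_diff[OF R(2) y *(2)] .
    then show "\<psi> y \<in> snd Q" using inj * by simp
  next
    fix y z assume yz: "y \<in> fst R" "z \<in> fst R"
    have yz': "y + z \<in> fst R" using t.subspace_add[OF R(1)] yz by blast
    have a: "\<psi> y + \<psi> z \<in> fst Q" by (intro s.subspace_add[OF Q(1)] \<psi>1 yz)
    have "(y - \<phi> (\<psi> y)) + (z - \<phi> (\<psi> z)) - (y + z - \<phi> (\<psi> (y + z)))
        - (\<phi> (\<psi> y + \<psi> z) - (\<phi> (\<psi> y) + \<phi> (\<psi> z))) \<in> snd R"
      by (intro t.subspace_add[OF R(2)] t.subspace_diff[OF R(2)] hom(3) \<psi>1 \<psi>2 yz yz')
    then have "\<phi> (\<psi> (y + z)) - \<phi> (\<psi> y + \<psi> z) \<in> snd R" by (simp add: algebra_simps)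
    then show "\<psi> (y + z) - (\<psi> y + \<psi> z) \<in> snd Q" by (intro diff a \<psi>1 yz')
  next
    fix c y assume y: "y \<in> fst R"
    have y': "t c y \<in> fst R" using t.subspace_scale[OF R(1)] y by blast
    have a: "s c (\<psi> y) \<in> fst Q" by (intro s.subspace_scale[OF Q(1)] \<psi>1 y)
    have "t c (y - \<phi> (\<psi> y)) - (t c y - \<phi> (\<psi> (t c y))) - (\<phi> (s c (\<psi> y)) - t c (\<phi> (\<psi> y))) \<in> snd R"
      by (intro t.subspace_diff[OF R(2)] t.subspace_scale[OF R(2)] hom(2) \<psi>1 \<psi>2 y y')
    then have "\<phi> (\<psi> (t c y)) - \<phi> (s c (\<psi> y)) \<in> snd R" by (simp add: algebra_simps t.scale_right_diff_distrib)
    then show "\<psi> (t c y) - s c (\<psi> y) \<in> snd Q" by (intro diff a \<psi>1 y')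
  next
    fix y assume y: "y \<in> fst R" "\<psi> y \<in> snd Q"
    have "(y - \<phi> (\<psi> y)) + \<phi> (\<psi> y) \<in> snd R" using t.subspace_add[OF R(2)] \<psi>[OF y(1)] rel[OF y(2)] by blast
    then show "y \<in> snd R" by simp
  next
    fix x assume x: "x \<in> fst Q"
    then have "\<phi> x \<in> fst R" using hom by blast
    then show "\<exists>y\<in>fst R. x - \<psi> y \<in> snd Q" using diff[OF x] \<psi> by blast
  qed
  then show ?thesis unfolding sq_isomorphic_def by blast
qed

section \<open>The spectral sequence of the column filtration\<close>

text \<open>Linearity is demanded strictly on representatives, the complex identities only modulo
  the relations. Arrows are indexed with \<open>Suc\<close>, so that none leaves the first
  quadrant.\<close>

locale first_quadrant_double_complex =
  fixes X :: "('k::comm_ring_1, 'm::ab_group_add) double_complex" assumes scale_module: "module (dc_scale X)"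
    and obj_subquotient: "subquotient (dc_scale X) (dc_obj X p q)"
    and vert_in: "x \<in> dcZ X p (Suc q) \<Longrightarrow> vert X p (Suc q) x \<in> dcZ X p q"
    and vert_rel: "x \<in> dcN X p (Suc q) \<Longrightarrow> vert X p (Suc q) x \<in> dcN X p q"
    and vert_add: "x \<in> dcZ X p (Suc q) \<Longrightarrow> y \<in> dcZ X p (Suc q) \<Longrightarrow>
      vert X p (Suc q) (x + y) = vert X p (Suc q) x + vert X p (Suc q) y" and vert_scale: "x \<in> dcZ X p (Suc q) \<Longrightarrow>
      vert X p (Suc q) (dc_scale X c x) = dc_scale X c (vert X p (Suc q) x)"
    and horiz_in: "x \<in> dcZ X (Suc p) q \<Longrightarrow> horiz X (Suc p) q x \<in> dcZ X p q"
    and horiz_rel: "x \<in> dcN X (Suc p) q \<Longrightarrow> horiz X (Suc p) q x \<in> dcN X p q"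
    and horiz_add: "x \<in> dcZ X (Suc p) q \<Longrightarrow> y \<in> dcZ X (Suc p) q \<Longrightarrow>
      horiz X (Suc p) q (x + y) = horiz X (Suc p) q x + horiz X (Suc p) q y" and horiz_scale: "x \<in> dcZ X (Suc p) q \<Longrightarrow>
      horiz X (Suc p) q (dc_scale X c x) = dc_scale X c (horiz X (Suc p) q x)" and vert_vert: "x \<in> dcZ X p (Suc (Suc q)) \<Longrightarrow>
      vert X p (Suc q) (vert X p (Suc (Suc q)) x) \<in> dcN X p q" and horiz_horiz: "x \<in> dcZ X (Suc (Suc p)) q \<Longrightarrow>
      horiz X (Suc p) q (horiz X (Suc (Suc p)) q x) \<in> dcN X p q" and vert_horiz: "x \<in> dcZ X (Suc p) (Suc q) \<Longrightarrow>
      vert X p (Suc q) (horiz X (Suc p) (Suc q) x) + horiz X (Suc p) q (vert X (Suc p) (Suc q) x) \<in> dcN X p q"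
begin

sublocale scale: module "dc_scale X" by (rule scale_module)

lemma obj_subspace: "scale.subspace (dcZ X p q)" "scale.subspace (dcN X p q)" and obj_subset: "dcN X p q \<subseteq> dcZ X p q"
  using obj_subquotient[of p q] by (auto simp: subquotient_def)

sublocale tot: module "tot_scale X" by unfold_locales (auto simp: tot_scale_def scale.scale_right_distrib scale.scale_left_distrib)

lemma tot_eq_col: "tot X n = col X (int n) n" by (auto simp: col_def tot_def)

lemma col_subspace: "tot.subspace (col X p n)" by (rule tot.subspaceI)
    (auto simp: col_def tot_def tot_scale_def intro: scale.subspace_0 scale.subspace_add scale.subspace_scale obj_subspace)

lemma tot_rel_subspace: "tot.subspace (tot_rel X n)" by (rule tot.subspaceI)
    (auto simp: tot_rel_def tot_scale_def intro: scale.subspace_0 scale.subspace_add scale.subspace_scale obj_subspace)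

lemmas col_0 = tot.subspace_0[OF col_subspace] and col_add = tot.subspace_add[OF col_subspace] and col_diff = tot.subspace_diff[OF col_subspace]
  and col_neg = tot.subspace_neg[OF col_subspace] and col_scale = tot.subspace_scale[OF col_subspace] and rel_0 = tot.subspace_0[OF tot_rel_subspace]
  and rel_add = tot.subspace_add[OF tot_rel_subspace] and rel_diff = tot.subspace_diff[OF tot_rel_subspace]
  and rel_neg = tot.subspace_neg[OF tot_rel_subspace] and rel_scale = tot.subspace_scale[OF tot_rel_subspace]

lemma col_mono: "x \<in> col X p n \<Longrightarrow> p \<le> p' \<Longrightarrow> x \<in> col X p' n" by (auto simp: col_def)

lemma col_tot: "x \<in> col X p n \<Longrightarrow> x \<in> col X (int n) n" by (auto simp: col_def tot_def)

lemma col_negative: "p < 0 \<Longrightarrow> x \<in> col X p n \<Longrightarrow> x = 0" by (auto simp: col_def)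

lemma tot_d_0: "tot_d X 0 x = 0" by (auto simp: tot_d_def)

lemma tot_component: assumes "x \<in> col X p n" shows "i < n \<Longrightarrow> x i \<in> dcZ X i (Suc (n - Suc i))"
    "i < n \<Longrightarrow> x (Suc i) \<in> dcZ X (Suc i) (n - Suc i)" using assms by (auto simp: col_def tot_def Suc_diff_Suc)

text \<open>For \<open>i < n\<close> the row \<open>n - i\<close> is written as a successor, the
  form to which the axioms on the vertical map apply.\<close>

lemma tot_d_eq:
  "tot_d X n x = (\<lambda>i. if i < n then vert X i (Suc (n - Suc i)) (x i)
    + horiz X (Suc i) (n - Suc i) (x (Suc i)) else 0)" by (auto simp: tot_d_def Suc_diff_Suc fun_eq_iff)

lemma horiz_0: "horiz X (Suc p) q 0 = 0" using horiz_add[of 0 p q 0] scale.subspace_0 obj_subspace by fastforce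

lemma vert_0: "vert X p (Suc q) 0 = 0" using vert_add[of 0 p q 0] scale.subspace_0 obj_subspace by fastforce

lemma vert_diff: "x \<in> dcZ X p (Suc q) \<Longrightarrow> y \<in> dcZ X p (Suc q) \<Longrightarrow>
      vert X p (Suc q) (x - y) = vert X p (Suc q) x - vert X p (Suc q) y"
  using vert_add[of "x - y" p q y] scale.subspace_diff obj_subspace by fastforce

lemma horiz_diff: "x \<in> dcZ X (Suc p) q \<Longrightarrow> y \<in> dcZ X (Suc p) q \<Longrightarrow>
      horiz X (Suc p) q (x - y) = horiz X (Suc p) q x - horiz X (Suc p) q y"
  using horiz_add[of "x - y" p q y] scale.subspace_diff obj_subspace by fastforce

lemma tot_d_add: "x \<in> col X p n \<Longrightarrow> y \<in> col X p' n \<Longrightarrow> tot_d X n (x + y) = tot_d X n x + tot_d X n y"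
  by (auto simp: tot_d_eq fun_eq_iff vert_add horiz_add tot_component)

lemma tot_d_diff: "x \<in> col X p n \<Longrightarrow> y \<in> col X p' n \<Longrightarrow> tot_d X n (x - y) = tot_d X n x - tot_d X n y"
  by (auto simp: tot_d_eq fun_eq_iff vert_diff horiz_diff tot_component)

lemma tot_d_scale: "x \<in> col X p n \<Longrightarrow> tot_d X n (tot_scale X c x) = tot_scale X c (tot_d X n x)"
  by (auto simp: tot_d_eq fun_eq_iff vert_scale horiz_scale tot_component tot_scale_def scale.scale_right_distrib)

lemma tot_d_col: assumes "x \<in> col X p n" shows "tot_d X n x \<in> col X p (n - 1)"
proof -
  have "vert X i (Suc (n - Suc i)) (x i) + horiz X (Suc i) (n - Suc i) (x (Suc i))
      \<in> dcZ X i (n - Suc i)" if "i < n" for i using that by (intro scale.subspace_add[OF obj_subspace(1)] vert_in horiz_in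
        tot_component[OF assms])
  moreover have "vert X i (Suc (n - Suc i)) (x i) + horiz X (Suc i) (n - Suc i) (x (Suc i)) = 0" if "p < int i" for i
    using that assms by (simp add: col_def horiz_0 vert_0)
  moreover have "0 \<in> dcZ X i j" for i j using scale.subspace_0 obj_subspace by blast
  ultimately show ?thesis unfolding tot_d_eq col_def tot_def by auto
qed

lemma tot_d_rel: assumes "x \<in> tot_rel X n" shows "tot_d X n x \<in> tot_rel X (n - 1)"
proof -
  have "x i \<in> dcN X i (Suc (n - Suc i))" "x (Suc i) \<in> dcN X (Suc i) (n - Suc i)" if "i < n" for i
    using assms that by (auto simp: tot_rel_def Suc_diff_Suc)
  then have "vert X i (Suc (n - Suc i)) (x i) + horiz X (Suc i) (n - Suc i) (x (Suc i))
      \<in> dcN X i (n - Suc i)" if "i < n" for i using that by (intro scale.subspace_add[OF obj_subspace(2)] vert_rel horiz_rel) auto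
  moreover have "0 \<in> dcN X i j" for i j using scale.subspace_0 obj_subspace by blast
  ultimately show ?thesis unfolding tot_d_eq tot_rel_def by auto
qed

text \<open>Each component consists of vertical after vertical, an anticommutator, and horizontal
  after horizontal. For \<open>n < 2\<close> the truncated degrees do no harm, since
  \<open>tot_d X 0\<close> is zero.\<close>

lemma tot_d_tot_d: assumes "x \<in> col X p n" shows "tot_d X (n - 1) (tot_d X n x) \<in> tot_rel X (n - 2)"
proof -
  have z: "0 \<in> dcN X i j" for i j using scale.subspace_0 obj_subspace by blast
  have "tot_d X (n - 1) (tot_d X n x) i \<in> dcN X i (n - 2 - i)" if "i \<le> n - 2" for i proof (cases "Suc i < n")
    case False
    then show ?thesis using that by (subst tot_d_def) (simp add: z)
  next
    case True
    then obtain j where n: "n = Suc (Suc (i + j))" using less_imp_Suc_add[OF True] by auto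
    have x: "x i \<in> dcZ X i (Suc (Suc j))" "x (Suc i) \<in> dcZ X (Suc i) (Suc j)"
      "x (Suc (Suc i)) \<in> dcZ X (Suc (Suc i)) j" using tot_component[OF assms, of i] tot_component[OF assms, of "Suc i"]
      by (simp_all add: n Suc_diff_le)
    let ?v = "vert X i (Suc j)" and ?h = "horiz X (Suc i) j"
    let ?a = "vert X i (Suc (Suc j)) (x i)" and ?b = "horiz X (Suc i) (Suc j) (x (Suc i))"
      and ?c = "vert X (Suc i) (Suc j) (x (Suc i))" and ?d = "horiz X (Suc (Suc i)) j (x (Suc (Suc i)))"
    have "tot_d X (n - 1) (tot_d X n x) i = ?v (?a + ?b) + ?h (?c + ?d)" by (simp add: tot_d_def n Suc_diff_le)
    also have "\<dots> = ?v ?a + (?v ?b + ?h ?c) + ?h ?d" by (simp add: vert_add horiz_add vert_in horiz_in x)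
    also have "\<dots> \<in> dcN X i j" by (intro scale.subspace_add[OF obj_subspace(2)] vert_vert horiz_horiz vert_horiz x)
    finally show ?thesis by (simp add: n)
  qed
  moreover have "tot_d X (n - 1) (tot_d X n x) i = 0" if "i > n - 2" for i using that by (subst tot_d_def) auto
  ultimately show ?thesis by (auto simp: tot_rel_def)
qed

end

section \<open>Page differentials and the homology of the pages\<close>

context first_quadrant_double_complex
begin

text \<open>\<open>u\<close> represents the value of the differential of page \<open>r\<close> on
  the class of \<open>x\<close>: after subtraction of a term of lower filtration, the boundary of
  \<open>x\<close> drops by \<open>r\<close> columns. A relation is used because \<open>u\<close> is
  determined only modulo \<open>col_B\<close>.\<close>

definition lead :: "nat \<Rightarrow> int \<Rightarrow> nat \<Rightarrow> (nat \<Rightarrow> 'm) \<Rightarrow> (nat \<Rightarrow> 'm) \<Rightarrow> bool" where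
  "lead r p n x u \<longleftrightarrow> x \<in> col X p n \<and> u \<in> col X (p - int r) (n - 1) \<and>
     (\<exists>w\<in>col X (p - 1) n. tot_d X n (x - w) - u \<in> tot_rel X (n - 1))"

lemma col_Z_iff: "x \<in> col_Z X r p n \<longleftrightarrow> (\<exists>u. lead r p n x u)" unfolding col_Z_def lead_def by blast

lemma lead_0: "lead r p n 0 0" unfolding lead_def using rel_0 tot_d_diff[OF col_0 col_0, of n] by (auto simp: col_0 intro!: bexI[of _ 0])

lemma lead_lin: assumes "lead r p n x u" "lead r p n x' u'" shows "lead r p n (tot_scale X c x + x') (tot_scale X c u + u')"
proof -
  obtain w w' where w: "w \<in> col X (p - 1) n" "w' \<in> col X (p - 1) n"
    "tot_d X n (x - w) - u \<in> tot_rel X (n - 1)" "tot_d X n (x' - w') - u' \<in> tot_rel X (n - 1)" and x: "x \<in> col X p n" "x' \<in> col X p n"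
    and u: "u \<in> col X (p - int r) (n - 1)" "u' \<in> col X (p - int r) (n - 1)" using assms unfolding lead_def by auto
  have xw: "x - w \<in> col X p n" "x' - w' \<in> col X p n" using w x col_mono by (auto intro!: col_diff)
  have "tot_scale X c (tot_d X n (x - w) - u) + (tot_d X n (x' - w') - u') \<in> tot_rel X (n - 1)" by (intro rel_add rel_scale w)
  then have "tot_d X n ((tot_scale X c x + x') - (tot_scale X c w + w')) - (tot_scale X c u + u') \<in> tot_rel X (n - 1)"
    using tot_d_add[OF col_scale[OF xw(1)] xw(2), of c] tot_d_scale[OF xw(1), of c] by (simp add: tot.scale_right_diff_distrib algebra_simps)
  then show ?thesis unfolding lead_def using x u w col_add col_scale by blast
qed

lemma lead_add: "lead r p n x u \<Longrightarrow> lead r p n x' u' \<Longrightarrow> lead r p n (x + x') (u + u')"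
  and lead_scale: "lead r p n x u \<Longrightarrow> lead r p n (tot_scale X c x) (tot_scale X c u)"
  using lead_lin[of r p n x u x' u' 1] lead_lin[OF _ lead_0, of r p n x u c] by simp_all

lemma lead_uminus: "lead r p n x u \<Longrightarrow> lead r p n (- x) (- u)" using lead_scale[of r p n x u "- 1"] by simp

lemma lead_diff: "lead r p n x u \<Longrightarrow> lead r p n x' u' \<Longrightarrow> lead r p n (x - x') (u - u')"
  using lead_add[OF _ lead_uminus] by fastforce

lemma col_Z_subspace: "tot.subspace (col_Z X r p n)" by (rule tot.subspaceI) (auto simp: col_Z_iff intro: lead_0 lead_add lead_scale)

lemma col_B_subspace: "tot.subspace (col_B X r p n)" unfolding col_B_def
  by (rule subspace_modulo[OF tot.module_axioms]) (simp_all add: col_subspace tot_rel_subspace tot_d_add[OF col_scale] tot_d_scale)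

lemmas B_0 = tot.subspace_0[OF col_B_subspace] and B_add = tot.subspace_add[OF col_B_subspace] and B_diff = tot.subspace_diff[OF col_B_subspace]

lemma col_BI: "x \<in> col X p n \<Longrightarrow> w \<in> col X (p - 1) n \<Longrightarrow> y \<in> col X (p + int r - 1) (Suc n) \<Longrightarrow>
  x - w - tot_d X (Suc n) y \<in> tot_rel X n \<Longrightarrow> x \<in> col_B X r p n" unfolding col_B_def by blast

lemma lower_col_B: assumes "x \<in> col X (p - 1) n" shows "x \<in> col_B X r p n"
proof (rule col_BI)
  show "x - x - tot_d X (Suc n) 0 \<in> tot_rel X n" using tot_d_diff[OF col_0 col_0, of "Suc n"] rel_0 by simp
qed (use assms col_mono col_0 in auto)

lemma rel_col_B: assumes "x \<in> tot_rel X n" "x \<in> col X p n" shows "x \<in> col_B X r p n"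
proof (rule col_BI)
  show "x - 0 - tot_d X (Suc n) 0 \<in> tot_rel X n" using tot_d_diff[OF col_0 col_0, of "Suc n"] assms by simp
qed (use assms col_0 in auto)

text \<open>Up to lower filtration and relations an element of \<open>col_B\<close> is a total
  boundary, hence becomes a cycle after a lower correction. So 0 is a possible value on every page
  \<open>r'\<close>.\<close>

lemma col_B_lead: assumes "x \<in> col_B X r p n" shows "lead r' p n x 0"
proof -
  obtain w y where w: "w \<in> col X (p - 1) n" and y: "y \<in> col X (p + int r - 1) (Suc n)"
    and *: "x - w - tot_d X (Suc n) y \<in> tot_rel X n" and x: "x \<in> col X p n" using assms unfolding col_B_def by auto
  have "tot_d X n (x - w) - tot_d X n (tot_d X (Suc n) y) = tot_d X n (x - w - tot_d X (Suc n) y)"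
    by (rule tot_d_diff[symmetric, where p = "int n" and p' = "int n"])
      (use col_diff[OF col_tot[OF x] col_tot[OF w]] col_tot[OF tot_d_col[OF y]] in auto)
  moreover have "tot_d X n (tot_d X (Suc n) y) \<in> tot_rel X (n - 1)" using tot_d_tot_d[OF y] by simp
  moreover have "tot_d X n (x - w - tot_d X (Suc n) y) \<in> tot_rel X (n - 1)" using tot_d_rel * by blast
  ultimately have "tot_d X n (x - w) - 0 \<in> tot_rel X (n - 1)" using rel_add by (metis diff_add_cancel diff_zero)
  then show ?thesis unfolding lead_def using x w col_0 by blast
qed

text \<open>Subtracting the value 0 from \<open>col_B_lead\<close> leaves a lead of 0, so
  \<open>u\<close> is a boundary of something of filtration \<open>p - 1\<close>. As
  \<open>p - 1 = (p - r) + r - 1\<close>, this is exactly what page \<open>r\<close> kills at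
  \<open>p - r\<close>.\<close>

lemma lead_col_B: assumes "lead r p (Suc m) x u" "x \<in> col_B X r p (Suc m)" shows "u \<in> col_B X r (p - int r) m"
proof -
  have "lead r p (Suc m) (x - x) (u - 0)" using lead_diff[OF assms(1) col_B_lead[OF assms(2)]] .
  then obtain w where u: "u \<in> col X (p - int r) m" and w: "w \<in> col X (p - 1) (Suc m)" and *: "tot_d X (Suc m) (0 - w) - u \<in> tot_rel X m"
    unfolding lead_def by auto
  have "- (tot_d X (Suc m) (0 - w) - u) \<in> tot_rel X m" using * rel_neg by blast
  then show ?thesis by (intro col_BI[where w = 0 and y = "0 - w"]) (use u w col_0 col_diff[OF col_0 w] in \<open>auto\<close>)
qed

lemma lead_tot_d: assumes "lead r p (Suc m) x u" shows "tot_d X m u \<in> tot_rel X (m - 1)"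
proof -
  obtain w where x: "x \<in> col X p (Suc m)" and w: "w \<in> col X (p - 1) (Suc m)"
    and u: "u \<in> col X (p - int r) m" and u2: "tot_d X (Suc m) (x - w) - u \<in> tot_rel X m" using assms(1) unfolding lead_def by auto
  have xw: "x - w \<in> col X p (Suc m)" using x w col_mono[of w] col_diff by simp
  have a: "tot_d X m (tot_d X (Suc m) (x - w)) \<in> tot_rel X (m - 1)" using tot_d_tot_d[OF xw] by (simp add: numeral_2_eq_2)
  have "tot_d X (Suc m) (x - w) \<in> col X p m" using tot_d_col[OF xw] by simp
  then show ?thesis using rel_diff[OF a tot_d_rel[OF u2]] tot_d_diff[of "tot_d X (Suc m) (x - w)" p m u] u by simp
qed

text \<open>\<open>u\<close> is itself a cycle modulo relations, so \<open>v\<close> is the boundary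
  of the correction \<open>- w2\<close>, whose filtration \<open>p - r - 1\<close> equals
  \<open>(p - 2r) + r - 1\<close>. In total degree 0 there are no boundaries to use, and
  \<open>v\<close> is a relation.\<close>

lemma lead_lead: assumes "lead r p (Suc m) x u" "lead r (p - int r) m u v" shows "v \<in> col_B X r (p - 2 * int r) (m - 1)"
proof (cases m)
  case 0
  obtain w where w: "w \<in> col X (p - int r - 1) m" and v: "v \<in> col X (p - 2 * int r) (m - 1)"
    and *: "tot_d X m (u - w) - v \<in> tot_rel X (m - 1)" using assms(2) unfolding lead_def by (auto simp: algebra_simps)
  have "- v \<in> tot_rel X 0" using * 0 by (simp add: tot_d_0)
  then have "v \<in> tot_rel X 0" using rel_neg by fastforce
  then show ?thesis using rel_col_B v 0 by simp
next
  case (Suc l)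
  obtain w2 where w2: "w2 \<in> col X (p - int r - 1) m" and v: "v \<in> col X (p - 2 * int r) (m - 1)"
    and v2: "tot_d X m (u - w2) - v \<in> tot_rel X (m - 1)" and u: "u \<in> col X (p - int r) m"
    using assms(2) unfolding lead_def by (auto simp: algebra_simps)
  have "tot_d X m u \<in> tot_rel X (m - 1)" using lead_tot_d[OF assms(1)] .
  then have "tot_d X m u - (tot_d X m (u - w2) - v) \<in> tot_rel X (m - 1)" using v2 rel_diff by blast
  moreover have "tot_d X m (- w2) = - tot_d X m w2" using tot_d_scale[OF w2, of "- 1"] by simp
  ultimately have "v - 0 - tot_d X m (- w2) \<in> tot_rel X (m - 1)" using tot_d_diff[OF u w2] by (simp add: algebra_simps)
  then show ?thesis using col_BI[OF v col_0, of "- w2" r] col_neg[OF w2] Suc by (simp add: algebra_simps)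
qed

definition ss_d :: "nat \<Rightarrow> nat \<Rightarrow> nat \<Rightarrow> (nat \<Rightarrow> 'm) \<Rightarrow> nat \<Rightarrow> 'm" where
  "ss_d r p q x = (SOME u. lead r (int p) (p + q) x u)"

lemma ss_d_lead: "x \<in> col_Z X r (int p) (p + q) \<Longrightarrow> lead r (int p) (p + q) x (ss_d r p q x)"
  unfolding ss_d_def using someI_ex[of "lead r (int p) (p + q) x"] col_Z_iff by blast

text \<open>If \<open>u\<close> is killed on page \<open>r\<close>, a chain \<open>y\<close> of
  filtration \<open>p - 1\<close> bounding it up to lower terms is absorbed into the correction of
  \<open>x\<close>; the boundary then drops one column further.\<close>

lemma lead_col_Z_Suc: assumes "lead r p (Suc m) x u" "u \<in> col_B X r (p - int r) m" shows "x \<in> col_Z X (Suc r) p (Suc m)"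
proof -
  obtain w where x: "x \<in> col X p (Suc m)" and w: "w \<in> col X (p - 1) (Suc m)" and 1: "tot_d X (Suc m) (x - w) - u \<in> tot_rel X m"
    using assms(1) unfolding lead_def by auto
  obtain w2 y where w2: "w2 \<in> col X (p - int r - 1) m" and y: "y \<in> col X (p - 1) (Suc m)"
    and 2: "u - w2 - tot_d X (Suc m) y \<in> tot_rel X m" using assms(2) unfolding col_B_def by auto
  have xw: "x - w \<in> col X p (Suc m)" using x w col_mono[of w] col_diff by simp
  have "(tot_d X (Suc m) (x - w) - u) + (u - w2 - tot_d X (Suc m) y) \<in> tot_rel X m" using rel_add 1 2 by blast
  moreover have "tot_d X (Suc m) (x - (w + y)) = tot_d X (Suc m) (x - w) - tot_d X (Suc m) y" using tot_d_diff[OF xw y] by (simp add: diff_diff_eq)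
  then have "tot_d X (Suc m) (x - (w + y)) - w2 = (tot_d X (Suc m) (x - w) - u) + (u - w2 - tot_d X (Suc m) y)" by simp
  ultimately have "tot_d X (Suc m) (x - (w + y)) - w2 \<in> tot_rel X m" by (simp only:)
  then have "lead (Suc r) p (Suc m) x w2" unfolding lead_def using x col_add[OF w y] w2 by (auto simp: algebra_simps)
  then show ?thesis using col_Z_iff by blast
qed

lemma lead_Suc: "lead (Suc r) p n x u \<Longrightarrow> lead r p n x u"
  unfolding lead_def using col_mono[of u "p - int (Suc r)" "n - 1" "p - int r"] by auto

lemma col_Z_Suc: "col_Z X (Suc r) p n \<subseteq> col_Z X r p n" using lead_Suc col_Z_iff by blast

lemma lead_Suc_col_B: "lead (Suc r) p n x u \<Longrightarrow> u \<in> col_B X r (p - int r) (n - 1)"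
  by (rule lower_col_B) (auto simp: lead_def algebra_simps)

lemma col_B_Suc: "col_B X r p n \<subseteq> col_B X (Suc r) p n"
  using col_mono[of _ "p + int r - 1" "Suc n" "p + int (Suc r) - 1"] by (fastforce simp: col_B_def)

lemma col_Z_negative: assumes "p < int r" shows "col_Z X (Suc r) p n = col_Z X r p n"
proof -
  have "lead (Suc r) p n x u" if "lead r p n x u" for x u using that assms col_negative[of "p - int r" u "n - 1"] col_0 unfolding lead_def by auto
  then show ?thesis using col_Z_iff col_Z_Suc by blast
qed

lemma col_B_large: assumes "p + int r > int n + 1" shows "col_B X (Suc r) p n = col_B X r p n"
proof -
  have "y \<in> col X (p + int r - 1) (Suc n)" if "y \<in> col X (p + int (Suc r) - 1) (Suc n)" for y
    using col_tot[OF that] by (rule col_mono) (use assms in simp)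
  then show ?thesis using col_B_Suc unfolding col_B_def by blast
qed

lemma col_page_subquotient: "subquotient (tot_scale X) (col_page X r p q)" unfolding subquotient_def col_page_def
  using col_Z_subspace col_B_subspace by (auto simp: col_Z_iff) (meson col_B_lead)

text \<open>All pages are subquotients of the same quotient of two filtration steps, so the homology
  of a page is the next page on the nose. Where no differential arrives, \<open>col_B_large\<close>
  says that \<open>col_B\<close> has stopped growing; where none leaves,
  \<open>col_Z_negative\<close> does the same for cycles.\<close>

lemma ss_homology_eq: assumes "r \<ge> 1" shows "ss_homology (col_page X) ss_d r p q = col_page X (Suc r) p q"
proof -
  let ?p = "int p" and ?n = "p + q"
  have Z: "x \<in> col_Z X r ?p ?n \<and> (r \<le> p \<longrightarrow> ss_d r p q x \<in> col_B X r (int (p - r)) (p - r + (q + r - 1)))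
      \<longleftrightarrow> x \<in> col_Z X (Suc r) ?p ?n" for x proof (cases "r \<le> p")
    case False
    then show ?thesis using col_Z_negative[of ?p r ?n] by auto
  next
    case True
    then obtain m where m: "?n = Suc m" "p - r + (q + r - 1) = m" "int (p - r) = ?p - int r" using assms by (cases ?n) auto
    show ?thesis proof
      assume "x \<in> col_Z X r ?p ?n \<and> (r \<le> p \<longrightarrow> ss_d r p q x \<in> col_B X r (int (p - r)) (p - r + (q + r - 1)))"
      then have "lead r ?p (Suc m) x (ss_d r p q x)" "ss_d r p q x \<in> col_B X r (?p - int r) m" using ss_d_lead[of x r p q] m True by auto
      then show "x \<in> col_Z X (Suc r) ?p ?n" using lead_col_Z_Suc m by simp
    next
      assume x: "x \<in> col_Z X (Suc r) ?p ?n"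
      then obtain u where u: "lead (Suc r) ?p ?n x u" using col_Z_iff by blast
      have xr: "x \<in> col_Z X r ?p ?n" using x col_Z_Suc by blast
      \<comment> \<open>The chosen value \<open>ss_d\<close> and \<open>u\<close> lead from the same
        \<open>x\<close>, so they differ by an element of \<open>col_B\<close>.\<close>
      have "lead r ?p (Suc m) (x - x) (ss_d r p q x - u)" using lead_diff[OF ss_d_lead[OF xr] lead_Suc[OF u]] m by simp
      then have "ss_d r p q x - u \<in> col_B X r (?p - int r) m" using lead_col_B[of r ?p m 0] B_0 by simp
      moreover have "u \<in> col_B X r (?p - int r) m" using lead_Suc_col_B[OF u] m by simp
      ultimately have "ss_d r p q x \<in> col_B X r (?p - int r) m" using B_add by fastforce
      then show "x \<in> col_Z X r ?p ?n \<and> (r \<le> p \<longrightarrow> ss_d r p q x \<in> col_B X r (int (p - r)) (p - r + (q + r - 1)))"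
        using xr m by simp
    qed
  qed
  have B: "x \<in> col_Z X r ?p ?n \<and> (\<exists>y\<in>col_Z X r (int (p + r)) (p + r + (q + 1 - r)).
      x - ss_d r (p + r) (q + 1 - r) y \<in> col_B X r ?p ?n) \<longleftrightarrow> x \<in> col_B X (Suc r) ?p ?n" (is "?L \<longleftrightarrow> ?R")
    if rq: "r \<le> q + 1" for x proof -
    have n: "p + r + (q + 1 - r) = Suc ?n" "int (p + r) = ?p + int r" using rq by auto
    show ?thesis proof
      assume ?L
      then obtain y where y: "y \<in> col_Z X r (?p + int r) (Suc ?n)"
        and xd: "x - ss_d r (p + r) (q + 1 - r) y \<in> col_B X r ?p ?n" using n by auto
      let ?u = "ss_d r (p + r) (q + 1 - r) y"
      have "lead r (?p + int r) (Suc ?n) y ?u" using ss_d_lead[of y r "p + r" "q + 1 - r"] y n by simp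
      then obtain w where w: "w \<in> col X (?p + int r - 1) (Suc ?n)" and u: "?u \<in> col X ?p ?n"
        and *: "tot_d X (Suc ?n) (y - w) - ?u \<in> tot_rel X ?n" and yc: "y \<in> col X (?p + int r) (Suc ?n)" unfolding lead_def by auto
      have "?u - 0 - tot_d X (Suc ?n) (y - w) \<in> tot_rel X ?n" using rel_neg[OF *] by simp
      then have "?u \<in> col_B X (Suc r) ?p ?n" by (intro col_BI[where w = 0 and y = "y - w"])
          (use u yc col_mono[OF w, of "?p + int r"] col_0 col_diff in auto)
      then show ?R using xd col_B_Suc B_add by (metis diff_add_cancel subset_iff)
    next
      assume R: ?R
      then obtain w y where w: "w \<in> col X (?p - 1) ?n" and y: "y \<in> col X (?p + int r) (Suc ?n)"
        and *: "x - w - tot_d X (Suc ?n) y \<in> tot_rel X ?n" and x: "x \<in> col X ?p ?n" unfolding col_B_def by auto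
      have xw: "x - w \<in> col X ?p ?n" using x w col_mono[of w] col_diff by simp
      have "tot_d X (Suc ?n) (y - 0) - (x - w) \<in> tot_rel X ?n" using rel_neg[OF *] by simp
      then have l: "lead r (?p + int r) (Suc ?n) y (x - w)" unfolding lead_def using y xw by (auto intro!: bexI[of _ 0] col_0)
      then have yZ: "y \<in> col_Z X r (int (p + r)) (p + r + (q + 1 - r))" using col_Z_iff n by auto
      let ?u = "ss_d r (p + r) (q + 1 - r) y"
      have "lead r (?p + int r) (Suc ?n) (y - y) (x - w - ?u)" using lead_diff[OF l ss_d_lead[OF yZ, unfolded n]] .
      then have "x - w - ?u \<in> col_B X r ?p ?n" using lead_col_B[of r "?p + int r" ?n 0] B_0 by simp
      then have "x - w - ?u + w \<in> col_B X r ?p ?n" using lower_col_B[OF w] B_add by blast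
      then have "x - ?u \<in> col_B X r ?p ?n" by (simp add: algebra_simps)
      moreover have "x \<in> col_Z X r ?p ?n" using col_B_lead[OF R] col_Z_iff by blast
      ultimately show ?L using yZ by blast
    qed
  qed
  show ?thesis using Z B col_B_large[of ?n ?p r] unfolding ss_homology_def col_page_def fst_conv snd_conv by (auto simp: not_le)
qed

lemma ss_d_hom: assumes "r \<ge> 1" "r \<le> p"
  shows "sq_hom (tot_scale X) (tot_scale X) (ss_d r p q) (col_page X r p q) (col_page X r (p - r) (q + r - 1))"
proof -
  obtain m where m: "p + q = Suc m" "p - r + (q + r - 1) = m" "int (p - r) = int p - int r" using assms by (cases "p + q") auto
  have B: "u \<in> snd (col_page X r (p - r) (q + r - 1))" if "lead r (int p) (p + q) x u" "x \<in> snd (col_page X r p q)" for x u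
    using lead_col_B[of r "int p" m x u] that m by (simp add: col_page_def)
  have dl: "lead r (int p) (p + q) x (ss_d r p q x)" if "x \<in> fst (col_page X r p q)" for x using that ss_d_lead by (simp add: col_page_def)
  have Z: "tot.subspace (fst (col_page X r p q))" "snd (col_page X r p q) \<subseteq> fst (col_page X r p q)"
     "0 \<in> snd (col_page X r p q)" using col_page_subquotient[of r p q] tot.subspace_0 by (auto simp: subquotient_def)
  show ?thesis unfolding sq_hom_def proof (intro conjI ballI allI)
    fix x assume "x \<in> fst (col_page X r p q)"
    then have l: "lead r (int p) (p + q) x (ss_d r p q x)" using dl by blast
    then have "u \<in> col_Z X r (int p - int r) m" if "u = ss_d r p q x" for u proof -
      have "tot_d X m (u - 0) - 0 \<in> tot_rel X (m - 1)" and w: "u \<in> col X (int p - int r) m"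
        using lead_tot_d[of r "int p" m x u] l that m by (auto simp: lead_def)
      then have "lead r (int p - int r) m u 0" unfolding lead_def using w col_0 by blast
      then show ?thesis using col_Z_iff by blast
    qed
    then show "ss_d r p q x \<in> fst (col_page X r (p - r) (q + r - 1))" using m by (simp add: col_page_def)
  next
    fix x assume x: "x \<in> snd (col_page X r p q)"
    then show "ss_d r p q x \<in> snd (col_page X r (p - r) (q + r - 1))" using B dl Z by blast
  next
    fix x y assume xy: "x \<in> fst (col_page X r p q)" "y \<in> fst (col_page X r p q)"
    have "lead r (int p) (p + q) (x + y - (x + y)) (ss_d r p q (x + y) - (ss_d r p q x + ss_d r p q y))"
      by (intro lead_diff lead_add dl xy tot.subspace_add[OF Z(1)])
    then show "ss_d r p q (x + y) - (ss_d r p q x + ss_d r p q y) \<in> snd (col_page X r (p - r) (q + r - 1))" using B[of 0] Z by simp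
  next
    fix x c assume x: "x \<in> fst (col_page X r p q)"
    have "lead r (int p) (p + q) (tot_scale X c x - tot_scale X c x)
      (ss_d r p q (tot_scale X c x) - tot_scale X c (ss_d r p q x))" by (intro lead_diff lead_scale dl x tot.subspace_scale[OF Z(1)])
    then show "ss_d r p q (tot_scale X c x) - tot_scale X c (ss_d r p q x) \<in> snd (col_page X r (p - r) (q + r - 1))" using B[of 0] Z by simp
  qed
qed

lemma col_page_spectral_sequence: assumes "r0 \<ge> 1" shows "spectral_sequence (tot_scale X) r0 (col_page X) ss_d" unfolding spectral_sequence_def
proof (intro conjI allI impI ballI)
  show "module (tot_scale X)" by unfold_locales
  show "r0 \<ge> 1" by fact
  show "subquotient (tot_scale X) (col_page X r p q)" for r p q by (rule col_page_subquotient)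
  show "r0 \<le> r \<Longrightarrow> r \<le> p \<Longrightarrow>
    sq_hom (tot_scale X) (tot_scale X) (ss_d r p q) (col_page X r p q) (col_page X r (p - r) (q + r - 1))" for r p q using ss_d_hom assms by simp
next
  fix r p q x
  assume r: "r0 \<le> r" and r2: "2 * r \<le> p" and x: "x \<in> fst (col_page X r p q)"
  then obtain m where m: "p + q = Suc m" "p - r + (q + r - 1) = m" "int (p - r) = int p - int r" using assms by (cases "p + q") auto
  have l: "lead r (int p) (Suc m) x (ss_d r p q x)" using ss_d_lead[of x r p q] x m by (simp add: col_page_def)
  have "ss_d r p q x \<in> fst (col_page X r (p - r) (q + r - 1))" using ss_d_hom[of r p q] x r r2 assms unfolding sq_hom_def by auto
  then have "lead r (int p - int r) m (ss_d r p q x) (ss_d r (p - r) (q + r - 1) (ss_d r p q x))"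
    using ss_d_lead[of "ss_d r p q x" r "p - r" "q + r - 1"] m by (simp add: col_page_def)
  from lead_lead[OF l this] r2 m assms r
  show "ss_d r (p - r) (q + r - 1) (ss_d r p q x) \<in> snd (col_page X r (p - 2 * r) (q + 2 * r - 2))" by (simp add: col_page_def of_nat_diff)
next
  fix r p q assume "r0 \<le> r"
  then show "sq_isomorphic (tot_scale X) (tot_scale X) (ss_homology (col_page X) ss_d r p q) (col_page X (Suc r) p q)"
    using sq_iso_id[OF tot.module_axioms col_page_subquotient] ss_homology_eq assms unfolding sq_isomorphic_def by (metis le_trans)
qed

end

section \<open>Stationary pages and the filtration of total homology\<close>

context first_quadrant_double_complex
begin

lemma col_Z_antimono: "r \<le> r' \<Longrightarrow> col_Z X r' p n \<subseteq> col_Z X r p n"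
  by (rule lift_Suc_antimono_le[of "\<lambda>r. col_Z X r p n"]) (use col_Z_Suc in auto)

lemma col_B_mono: "r \<le> r' \<Longrightarrow> col_B X r p n \<subseteq> col_B X r' p n"
  by (rule lift_Suc_mono_le[of "\<lambda>r. col_B X r p n"]) (use col_B_Suc in auto)

lemma col_Z_stationary: "p < int r \<Longrightarrow> r \<le> r' \<Longrightarrow> col_Z X r' p n = col_Z X r p n"
  by (rotate_tac 1, induction r' rule: dec_induct) (use col_Z_negative in auto)

lemma col_B_stationary: "p + int r > int n + 1 \<Longrightarrow> r \<le> r' \<Longrightarrow> col_B X r' p n = col_B X r p n"
  by (rotate_tac 1, induction r' rule: dec_induct) (use col_B_large in auto)

text \<open>From \<open>r = p + q + 2\<close> on, the arriving and the leaving differential both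
  involve positions outside the first quadrant, so the intersection and the union are
  attained.\<close>

lemma col_infinity_eq: assumes "r \<ge> p + q + 2" shows "col_page X r p q = col_infinity X p q"
proof -
  have "col_Z X r (int p) (p + q) \<subseteq> col_Z X r' (int p) (p + q)" for r'
    using col_Z_antimono[of r' r] col_Z_stationary[of "int p" r r' "p + q"] assms by (cases "r \<le> r'") auto
  moreover have "col_B X r' (int p) (p + q) \<subseteq> col_B X r (int p) (p + q)" for r'
    using col_B_mono[of r' r] col_B_stationary[of "p + q" "int p" r r'] assms by (cases "r \<le> r'") auto
  ultimately show ?thesis unfolding col_infinity_def col_page_def by auto
qed

lemma col_infinity_subquotient: "subquotient (tot_scale X) (col_infinity X p q)" using col_page_subquotient col_infinity_eq[OF le_refl] by metis

lemma ss_infinity_col_infinity: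
  "ss_infinity (tot_scale X) (col_page X) (tot_scale X) p q (col_infinity X p q)" unfolding ss_infinity_def sq_isomorphic_def
  using sq_iso_id[OF tot.module_axioms col_infinity_subquotient] col_infinity_eq by metis

lemma tot_cycles_iff: "x \<in> tot_cycles X n \<longleftrightarrow> x \<in> col X (int n) n \<and> tot_d X n x \<in> tot_rel X (n - 1)"
  by (auto simp: tot_cycles_def tot_eq_col)

lemma tot_boundaries_iff: "x \<in> tot_boundaries X n \<longleftrightarrow> x \<in> col X (int n) n \<and>
    (\<exists>y\<in>col X (int (Suc n)) (Suc n). x - tot_d X (Suc n) y \<in> tot_rel X n)" unfolding tot_boundaries_def tot_eq_col by blast

lemma tot_cycles_subspace: "tot.subspace (tot_cycles X n)" by (rule tot.subspaceI)
    (auto simp: tot_cycles_iff tot_d_add tot_d_scale col_add col_scale col_0 rel_0 rel_add rel_scale tot_d_scale[OF col_0, of n 0, simplified])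

lemma tot_boundaries_subspace: "tot.subspace (tot_boundaries X n)"
proof -
  have "tot_boundaries X n = {x \<in> col X (int n) n. \<exists>w\<in>{0}. \<exists>y\<in>col X (int (Suc n)) (Suc n). x - w - tot_d X (Suc n) y \<in> tot_rel X n}"
    by (auto simp: tot_boundaries_iff)
  then show ?thesis
    by (simp only:) (rule subspace_modulo[OF tot.module_axioms],
      simp_all add: col_subspace tot_rel_subspace tot.subspace_single_0 tot_d_add[OF col_scale] tot_d_scale)
qed

lemma tot_boundaries_cycles: "tot_boundaries X n \<subseteq> tot_cycles X n"
proof
  fix x assume "x \<in> tot_boundaries X n"
  then obtain y where y: "y \<in> col X (int (Suc n)) (Suc n)" and *: "x - tot_d X (Suc n) y \<in> tot_rel X n" and x: "x \<in> col X (int n) n"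
    unfolding tot_boundaries_iff by auto
  have "tot_d X (Suc n) y \<in> col X (int n) n" using col_tot[OF tot_d_col[OF y]] by simp
  then have "tot_d X n (x - tot_d X (Suc n) y) = tot_d X n x - tot_d X n (tot_d X (Suc n) y)" using tot_d_diff x by blast
  moreover have "tot_d X n (tot_d X (Suc n) y) \<in> tot_rel X (n - 1)" using tot_d_tot_d[OF y] by simp
  ultimately have "tot_d X n x \<in> tot_rel X (n - 1)" using tot_d_rel[OF *] rel_add by (metis diff_add_cancel)
  then show "x \<in> tot_cycles X n" using x tot_cycles_iff by blast
qed

lemmas cycles_add = tot.subspace_add[OF tot_cycles_subspace] and cycles_diff = tot.subspace_diff[OF tot_cycles_subspace] and boundaries_diff = tot.subspace_diff[OF tot_boundaries_subspace]
  and boundaries_0 = tot.subspace_0[OF tot_boundaries_subspace]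

lemma filtration_iff: "x \<in> col_homology_filtration X p n \<longleftrightarrow>
    (\<exists>y z. x = y + z \<and> y \<in> tot_cycles X n \<and> y \<in> col X p n \<and> z \<in> tot_boundaries X n)"
proof
  assume "x \<in> col_homology_filtration X p n"
  then obtain y where "y \<in> tot_cycles X n" "y \<in> col X p n" "x - y \<in> tot_boundaries X n" unfolding col_homology_filtration_def by blast
  then show "\<exists>y z. x = y + z \<and> y \<in> tot_cycles X n \<and> y \<in> col X p n \<and> z \<in> tot_boundaries X n"
    by (intro exI[of _ y] exI[of _ "x - y"]) auto
next
  assume "\<exists>y z. x = y + z \<and> y \<in> tot_cycles X n \<and> y \<in> col X p n \<and> z \<in> tot_boundaries X n"
  then obtain y z where *: "x = y + z" "y \<in> tot_cycles X n" "y \<in> col X p n" "z \<in> tot_boundaries X n" by blast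
  have "x \<in> tot_cycles X n" unfolding *(1) using * tot_boundaries_cycles by (intro cycles_add) auto
  moreover have "x - y \<in> tot_boundaries X n" using * by simp
  ultimately show "x \<in> col_homology_filtration X p n" unfolding col_homology_filtration_def using * by blast
qed

lemma filtration_subspace: "tot.subspace (col_homology_filtration X p n)"
proof -
  have "col_homology_filtration X p n = {x \<in> tot_cycles X n. \<exists>w\<in>{0}. \<exists>y\<in>tot_cycles X n \<inter> col X p n. x - w - y \<in> tot_boundaries X n}"
    by (auto simp: col_homology_filtration_def)
  then show ?thesis
    by (simp only:) (rule subspace_modulo[OF tot.module_axioms],
      simp_all add: tot_cycles_subspace tot_boundaries_subspace tot.subspace_single_0 tot.subspace_inter col_subspace)
qed

lemma filtration_mono: "p \<le> p' \<Longrightarrow> col_homology_filtration X p n \<subseteq> col_homology_filtration X p' n"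
  unfolding col_homology_filtration_def using col_mono by blast

lemma boundaries_filtration: "z \<in> tot_boundaries X n \<Longrightarrow> z \<in> col_homology_filtration X p n" unfolding filtration_iff
  by (intro exI[of _ 0] exI[of _ z]) (simp add: tot.subspace_0[OF tot_cycles_subspace] col_0)

lemma col_filtration: "y \<in> tot_cycles X n \<Longrightarrow> y \<in> col X p n \<Longrightarrow> y \<in> col_homology_filtration X p n"
  unfolding filtration_iff by (intro exI[of _ y] exI[of _ 0]) (simp add: boundaries_0)

text \<open>On a late page each class has a representative \<open>x\<close> that a lower term
  \<open>w\<close> completes to a total cycle; \<open>x - w\<close> gives the class in the graded
  piece of homology. Another choice of \<open>w\<close> changes the cycle by one of lower
  filtration, so the map is well defined and additive there.\<close>

lemma ss_infinity_filtration:
  "ss_infinity (tot_scale X) (col_page X) (tot_scale X) p q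
    (col_homology_filtration X (int p) (p + q), col_homology_filtration X (int p - 1) (p + q))" unfolding ss_infinity_def
proof (intro exI allI impI)
  fix r assume r: "p + q + 2 \<le> r"
  let ?p = "int p" and ?n = "p + q"
  let ?F = "\<lambda>p. col_homology_filtration X p ?n"
  define \<phi> where "\<phi> x = x - (SOME w. w \<in> col X (?p - 1) ?n \<and> tot_d X ?n (x - w) \<in> tot_rel X (?n - 1))" for x
  have Z: "x \<in> col_Z X r ?p ?n \<longleftrightarrow> x \<in> col X ?p ?n \<and>
      (\<exists>w\<in>col X (?p - 1) ?n. tot_d X ?n (x - w) \<in> tot_rel X (?n - 1))" for x proof -
    have "u = 0" if "u \<in> col X (?p - int r) (?n - 1)" for u using that r by (intro col_negative[of "?p - int r"]) auto
    then have "col X (?p - int r) (?n - 1) = {0}" using col_0 [of "?p - int r" "?n - 1"] by auto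
    then show ?thesis unfolding col_Z_def by simp
  qed
  have B: "x \<in> col_B X r ?p ?n \<longleftrightarrow> x \<in> col X ?p ?n \<and>
      (\<exists>w\<in>col X (?p - 1) ?n. x - w \<in> tot_boundaries X ?n)" for x proof -
    have 1: "y \<in> col X (?p + int r - 1) (Suc ?n) \<longleftrightarrow> y \<in> col X (int (Suc ?n)) (Suc ?n)" for y
      using col_tot[of y "?p + int r - 1" "Suc ?n"] col_mono[of y "int (Suc ?n)" "Suc ?n" "?p + int r - 1"] r by auto
    have 2: "x - w \<in> col X (int ?n) ?n" if "x \<in> col X ?p ?n" "w \<in> col X (?p - 1) ?n" for w using col_diff col_tot that by blast
    show ?thesis proof
      assume "x \<in> col_B X r ?p ?n"
      then obtain w y where *: "x \<in> col X ?p ?n" "w \<in> col X (?p - 1) ?n"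
        "y \<in> col X (?p + int r - 1) (Suc ?n)" "x - w - tot_d X (Suc ?n) y \<in> tot_rel X ?n" unfolding col_B_def by auto
      have "x - w \<in> tot_boundaries X ?n" unfolding tot_boundaries_iff using 2[OF *(1,2)] 1[THEN iffD1, OF *(3)] *(4) by (intro conjI bexI[of _ y])
      then show "x \<in> col X ?p ?n \<and> (\<exists>w\<in>col X (?p - 1) ?n. x - w \<in> tot_boundaries X ?n)" using * by (intro conjI bexI[of _ w])
    next
      assume "x \<in> col X ?p ?n \<and> (\<exists>w\<in>col X (?p - 1) ?n. x - w \<in> tot_boundaries X ?n)"
      then obtain w where *: "x \<in> col X ?p ?n" "w \<in> col X (?p - 1) ?n" "x - w \<in> tot_boundaries X ?n" by auto
      then obtain y where y: "y \<in> col X (int (Suc ?n)) (Suc ?n)" "x - w - tot_d X (Suc ?n) y \<in> tot_rel X ?n"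
        unfolding tot_boundaries_iff by auto
      show "x \<in> col_B X r ?p ?n" by (rule col_BI[OF *(1,2) 1[THEN iffD2, OF y(1)] y(2)])
    qed
  qed
  have \<phi>: "x - \<phi> x \<in> col X (?p - 1) ?n \<and> \<phi> x \<in> tot_cycles X ?n \<and> \<phi> x \<in> col X ?p ?n"
    if "x \<in> col_Z X r ?p ?n" for x proof -
    from that have x: "x \<in> col X ?p ?n" using Z by blast
    have "\<exists>w. w \<in> col X (?p - 1) ?n \<and> tot_d X ?n (x - w) \<in> tot_rel X (?n - 1)" using that Z by blast
    from someI_ex[OF this] have w: "x - \<phi> x \<in> col X (?p - 1) ?n" "tot_d X ?n (\<phi> x) \<in> tot_rel X (?n - 1)"
      unfolding \<phi>_def by auto
    have "x - (x - \<phi> x) \<in> col X ?p ?n" by (intro col_diff x col_mono[OF w(1)]) simp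
    then have c: "\<phi> x \<in> col X ?p ?n" by simp
    have "\<phi> x \<in> tot_cycles X ?n" unfolding tot_cycles_iff using col_tot[OF c] w(2) by (rule conjI)
    then show ?thesis using w(1) c by (intro conjI)
  qed
  have low: "u - v \<in> ?F (?p - 1)" if "u - v \<in> col X (?p - 1) ?n" "u \<in> tot_cycles X ?n" "v \<in> tot_cycles X ?n" for u v
    using that cycles_diff col_filtration by blast
  have Zs: "tot.subspace (col_Z X r ?p ?n)" by (rule col_Z_subspace)
  have BZ: "x \<in> col_Z X r ?p ?n" if "x \<in> col_B X r ?p ?n" for x using col_B_lead[OF that] col_Z_iff by blast
  have Bs: "\<phi> x \<in> ?F (?p - 1)" if xB: "x \<in> col_B X r ?p ?n" for x proof -
    obtain w where w: "w \<in> col X (?p - 1) ?n" "x - w \<in> tot_boundaries X ?n" using xB B by blast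
    have "w - (x - \<phi> x) \<in> col X (?p - 1) ?n" using col_diff w \<phi>[OF BZ[OF xB]] by blast
    moreover have "w - (x - \<phi> x) = \<phi> x - (x - w)" by simp
    moreover have "\<phi> x - (x - w) \<in> tot_cycles X ?n" using \<phi>[OF BZ[OF xB]] w tot_boundaries_cycles cycles_diff by blast
    ultimately have "\<phi> x - (x - w) \<in> ?F (?p - 1)" using col_filtration by simp
    then have "(\<phi> x - (x - w)) + (x - w) \<in> ?F (?p - 1)"
      using tot.subspace_add[OF filtration_subspace] boundaries_filtration[OF w(2)] by blast
    then show ?thesis by simp
  qed
  have "sq_iso (tot_scale X) (tot_scale X) \<phi> (col_page X r p q) (?F ?p, ?F (?p - 1))"
    unfolding sq_iso_def sq_hom_def col_page_def fst_conv snd_conv proof (intro conjI ballI allI impI)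
    fix x assume "x \<in> col_Z X r ?p ?n" then show "\<phi> x \<in> ?F ?p" using \<phi> col_filtration by blast
  next
    fix x assume "x \<in> col_B X r ?p ?n" then show "\<phi> x \<in> ?F (?p - 1)" by (rule Bs)
  next
    fix x y assume xy: "x \<in> col_Z X r ?p ?n" "y \<in> col_Z X r ?p ?n"
    have xy': "x + y \<in> col_Z X r ?p ?n" by (rule tot.subspace_add[OF Zs xy])
    have "(x - \<phi> x) + (y - \<phi> y) - (x + y - \<phi> (x + y)) \<in> col X (?p - 1) ?n"
      using \<phi>[OF xy(1)] \<phi>[OF xy(2)] \<phi>[OF xy'] by (meson col_diff col_add)
    moreover have "(x - \<phi> x) + (y - \<phi> y) - (x + y - \<phi> (x + y)) = \<phi> (x + y) - (\<phi> x + \<phi> y)" by simp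
    ultimately show "\<phi> (x + y) - (\<phi> x + \<phi> y) \<in> ?F (?p - 1)"
      using \<phi>[OF xy(1)] \<phi>[OF xy(2)] \<phi>[OF xy'] by (intro low cycles_add) simp_all
  next
    fix c x assume x: "x \<in> col_Z X r ?p ?n"
    have x': "tot_scale X c x \<in> col_Z X r ?p ?n" by (rule tot.subspace_scale[OF Zs x])
    have "tot_scale X c (x - \<phi> x) - (tot_scale X c x - \<phi> (tot_scale X c x)) \<in> col X (?p - 1) ?n"
      using \<phi>[OF x] \<phi>[OF x'] by (meson col_diff col_scale)
    moreover have "tot_scale X c (x - \<phi> x) - (tot_scale X c x - \<phi> (tot_scale X c x))
        = \<phi> (tot_scale X c x) - tot_scale X c (\<phi> x)" by (simp add: tot.scale_right_diff_distrib)
    ultimately show "\<phi> (tot_scale X c x) - tot_scale X c (\<phi> x) \<in> ?F (?p - 1)" using \<phi>[OF x] \<phi>[OF x']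
      by (intro low tot.subspace_scale[OF tot_cycles_subspace]) simp_all
  next
    fix x assume x: "x \<in> col_Z X r ?p ?n" and "\<phi> x \<in> ?F (?p - 1)"
    then obtain y z where yz: "\<phi> x = y + z" "y \<in> col X (?p - 1) ?n" "z \<in> tot_boundaries X ?n" unfolding filtration_iff by blast
    have "(x - \<phi> x) + y \<in> col X (?p - 1) ?n" using col_add \<phi>[OF x] yz by blast
    moreover have "x - ((x - \<phi> x) + y) = z" using yz by simp
    ultimately show "x \<in> col_B X r ?p ?n" using B Z x yz by metis
  next
    fix f assume "f \<in> ?F ?p"
    then obtain y z where yz: "f = y + z" "y \<in> tot_cycles X ?n" "y \<in> col X ?p ?n" "z \<in> tot_boundaries X ?n"
      unfolding filtration_iff by blast
    have yZ: "y \<in> col_Z X r ?p ?n" unfolding Z using yz col_0 by (auto simp: tot_cycles_iff intro!: bexI[of _ 0])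
    have "y - \<phi> y \<in> ?F (?p - 1)" using low \<phi>[OF yZ] yz by blast
    then have "(y - \<phi> y) + z \<in> ?F (?p - 1)" using tot.subspace_add[OF filtration_subspace] boundaries_filtration yz by blast
    moreover have "(y - \<phi> y) + z = f - \<phi> y" using yz by simp
    ultimately show "\<exists>x\<in>col_Z X r ?p ?n. f - \<phi> x \<in> ?F (?p - 1)" using yZ by metis
  qed
  then show "sq_isomorphic (tot_scale X) (tot_scale X) (col_page X r p q) (?F ?p, ?F (?p - 1))" unfolding sq_isomorphic_def by blast
qed

lemma col_page_converges:
  "ss_converges (tot_scale X) (col_page X) (tot_scale X) (tot_homology X) (col_homology_filtration X)" unfolding ss_converges_def tot_homology_def
proof (intro conjI allI)
  show "module (tot_scale X)" by unfold_locales
  show "subquotient (tot_scale X) (tot_cycles X n, tot_boundaries X n)" for n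
    unfolding subquotient_def using tot_cycles_subspace tot_boundaries_subspace tot_boundaries_cycles by simp
  show "col_homology_filtration X (- 1) n = snd (tot_cycles X n, tot_boundaries X n)" for n proof (rule equalityI; rule subsetI)
    fix x assume "x \<in> col_homology_filtration X (- 1) n"
    then obtain y z where "x = y + z" "y \<in> col X (- 1) n" "z \<in> tot_boundaries X n" unfolding filtration_iff by blast
    then show "x \<in> snd (tot_cycles X n, tot_boundaries X n)" using col_negative[of "- 1" y n] by simp
  qed (simp add: boundaries_filtration)
  show "col_homology_filtration X (int n) n = fst (tot_cycles X n, tot_boundaries X n)" for n proof (rule equalityI; rule subsetI)
    fix x assume "x \<in> col_homology_filtration X (int n) n"
    then show "x \<in> fst (tot_cycles X n, tot_boundaries X n)" by (simp add: col_homology_filtration_def)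
  qed (simp add: tot_cycles_iff col_filtration)
qed (use filtration_subspace filtration_mono ss_infinity_filtration in auto)

end

section \<open>The second page in terms of vertical homology\<close>

context first_quadrant_double_complex
begin

definition vcyc :: "nat \<Rightarrow> nat \<Rightarrow> 'm set" where
  "vcyc p q = {x \<in> dcZ X p q. q > 0 \<longrightarrow> vert X p q x \<in> dcN X p (q - 1)}"

definition vbd :: "nat \<Rightarrow> nat \<Rightarrow> 'm set" where
  "vbd p q = {x \<in> dcZ X p q. \<exists>z\<in>dcZ X p (Suc q). x - vert X p (Suc q) z \<in> dcN X p q}"

lemmas obj_0 = scale.subspace_0[OF obj_subspace(1)] scale.subspace_0[OF obj_subspace(2)]
  and obj_add = scale.subspace_add[OF obj_subspace(1)] scale.subspace_add[OF obj_subspace(2)]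
  and obj_diff = scale.subspace_diff[OF obj_subspace(1)] scale.subspace_diff[OF obj_subspace(2)]
  and obj_neg = scale.subspace_neg[OF obj_subspace(1)] scale.subspace_neg[OF obj_subspace(2)]
  and obj_scale = scale.subspace_scale[OF obj_subspace(1)] scale.subspace_scale[OF obj_subspace(2)]

lemma vbd_subspace: "scale.subspace (vbd p q)"
proof -
  have "vbd p q = {x \<in> dcZ X p q. \<exists>w\<in>{0}. \<exists>z\<in>dcZ X p (Suc q). x - w - vert X p (Suc q) z \<in> dcN X p q}" by (auto simp: vbd_def)
  then show ?thesis
    by (simp only:) (rule subspace_modulo[OF scale.module_axioms], simp_all add: obj_subspace scale.subspace_single_0 vert_add obj_scale vert_scale)
qed

lemmas vbd_add = scale.subspace_add[OF vbd_subspace] and vbd_diff = scale.subspace_diff[OF vbd_subspace]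
  and vbd_neg = scale.subspace_neg[OF vbd_subspace] and vbd_0 = scale.subspace_0[OF vbd_subspace]

lemma rel_vbd: "x \<in> dcN X p q \<Longrightarrow> x \<in> vbd p q" unfolding vbd_def using obj_subset obj_0 vert_0 by (auto intro!: bexI[of _ 0])

lemma vcyc_obj: "x \<in> vcyc p q \<Longrightarrow> x \<in> dcZ X p q" by (simp add: vcyc_def)

text \<open>The horizontal map anticommutes with the vertical one, so the witness is moved along
  with a sign. Hence the horizontal map descends to vertical homology.\<close>

lemma horiz_vbd: assumes "x \<in> vbd (Suc p) q" shows "horiz X (Suc p) q x \<in> vbd p q"
proof -
  obtain z where x: "x \<in> dcZ X (Suc p) q" and z: "z \<in> dcZ X (Suc p) (Suc q)" and *: "x - vert X (Suc p) (Suc q) z \<in> dcN X (Suc p) q"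
    using assms unfolding vbd_def by blast
  let ?h = "horiz X (Suc p) q" and ?v = "vert X (Suc p) (Suc q) z"
  have "?h (x - ?v) \<in> dcN X p q" using horiz_rel * by blast
  moreover have "?h (x - ?v) = ?h x - ?h ?v" by (intro horiz_diff x vert_in z)
  moreover have "vert X p (Suc q) (horiz X (Suc p) (Suc q) z) + ?h ?v \<in> dcN X p q" by (rule vert_horiz[OF z])
  ultimately have "(?h x - ?h ?v) + (vert X p (Suc q) (horiz X (Suc p) (Suc q) z) + ?h ?v) \<in> dcN X p q" using obj_add(2) by metis
  moreover have "vert X p (Suc q) (- horiz X (Suc p) (Suc q) z) = - vert X p (Suc q) (horiz X (Suc p) (Suc q) z)"
    using vert_scale[OF horiz_in[OF z], of "- 1"] by simp
  ultimately have "?h x - vert X p (Suc q) (- horiz X (Suc p) (Suc q) z) \<in> dcN X p q" by (simp add: algebra_simps)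
  then show ?thesis unfolding vbd_def using horiz_in[OF x] obj_neg(1)[OF horiz_in[OF z]] by blast
qed

lemma col_at: "x \<in> col X r (p + q) \<Longrightarrow> x p \<in> dcZ X p q" by (simp add: col_def tot_def) (metis add_diff_cancel_left' le_add1)

lemma rel_at: "x \<in> tot_rel X n \<Longrightarrow> i + j = n \<Longrightarrow> x i \<in> dcN X i j"
  by (simp add: tot_rel_def) (metis add_diff_cancel_left' le_add1)

lemma tot_d_at: "p + q = n \<Longrightarrow> q > 0 \<Longrightarrow> tot_d X n x p = vert X p q (x p) + horiz X (Suc p) (q - 1) (x (Suc p))"
  by (auto simp: tot_d_def)

text \<open>Only the leading component counts: it has to be a vertical cycle whose horizontal image
  bounds vertically, in other words a cycle for the first differential.\<close>

lemma vcyc_Z: "x \<in> col_Z X 2 (int p) (p + q) \<longleftrightarrow> x \<in> col X (int p) (p + q) \<and> x p \<in> vcyc p q \<and>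
    (p > 0 \<longrightarrow> horiz X p q (x p) \<in> vbd (p - 1) q)"
proof
  assume "x \<in> col_Z X 2 (int p) (p + q)"
  then obtain w u where x: "x \<in> col X (int p) (p + q)" and w: "w \<in> col X (int p - 1) (p + q)" and u: "u \<in> col X (int p - 2) (p + q - 1)"
    and rel: "tot_d X (p + q) (x - w) - u \<in> tot_rel X (p + q - 1)" unfolding col_Z_def by auto
  have xp: "x p \<in> dcZ X p q" using x col_at by blast
  have z: "x (Suc p) = 0" "w p = 0" "w (Suc p) = 0" "u p = 0" using x w u by (auto simp: col_def)
  have "vert X p q (x p) \<in> dcN X p (q - 1)" if q: "q > 0" proof -
    have "(tot_d X (p + q) (x - w) - u) p \<in> dcN X p (q - 1)" by (rule rel_at[OF rel]) (use q in simp)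
    then show ?thesis using z q by (simp add: tot_d_at horiz_0)
  qed
  moreover have "horiz X p q (x p) \<in> vbd (p - 1) q" if p: "p > 0" proof -
    obtain p' where p': "p = Suc p'" using p gr0_implies_Suc by blast
    have "(tot_d X (p + q) (x - w) - u) p' \<in> dcN X p' q" by (rule rel_at[OF rel]) (simp add: p')
    moreover have "(tot_d X (p + q) (x - w) - u) p' = vert X p' (Suc q) (x p' - w p') + horiz X p q (x p)"
      using z u by (simp add: p' tot_d_at[of p' "Suc q"] col_def)
    ultimately have *: "horiz X p q (x p) - vert X p' (Suc q) (- (x p' - w p')) \<in> dcN X p' q" and xw: "x p' - w p' \<in> dcZ X p' (Suc q)" proof -
      have "x p' \<in> dcZ X p' (Suc q)" "w p' \<in> dcZ X p' (Suc q)"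
        using x w unfolding col_def tot_def p' by (auto simp: Suc_diff_le dest: spec[of _ p'])
      then show a: "x p' - w p' \<in> dcZ X p' (Suc q)" using obj_diff(1) by blast
      assume "(tot_d X (p + q) (x - w) - u) p' \<in> dcN X p' q"
       "(tot_d X (p + q) (x - w) - u) p' = vert X p' (Suc q) (x p' - w p') + horiz X p q (x p)"
      then show "horiz X p q (x p) - vert X p' (Suc q) (- (x p' - w p')) \<in> dcN X p' q"
        using vert_scale[OF a, of "- 1"] by (simp add: algebra_simps)
    qed
    show ?thesis unfolding vbd_def using * obj_neg(1)[OF xw] horiz_in[of "x p" p' q] xp p' by auto
  qed
  ultimately show "x \<in> col X (int p) (p + q) \<and> x p \<in> vcyc p q \<and> (p > 0 \<longrightarrow> horiz X p q (x p) \<in> vbd (p - 1) q)"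
    using x xp by (simp add: vcyc_def)
next
  assume "x \<in> col X (int p) (p + q) \<and> x p \<in> vcyc p q \<and> (p > 0 \<longrightarrow> horiz X p q (x p) \<in> vbd (p - 1) q)"
  then have x: "x \<in> col X (int p) (p + q)" and xp: "x p \<in> dcZ X p q" and v: "q > 0 \<Longrightarrow> vert X p q (x p) \<in> dcN X p (q - 1)"
    and h: "p > 0 \<Longrightarrow> horiz X p q (x p) \<in> vbd (p - 1) q" by (auto simp: vcyc_def)
  have "\<exists>z. \<forall>p'. p = Suc p' \<longrightarrow> z \<in> dcZ X p' (Suc q) \<and>
      vert X p' (Suc q) z + horiz X p q (x p) \<in> dcN X p' q" proof (cases p)
    case (Suc p')
    then obtain z where z: "z \<in> dcZ X p' (Suc q)"
      "horiz X p q (x p) - vert X p' (Suc q) z \<in> dcN X p' q" using h unfolding vbd_def by auto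
    have "vert X p' (Suc q) (- z) + horiz X p q (x p) \<in> dcN X p' q" using z(2) vert_scale[OF z(1), of "- 1"] by (simp add: algebra_simps)
    then show ?thesis using obj_neg(1)[OF z(1)] Suc by (intro exI[of _ "- z"]) simp
  qed simp
  then obtain z where z: "\<And>p'. p = Suc p' \<Longrightarrow> z \<in> dcZ X p' (Suc q) \<and>
      vert X p' (Suc q) z + horiz X p q (x p) \<in> dcN X p' q" by blast
  \<comment> \<open>Two columns suffice: the leading component, and \<open>z\<close>, whose vertical
    boundary cancels the horizontal image of the former. The rest of \<open>x\<close> goes into the
    correction.\<close>
  define x' where "x' i = (if i = p then x p else if Suc i = p then z else 0)" for i
  have x': "x' \<in> col X (int p) (p + q)" using xp z obj_0 by (auto simp: x'_def col_def tot_def Suc_diff_le)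
  have d: "tot_d X (p + q) x' \<in> col X (int p) (p + q - 1)" by (rule tot_d_col[OF x'])
  \<comment> \<open>What survives of the boundary of \<open>x'\<close> lies at least two columns to
    the left, as page 2 requires.\<close>
  define u where "u i = (if Suc i < p then tot_d X (p + q) x' i else 0)" for i
  have u: "u \<in> col X (int p - 2) (p + q - 1)" using d obj_0 by (auto simp: u_def col_def tot_def)
  have w: "x - x' \<in> col X (int p - 1) (p + q)" using col_diff[OF x x'] by (auto simp: col_def x'_def dest: le_neq_implies_less)
  have "(tot_d X (p + q) x' - u) i \<in> dcN X i (p + q - 1 - i)" if i: "i \<le> p + q - 1" for i proof -
    consider "Suc i < p" | "Suc i = p" | "i = p" "q > 0" | "i = p" "q = 0" | "i > p" by linarith
    then show ?thesis proof cases
      case 2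
      then have "tot_d X (p + q) x' i = vert X i (Suc q) z + horiz X p q (x p)" by (subst tot_d_at[of i "Suc q"]) (auto simp: x'_def)
      then show ?thesis using z[of i] 2 by (auto simp: u_def)
    next
      case 3
      then have "tot_d X (p + q) x' i = vert X i q (x p)" by (subst tot_d_at[of i "q"]) (auto simp: x'_def horiz_0)
      then show ?thesis using v 3 by (simp add: u_def)
    next
      case 4 then show ?thesis using obj_0 by (simp add: u_def tot_d_def)
    next
      case 5 then show ?thesis using d obj_0 by (simp add: u_def col_def)
    qed (simp add: u_def obj_0)
  qed
  moreover have "(tot_d X (p + q) x' - u) i = 0" if i: "i > p + q - 1" for i using d i by (auto simp: u_def col_def tot_def)
  ultimately have "tot_d X (p + q) (x - (x - x')) - u \<in> tot_rel X (p + q - 1)" by (simp add: tot_rel_def)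
  then show "x \<in> col_Z X 2 (int p) (p + q)" unfolding col_Z_def using x w u by force
qed

text \<open>A bounding chain for page 2 reaches one column beyond \<open>p\<close>. Its entry there
  must be a vertical cycle, and its entry in column \<open>p\<close> contributes a vertical
  boundary. In the converse, the boundary in columns left of \<open>p\<close> is compensated by
  \<open>w\<close>.\<close>

lemma vbd_B: "x \<in> col_B X 2 (int p) (p + q) \<longleftrightarrow> x \<in> col X (int p) (p + q) \<and>
    (\<exists>y\<in>vcyc (Suc p) q. x p - horiz X (Suc p) q y \<in> vbd p q)"
proof
  assume "x \<in> col_B X 2 (int p) (p + q)"
  then obtain w y where x: "x \<in> col X (int p) (p + q)" and w: "w \<in> col X (int p - 1) (p + q)" and y: "y \<in> col X (int p + 1) (Suc (p + q))"
    and rel: "x - w - tot_d X (Suc (p + q)) y \<in> tot_rel X (p + q)" unfolding col_B_def by (auto simp: add.commute)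
  have xp: "x p \<in> dcZ X p q" using x col_at by blast
  have yp: "y p \<in> dcZ X p (Suc q)" "y (Suc p) \<in> dcZ X (Suc p) q" using tot_component[OF y, of p] by auto
  have z: "x (Suc p) = 0" "w p = 0" "w (Suc p) = 0" "y (Suc (Suc p)) = 0" using x w y by (auto simp: col_def)
  have "vert X (Suc p) q (y (Suc p)) \<in> dcN X (Suc p) (q - 1)" if q: "q > 0" proof -
    have "(x - w - tot_d X (Suc (p + q)) y) (Suc p) \<in> dcN X (Suc p) (q - 1)" by (rule rel_at[OF rel]) (use q in simp)
    then show ?thesis using z q obj_neg(2) by (fastforce simp: tot_d_at[of "Suc p" q] horiz_0)
  qed
  then have "y (Suc p) \<in> vcyc (Suc p) q" using yp by (simp add: vcyc_def)
  moreover have "(x - w - tot_d X (Suc (p + q)) y) p \<in> dcN X p q" by (rule rel_at[OF rel]) simp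
  then have "x p - horiz X (Suc p) q (y (Suc p)) - vert X p (Suc q) (y p) \<in> dcN X p q" using z by (simp add: tot_d_at[of p "Suc q"] algebra_simps)
  then have "x p - horiz X (Suc p) q (y (Suc p)) \<in> vbd p q" unfolding vbd_def using obj_diff(1)[OF xp horiz_in[OF yp(2)]] yp by blast
  ultimately show "x \<in> col X (int p) (p + q) \<and> (\<exists>y\<in>vcyc (Suc p) q. x p - horiz X (Suc p) q y \<in> vbd p q)" using x by blast
next
  assume "x \<in> col X (int p) (p + q) \<and> (\<exists>y\<in>vcyc (Suc p) q. x p - horiz X (Suc p) q y \<in> vbd p q)"
  then obtain y z where x: "x \<in> col X (int p) (p + q)" and y: "y \<in> vcyc (Suc p) q" and z: "z \<in> dcZ X p (Suc q)"
    and h: "x p - horiz X (Suc p) q y - vert X p (Suc q) z \<in> dcN X p q" unfolding vbd_def by blast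
  define Y where "Y i = (if i = Suc p then y else if i = p then z else 0)" for i
  have Y: "Y \<in> col X (int p + 1) (Suc (p + q))" using vcyc_obj[OF y] z obj_0 by (auto simp: Y_def col_def tot_def Suc_diff_le)
  have d: "tot_d X (Suc (p + q)) Y \<in> col X (int p + 1) (p + q)" using tot_d_col[OF Y] by simp
  define w where "w i = (if i < p then x i - tot_d X (Suc (p + q)) Y i else 0)" for i
  have w: "w \<in> col X (int p - 1) (p + q)" using x d obj_0 obj_diff by (auto simp: w_def col_def tot_def)
  have "(x - w - tot_d X (Suc (p + q)) Y) i \<in> dcN X i (p + q - i)" if i: "i \<le> p + q" for i proof -
    consider "i < p" | "i = p" | "i = Suc p" | "i > Suc p" by linarith
    then show ?thesis proof cases
      case 2
      then have "tot_d X (Suc (p + q)) Y i = vert X p (Suc q) z + horiz X (Suc p) q y" by (subst tot_d_at[of i "Suc q"]) (auto simp: Y_def)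
      then show ?thesis using h 2 by (simp add: w_def algebra_simps)
    next
      case 3
      then have q: "q > 0" using i by simp
      then have "tot_d X (Suc (p + q)) Y i = vert X (Suc p) q y" using 3 by (subst tot_d_at[of i q]) (auto simp: Y_def horiz_0)
      then show ?thesis using y q 3 x obj_neg(2) by (simp add: w_def vcyc_def col_def)
    next
      case 4
      then show ?thesis using d x obj_0 by (simp add: w_def col_def)
    qed (simp add: w_def obj_0)
  qed
  moreover have "(x - w - tot_d X (Suc (p + q)) Y) i = 0" if i: "i > p + q" for i using d x w i by (auto simp: w_def col_def tot_def)
  ultimately have "x - w - tot_d X (Suc (p + q)) Y \<in> tot_rel X (p + q)" by (simp add: tot_rel_def)
  then show "x \<in> col_B X 2 (int p) (p + q)" by (rule col_BI[OF x w, of Y 2, rotated]) (use Y in \<open>simp add: algebra_simps\<close>)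
qed

end

text \<open>In \<open>Y\<close> relations and vertical maps are zero, so \<open>f\<close> identifies
  its modules with the vertical homology of \<open>X\<close>. All conditions on \<open>f\<close> are
  conditions on homology classes: linearity and compatibility with the horizontal maps hold modulo
  vertical boundaries.\<close>

locale first_page_equivalence = X: first_quadrant_double_complex X + Y: first_quadrant_double_complex Y
  for X :: "('k::comm_ring_1, 'm::ab_group_add) double_complex" and Y :: "('k, 'n::ab_group_add) double_complex" +
  fixes f :: "nat \<Rightarrow> nat \<Rightarrow> 'n \<Rightarrow> 'm" assumes Y_rel: "dcN Y p q = {0}"
    and Y_vert: "y \<in> dcZ Y p (Suc q) \<Longrightarrow> vert Y p (Suc q) y = 0"
    and f_vcyc: "y \<in> dcZ Y p q \<Longrightarrow> f p q y \<in> X.vcyc p q"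
    and f_add: "y \<in> dcZ Y p q \<Longrightarrow> y' \<in> dcZ Y p q \<Longrightarrow>
      f p q (y + y') - (f p q y + f p q y') \<in> X.vbd p q" and f_scale: "y \<in> dcZ Y p q \<Longrightarrow>
      f p q (dc_scale Y c y) - dc_scale X c (f p q y) \<in> X.vbd p q"
    and f_inj: "y \<in> dcZ Y p q \<Longrightarrow> f p q y \<in> X.vbd p q \<Longrightarrow> y = 0"
    and f_surj: "x \<in> X.vcyc p q \<Longrightarrow> \<exists>y\<in>dcZ Y p q. x - f p q y \<in> X.vbd p q"
    and f_horiz: "y \<in> dcZ Y (Suc p) q \<Longrightarrow> horiz X (Suc p) q (f (Suc p) q y) - f p q (horiz Y (Suc p) q y) \<in> X.vbd p q"
begin

lemma f_0: "f p q 0 \<in> X.vbd p q" using X.vbd_neg[OF f_add[of 0 p q 0]] Y.obj_0 by simp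

lemma f_diff_vbd: assumes y: "y \<in> dcZ Y p q" "y' \<in> dcZ Y p q" and "f p q y - f p q y' \<in> X.vbd p q" shows "y = y'"
proof -
  have d: "y - y' \<in> dcZ Y p q" using Y.obj_diff(1) y by blast
  have "(f p q y - f p q y') - (f p q (y - y' + y') - (f p q (y - y') + f p q y')) \<in> X.vbd p q" by (intro X.vbd_diff[OF assms(3)] f_add d y)
  then have "f p q (y - y') \<in> X.vbd p q" by simp
  then show ?thesis using f_inj d by fastforce
qed

lemma Y_vbd: "Y.vbd p q = {0}" using Y_vert Y.obj_0 by (fastforce simp: Y.vbd_def Y_rel)

lemma Y_vcyc: "Y.vcyc p q = dcZ Y p q" using Y_vert[of _ p "q - 1"] by (cases q) (auto simp: Y.vcyc_def Y_rel)

lemma Y_tot_d: "x \<in> col Y p n \<Longrightarrow> tot_d Y n x i = (if i < n then horiz Y (Suc i) (n - Suc i) (x (Suc i)) else 0)"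
  using Y.tot_component[of x p n i] Y_vert by (simp add: Y.tot_d_eq)

lemma Y_tot_rel: "tot_rel Y n = {0}" by (auto simp: tot_rel_def Y_rel fun_eq_iff) (metis not_le)

text \<open>Without vertical maps a cycle of page 2 may be replaced by its leading component alone,
  which is then a total cycle, and a boundary reaches column \<open>p\<close> only from column
  \<open>p + 1\<close>. So all later differentials vanish.\<close>

lemma Y_page: assumes "r \<ge> 2" shows "col_page Y r p q = col_page Y 2 p q"
proof -
  let ?n = "p + q"
  have "col_Z Y 2 (int p) ?n \<subseteq> col_Z Y r (int p) ?n" proof
    fix x assume x: "x \<in> col_Z Y 2 (int p) ?n"
    then have xc: "x \<in> col Y (int p) ?n" and h: "p > 0 \<Longrightarrow> horiz Y p q (x p) = 0" unfolding Y.vcyc_Z Y_vbd by auto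
    define x' where "x' i = (if i = p then x p else 0)" for i
    have x': "x' \<in> col Y (int p) ?n" using Y.col_at[OF xc] Y.obj_0 by (auto simp: x'_def col_def tot_def)
    have "x - x' \<in> col Y (int p - 1) ?n" using Y.col_diff[OF xc x'] by (auto simp: col_def x'_def dest: le_neq_implies_less)
    moreover have "horiz Y (Suc i) (?n - Suc i) 0 = 0" for i by (rule Y.horiz_0)
    then have "tot_d Y ?n x' = 0" using h by (auto simp: fun_eq_iff Y_tot_d[OF x'] x'_def)
    ultimately show "x \<in> col_Z Y r (int p) ?n"
      unfolding col_Z_def using xc Y.col_0 Y.rel_0 by (intro CollectI conjI bexI[of _ "x - x'"] bexI[of _ 0]) auto
  qed
  moreover have "col_B Y r (int p) ?n \<subseteq> col_B Y 2 (int p) ?n" proof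
    fix x assume "x \<in> col_B Y r (int p) ?n"
    then obtain w y where x: "x \<in> col Y (int p) ?n" and w: "w \<in> col Y (int p - 1) ?n"
      and y: "y \<in> col Y (int p + int r - 1) (Suc ?n)" and *: "x - w - tot_d Y (Suc ?n) y = 0" unfolding col_B_def Y_tot_rel by auto
    have "x p = tot_d Y (Suc ?n) y p" using w fun_cong[OF *, of p] by (simp add: col_def)
    then have "x p = horiz Y (Suc p) q (y (Suc p))" using Y_tot_d[OF y, of p] by simp
    moreover have "y (Suc p) \<in> dcZ Y (Suc p) q" using Y.tot_component(2)[OF y, of p] by simp
    ultimately show "x \<in> col_B Y 2 (int p) ?n" unfolding Y.vbd_B Y_vbd Y_vcyc using x by auto
  qed
  ultimately show ?thesis using Y.col_Z_antimono[OF assms] Y.col_B_mono[OF assms] unfolding col_page_def by (metis equalityI)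
qed

text \<open>The term at infinity of \<open>Y\<close> is its second page, on which \<open>f\<close>
  acts through the leading component. The isomorphism is constructed from \<open>Y\<close> to
  \<open>X\<close>, where it is explicit, and inverted at the end.\<close>

lemma second_page:
  "sq_isomorphic (tot_scale X) (tot_scale Y) (col_page X 2 p q) (col_infinity Y p q)"
proof -
  let ?n = "p + q"
  define \<psi> where "\<psi> y = (\<lambda>i. if i = p then f p q (y p) else 0)" for y :: "nat \<Rightarrow> 'n"
  have inf: "col_infinity Y p q = col_page Y 2 p q" using Y.col_infinity_eq[of p q "p + q + 2"] Y_page[of "p + q + 2"] by simp
  have Yp: "y p \<in> dcZ Y p q" if "y \<in> col Y (int p) ?n" for y using that Y.col_at by blast
  have \<psi>: "\<psi> y \<in> col X (int p) ?n" if "y \<in> col Y (int p) ?n" for y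
    using X.vcyc_obj[OF f_vcyc[OF Yp[OF that]]] X.obj_0 by (auto simp: \<psi>_def col_def tot_def)
  have B: "x \<in> col_B X 2 (int p) ?n" if "x \<in> col X (int p) ?n" "x p \<in> X.vbd p q" for x unfolding X.vbd_B using that X.obj_0 X.vert_0
    by (intro conjI bexI[of _ 0]) (auto simp: X.horiz_0 X.vcyc_def gr0_conv_Suc)
  have Z: "y \<in> col_Z Y 2 (int p) ?n \<longleftrightarrow> y \<in> col Y (int p) ?n \<and> (p > 0 \<longrightarrow> horiz Y p q (y p) = 0)" for y
    unfolding Y.vcyc_Z Y_vbd Y_vcyc using Yp by auto
  have hf: "horiz X p q (f p q y) - f (p - 1) q (horiz Y p q y) \<in> X.vbd (p - 1) q" if "p > 0" "y \<in> dcZ Y p q" for y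
    using f_horiz[of y "p - 1" q] that by simp
  have "sq_iso (tot_scale Y) (tot_scale X) \<psi> (col_page Y 2 p q) (col_page X 2 p q)"
    unfolding sq_iso_def sq_hom_def col_page_def fst_conv snd_conv proof (intro conjI ballI allI impI)
    fix y assume y: "y \<in> col_Z Y 2 (int p) ?n"
    have "horiz X p q (f p q (y p)) \<in> X.vbd (p - 1) q" if p: "p > 0" using X.vbd_add[OF hf[OF p Yp[of y]] f_0] y p by (simp add: Z)
    then show "\<psi> y \<in> col_Z X 2 (int p) ?n" unfolding X.vcyc_Z using \<psi> y f_vcyc Yp by (auto simp: Z \<psi>_def)
  next
    fix y assume y: "y \<in> col_B Y 2 (int p) ?n"
    then obtain z where z: "z \<in> dcZ Y (Suc p) q" "y p = horiz Y (Suc p) q z" and yc: "y \<in> col Y (int p) ?n"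
      unfolding Y.vbd_B Y_vbd Y_vcyc by auto
    have "f p q (y p) - horiz X (Suc p) q (f (Suc p) q z) \<in> X.vbd p q" using X.vbd_neg[OF f_horiz[OF z(1)]] z by simp
    then show "\<psi> y \<in> col_B X 2 (int p) ?n" unfolding X.vbd_B using \<psi>[OF yc] f_vcyc[OF z(1)] by (auto simp: \<psi>_def)
  next
    fix x y assume "x \<in> col_Z Y 2 (int p) ?n" "y \<in> col_Z Y 2 (int p) ?n"
    then have c: "x \<in> col Y (int p) ?n" "y \<in> col Y (int p) ?n" by (simp_all add: Z)
    show "\<psi> (x + y) - (\<psi> x + \<psi> y) \<in> col_B X 2 (int p) ?n"
      by (intro B X.col_diff X.col_add \<psi> Y.col_add c) (use f_add[OF Yp Yp, OF c] in \<open>simp add: \<psi>_def\<close>)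
  next
    fix c x assume "x \<in> col_Z Y 2 (int p) ?n"
    then have x: "x \<in> col Y (int p) ?n" by (simp add: Z)
    show "\<psi> (tot_scale Y c x) - tot_scale X c (\<psi> x) \<in> col_B X 2 (int p) ?n"
      by (intro B X.col_diff X.col_scale \<psi> Y.col_scale x) (use f_scale[OF Yp, OF x] in \<open>simp add: \<psi>_def tot_scale_def\<close>)
  next
    fix y assume yZ: "y \<in> col_Z Y 2 (int p) ?n" and yB: "\<psi> y \<in> col_B X 2 (int p) ?n"
    from yZ have y: "y \<in> col Y (int p) ?n" by (simp add: Z)
    from yB obtain x where x: "x \<in> X.vcyc (Suc p) q" and 1: "f p q (y p) - horiz X (Suc p) q x \<in> X.vbd p q"
      unfolding X.vbd_B by (auto simp: \<psi>_def)
    \<comment> \<open>The vertical cycle \<open>x\<close> is replaced by an element coming from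
      \<open>Y\<close>; then the relation can be pulled back along \<open>f\<close>, which is
      injective on classes.\<close>
    obtain z where z: "z \<in> dcZ Y (Suc p) q" and 2: "x - f (Suc p) q z \<in> X.vbd (Suc p) q" using f_surj[OF x] by blast
    have "horiz X (Suc p) q (x - f (Suc p) q z) \<in> X.vbd p q" using X.horiz_vbd[OF 2] .
    then have 3: "horiz X (Suc p) q x - horiz X (Suc p) q (f (Suc p) q z) \<in> X.vbd p q"
      using X.horiz_diff[OF X.vcyc_obj[OF x] X.vcyc_obj[OF f_vcyc[OF z]]] by simp
    have "f p q (y p) - f p q (horiz Y (Suc p) q z) \<in> X.vbd p q" using X.vbd_add[OF X.vbd_add[OF 1 3] f_horiz[OF z]] by simp
    then have "y p = horiz Y (Suc p) q z" using f_diff_vbd[OF Yp[OF y] Y.horiz_in[OF z]] by blast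
    then show "y \<in> col_B Y 2 (int p) ?n" unfolding Y.vbd_B Y_vbd Y_vcyc using y z by auto
  next
    fix x assume "x \<in> col_Z X 2 (int p) ?n"
    then have x: "x \<in> col X (int p) ?n" "x p \<in> X.vcyc p q" and h: "p > 0 \<Longrightarrow> horiz X p q (x p) \<in> X.vbd (p - 1) q"
      unfolding X.vcyc_Z by auto
    obtain z where z: "z \<in> dcZ Y p q" "x p - f p q z \<in> X.vbd p q" using f_surj[OF x(2)] by blast
    define y where "y i = (if i = p then z else 0)" for i
    have y: "y \<in> col Y (int p) ?n" using z Y.obj_0 by (auto simp: y_def col_def tot_def)
    have "horiz Y p q z = 0" if p: "p > 0" proof (rule f_inj)
      obtain p' where p': "p = Suc p'" using p gr0_implies_Suc by blast
      show "horiz Y p q z \<in> dcZ Y (p - 1) q" using Y.horiz_in[of z p' q] z p' by simp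
      have "horiz X p q (x p) - horiz X p q (f p q z) \<in> X.vbd (p - 1) q"
        using X.horiz_vbd[of "x p - f p q z" p' q] z p' x X.horiz_diff[of "x p" p' q "f p q z"] by (simp add: X.vcyc_obj f_vcyc)
      from X.vbd_diff[OF X.vbd_diff[OF h[OF p] this] hf[OF p z(1)]]
      show "f (p - 1) q (horiz Y p q z) \<in> X.vbd (p - 1) q" by simp
    qed
    then have "y \<in> col_Z Y 2 (int p) ?n" using y by (simp add: Z y_def)
    moreover have "x - \<psi> y \<in> col_B X 2 (int p) ?n" by (intro B X.col_diff \<psi> y x) (use z in \<open>simp add: \<psi>_def y_def\<close>)
    ultimately show "\<exists>y\<in>col_Z Y 2 (int p) ?n. x - \<psi> y \<in> col_B X 2 (int p) ?n" by blast
  qed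
  then show ?thesis unfolding inf
    by (rule sq_isomorphic_sym[OF Y.tot.module_axioms X.tot.module_axioms Y.col_page_subquotient X.col_page_subquotient])
qed

end

section \<open>Linear mixed complexes\<close>

text \<open>The operators are strictly linear on representatives, as linear extensions are. The
  cyclic construction adds values of \<open>mx_del\<close> and \<open>mx_B\<close>, and strictness
  makes the result a double complex in the sense used above.\<close>

locale linear_mixed_complex =
  fixes M :: "('k::comm_ring_1, 'm::ab_group_add) mixed_complex" assumes scale_module: "module (mx_scale M)"
    and obj_subquotient: "subquotient (mx_scale M) (mx_obj M p q)" and D_in: "x \<in> mxZ M p (Suc q) \<Longrightarrow> mx_D M x \<in> mxZ M p q"
    and D_rel: "x \<in> mxN M p (Suc q) \<Longrightarrow> mx_D M x \<in> mxN M p q"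
    and D_add: "x \<in> mxZ M p q \<Longrightarrow> y \<in> mxZ M p q \<Longrightarrow> mx_D M (x + y) = mx_D M x + mx_D M y"
    and D_scale: "x \<in> mxZ M p q \<Longrightarrow> mx_D M (mx_scale M c x) = mx_scale M c (mx_D M x)"
    and del_in: "x \<in> mxZ M (Suc p) q \<Longrightarrow> mx_del M x \<in> mxZ M p q"
    and del_rel: "x \<in> mxN M (Suc p) q \<Longrightarrow> mx_del M x \<in> mxN M p q"
    and del_add: "x \<in> mxZ M p q \<Longrightarrow> y \<in> mxZ M p q \<Longrightarrow> mx_del M (x + y) = mx_del M x + mx_del M y"
    and del_scale: "x \<in> mxZ M p q \<Longrightarrow> mx_del M (mx_scale M c x) = mx_scale M c (mx_del M x)"
    and B_in: "x \<in> mxZ M p q \<Longrightarrow> mx_B M x \<in> mxZ M p (Suc q)"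
    and B_rel: "x \<in> mxN M p q \<Longrightarrow> mx_B M x \<in> mxN M p (Suc q)"
    and B_add: "x \<in> mxZ M p q \<Longrightarrow> y \<in> mxZ M p q \<Longrightarrow> mx_B M (x + y) = mx_B M x + mx_B M y"
    and B_scale: "x \<in> mxZ M p q \<Longrightarrow> mx_B M (mx_scale M c x) = mx_scale M c (mx_B M x)"
    and D_D: "x \<in> mxZ M p (Suc (Suc q)) \<Longrightarrow> mx_D M (mx_D M x) \<in> mxN M p q"
    and del_del: "x \<in> mxZ M (Suc (Suc p)) q \<Longrightarrow> mx_del M (mx_del M x) \<in> mxN M p q"
    and B_B: "x \<in> mxZ M p q \<Longrightarrow> mx_B M (mx_B M x) \<in> mxN M p (Suc (Suc q))"
    and D_del: "x \<in> mxZ M (Suc p) (Suc q) \<Longrightarrow>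
      mx_D M (mx_del M x) + mx_del M (mx_D M x) \<in> mxN M p q" and B_del: "x \<in> mxZ M (Suc p) q \<Longrightarrow>
      mx_B M (mx_del M x) + mx_del M (mx_B M x) \<in> mxN M p (Suc q)" and D_B: "x \<in> mxZ M p (Suc q) \<Longrightarrow>
      mx_D M (mx_B M x) + mx_B M (mx_D M x) \<in> mxN M p (Suc q)" and D_B_0: "x \<in> mxZ M p 0 \<Longrightarrow> mx_D M (mx_B M x) \<in> mxN M p 0"
begin

sublocale scale: module "mx_scale M" by (rule scale_module)

lemma obj_subspace: "scale.subspace (mxZ M p q)" "scale.subspace (mxN M p q)" and obj_subset: "mxN M p q \<subseteq> mxZ M p q"
  using obj_subquotient[of p q] by (auto simp: subquotient_def)

lemmas obj_0 = scale.subspace_0[OF obj_subspace(1)] scale.subspace_0[OF obj_subspace(2)]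
  and obj_add = scale.subspace_add[OF obj_subspace(1)] scale.subspace_add[OF obj_subspace(2)]

sublocale HH: first_quadrant_double_complex "HH_complex M" by unfold_locales
    (auto simp: HH_complex_def scale.scale_right_distrib scale.scale_left_distrib obj_subquotient D_in D_rel D_add D_scale
      del_in del_rel del_add del_scale D_D del_del D_del)

lemma HH_vbd: "x \<in> HH.vbd p q \<longleftrightarrow> x \<in> mxZ M p q \<and> (\<exists>z\<in>mxZ M p (Suc q). x - mx_D M z \<in> mxN M p q)"
  and HH_vcyc: "x \<in> HH.vcyc p q \<longleftrightarrow> x \<in> mxZ M p q \<and> (q > 0 \<longrightarrow> mx_D M x \<in> mxN M p (q - 1))"
  unfolding HH.vbd_def HH.vcyc_def by (simp_all add: HH_complex_def)

abbreviation HCM where "HCM \<equiv> HC_complex M"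

lemma HC_obj:
  "x \<in> dcZ HCM p q \<longleftrightarrow> (\<forall>i\<le>min p q. x i \<in> mxZ M (p - i) (q - i)) \<and> (\<forall>i>min p q. x i = 0)"
  "x \<in> dcN HCM p q \<longleftrightarrow> (\<forall>i\<le>min p q. x i \<in> mxN M (p - i) (q - i)) \<and> (\<forall>i>min p q. x i = 0)"
  by (simp_all add: HC_complex_def)

lemma HC_at:
  "x \<in> dcZ HCM p q \<Longrightarrow> i + j = p \<Longrightarrow> i + l = q \<Longrightarrow> x i \<in> mxZ M j l"
  "x \<in> dcN HCM p q \<Longrightarrow> i + j = p \<Longrightarrow> i + l = q \<Longrightarrow> x i \<in> mxN M j l"
  unfolding HC_obj by (metis add_diff_cancel_left' le_add1 min.bounded_iff)+

lemma HC_objI: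
  "(\<And>i j l. i + j = p \<Longrightarrow> i + l = q \<Longrightarrow> x i \<in> mxZ M j l) \<Longrightarrow> (\<And>i. i > p \<or> i > q \<Longrightarrow> x i = 0)
    \<Longrightarrow> x \<in> dcZ HCM p q"
  "(\<And>i j l. i + j = p \<Longrightarrow> i + l = q \<Longrightarrow> x i \<in> mxN M j l) \<Longrightarrow> (\<And>i. i > p \<or> i > q \<Longrightarrow> x i = 0)
    \<Longrightarrow> x \<in> dcN HCM p q" unfolding HC_obj by (auto simp: min_less_iff_disj)

lemma HC_vert: "vert HCM p q y i = (if i \<le> p \<and> i < q then mx_D M (y i) else 0)"
  and HC_horiz: "horiz HCM p q y i = (if i < p \<and> i \<le> q
        then mx_del M (y i) + (if i < q then mx_B M (y (Suc i)) else 0) else 0)"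
  and HC_dc_scale: "dc_scale HCM c y = (\<lambda>i. mx_scale M c (y i))" by (simp_all add: HC_complex_def)

text \<open>In summand \<open>i\<close> the square of the horizontal map consists of
  \<open>mx_del\<close> twice from summand \<open>i\<close>, the anticommutator with
  \<open>mx_B\<close> from \<open>i + 1\<close>, and \<open>mx_B\<close> twice from
  \<open>i + 2\<close>. The mixed square pairs \<open>mx_D\<close> with \<open>mx_del\<close> in
  \<open>i\<close> and with \<open>mx_B\<close> in \<open>i + 1\<close>; in the bottom row the
  latter is \<open>D_B_0\<close>.\<close>

lemma HC_first_quadrant: "first_quadrant_double_complex HCM"
proof
  show "dc_scale HCM a (x + y) = dc_scale HCM a x + dc_scale HCM a y" 
    "dc_scale HCM (a + b) x = dc_scale HCM a x + dc_scale HCM b x"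
    "dc_scale HCM a (dc_scale HCM b x) = dc_scale HCM (a * b) x"
    "dc_scale HCM 1 x = x" for a b x y by (auto simp: HC_dc_scale scale.scale_right_distrib scale.scale_left_distrib)
  then interpret S: module "dc_scale HCM" by unfold_locales
  show "subquotient (dc_scale HCM) (dc_obj HCM p q)" for p q unfolding subquotient_def proof (intro conjI S.subspaceI subsetI)
    fix x assume "x \<in> dcN HCM p q"
    then show "x \<in> dcZ HCM p q" using obj_subset unfolding HC_obj by blast
  qed (auto simp: HC_obj HC_dc_scale obj_0 obj_add scale.subspace_scale[OF obj_subspace(1)]
      scale.subspace_scale[OF obj_subspace(2)])
  fix p q
  {
    fix x assume x: "x \<in> dcZ HCM p (Suc q)"
    have xi: "i + j = p \<Longrightarrow> i + l = q \<Longrightarrow> x i \<in> mxZ M j (Suc l)" for i j l using HC_at(1)[OF x] by simp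
    have xi': "i \<le> p \<Longrightarrow> i < Suc q \<Longrightarrow> x i \<in> mxZ M (p - i) (Suc (q - i))" for i by (rule xi) auto
    show "vert HCM p (Suc q) x \<in> dcZ HCM p q" by (rule HC_objI) (auto simp: HC_vert intro: D_in xi)
    show "vert HCM p (Suc q) (dc_scale HCM c x) = dc_scale HCM c (vert HCM p (Suc q) x)" for c
      using D_scale[OF xi'] by (auto simp: HC_vert HC_dc_scale fun_eq_iff)
    fix y assume y: "y \<in> dcZ HCM p (Suc q)"
    have yi: "i + j = p \<Longrightarrow> i + l = q \<Longrightarrow> y i \<in> mxZ M j (Suc l)" for i j l using HC_at(1)[OF y] by simp
    have yi': "i \<le> p \<Longrightarrow> i < Suc q \<Longrightarrow> y i \<in> mxZ M (p - i) (Suc (q - i))" for i by (rule yi) auto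
    show "vert HCM p (Suc q) (x + y) = vert HCM p (Suc q) x + vert HCM p (Suc q) y" using D_add[OF xi' yi'] by (auto simp: HC_vert fun_eq_iff)
  }
  {
    fix x assume x: "x \<in> dcN HCM p (Suc q)"
    have xi: "i + j = p \<Longrightarrow> i + l = q \<Longrightarrow> x i \<in> mxN M j (Suc l)" for i j l using HC_at(2)[OF x] by simp
    show "vert HCM p (Suc q) x \<in> dcN HCM p q" by (rule HC_objI) (auto simp: HC_vert intro: D_rel xi)
  }
  {
    fix x assume x: "x \<in> dcZ HCM (Suc p) q"
    have xi: "i + j = p \<Longrightarrow> i + l = q \<Longrightarrow> x i \<in> mxZ M (Suc j) l"
      and xs: "i + j = p \<Longrightarrow> i + Suc l = q \<Longrightarrow> x (Suc i) \<in> mxZ M j l" for i j l using HC_at(1)[OF x] by simp_all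
    have x1: "i \<le> p \<Longrightarrow> i \<le> q \<Longrightarrow> x i \<in> mxZ M (Suc (p - i)) (q - i)"
      and x2: "i \<le> p \<Longrightarrow> i < q \<Longrightarrow> x (Suc i) \<in> mxZ M (p - i) (q - Suc i)" for i by (auto intro: xi xs)
    show "horiz HCM (Suc p) q x \<in> dcZ HCM p q" proof (rule HC_objI)
      fix i j l assume ij: "i + j = p" "i + l = q"
      show "horiz HCM (Suc p) q x i \<in> mxZ M j l" using del_in[OF xi[OF ij]] B_in[OF xs[of i j "l - 1"]] ij
        by (cases l) (auto simp: HC_horiz intro: obj_add(1))
    qed (auto simp: HC_horiz)
    show "horiz HCM (Suc p) q (dc_scale HCM c x) = dc_scale HCM c (horiz HCM (Suc p) q x)" for c
      using del_scale[OF x1] B_scale[OF x2] by (auto simp: HC_horiz HC_dc_scale fun_eq_iff scale.scale_right_distrib)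
    fix y assume y: "y \<in> dcZ HCM (Suc p) q"
    have y1: "i \<le> p \<Longrightarrow> i \<le> q \<Longrightarrow> y i \<in> mxZ M (Suc (p - i)) (q - i)"
      and y2: "i \<le> p \<Longrightarrow> i < q \<Longrightarrow> y (Suc i) \<in> mxZ M (p - i) (q - Suc i)" for i using HC_at(1)[OF y] by simp_all
    show "horiz HCM (Suc p) q (x + y) = horiz HCM (Suc p) q x + horiz HCM (Suc p) q y"
      using del_add[OF x1 y1] B_add[OF x2 y2] by (auto simp: HC_horiz fun_eq_iff)
  }
  {
    fix x assume x: "x \<in> dcN HCM (Suc p) q"
    have xi: "i + j = p \<Longrightarrow> i + l = q \<Longrightarrow> x i \<in> mxN M (Suc j) l"
      and xs: "i + j = p \<Longrightarrow> i + Suc l = q \<Longrightarrow> x (Suc i) \<in> mxN M j l" for i j l using HC_at(2)[OF x] by simp_all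
    show "horiz HCM (Suc p) q x \<in> dcN HCM p q" proof (rule HC_objI)
      fix i j l assume ij: "i + j = p" "i + l = q"
      show "horiz HCM (Suc p) q x i \<in> mxN M j l" using del_rel[OF xi[OF ij]] B_rel[OF xs[of i j "l - 1"]] ij
        by (cases l) (auto simp: HC_horiz intro: obj_add(2))
    qed (auto simp: HC_horiz)
  }
  {
    fix x assume x: "x \<in> dcZ HCM p (Suc (Suc q))"
    have xi: "i + j = p \<Longrightarrow> i + l = q \<Longrightarrow> x i \<in> mxZ M j (Suc (Suc l))" for i j l using HC_at(1)[OF x] by simp
    show "vert HCM p (Suc q) (vert HCM p (Suc (Suc q)) x) \<in> dcN HCM p q" by (rule HC_objI) (auto simp: HC_vert intro: D_D xi)
  }
  {
    fix x assume x: "x \<in> dcZ HCM (Suc (Suc p)) q"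
    have "horiz HCM (Suc p) q (horiz HCM (Suc (Suc p)) q x) i \<in> mxN M j l" if ij: "i + j = p" "i + l = q" for i j l proof -
      have x0: "x i \<in> mxZ M (Suc (Suc j)) l" using HC_at(1)[OF x] ij by simp
      have x1: "x (Suc i) \<in> mxZ M (Suc j) (l - 1)" if "l > 0" using HC_at(1)[OF x, of "Suc i"] ij that by simp
      have x2: "x (Suc (Suc i)) \<in> mxZ M j (l - 2)" if "l > 1" using HC_at(1)[OF x, of "Suc (Suc i)"] ij that by simp
      let ?d = "mx_del M" and ?B = "mx_B M"
      have "horiz HCM (Suc p) q (horiz HCM (Suc (Suc p)) q x) i = ?d (?d (x i)) + (if l > 0 then ?B (?d (x (Suc i))) + ?d (?B (x (Suc i))) else 0)
            + (if l > 1 then ?B (?B (x (Suc (Suc i)))) else 0)" proof (cases l)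
        case 0 then show ?thesis using ij by (simp add: HC_horiz)
      next
        case (Suc l')
        have a: "?d (?d (x i) + ?B (x (Suc i))) = ?d (?d (x i)) + ?d (?B (x (Suc i)))" using del_in[OF x0] B_in[OF x1] Suc by (intro del_add) auto
        have b: "?B (?d (x (Suc i)) + ?B (x (Suc (Suc i)))) = ?B (?d (x (Suc i))) + ?B (?B (x (Suc (Suc i))))" if "l' > 0"
          using del_in[OF x1] B_in[OF x2] Suc that by (intro B_add) (auto simp: Suc_diff_Suc numeral_2_eq_2)
        show ?thesis using ij Suc a b by (auto simp: HC_horiz)
      qed
      moreover have "(if l > 0 then ?B (?d (x (Suc i))) + ?d (?B (x (Suc i))) else 0) \<in> mxN M j l" using B_del[OF x1] by (auto simp: obj_0)
      moreover have "(if l > 1 then ?B (?B (x (Suc (Suc i)))) else 0) \<in> mxN M j l"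
        using B_B[OF x2] by (auto simp: obj_0 numeral_2_eq_2 Suc_diff_Suc)
      ultimately show ?thesis by (simp only:) (intro obj_add(2) del_del[OF x0])
    qed
    then show "horiz HCM (Suc p) q (horiz HCM (Suc (Suc p)) q x) \<in> dcN HCM p q" by (intro HC_objI) (auto simp: HC_horiz)
  }
  {
    fix x assume x: "x \<in> dcZ HCM (Suc p) (Suc q)"
    let ?X = "vert HCM p (Suc q) (horiz HCM (Suc p) (Suc q) x) + horiz HCM (Suc p) q (vert HCM (Suc p) (Suc q) x)"
    have "?X i \<in> mxN M j l" if ij: "i + j = p" "i + l = q" for i j l proof -
      have x0: "x i \<in> mxZ M (Suc j) (Suc l)" using HC_at(1)[OF x] ij by simp
      have x1: "x (Suc i) \<in> mxZ M j l" using HC_at(1)[OF x, of "Suc i"] ij by simp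
      let ?d = "mx_del M" and ?B = "mx_B M" and ?D = "mx_D M"
      have a: "?D (?d (x i) + ?B (x (Suc i))) = ?D (?d (x i)) + ?D (?B (x (Suc i)))" using del_in[OF x0] B_in[OF x1] by (intro D_add) auto
      have "?X i = (?D (?d (x i)) + ?d (?D (x i))) + (?D (?B (x (Suc i))) + (if l > 0 then ?B (?D (x (Suc i))) else 0))"
        using ij a by (auto simp: HC_horiz HC_vert)
      moreover have "?D (?B (x (Suc i))) + (if l > 0 then ?B (?D (x (Suc i))) else 0) \<in> mxN M j l"
        using D_B[of "x (Suc i)" j "l - 1"] D_B_0[of "x (Suc i)" j] x1 by (cases l) auto
      ultimately show ?thesis using obj_add(2)[OF D_del[OF x0]] by (simp only:)
    qed
    then show "?X \<in> dcN HCM p q" by (intro HC_objI) (auto simp: HC_horiz HC_vert)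
  }
qed

sublocale HC: first_quadrant_double_complex "HCM" by (rule HC_first_quadrant)

text \<open>The vertical map acts by \<open>mx_D\<close> in every summand separately, so its cycles
  and boundaries are computed summand by summand. Through this the comparison of Hochschild columns
  carries over to cyclic homology.\<close>

lemma HC_vcyc: "x \<in> HC.vcyc p q \<longleftrightarrow> (\<forall>i\<le>min p q. x i \<in> HH.vcyc (p - i) (q - i)) \<and> (\<forall>i>min p q. x i = 0)"
proof (cases q)
  case 0 then show ?thesis by (auto simp: HC.vcyc_def HH_vcyc HC_obj)
next
  case (Suc q')
  have *: "Suc q' - i - 1 = q' - i" for i by simp
  have "(\<forall>i\<le>min p q. x i \<in> mxZ M (p - i) (q - i)) \<Longrightarrow> (vert HCM p q x \<in> dcN HCM p q' \<longleftrightarrow>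
    (\<forall>i\<le>min p q. q - i > 0 \<longrightarrow> mx_D M (x i) \<in> mxN M (p - i) (q' - i)))"
    unfolding HC_obj using Suc by (auto simp: HC_vert less_Suc_eq_le)
  then show ?thesis unfolding HC.vcyc_def HH_vcyc using Suc by (auto simp: HC_obj)
qed

lemma HC_vbd: "x \<in> HC.vbd p q \<longleftrightarrow> (\<forall>i\<le>min p q. x i \<in> HH.vbd (p - i) (q - i)) \<and> (\<forall>i>min p q. x i = 0)"
proof
  assume "x \<in> HC.vbd p q"
  then obtain z where x: "x \<in> dcZ HCM p q" and z: "z \<in> dcZ HCM p (Suc q)"
    and *: "x - vert HCM p (Suc q) z \<in> dcN HCM p q" unfolding HC.vbd_def by blast
  have "x i \<in> HH.vbd (p - i) (q - i)" if i: "i \<le> p" "i \<le> q" for i proof -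
    have "x i \<in> mxZ M (p - i) (q - i)" "z i \<in> mxZ M (p - i) (Suc (q - i))" using HC_at(1)[OF x, of i] HC_at(1)[OF z, of i] i by auto
    moreover have "x i - mx_D M (z i) \<in> mxN M (p - i) (q - i)" using HC_at(2)[OF *, of i] i by (auto simp: HC_vert)
    ultimately show ?thesis unfolding HH_vbd by auto
  qed
  then show "(\<forall>i\<le>min p q. x i \<in> HH.vbd (p - i) (q - i)) \<and> (\<forall>i>min p q. x i = 0)" using x HC_obj(1) by auto
next
  assume x: "(\<forall>i\<le>min p q. x i \<in> HH.vbd (p - i) (q - i)) \<and> (\<forall>i>min p q. x i = 0)"
  then have "\<forall>i\<in>{..min p q}. \<exists>z. z \<in> mxZ M (p - i) (Suc (q - i)) \<and> x i - mx_D M z \<in> mxN M (p - i) (q - i)"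
    by (auto simp: HH_vbd Bex_def)
  from bchoice[OF this] obtain z where
    z: "\<forall>i\<in>{..min p q}. z i \<in> mxZ M (p - i) (Suc (q - i)) \<and> x i - mx_D M (z i) \<in> mxN M (p - i) (q - i)" by blast
  define z' where "z' i = (if i \<le> min p q then z i else 0)" for i
  have "z' \<in> dcZ HCM p (Suc q)" using z obj_0 unfolding HC_obj by (auto simp: z'_def Suc_diff_le)
  moreover have "x - vert HCM p (Suc q) z' \<in> dcN HCM p q" using z x unfolding HC_obj by (auto simp: HC_vert z'_def)
  moreover have "x \<in> dcZ HCM p q" using x unfolding HC_obj by (auto simp: HH_vbd)
  ultimately show "x \<in> HC.vbd p q" unfolding HC.vbd_def by blast
qed

end

locale mixed_equivalence = M: linear_mixed_complex M + N: linear_mixed_complex N for M :: "('k::comm_ring_1, 'm::ab_group_add) mixed_complex"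
    and N :: "('k, 'n::ab_group_add) mixed_complex" +
  fixes f :: "nat \<Rightarrow> nat \<Rightarrow> 'n \<Rightarrow> 'm" assumes N_rel: "mxN N p q = {0}" and N_D: "mx_D N y = 0"
    and f_vcyc: "y \<in> mxZ N p q \<Longrightarrow> f p q y \<in> M.HH.vcyc p q"
    and f_add: "y \<in> mxZ N p q \<Longrightarrow> y' \<in> mxZ N p q \<Longrightarrow>
      f p q (y + y') - (f p q y + f p q y') \<in> M.HH.vbd p q" and f_scale: "y \<in> mxZ N p q \<Longrightarrow>
      f p q (mx_scale N c y) - mx_scale M c (f p q y) \<in> M.HH.vbd p q"
    and f_inj: "y \<in> mxZ N p q \<Longrightarrow> f p q y \<in> M.HH.vbd p q \<Longrightarrow> y = 0"
    and f_surj: "x \<in> M.HH.vcyc p q \<Longrightarrow> \<exists>y\<in>mxZ N p q. x - f p q y \<in> M.HH.vbd p q"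
    and f_del: "y \<in> mxZ N (Suc p) q \<Longrightarrow>
      mx_del M (f (Suc p) q y) - f p q (mx_del N y) \<in> M.HH.vbd p q" and f_B: "y \<in> mxZ N p q \<Longrightarrow>
      mx_B M (f p q y) - f p (Suc q) (mx_B N y) \<in> M.HH.vbd p (Suc q)"
begin

sublocale HH: first_page_equivalence "HH_complex M" "HH_complex N" f by unfold_locales
    (use f_vcyc f_add f_scale f_inj f_surj f_del in \<open>auto simp: HH_complex_def[of N] N_rel N_D\<close>,
     use f_scale f_del in \<open>auto simp: HH_complex_def\<close>)

definition f' :: "nat \<Rightarrow> nat \<Rightarrow> (nat \<Rightarrow> 'n) \<Rightarrow> nat \<Rightarrow> 'm" where
  "f' p q y = (\<lambda>i. if i \<le> min p q then f (p - i) (q - i) (y i) else 0)"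

text \<open>Horizontal compatibility in a summand combines \<open>f_del\<close> and
  \<open>f_B\<close>; the defect of additivity of \<open>f\<close> on the sum of the two images is a
  vertical boundary as well.\<close>

lemma HC_first_page_equivalence: "first_page_equivalence (HC_complex M) (HC_complex N) f'"
proof
  fix p q
  show "dcN (HC_complex N) p q = {0}" unfolding HC_complex_def by (auto simp: N_rel fun_eq_iff) (metis not_le min.bounded_iff)
  {
    fix y assume "y \<in> dcZ (HC_complex N) p (Suc q)"
    then show "vert (HC_complex N) p (Suc q) y = 0" by (auto simp: N.HC_vert N_D fun_eq_iff)
  }
  {
    fix y assume y: "y \<in> dcZ (HC_complex N) p q"
    have yi: "y i \<in> mxZ N (p - i) (q - i)" if "i \<le> p" "i \<le> q" for i using N.HC_at(1)[OF y, of i] that by simp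
    show "f' p q y \<in> M.HC.vcyc p q" unfolding M.HC_vcyc using f_vcyc yi by (auto simp: f'_def)
    show "f' p q (dc_scale (HC_complex N) c y) - dc_scale (HC_complex M) c (f' p q y) \<in> M.HC.vbd p q" for c
      unfolding M.HC_vbd N.HC_dc_scale M.HC_dc_scale using f_scale yi by (auto simp: f'_def)
    show "y = 0" if "f' p q y \<in> M.HC.vbd p q" proof
      fix i
      have "y i = 0" if "i \<le> min p q" proof (rule f_inj)
        show "y i \<in> mxZ N (p - i) (q - i)" using yi that by simp
        show "f (p - i) (q - i) (y i) \<in> M.HH.vbd (p - i) (q - i)"
          using \<open>f' p q y \<in> M.HC.vbd p q\<close> that unfolding M.HC_vbd by (auto simp: f'_def)
      qed
      then show "y i = 0 i" using y unfolding N.HC_obj by (cases "i \<le> min p q") auto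
    qed
    fix y' assume y': "y' \<in> dcZ (HC_complex N) p q"
    have yi': "y' i \<in> mxZ N (p - i) (q - i)" if "i \<le> p" "i \<le> q" for i using N.HC_at(1)[OF y', of i] that by simp
    show "f' p q (y + y') - (f' p q y + f' p q y') \<in> M.HC.vbd p q" unfolding M.HC_vbd using f_add yi yi' by (auto simp: f'_def)
  }
  {
    fix x assume "x \<in> M.HC.vcyc p q"
    then have x: "(\<forall>i\<le>min p q. x i \<in> M.HH.vcyc (p - i) (q - i)) \<and> (\<forall>i>min p q. x i = 0)" unfolding M.HC_vcyc .
    then have "\<forall>i\<in>{..min p q}. \<exists>y. y \<in> mxZ N (p - i) (q - i) \<and> x i - f (p - i) (q - i) y \<in> M.HH.vbd (p - i) (q - i)"
      using f_surj by blast
    from bchoice[OF this] obtain y where y: "\<forall>i\<in>{..min p q}.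
        y i \<in> mxZ N (p - i) (q - i) \<and> x i - f (p - i) (q - i) (y i) \<in> M.HH.vbd (p - i) (q - i)" by blast
    define y' where "y' i = (if i \<le> min p q then y i else 0)" for i
    have "y' \<in> dcZ (HC_complex N) p q" unfolding N.HC_obj using y by (auto simp: y'_def)
    moreover have "x - f' p q y' \<in> M.HC.vbd p q" unfolding M.HC_vbd using x y by (auto simp: f'_def y'_def)
    ultimately show "\<exists>y\<in>dcZ (HC_complex N) p q. x - f' p q y \<in> M.HC.vbd p q" by blast
  }
  {
    fix y assume y: "y \<in> dcZ (HC_complex N) (Suc p) q"
    have "horiz (HC_complex M) (Suc p) q (f' (Suc p) q y) i - f' p q (horiz (HC_complex N) (Suc p) q y) i \<in> M.HH.vbd j l"
      if ij: "i + j = p" "i + l = q" for i j l proof -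
      have y0: "y i \<in> mxZ N (Suc j) l" using N.HC_at(1)[OF y] ij by simp
      have eq: "Suc p - i = Suc j" "p - i = j" "q - i = l" "i \<le> p" "i \<le> q" using ij by auto
      show ?thesis proof (cases l)
        case 0
        then have "\<not> i < q" using ij by simp
        then show ?thesis using f_del[OF y0] eq by (simp add: f'_def M.HC_horiz N.HC_horiz)
      next
        case (Suc l')
        have iq: "i < q" "q - Suc i = l'" using ij Suc by auto
        have y1: "y (Suc i) \<in> mxZ N j l'" using N.HC_at(1)[OF y, of "Suc i"] ij Suc by simp
        let ?u = "mx_del M (f (Suc j) l (y i))" and ?v = "mx_B M (f j l' (y (Suc i)))"
        let ?a = "mx_del N (y i)" and ?b = "mx_B N (y (Suc i))"
        have "(?u - f j l ?a) + (?v - f j l ?b) - (f j l (?a + ?b) - (f j l ?a + f j l ?b)) \<in> M.HH.vbd j l"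
          using N.B_in[OF y1] N.del_in[OF y0] f_B[OF y1] Suc by (intro M.HH.vbd_diff[OF M.HH.vbd_add] f_del[OF y0] f_add) auto
        moreover have "(?u - f j l ?a) + (?v - f j l ?b) - (f j l (?a + ?b) - (f j l ?a + f j l ?b)) = ?u + ?v - f j l (?a + ?b)" by simp
        ultimately show ?thesis using eq iq by (simp add: f'_def M.HC_horiz N.HC_horiz)
      qed
    qed
    then show "horiz (HC_complex M) (Suc p) q (f' (Suc p) q y) - f' p q (horiz (HC_complex N) (Suc p) q y) \<in> M.HC.vbd p q"
      unfolding M.HC_vbd by (auto simp: M.HC_horiz f'_def)
  }
qed

sublocale HC: first_page_equivalence "HC_complex M" "HC_complex N" f' by (rule HC_first_page_equivalence)

theorem second_pages:
  "(\<exists>E dE. spectral_sequence (HH_scale M) 2 E dE \<and>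
      (\<forall>p q. sq_isomorphic (HH_scale M) (HH_scale N) (E 2 p q) (HH_layer N (p + q) q)) \<and>
      ss_converges (HH_scale M) E (HH_scale M) (HH M) (col_homology_filtration (HH_complex M)) \<and>
      (\<forall>p q. ss_infinity (HH_scale M) E (HH_scale M) p q (HH_layer M (p + q) q)))
    \<and> (\<exists>E dE. spectral_sequence (HC_scale M) 2 E dE \<and>
      (\<forall>p q. sq_isomorphic (HC_scale M) (HC_scale N) (E 2 p q) (HC_layer N (p + q) q)) \<and>
      ss_converges (HC_scale M) E (HC_scale M) (HC M) (col_homology_filtration (HC_complex M)) \<and>
      (\<forall>p q. ss_infinity (HC_scale M) E (HC_scale M) p q (HC_layer M (p + q) q)))"
proof -
  have HH: "HH M = tot_homology (HH_complex M)" and HC: "HC M = tot_homology (HC_complex M)" by (simp_all add: fun_eq_iff HH_def HC_def)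
  have l: "HH_layer M (p + q) q = col_infinity (HH_complex M) p q" "HC_layer M (p + q) q = col_infinity (HC_complex M) p q"
    "HH_layer N (p + q) q = col_infinity (HH_complex N) p q" "HC_layer N (p + q) q = col_infinity (HC_complex N) p q" for p q
    by (simp_all add: HH_layer_def HC_layer_def)
  have two: "(2::nat) \<ge> 1" by simp
  show ?thesis unfolding l HH HC using M.HH.col_page_spectral_sequence[OF two] M.HC.col_page_spectral_sequence[OF two]
      HH.second_page HC.second_page M.HH.col_page_converges M.HC.col_page_converges M.HH.ss_infinity_col_infinity M.HC.ss_infinity_col_infinity
    by (intro conjI exI[of _ "col_page (HH_complex M)"] exI[of _ "col_page (HC_complex M)"] exI[of _ M.HH.ss_d] exI[of _ M.HC.ss_d] allI)
qed

end

section \<open>Hochschild and Connes operators on functionals\<close>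

lemma sgn_pow_pow [simp]: "sgn_pow m (sgn_pow n a) = sgn_pow (m + n) a" by (auto simp: sgn_pow_def)

lemma sgn_pow_0 [simp]: "sgn_pow n 0 = 0" "sgn_pow 0 a = a" by (auto simp: sgn_pow_def)

lemma sgn_pow_add: "sgn_pow n (a + b) = sgn_pow n a + sgn_pow n b" by (auto simp: sgn_pow_def)

lemma sgn_pow_diff: "sgn_pow n (a - b) = sgn_pow n a - sgn_pow n b" by (auto simp: sgn_pow_def)

lemma sgn_pow_minus: "sgn_pow n (- a) = - sgn_pow n a" by (auto simp: sgn_pow_def)

lemma sgn_pow_sum: "sgn_pow n (\<Sum>i\<in>I. f i) = (\<Sum>i\<in>I. sgn_pow n (f i))" by (auto simp: sgn_pow_def sum_negf)

lemma sgn_pow_Suc: "sgn_pow (Suc n) a = - sgn_pow n a" by (auto simp: sgn_pow_def)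

lemma sgn_pow_cong: "even (m + n) \<Longrightarrow> a = b \<Longrightarrow> sgn_pow m a = sgn_pow n b" by (auto simp: sgn_pow_def)

lemma sgn_pow_cong': "odd (m + n) \<Longrightarrow> a = b \<Longrightarrow> sgn_pow m a = - sgn_pow n b" by (auto simp: sgn_pow_def)

lemma tdeg_simps [simp]: "tdeg [] = 0" "tdeg (x # xs) = fst x + tdeg xs" "tdeg (xs @ ys) = tdeg xs + tdeg ys" by (auto simp: tdeg_def)

definition tmul :: "nat \<times> 'a \<Rightarrow> nat \<times> 'a \<Rightarrow> nat \<times> 'a::{ring, monoid_mult}" where
  "tmul x y = (fst x + fst y, snd x * snd y)"

abbreviation tone :: "nat \<times> 'a::{ring, monoid_mult}" where "tone \<equiv> (0, 1)"

lemma tmul_simps [simp]: "fst (tmul x y) = fst x + fst y" "snd (tmul x y) = snd x * snd y"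
  "tmul tone x = x" "tmul x tone = x" "tmul (tmul x y) z = tmul x (tmul y z)" by (auto simp: tmul_def mult.assoc)

text \<open>
  An operator \<open>P\<close> on tensors is represented by its action \<open>F \<mapsto> F \<circ> P\<close> on functionals, so that signed sums
  of tensors never have to be formed: \<open>bet\<close> is the Hochschild boundary without the cyclic face,
  \<open>hb\<close> the full boundary, \<open>rot\<close> the signed cyclic rotation.
\<close>

fun bet :: "('a::{ring, monoid_mult} tensor \<Rightarrow> 'v::ab_group_add) \<Rightarrow> 'a tensor \<Rightarrow> 'v" where
  "bet F (x # z # r) = F (tmul x z # r) - bet (\<lambda>u. F (x # u)) (z # r)"
| "bet F [x] = 0"
| "bet F [] = 0"

fun rot :: "('a tensor \<Rightarrow> 'v::ab_group_add) \<Rightarrow> 'a tensor \<Rightarrow> 'v" where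
  "rot F [] = F []"
| "rot F (x # r) = sgn_pow (length r + fst x * tdeg r) (F (r @ [x]))"

text \<open>The zeroth face. All other faces, the cyclic one included, are conjugates of it under
  \<open>rot\<close>.\<close>

fun dmul :: "('a::{ring, monoid_mult} tensor \<Rightarrow> 'v::ab_group_add) \<Rightarrow> 'a tensor \<Rightarrow> 'v" where
  "dmul F (x # z # r) = F (tmul x z # r)"
| "dmul F _ = 0"

definition cyc :: "('a::{ring, monoid_mult} tensor \<Rightarrow> 'v::ab_group_add) \<Rightarrow> 'a tensor \<Rightarrow> 'v" where
  "cyc F w = (if length w \<le> 1 then 0 else sgn_pow (length w - 1 + fst (last w) * tdeg (butlast w)) (F (tmul (last w) (hd w) # tl (butlast w))))"

definition hb :: "('a::{ring, monoid_mult} tensor \<Rightarrow> 'v::ab_group_add) \<Rightarrow> 'a tensor \<Rightarrow> 'v" where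
  "hb F w = bet F w + cyc F w"

text \<open>The norm of the signed cyclic group acting on tensors of the length of
  \<open>w\<close>.\<close>

definition nrm :: "('a tensor \<Rightarrow> 'v::ab_group_add) \<Rightarrow> 'a tensor \<Rightarrow> 'v" where
  "nrm F w = (\<Sum>i<length w. (rot ^^ i) F w)"

text \<open>The extra degeneracy; norm followed by it is Connes' operator.\<close>

definition ones :: "('a::{ring, monoid_mult} tensor \<Rightarrow> 'v::ab_group_add) \<Rightarrow> 'a tensor \<Rightarrow> 'v" where
  "ones F w = F (tone # w)"

lemma cyc_snoc: "cyc F (x # s @ [z]) = sgn_pow (length s + 1 + fst z * (fst x + tdeg s)) (F (tmul z x # s))" by (simp add: cyc_def butlast_append)

lemma bet_nth: "bet F w = (\<Sum>i<length w - 1. sgn_pow i (F (take i w @ tmul (w ! i) (w ! Suc i) # drop (i + 2) w)))"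
proof (induction F w rule: bet.induct)
  case (1 F x z r)
  have "bet F (x # z # r) = F (tmul x z # r) + (\<Sum>i<length r. - sgn_pow i
      (F (x # take i (z # r) @ tmul ((z # r) ! i) ((z # r) ! Suc i) # drop (i + 2) (z # r))))" using 1 by (simp add: sum_negf)
  then show ?case by (simp add: sum.lessThan_Suc_shift sgn_pow_Suc del: sum.lessThan_Suc)
qed auto

lemma rot_pow:
  "j \<le> length w \<Longrightarrow> (rot ^^ j) F w = sgn_pow (j * (length w - 1) + tdeg (take j w) * tdeg (drop j w)) (F (drop j w @ take j w))"
proof (induction j arbitrary: F)
  case (Suc j)
  then have j: "j < length w" by simp
  define x where "x = w ! j"
  have w: "drop j w = x # drop (Suc j) w" "take (Suc j) w = take j w @ [x]" using j by (simp_all add: x_def Cons_nth_drop_Suc take_Suc_conv_app_nth)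
  obtain m where m: "length w = Suc m" using j by (cases "length w") auto
  have "(rot ^^ Suc j) F w = (rot ^^ j) (rot F) w" by (simp add: funpow_swap1)
  also have "\<dots> = sgn_pow (j * m + tdeg (take j w) * (fst x + tdeg (drop (Suc j) w)) + (m + fst x * (tdeg (drop (Suc j) w) + tdeg (take j w))))
      (F (drop (Suc j) w @ take j w @ [x]))" using Suc j by (simp add: w m)
  also have "\<dots> = sgn_pow (Suc j * (length w - 1) + tdeg (take (Suc j) w) * tdeg (drop (Suc j) w))
     (F (drop (Suc j) w @ take (Suc j) w))" by (rule sgn_pow_cong) (auto simp: w m)
  finally show ?case .
qed simp

lemma rot_pow_length: "(rot ^^ length w) F w = F w"
  using rot_pow[of "length w" w F] by (cases w) (auto intro: sgn_pow_cong[of _ 0, simplified] simp: sgn_pow_def)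

lemma rot_sum: "rot (\<lambda>w. \<Sum>i\<in>I. F i w) w = (\<Sum>i\<in>I. rot (F i) w)" by (cases w) (auto simp: sgn_pow_sum)

lemma rot_pow_sum: "(rot ^^ j) (\<lambda>w. \<Sum>i\<in>I. F i w) w = (\<Sum>i\<in>I. (rot ^^ j) (F i) w)"
proof (induction j arbitrary: w)
  case (Suc j)
  then have "(rot ^^ j) (\<lambda>w. \<Sum>i\<in>I. F i w) = (\<lambda>w. \<Sum>i\<in>I. (rot ^^ j) (F i) w)" by (rule ext)
  then show ?case by (simp add: rot_sum)
qed simp

lemma rot_cong: "(\<And>v. length v = length w \<Longrightarrow> F v = G v) \<Longrightarrow> rot F w = rot G w" by (cases w) auto

lemma rot_pow_cong: "(\<And>v. length v = length w \<Longrightarrow> F v = G v) \<Longrightarrow> (rot ^^ j) F w = (rot ^^ j) G w"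
proof (induction j arbitrary: w)
  case (Suc j)
  show ?case unfolding funpow.simps comp_def by (rule rot_cong) (use Suc in simp)
qed simp

lemma nrm_cong: "(\<And>v. length v = length w \<Longrightarrow> F v = G v) \<Longrightarrow> nrm F w = nrm G w"
  unfolding nrm_def by (intro sum.cong rot_pow_cong refl) auto

lemma sum_rot_pow_Suc: "(\<Sum>i<length w. (rot ^^ Suc i) F w) = nrm F w"
proof -
  have "(\<Sum>i<length w. (rot ^^ Suc i) F w) + (rot ^^ 0) F w = (\<Sum>i<Suc (length w). (rot ^^ i) F w)"
    by (simp add: sum.lessThan_Suc_shift del: sum.lessThan_Suc funpow.simps(2))
  also have "\<dots> = nrm F w + F w" by (simp add: nrm_def rot_pow_length)
  finally show ?thesis by simp
qed

lemma nrm_rot [simp]: "nrm (rot F) w = nrm F w" using sum_rot_pow_Suc[of F w] by (simp add: nrm_def funpow_swap1)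

lemma rot_nrm [simp]: "rot (nrm F) = nrm F"
proof
  fix w :: "'a tensor"
  have "rot (nrm F) w = rot (\<lambda>v. \<Sum>i<length w. (rot ^^ i) F v) w" by (rule rot_cong) (simp add: nrm_def)
  then show "rot (nrm F) w = nrm F w" using sum_rot_pow_Suc[of F w] by (simp add: rot_sum)
qed

lemma rot_pow_nrm [simp]: "(rot ^^ j) (nrm F) = nrm F" by (induction j) auto

lemma nrm_rot_pow [simp]: "nrm ((rot ^^ j) F) w = nrm F w" by (induction j) auto

lemma nrm_sum: "nrm (\<lambda>w. \<Sum>i\<in>I. F i w) w = (\<Sum>i\<in>I. nrm (F i) w)" unfolding nrm_def rot_pow_sum by (rule sum.swap)

text \<open>After \<open>j\<close> rotations the product at position \<open>j\<close> is the first
  one. The product leaves one factor less, so \<open>q - j\<close> further rotations restore the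
  order; of all signs only that of the face remains.\<close>

lemma rot_face: assumes "length w = Suc q" "j < q" shows "(rot ^^ j) (dmul ((rot ^^ (q - j)) F)) w
    = sgn_pow j (F (take j w @ tmul (w ! j) (w ! Suc j) # drop (j + 2) w))"
proof -
  define x z s t where "x = w ! j" and "z = w ! Suc j" and "s = drop (j + 2) w" and "t = take j w"
  have d: "drop j w = x # z # s" using assms by (simp add: x_def z_def s_def Cons_nth_drop_Suc)
  have l: "length s = q - j - 1" "length t = j" using assms by (auto simp: s_def t_def)
  have "(rot ^^ j) (dmul ((rot ^^ (q - j)) F)) w = sgn_pow (j * q + tdeg t * (fst x + fst z + tdeg s)) ((rot ^^ (q - j)) F (tmul x z # s @ t))"
    using assms rot_pow[of j w "dmul ((rot ^^ (q - j)) F)"] by (simp add: d add.assoc flip: t_def)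
  also have "(rot ^^ (q - j)) F (tmul x z # s @ t) = sgn_pow ((q - j) * (q - 1) + (fst x + fst z + tdeg s) * tdeg t) (F (t @ tmul x z # s))"
    using assms l rot_pow[of "q - j" "tmul x z # s @ t" F] by (simp add: take_Cons' drop_Cons' add.assoc)
  finally have "(rot ^^ j) (dmul ((rot ^^ (q - j)) F)) w = sgn_pow (j * q + tdeg t * (fst x + fst z + tdeg s)
      + ((q - j) * (q - 1) + (fst x + fst z + tdeg s) * tdeg t)) (F (t @ tmul x z # s))" by simp
  also have "\<dots> = sgn_pow j (F (t @ tmul x z # s))" proof -
    obtain e where "q = Suc (j + e)" using assms less_imp_Suc_add by blast
    then show ?thesis by (intro sgn_pow_cong) auto
  qed
  finally show ?thesis by (simp add: x_def z_def s_def t_def)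
qed

lemma bet_rot: "length w = Suc q \<Longrightarrow> bet F w = (\<Sum>j<q. (rot ^^ j) (dmul ((rot ^^ (q - j)) F)) w)"
  unfolding bet_nth by (auto intro!: sum.cong simp: rot_face)

lemma cyc_rot: assumes "length w = Suc q" "q > 0" shows "cyc F w = (rot ^^ q) (dmul F) w"
proof -
  obtain x s z where w: "w = x # s @ [z]" "length s = q - 1" using assms by (cases w; cases "tl w" rule: rev_cases) auto
  show ?thesis using assms w rot_pow[of q w "dmul F"] by (simp add: cyc_snoc) (auto intro!: sgn_pow_cong simp: take_Cons' drop_Cons' algebra_simps)
qed

text \<open>The cyclic face is the term \<open>j = q\<close>. With all faces on the same footing,
  identities for the Hochschild boundary become shifts of rotations around a single face.\<close>

lemma hb_rot: assumes "length w = Suc q" "q > 0" shows "hb F w = (\<Sum>j\<le>q. (rot ^^ j) (dmul ((rot ^^ (q - j)) F)) w)"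
  using assms by (simp add: hb_def bet_rot cyc_rot flip: lessThan_Suc_atMost)

lemma hb_singleton [simp]: "hb F [x] = 0" by (simp add: hb_def cyc_def)

lemma hb_cong: "(\<And>v. Suc (length v) = length w \<Longrightarrow> F v = G v) \<Longrightarrow> hb F w = hb G w"
  unfolding hb_def bet_nth cyc_def by (intro arg_cong2[where f = "(+)"] sum.cong refl) auto

lemma bet_cong: "(\<And>v. Suc (length v) = length w \<Longrightarrow> F v = G v) \<Longrightarrow> bet F w = bet G w"
  unfolding bet_nth by (intro sum.cong refl) auto

lemma dmul_cong: "(\<And>v. Suc (length v) = length w \<Longrightarrow> F v = G v) \<Longrightarrow> dmul F w = dmul G w"
  by (cases "(F, w)" rule: dmul.cases) auto

lemma dmul_sum: "dmul (\<lambda>w. \<Sum>i\<in>I. F i w) w = (\<Sum>i\<in>I. dmul (F i) w)" by (cases "(F undefined, w)" rule: dmul.cases) auto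

text \<open>This is \<open>N b = b' N\<close>. Under the norm the outer rotations disappear, and
  both sides become norm, zeroth face, norm on the shorter tensors: for \<open>j < q\<close> the
  exponents \<open>q - j\<close> run through a full period there.\<close>

theorem hb_nrm: assumes "length w = Suc q" "q > 0" shows "hb (nrm F) w = nrm (bet F) w"
proof -
  have "hb (nrm F) w = nrm (dmul (nrm F)) w" using assms by (simp add: hb_rot nrm_def[of "dmul (nrm F)"] lessThan_Suc_atMost)
  moreover have "nrm (bet F) w = nrm (\<lambda>v. \<Sum>j<q. (rot ^^ j) (dmul ((rot ^^ (q - j)) F)) v) w" by (rule nrm_cong) (simp add: assms bet_rot)
  moreover have "\<dots> = nrm (dmul (\<lambda>v. \<Sum>j<q. (rot ^^ (q - j)) F v)) w" by (subst dmul_sum[abs_def]) (simp add: nrm_sum)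
  moreover have "\<dots> = nrm (dmul (nrm F)) w" proof (intro nrm_cong dmul_cong)
    fix v u :: "'a tensor" assume "length v = length w" "Suc (length u) = length v"
    then have u: "length u = q" using assms by simp
    have "(\<Sum>j<q. (rot ^^ (q - j)) F u) = (\<Sum>j<q. (rot ^^ Suc j) F u)"
      by (subst sum.nat_diff_reindex[symmetric]) (simp add: Suc_diff_Suc del: funpow.simps)
    then show "(\<Sum>j<q. (rot ^^ (q - j)) F u) = nrm F u" using sum_rot_pow_Suc[of F u] u by simp
  qed
  ultimately show ?thesis by simp
qed

section \<open>The inverse rotation, and the identities between boundary and Connes operator\<close>

definition rinv :: "('a tensor \<Rightarrow> 'v::ab_group_add) \<Rightarrow> 'a tensor \<Rightarrow> 'v" where
  "rinv F w = (if w = [] then F [] else sgn_pow (length w - 1 + fst (last w) * tdeg (butlast w)) (F (last w # butlast w)))"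

lemma rot_rinv: "rot (rinv F) = F"
proof
  fix w show "rot (rinv F) w = F w" by (cases w) (auto simp: rinv_def sgn_pow_def)
qed

lemma rinv_rot: "rinv (rot F) = F"
proof
  fix w :: "'a tensor" show "rinv (rot F) w = F w" by (cases w rule: rev_cases) (auto simp: rinv_def sgn_pow_def)
qed

lemma nrm_rinv: "nrm (rinv F) w = nrm F w" using nrm_rot[of "rinv F" w] by (simp add: rot_rinv)

lemma rinv_cong: "(\<And>v. length v = length w \<Longrightarrow> F v = G v) \<Longrightarrow> rinv F w = rinv G w" by (auto simp: rinv_def)

lemma rinv_sum: "rinv (\<lambda>w. \<Sum>i\<in>I. F i w) w = (\<Sum>i\<in>I. rinv (F i) w)" by (auto simp: rinv_def sgn_pow_sum)

lemma rinv_eq_rot_pow: "length w = Suc q \<Longrightarrow> rinv F w = (rot ^^ q) F w"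
  using rot_pow_length[of w "rinv F"] by (simp add: funpow_swap1 rot_rinv)

text \<open>On a tensor with leading unit the first face returns \<open>w\<close>, the cyclic face
  puts the last factor of \<open>w\<close> in front, and the others act on \<open>w\<close> behind
  the unit: \<open>b s = 1 - t^(-1) - s b'\<close>.\<close>

lemma ones_hb: "w \<noteq> [] \<Longrightarrow> ones (hb F) w = F w - rinv F w - bet (ones F) w"
proof (cases w rule: rev_cases)
  case (snoc s z)
  have "ones (hb F) w = bet F (tone # w) + cyc F (tone # s @ [z])" by (simp add: ones_def hb_def snoc)
  also have "bet F (tone # w) = F w - bet (ones F) w" by (cases w) (auto simp: snoc ones_def[abs_def])
  also have "cyc F (tone # s @ [z]) = - rinv F w" unfolding cyc_snoc by (simp add: rinv_def snoc sgn_pow_Suc)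
  finally show ?thesis by simp
qed simp

lemma nrm_add: "nrm (\<lambda>w. F w + G w) w = nrm F w + nrm G w"
  using nrm_sum[of "\<lambda>b. if b then F else G" UNIV w] by (simp add: UNIV_bool add.commute)

lemma nrm_diff: "nrm (\<lambda>w. F w - G w) w = nrm F w - nrm G w" using nrm_add[of "\<lambda>w. F w - G w" G w] by simp

text \<open>The norm kills \<open>1 - t^(-1)\<close>. Together with \<open>hb_nrm\<close> this is
  the relation \<open>b B + B b = 0\<close>.\<close>

theorem nrm_ones_hb: "w \<noteq> [] \<Longrightarrow> nrm (ones (hb F)) w + nrm (bet (ones F)) w = 0"
proof -
  assume w: "w \<noteq> []"
  have "nrm (ones (hb F)) w = nrm (\<lambda>w. F w - rinv F w - bet (ones F) w) w" using w by (intro nrm_cong ones_hb) auto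
  then show ?thesis by (simp add: nrm_diff nrm_rinv)
qed

lemma bet_diff: "bet (\<lambda>w. F w - G w) w = bet F w - bet G w" unfolding bet_nth by (simp add: sgn_pow_diff sum_subtractf)

lemma bet_head: "bet (\<lambda>u. F (tmul x (hd u) # tl u)) (z # r) = bet F (tmul x z # r)" by (cases r) (auto simp: mult.assoc)

text \<open>Faces that multiply into the first factor cancel in pairs by associativity; the others
  form the same expression for the remaining factors.\<close>

lemma bet_bet: "bet (bet F) w = 0"
proof (induction "length w" arbitrary: F w)
  case (Suc n)
  show ?case proof (cases "(F, w)" rule: bet.cases)
    case (1 F' x z r)
    have "bet (\<lambda>u. bet F (x # u)) (z # r) = bet (\<lambda>u. F (tmul x (hd u) # tl u) - bet (\<lambda>v. F (x # v)) u) (z # r)"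
      if "r \<noteq> []" proof (rule bet_cong)
      show "bet F (x # v) = F (tmul x (hd v) # tl v) - bet (\<lambda>v. F (x # v)) v" if "Suc (length v) = length (z # r)" for v
        using that \<open>r \<noteq> []\<close> by (cases v) auto
    qed
    moreover have "bet (bet (\<lambda>v. F (x # v))) (z # r) = 0" using Suc 1 by simp
    ultimately show ?thesis using 1 by (cases "r = []") (auto simp: bet_diff bet_head)
  qed auto
qed auto

text \<open>This is \<open>b (1 - t^(-1)) = (1 - t^(-1)) b'\<close>: the inverse rotation shifts the
  sum over conjugates of the zeroth face by one, and only the end terms of the two sums do not
  match.\<close>

lemma rinv_bet: assumes "length w \<ge> 2" shows "hb F w - rinv (hb F) w = bet (\<lambda>v. F v - rinv F v) w"
proof -
  define q where "q = length w - 1"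
  have w: "length w = Suc q" "q > 0" using assms by (auto simp: q_def)
  define G where "G = rinv F"
  have F: "F = rot G" by (simp add: G_def rot_rinv)
  define D where "D j = dmul ((rot ^^ (q - j)) (rot G))" for j
  have "rinv (hb F) w = rinv (\<lambda>v. \<Sum>j\<le>q. (rot ^^ j) (D j) v) w" by (rule rinv_cong) (use w in \<open>simp add: hb_rot F D_def\<close>)
  also have "\<dots> = (\<Sum>j<Suc q. rinv ((rot ^^ j) (D j)) w)" unfolding lessThan_Suc_atMost by (rule rinv_sum)
  also have "\<dots> = rinv (D 0) w + (\<Sum>j<q. rinv ((rot ^^ Suc j) (D (Suc j))) w)" unfolding sum.lessThan_Suc_shift by simp
  also have "\<dots> = (rot ^^ q) (D 0) w + (\<Sum>j<q. (rot ^^ j) (D (Suc j)) w)" using w by (simp add: rinv_eq_rot_pow[of w q "D 0"] rinv_rot)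
  also have "(\<Sum>j<q. (rot ^^ j) (D (Suc j)) w) = bet G w"
    unfolding bet_rot[OF w(1)] by (intro sum.cong refl) (simp add: D_def Suc_diff_Suc flip: funpow_Suc_right[unfolded comp_def, THEN fun_cong])
  also have "(rot ^^ q) (D 0) w = cyc F w" proof -
    have "(rot ^^ q) (rot G) v = rot G v" if "length v = q" for v using rot_pow_length[of v "rot G"] that by simp
    then have "(rot ^^ q) (D 0) w = (rot ^^ q) (dmul (rot G)) w" unfolding D_def by (intro rot_pow_cong dmul_cong) (use w in simp)
    then show ?thesis using w by (simp add: cyc_rot F)
  qed
  finally show ?thesis by (simp add: hb_def[of F w] bet_diff G_def)
qed

text \<open>The two formulas containing \<open>1 - t^(-1)\<close> reduce \<open>b b s\<close> to
  \<open>s b' b'\<close>. So the boundary squares to zero on tensors with leading unit, the case to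
  which \<open>hb_hb\<close> reduces all others.\<close>

lemma ones_hb_hb: assumes "length w \<ge> 2" shows "ones (hb (hb F)) w = 0"
proof -
  have "w \<noteq> []" using assms by auto
  then have "ones (hb (hb F)) w = hb F w - rinv (hb F) w - bet (ones (hb F)) w" by (rule ones_hb)
  moreover have "bet (ones (hb F)) w = bet (\<lambda>v. F v - rinv F v - bet (ones F) v) w" by (rule bet_cong) (rule ones_hb, use assms in auto)
  ultimately show ?thesis using rinv_bet[OF assms, of F] by (simp add: bet_diff bet_bet)
qed

section \<open>Linear extension, and the translation of chain operators to functionals\<close>

lemma lookup_fscale [simp]: "lookup (fscale c f) x = c * lookup f x" by (simp add: fscale_def Poly_Mapping.map.rep_eq when_def)

lemma fscale_module: "module (fscale :: 'k::comm_ring_1 \<Rightarrow> ('b \<Rightarrow>\<^sub>0 'k) \<Rightarrow> _)"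
proof
  fix a b :: 'k and x y :: "'b \<Rightarrow>\<^sub>0 'k"
  show "fscale a (x + y) = fscale a x + fscale a y" "fscale (a + b) x = fscale a x + fscale b x"
    "fscale a (fscale b x) = fscale (a * b) x" "fscale 1 x = x"
    by (auto intro!: poly_mapping_eqI simp: lookup_add distrib_left distrib_right mult.assoc)
qed

interpretation fs: module fscale by (rule fscale_module)

lemma fscale_single [simp]: "fscale c (single x a) = single x (c * a)" by (rule poly_mapping_eqI) (simp add: lookup_single when_def)

lemma lin_extend_superset: assumes "finite S" "keys f \<subseteq> S" shows "lin_extend \<phi> f = (\<Sum>x\<in>S. fscale (lookup f x) (\<phi> x))"
  unfolding lin_extend_def by (rule sum.mono_neutral_left) (use assms in \<open>auto simp: in_keys_iff\<close>)

lemma lin_extend_add: "lin_extend \<phi> (f + g) = lin_extend \<phi> f + lin_extend \<phi> g"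
proof -
  let ?S = "keys f \<union> keys g"
  have "keys (f + g) \<subseteq> ?S" by (rule Poly_Mapping.keys_add)
  then show ?thesis by (simp add: lin_extend_superset[of ?S] lookup_add fs.scale_left_distrib sum.distrib)
qed

lemma lin_extend_0 [simp]: "lin_extend \<phi> 0 = 0" by (simp add: lin_extend_def)

lemma lin_extend_minus: "lin_extend \<phi> (- f) = - lin_extend \<phi> f"
  using lin_extend_add[of \<phi> f "- f"] by (simp add: eq_neg_iff_add_eq_0 add.commute)

lemma lin_extend_diff: "lin_extend \<phi> (f - g) = lin_extend \<phi> f - lin_extend \<phi> g"
  using lin_extend_add[of \<phi> f "- g"] by (simp add: lin_extend_minus)

lemma lin_extend_sum: "lin_extend \<phi> (\<Sum>i\<in>I. f i) = (\<Sum>i\<in>I. lin_extend \<phi> (f i))"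
  by (induction I rule: infinite_finite_induct) (auto simp: lin_extend_add)

lemma lin_extend_sgn_pow: "lin_extend \<phi> (sgn_pow n f) = sgn_pow n (lin_extend \<phi> f)" by (auto simp: sgn_pow_def lin_extend_minus)

lemma lin_extend_scale: "lin_extend \<phi> (fscale c f) = fscale c (lin_extend \<phi> f)"
proof -
  have "keys (fscale c f) \<subseteq> keys f" by (auto simp: in_keys_iff)
  then have "lin_extend \<phi> (fscale c f) = (\<Sum>x\<in>keys f. fscale (c * lookup f x) (\<phi> x))"
    by (subst lin_extend_superset[of "keys f"]) auto
  then show ?thesis by (simp add: lin_extend_def fs.scale_sum_right)
qed

lemma lin_extend_single [simp]: "lin_extend \<phi> (single x c) = fscale c (\<phi> x)" by (simp add: lin_extend_def)

lemma lin_extend_lin_extend: "lin_extend \<phi> (lin_extend \<psi> f) = lin_extend (\<lambda>x. lin_extend \<phi> (\<psi> x)) f"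
  unfolding lin_extend_def[of \<psi>] lin_extend_def[of "\<lambda>x. lin_extend \<phi> (\<psi> x)"] by (simp add: lin_extend_sum lin_extend_scale)

lemma lin_extend_cong: "(\<And>x. x \<in> keys f \<Longrightarrow> \<phi> x = \<psi> x) \<Longrightarrow> lin_extend \<phi> f = lin_extend \<psi> f"
  by (simp add: lin_extend_def)

lemma lin_extend_eq_0: "(\<And>x. x \<in> keys f \<Longrightarrow> \<phi> x = 0) \<Longrightarrow> lin_extend \<phi> f = 0"
  by (simp add: lin_extend_def)

lemma lin_extend_single_id: "lin_extend (\<lambda>x. single x 1) f = f"
  by (rule poly_mapping_eqI) (simp add: lin_extend_def lookup_sum lookup_single when_def in_keys_iff)

lemma lin_extend_fun_add: "lin_extend (\<lambda>x. \<phi> x + \<psi> x) f = lin_extend \<phi> f + lin_extend \<psi> f"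
  by (simp add: lin_extend_def fs.scale_right_distrib sum.distrib)

lemma fscale_sgn_pow: "fscale c (sgn_pow n f) = sgn_pow n (fscale c f)" by (auto simp: sgn_pow_def)

lemma lin_extend_fun_sgn_pow: "lin_extend (\<lambda>x. sgn_pow n (\<phi> x)) f = sgn_pow n (lin_extend \<phi> f)"
  by (simp add: lin_extend_def fscale_sgn_pow sgn_pow_sum)

lemma keys_lin_extend: "keys (lin_extend \<phi> f) \<subseteq> (\<Union>x\<in>keys f. keys (\<phi> x))" unfolding lin_extend_def
  by (rule subset_trans[OF Poly_Mapping.keys_sum UN_mono]) (auto simp: in_keys_iff)

lemma fscale_minus_one_power: "fscale ((- 1) ^ n) v = sgn_pow n v" by (auto simp: sgn_pow_def uminus_power_if)

text \<open>With the analogous lemmas for \<open>connes_B\<close> and \<open>tensor_bdry\<close>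
  this is the bridge between operators on chains and the action on functionals.\<close>

lemma lin_extend_hochschild_b: "w \<noteq> [] \<Longrightarrow> lin_extend F (hochschild_b w) = hb F w"
proof -
  assume w: "w \<noteq> []"
  have 1: "take (length w - 1) w = butlast w" by (simp add: butlast_conv_take)
  have 2: "w ! (length w - 1) = last w" using w by (simp add: last_conv_nth)
  have 3: "w ! 0 = hd w" using w by (simp add: hd_conv_nth)
  have 4: "butlast (tl w) = tl (butlast w)" by (cases w) simp_all
  show ?thesis unfolding hochschild_b_def Let_def hb_def bet_nth cyc_def 1 2 3 4
    by (cases "length w \<le> 1") (simp_all add: lin_extend_add lin_extend_sum fscale_minus_one_power tmul_def)
qed

lemma lin_extend_connes_B: "w \<noteq> [] \<Longrightarrow> lin_extend F (connes_B w) = nrm (ones F) w"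
proof -
  assume "w \<noteq> []"
  then obtain q where l: "length w = Suc q" by (cases w) auto
  show ?thesis by (simp add: connes_B_def nrm_def lin_extend_sum l lessThan_Suc_atMost del: sum.lessThan_Suc)
      (intro sum.cong refl, simp add: rot_pow l fscale_minus_one_power ones_def)
qed

text \<open>The internal differential without its factor \<open>(-1)^q\<close>, which
  \<open>lin_extend_tensor_bdry\<close> restores. In this form it commutes with rotations and with
  the Hochschild boundary; the factor turns this into anticommutation.\<close>

fun bd :: "('k, 'a) chain_alg \<Rightarrow> ('a::{ring, monoid_mult} tensor \<Rightarrow> 'v::ab_group_add) \<Rightarrow> 'a tensor \<Rightarrow> 'v" where
  "bd A F [] = 0"
| "bd A F (x # r) = (if fst x > 0 then F ((fst x - 1, bdry A (snd x)) # r) else 0) + sgn_pow (fst x) (bd A (\<lambda>u. F (x # u)) r)"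

lemma bd_nth: "bd A F w = (\<Sum>i<length w. if fst (w ! i) > 0 then
    sgn_pow (tdeg (take i w)) (F (w[i := (fst (w ! i) - 1, bdry A (snd (w ! i)))])) else 0)"
proof (induction w arbitrary: F)
  case (Cons x r)
  show ?case by (simp add: sum.lessThan_Suc_shift Cons sgn_pow_sum if_distrib[of "sgn_pow _"] del: sum.lessThan_Suc cong: if_cong)
qed simp

lemma lin_extend_tensor_bdry: "w \<noteq> [] \<Longrightarrow> lin_extend F (tensor_bdry A w) = sgn_pow (length w - 1) (bd A F w)"
proof -
  assume "w \<noteq> []"
  then have *: "{i. i \<le> length w - 1 \<and> fst (w ! i) > 0} = {i \<in> {..<length w}. fst (w ! i) > 0}" by (cases w) auto
  show ?thesis unfolding tensor_bdry_def Let_def lin_extend_sum * sum.inter_filter[OF finite_lessThan] bd_nth sgn_pow_sum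
    by (intro sum.cong refl) (simp add: fscale_minus_one_power)
qed

lemma bd_append: "bd A F (xs @ ys) = bd A (\<lambda>u. F (u @ ys)) xs + sgn_pow (tdeg xs) (bd A (\<lambda>v. F (xs @ v)) ys)"
  by (induction xs arbitrary: F) (auto simp: sgn_pow_add add.assoc)

lemma bd_ones: "bd A (ones F) w = ones (bd A F) w" by (simp add: ones_def[abs_def])

lemma bd_sum: "bd A (\<lambda>w. \<Sum>i\<in>I. F i w) w = (\<Sum>i\<in>I. bd A (F i) w)"
  unfolding bd_nth by (subst sum.swap) (auto simp: sgn_pow_sum intro!: sum.cong)

lemma bd_add: "bd A (\<lambda>w. F w + G w) w = bd A F w + bd A G w"
  unfolding bd_nth by (auto simp: sgn_pow_add simp flip: sum.distrib intro!: sum.cong)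

lemma bd_sgn_pow: "bd A (\<lambda>w. sgn_pow n (F w)) w = sgn_pow n (bd A F w)"
  unfolding bd_nth sgn_pow_sum by (intro sum.cong) (auto simp: add.commute)

lemma bd_zero [simp]: "bd A (\<lambda>w. 0) w = 0" unfolding bd_nth by (intro sum.neutral) auto

lemma bd_cong_length: "(\<And>v. length v = length w \<Longrightarrow> F v = G v) \<Longrightarrow> bd A F w = bd A G w"
  unfolding bd_nth by (intro sum.cong) auto

text \<open>The differential lowers the degree by one, so a sign with exponent \<open>c\<close>
  times the degree changes by \<open>(-1)^c\<close>. The shape is that of the sign of a rotation,
  where \<open>c\<close> is the degree of the moved factor.\<close>

lemma bd_sign:
  "bd A (\<lambda>u. sgn_pow (length u + c * tdeg u + k) (F u)) r = sgn_pow (length r + c * tdeg r + k + c) (bd A F r)"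
proof (induction r arbitrary: F k)
  case (Cons x r)
  have "bd A (\<lambda>u. sgn_pow (length (x # u) + c * tdeg (x # u) + k) (F (x # u))) r
     = bd A (\<lambda>u. sgn_pow (length u + c * tdeg u + (k + 1 + c * fst x)) (F (x # u))) r" by (simp add: algebra_simps)
  also have "\<dots> = sgn_pow (length r + c * tdeg r + (k + 1 + c * fst x) + c) (bd A (\<lambda>u. F (x # u)) r)" by (rule Cons)
  finally show ?case by (auto simp: sgn_pow_add gr0_conv_Suc intro!: arg_cong2[where f = "(+)"] sgn_pow_cong)
qed simp

lemma bd_rot: "w \<noteq> [] \<Longrightarrow> bd A (rot F) w = rot (bd A F) w"
proof (cases w)
  case (Cons x r)
  have *: "bd A (\<lambda>u. rot F (x # u)) r = sgn_pow (length r + fst x * tdeg r + fst x) (bd A (\<lambda>u. F (u @ [x])) r)"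
    using bd_sign[of A "fst x" 0 "\<lambda>u. F (u @ [x])" r] by simp
  let ?G = "bd A (\<lambda>u. F (u @ [x])) r" and ?n = "length r + fst x * tdeg r"
  have 1: "sgn_pow (fst x) (sgn_pow (?n + fst x) ?G) = sgn_pow ?n ?G" unfolding sgn_pow_pow by (rule sgn_pow_cong) auto
  have 2: "(if fst x > 0 then rot F ((fst x - 1, bdry A (snd x)) # r) else 0)
      = sgn_pow ?n (sgn_pow (tdeg r) (bd A (\<lambda>v. F (r @ v)) [x]))" by (cases "fst x") (auto intro: sgn_pow_cong)
  show ?thesis unfolding Cons bd.simps(2)[of A "rot F"] * 1 2 rot.simps(2)[of "bd A F"] bd_append[of A F r "[x]"]
    by (simp only: sgn_pow_add add.commute)
qed simp

lemma bd_rot_pow: "w \<noteq> [] \<Longrightarrow> bd A ((rot ^^ j) F) w = (rot ^^ j) (bd A F) w"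
proof (induction j arbitrary: w)
  case (Suc j)
  have "bd A ((rot ^^ Suc j) F) w = rot (bd A ((rot ^^ j) F)) w" using Suc.prems by (simp add: bd_rot)
  also have "\<dots> = rot ((rot ^^ j) (bd A F)) w" by (rule rot_cong) (use Suc in \<open>metis length_0_conv\<close>)
  finally show ?case by simp
qed simp

lemma bd_nrm: "w \<noteq> [] \<Longrightarrow> bd A (nrm F) w = nrm (bd A F) w"
proof -
  assume "w \<noteq> []"
  then have "bd A (\<lambda>v. \<Sum>i<length w. (rot ^^ i) F v) w = nrm (bd A F) w" by (simp add: bd_sum nrm_def bd_rot_pow)
  then show ?thesis using bd_cong_length[of w "nrm F" "\<lambda>v. \<Sum>i<length w. (rot ^^ i) F v" A] by (simp add: nrm_def)
qed

theorem bd_connes: "w \<noteq> [] \<Longrightarrow> bd A (nrm (ones F)) w = nrm (ones (bd A F)) w"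
  unfolding bd_nrm by (rule nrm_cong) (simp add: bd_ones)

section \<open>Multilinear reduced functionals\<close>

definition lmul :: "nat \<times> 'a \<Rightarrow> ('a::{ring, monoid_mult} tensor \<Rightarrow> 'v::ab_group_add) \<Rightarrow> 'a tensor \<Rightarrow> 'v" where
  "lmul a F w = dmul F (a # w)"

lemma lmul_Cons [simp]: "lmul a F (y # r) = F (tmul a y # r)" by (simp add: lmul_def)

lemma bet_lmul: "bet (lmul a F) (tone # w) = bet F (a # w)"
proof (cases w)
  case (Cons z r)
  have "(\<lambda>u. lmul a F (tone # u)) = (\<lambda>u. F (a # u))" by simp
  then show ?thesis by (simp add: Cons)
qed simp

context chain_algebra
begin

sublocale sm: module "smul A" by (rule smul_module)

abbreviation tens :: "'a tensor \<Rightarrow> bool" where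
  "tens w \<equiv> \<forall>x\<in>set w. snd x \<in> grade A (fst x)"

lemmas grade_0 = sm.subspace_0[OF grade_subspace] and grade_add = sm.subspace_add[OF grade_subspace] and grade_neg = sm.subspace_neg[OF grade_subspace]
  and grade_scale = sm.subspace_scale[OF grade_subspace] and grade_sum = sm.subspace_sum[OF grade_subspace]

lemma bdry_add: "bdry A (a + b) = bdry A a + bdry A b" and bdry_scale: "bdry A (smul A c a) = smul A c (bdry A a)"
  using bdry_hom by (auto simp: module_hom_iff)

lemma tmul_grade: "snd x \<in> grade A (fst x) \<Longrightarrow> snd y \<in> grade A (fst y) \<Longrightarrow> snd x * snd y \<in> grade A (fst x + fst y)"
  by (rule grade_mult)

text \<open>The condition under which a functional respects the first two kinds of tensor relations.
  Only homogeneous factors are tested, as only they occur in generators; the values lie in a free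
  module, like the expansion in words.\<close>

definition multilin :: "('a tensor \<Rightarrow> ('c \<Rightarrow>\<^sub>0 'k)) \<Rightarrow> bool" where
  "multilin F \<longleftrightarrow> (\<forall>xs n a b ys. tens (xs @ (n, a) # ys) \<longrightarrow> tens (xs @ (n, b) # ys) \<longrightarrow>
      F (xs @ (n, a + b) # ys) = F (xs @ (n, a) # ys) + F (xs @ (n, b) # ys)) \<and>
    (\<forall>xs n a c ys. tens (xs @ (n, a) # ys) \<longrightarrow> F (xs @ (n, smul A c a) # ys) = fscale c (F (xs @ (n, a) # ys)))"

lemma multilin_add: "multilin F \<Longrightarrow> tens xs \<Longrightarrow> tens ys \<Longrightarrow> a \<in> grade A n \<Longrightarrow> b \<in> grade A n \<Longrightarrow>
    F (xs @ (n, a + b) # ys) = F (xs @ (n, a) # ys) + F (xs @ (n, b) # ys)"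
  and multilin_scale: "multilin F \<Longrightarrow> tens xs \<Longrightarrow> tens ys \<Longrightarrow> a \<in> grade A n \<Longrightarrow>
    F (xs @ (n, smul A c a) # ys) = fscale c (F (xs @ (n, a) # ys))"
  unfolding multilin_def by (metis (no_types, lifting) UnE fst_conv set_ConsD set_append snd_conv)+

lemma multilinI:
  assumes "\<And>xs n a b c ys. tens xs \<Longrightarrow> tens ys \<Longrightarrow> a \<in> grade A n \<Longrightarrow> b \<in> grade A n \<Longrightarrow>
      F (xs @ (n, smul A c a + b) # ys) = fscale c (F (xs @ (n, a) # ys)) + F (xs @ (n, b) # ys)" shows "multilin F"
proof -
  have "F (xs @ (n, 0) # ys) = 0" if "tens xs" "tens ys" for xs n ys using assms[OF that grade_0 grade_0, of n 1] by simp
  then show ?thesis unfolding multilin_def using assms[of _ _ _ _ _ 1] assms[of _ _ _ _ 0] grade_0 by (simp add: ball_Un)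
qed

lemma multilin_lin: "multilin F \<Longrightarrow> tens xs \<Longrightarrow> tens ys \<Longrightarrow> a \<in> grade A n \<Longrightarrow> b \<in> grade A n \<Longrightarrow>
    F (xs @ (n, smul A c a + b) # ys) = fscale c (F (xs @ (n, a) # ys)) + F (xs @ (n, b) # ys)"
  by (simp add: multilin_add multilin_scale sm.subspace_scale[OF grade_subspace])

lemma multilin_zero: "multilin F \<Longrightarrow> tens xs \<Longrightarrow> tens ys \<Longrightarrow> F (xs @ (n, 0) # ys) = 0"
  using multilin_scale[of F xs ys 0 n 0] grade_0 by simp

lemma multilin_minus: "multilin F \<Longrightarrow> tens xs \<Longrightarrow> tens ys \<Longrightarrow> a \<in> grade A n \<Longrightarrow>
    F (xs @ (n, - a) # ys) = - F (xs @ (n, a) # ys)" using multilin_scale[of F xs ys a n "- 1"] by simp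

lemma multilin_sgn_pow: "multilin F \<Longrightarrow> tens xs \<Longrightarrow> tens ys \<Longrightarrow> a \<in> grade A n \<Longrightarrow>
    F (xs @ (n, sgn_pow m a) # ys) = sgn_pow m (F (xs @ (n, a) # ys))" by (auto simp: sgn_pow_def multilin_minus)

lemmas multilin_add_hd = multilin_add[of _ "[]", simplified] and multilin_scale_hd = multilin_scale[of _ "[]", simplified]
  and multilin_zero_hd = multilin_zero[of _ "[]", simplified] and multilin_lin_hd = multilin_lin[of _ "[]", simplified]
  and multilin_sgn_pow_hd = multilin_sgn_pow[of _ "[]", simplified]

lemma multilin_Cons: "multilin F \<Longrightarrow> snd x \<in> grade A (fst x) \<Longrightarrow> multilin (\<lambda>u. F (x # u))"
  using multilin_lin[of F "x # _"] by (intro multilinI) simp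

lemma multilin_sum: "(\<And>i. i \<in> I \<Longrightarrow> multilin (F i)) \<Longrightarrow> multilin (\<lambda>w. \<Sum>i\<in>I. F i w)"
  by (rule multilinI) (auto simp: multilin_lin sum.distrib fs.scale_sum_right)

lemma multilin_rot: assumes "multilin F" shows "multilin (rot F)"
proof (rule multilinI)
  fix xs n a b c ys assume *: "tens xs" "tens ys" "a \<in> grade A n" "b \<in> grade A n"
  then show "rot F (xs @ (n, smul A c a + b) # ys) = fscale c (rot F (xs @ (n, a) # ys)) + rot F (xs @ (n, b) # ys)"
    using multilin_lin[OF assms, of "ys" "[]" a n b c] multilin_lin[OF assms, of "tl xs" "ys @ [hd xs]" a n b c]
    by (cases xs) (auto simp: sgn_pow_add fscale_sgn_pow)
qed

lemma multilin_rot_pow: "multilin F \<Longrightarrow> multilin ((rot ^^ j) F)" by (induction j) (auto intro: multilin_rot)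

lemma multilin_dmul: assumes "multilin F" shows "multilin (dmul F)"
proof (rule multilinI)
  fix xs n a b c ys assume *: "tens xs" "tens ys" "a \<in> grade A n" "b \<in> grade A n"
  show "dmul F (xs @ (n, smul A c a + b) # ys) = fscale c (dmul F (xs @ (n, a) # ys)) + dmul F (xs @ (n, b) # ys)" proof (cases xs)
    case Nil
    then show ?thesis using * by (cases ys) (auto simp: tmul_def distrib_right smul_mult_left intro!: multilin_lin_hd[OF assms] grade_mult)
  next
    case (Cons x xs')
    then show ?thesis using * multilin_lin[OF assms, of "tmul x (hd xs') # tl xs'" ys a n b c]
      by (cases xs') (auto simp: tmul_def distrib_left smul_mult_right grade_mult intro!: multilin_lin_hd[OF assms])
  qed
qed

lemma multilin_lmul: "multilin F \<Longrightarrow> snd a \<in> grade A (fst a) \<Longrightarrow> multilin (lmul a F)"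
  unfolding lmul_def[abs_def] by (intro multilin_Cons multilin_dmul)

text \<open>The number of terms in \<open>hb\<close> and \<open>nrm\<close> varies with the length,
  but the condition compares tensors of one length only, where each agrees with a fixed sum.\<close>

lemma multilin_length: assumes "\<And>q. \<exists>G. multilin G \<and> (\<forall>w. length w = Suc q \<longrightarrow> F w = G w)" shows "multilin F"
proof (rule multilinI)
  fix xs n a b c ys assume *: "tens xs" "tens ys" "a \<in> grade A n" "b \<in> grade A n"
  obtain G where "multilin G" "\<And>w. length w = Suc (length xs + length ys) \<Longrightarrow> F w = G w" using assms by blast
  then show "F (xs @ (n, smul A c a + b) # ys) = fscale c (F (xs @ (n, a) # ys)) + F (xs @ (n, b) # ys)" using * by (simp add: multilin_lin)
qed

lemma multilin_0: "multilin (\<lambda>w. 0)" by (rule multilinI) auto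

lemma multilin_hb: assumes "multilin F" shows "multilin (hb F)"
proof (rule multilin_length)
  fix q
  show "\<exists>G. multilin G \<and> (\<forall>w. length w = Suc q \<longrightarrow> hb F w = G w)" proof (cases "q = 0")
    case True
    then show ?thesis using multilin_0 by (intro exI[of _ "\<lambda>w. 0"]) (auto simp: length_Suc_conv)
  next
    case False
    then show ?thesis using hb_rot[of _ q F] assms by (intro exI[of _ "\<lambda>w. \<Sum>j\<le>q. (rot ^^ j) (dmul ((rot ^^ (q - j)) F)) w"])
        (auto intro!: multilin_sum multilin_rot_pow multilin_dmul)
  qed
qed

lemma multilin_nrm: assumes "multilin F" shows "multilin (nrm F)" by (rule multilin_length)
    (rule_tac x = "\<lambda>w. \<Sum>j<Suc q. (rot ^^ j) F w" in exI,
     auto simp: nrm_def simp del: sum.lessThan_Suc intro!: multilin_sum multilin_rot_pow assms)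

lemma multilin_ones: "multilin F \<Longrightarrow> multilin (ones F)" unfolding ones_def[abs_def] by (rule multilin_Cons) (auto simp: grade_one)

lemma bet_cong_tens:
  "(\<And>v. tens v \<Longrightarrow> Suc (length v) = length w \<Longrightarrow> F v = G v) \<Longrightarrow> tens w \<Longrightarrow> bet F w = bet G w"
proof (induction F w arbitrary: G rule: bet.induct)
  case (1 F x z r)
  have "F (tmul x z # r) = G (tmul x z # r)" using 1(3) by (intro 1(2)) (auto simp: tmul_grade)
  moreover have "bet (\<lambda>u. F (x # u)) (z # r) = bet (\<lambda>u. G (x # u)) (z # r)" using 1(2,3) by (intro 1(1)) auto
  ultimately show ?case by simp
qed auto

lemma hb_cong_tens: assumes "\<And>v. tens v \<Longrightarrow> Suc (length v) = length w \<Longrightarrow> F v = G v" "tens w" shows "hb F w = hb G w"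
proof (cases "length w \<le> 1")
  case True
  then show ?thesis using bet_cong_tens[of w F G] assms by (simp add: hb_def cyc_def)
next
  case False
  then obtain x s z where w: "w = x # s @ [z]" by (cases w; cases "tl w" rule: rev_cases) auto
  have "F (tmul z x # s) = G (tmul z x # s)" using assms(2) by (intro assms(1)) (auto simp: w tmul_grade)
  then show ?thesis using bet_cong_tens[of w F G] assms by (simp add: hb_def w cyc_snoc)
qed

lemma bd_cong_tens:
  "(\<And>v. tens v \<Longrightarrow> length v = length w \<Longrightarrow> F v = G v) \<Longrightarrow> tens w \<Longrightarrow> bd A F w = bd A G w"
proof (induction w arbitrary: F G)
  case (Cons x r)
  have "F ((fst x - 1, bdry A (snd x)) # r) = G ((fst x - 1, bdry A (snd x)) # r)" if "fst x > 0"
    using Cons(3) that bdry_grade[of "snd x" "fst x - 1"] by (intro Cons(2)) auto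
  moreover have "bd A (\<lambda>u. F (x # u)) r = bd A (\<lambda>u. G (x # u)) r" using Cons(2,3) by (intro Cons(1)) auto
  ultimately show ?case by simp
qed simp

lemma rot_pow_cong_tens: assumes "\<And>v. tens v \<Longrightarrow> length v = length w \<Longrightarrow> F v = G v" "tens w" "j \<le> length w"
  shows "(rot ^^ j) F w = (rot ^^ j) G w"
proof -
  have "tens (drop j w @ take j w)" using assms(2) by (auto dest: in_set_dropD in_set_takeD)
  then show ?thesis using assms by (simp add: rot_pow)
qed

text \<open>In the cyclic face the last factor multiplies \<open>a\<close> from the left; graded
  commutativity moves it to the right, where the first face has its factor anyway. Thus the boundary
  is linear over the first factor.\<close>

lemma hb_Cons: assumes "multilin F" "tens (a # w)" shows "hb F (a # w) = hb (lmul a F) (tone # w)"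
proof (cases w rule: rev_cases)
  case (snoc s z)
  have g: "snd z \<in> grade A (fst z)" "snd a \<in> grade A (fst a)" "tens s" using assms(2) snoc by auto
  have "F (tmul z a # s) = sgn_pow (fst a * fst z) (F (tmul a z # s))"
    using multilin_sgn_pow_hd[OF assms(1) g(3), of "snd a * snd z" "fst a + fst z" "fst a * fst z"] g
    by (simp add: graded_commute[of "snd a" "fst a" "snd z" "fst z"] grade_mult tmul_def add.commute)
  then have "cyc F (a # s @ [z]) = cyc (lmul a F) (tone # s @ [z])" by (auto simp: cyc_snoc intro!: sgn_pow_cong)
  then show ?thesis by (simp add: hb_def snoc bet_lmul)
qed simp

lemma lmul_hb: assumes "multilin F" "tens v" "snd a \<in> grade A (fst a)" "v \<noteq> []" shows "lmul a (hb F) v = hb (lmul a F) v"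
proof -
  obtain y r where v: "v = y # r" using assms(4) by (cases v) auto
  have "lmul a (hb F) v = hb (lmul (tmul a y) F) (tone # r)" using hb_Cons[OF assms(1), of "tmul a y" r] assms by (simp add: v tmul_grade)
  also have "\<dots> = hb (lmul y (lmul a F)) (tone # r)" proof (rule hb_cong)
    show "lmul (tmul a y) F u = lmul y (lmul a F) u" for u by (cases u) (auto simp: lmul_def)
  qed
  also have "\<dots> = hb (lmul a F) v" using hb_Cons[OF multilin_lmul[OF assms(1,3)], of y r] assms by (simp add: v)
  finally show ?thesis .
qed

text \<open>Linearity over the first factor moves \<open>a\<close> into the functional, and what
  remains is the square on a tensor with leading unit.\<close>

theorem hb_hb: assumes F: "multilin F" and w: "tens w" "length w \<ge> 3" shows "hb (hb F) w = 0"
proof -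
  obtain a u where u: "w = a # u" using w by (cases w) auto
  have a: "snd a \<in> grade A (fst a)" using w u by simp
  have "hb (hb F) w = hb (lmul a (hb F)) (tone # u)" using hb_Cons[OF multilin_hb[OF F], of a u] w u by simp
  also have "\<dots> = hb (hb (lmul a F)) (tone # u)" proof (rule hb_cong_tens)
    show "lmul a (hb F) v = hb (lmul a F) v" if "tens v" "Suc (length v) = length (tone # u)" for v
      using lmul_hb[OF F that(1) a] that(2) w u by fastforce
  qed (use w u in \<open>auto simp: grade_one\<close>)
  also have "\<dots> = 0" using ones_hb_hb[of u "lmul a F"] w u by (simp add: ones_def)
  finally show ?thesis .
qed

text \<open>This is the Leibniz rule. Degrees are truncated: in degree 0 the boundary of a factor is
  zero and \<open>bd\<close> omits its summand, so both conventions agree in all cases.\<close>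

lemma bd_dmul: assumes F: "multilin F" and w: "tens w" "length w \<ge> 2" shows "bd A (dmul F) w = dmul (bd A F) w"
proof -
  obtain x z r where wr: "w = x # z # r" using w by (cases w; cases "tl w") auto
  obtain n a m b where x: "x = (n, a)" and z: "z = (m, b)" by (cases x; cases z) auto
  have g: "a \<in> grade A n" "b \<in> grade A m" "tens r" using w by (auto simp: wr x z)
  have da: "n = 0 \<Longrightarrow> bdry A a = 0" "n > 0 \<Longrightarrow> bdry A a \<in> grade A (n - 1)"
    and db: "m = 0 \<Longrightarrow> bdry A b = 0" "m > 0 \<Longrightarrow> bdry A b \<in> grade A (m - 1)"
    using g bdry_grade_0 bdry_grade[of a "n - 1"] bdry_grade[of b "m - 1"] by auto
  let ?N = "n + m - 1"
  have 1: "bdry A a * b \<in> grade A ?N" if "n + m > 0" proof (cases "n = 0")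
    case False
    then show ?thesis using grade_mult[OF da(2) g(2)] by simp
  qed (simp add: da grade_0)
  have 2: "a * bdry A b \<in> grade A ?N" if "n + m > 0" proof (cases "m = 0")
    case False
    then show ?thesis using grade_mult[OF g(1) db(2)] by simp
  qed (simp add: db grade_0)
  have "bd A (dmul F) w = (if n > 0 then F ((n - 1 + m, bdry A a * b) # r) else 0)
      + sgn_pow n ((if m > 0 then F ((n + (m - 1), a * bdry A b) # r) else 0)
      + sgn_pow m (bd A (\<lambda>u. F (tmul x z # u)) r))" by (simp add: wr x z tmul_def)
  moreover have "dmul (bd A F) w = (if n + m > 0 then F ((?N, bdry A (a * b)) # r) else 0)
      + sgn_pow (n + m) (bd A (\<lambda>u. F (tmul x z # u)) r)" by (simp add: wr x z tmul_def)
  moreover have "F ((?N, bdry A (a * b)) # r) = F ((?N, bdry A a * b) # r) + sgn_pow n (F ((?N, a * bdry A b) # r))" if "n + m > 0" proof -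
    have "sgn_pow n (a * bdry A b) \<in> grade A ?N" using 2[OF that] by (auto simp: sgn_pow_def grade_neg)
    then show ?thesis using multilin_add_hd[OF F g(3) 1[OF that]] multilin_sgn_pow_hd[OF F g(3) 2[OF that]] by (simp add: leibniz[OF g(1)])
  qed
  moreover have "F ((k, 0) # r) = 0" for k using multilin_zero_hd[OF F g(3)] by simp
  ultimately show ?thesis using da db by (auto simp: sgn_pow_add)
qed

text \<open>All faces are conjugates of the zeroth one by rotations, which commute with
  \<open>bd\<close>; only the Leibniz rule for one product is left.\<close>

theorem bd_hb: assumes F: "multilin F" and w: "tens w" shows "bd A (hb F) w = hb (bd A F) w"
proof (cases "length w \<le> 1")
  case True
  then show ?thesis by (cases w) (auto simp: hb_def cyc_def)
next
  case False
  define q where "q = length w - 1"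
  have l: "length w = Suc q" "q > 0" using False by (auto simp: q_def)
  have ne: "w \<noteq> []" using l by auto
  have "bd A (hb F) w = bd A (\<lambda>v. \<Sum>j\<le>q. (rot ^^ j) (dmul ((rot ^^ (q - j)) F)) v) w"
    by (rule bd_cong_length) (use l in \<open>simp add: hb_rot\<close>)
  also have "\<dots> = (\<Sum>j\<le>q. (rot ^^ j) (bd A (dmul ((rot ^^ (q - j)) F))) w)" using ne by (simp add: bd_sum bd_rot_pow)
  also have "\<dots> = (\<Sum>j\<le>q. (rot ^^ j) (dmul ((rot ^^ (q - j)) (bd A F))) w)" proof (intro sum.cong refl rot_pow_cong_tens w)
    fix j v assume j: "j \<in> {..q}" and v: "tens v" "length v = length w"
    show "bd A (dmul ((rot ^^ (q - j)) F)) v = dmul ((rot ^^ (q - j)) (bd A F)) v"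
      unfolding bd_dmul[OF multilin_rot_pow[OF F] v(1)[unfolded] , of "q - j"] using bd_dmul[OF multilin_rot_pow[OF F] v(1), of "q - j"] v l
      by (simp, intro dmul_cong bd_rot_pow) auto
  qed (use l in auto)
  also have "\<dots> = hb (bd A F) w" using l by (simp add: hb_rot)
  finally show ?thesis .
qed

theorem bd_bd: assumes "multilin F" "tens w" shows "bd A (bd A F) w = 0" using assms
proof (induction w arbitrary: F)
  case (Cons x r)
  obtain n a where x: "x = (n, a)" by (cases x)
  have a: "a \<in> grade A n" "tens r" using Cons.prems by (auto simp: x)
  have IH: "bd A (bd A (\<lambda>u. F (x # u))) r = 0" using Cons.prems by (intro Cons.IH multilin_Cons) auto
  have z: "F ((k, 0) # r) = 0" for k using multilin_zero_hd[OF Cons.prems(1) a(2)] .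
  show ?case proof (cases n)
    case 0
    then show ?thesis using IH by (simp add: x bd_add bd_sgn_pow)
  next
    case (Suc m)
    let ?G = "\<lambda>u. F ((m, bdry A a) # u)" and ?H = "bd A (\<lambda>u. F (x # u))"
    have "bd A (bd A F) (x # r) = bd A F ((m, bdry A a) # r) + sgn_pow n (bd A (\<lambda>u. ?G u + sgn_pow n (?H u)) r)" by (simp add: x Suc)
    also have "\<dots> = bd A F ((m, bdry A a) # r) + sgn_pow n (bd A ?G r + sgn_pow n (bd A ?H r))" by (simp only: bd_add bd_sgn_pow)
    also have "\<dots> = 0" using IH z by (simp add: Suc bdry_bdry sgn_pow_Suc)
    finally show ?thesis .
  qed
qed simp

end

section \<open>Normalised functionals\<close>

context chain_algebra
begin

definition reduced :: "('a tensor \<Rightarrow> ('c \<Rightarrow>\<^sub>0 'k)) \<Rightarrow> bool" where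
  "reduced F \<longleftrightarrow> (\<forall>xs c ys. xs \<noteq> [] \<longrightarrow> tens xs \<longrightarrow> tens ys \<longrightarrow> F (xs @ (0, smul A c 1) # ys) = 0)"

lemma reducedD: "reduced F \<Longrightarrow> xs \<noteq> [] \<Longrightarrow> tens xs \<Longrightarrow> tens ys \<Longrightarrow> F (xs @ (0, smul A c 1) # ys) = 0"
  by (simp add: reduced_def)

lemma reduced_mem: assumes "reduced F" "tens (x # w)" "(0, smul A c 1) \<in> set w" shows "F (x # w) = 0"
proof -
  obtain xs ys where "w = xs @ (0, smul A c 1) # ys" using assms(3) by (meson split_list)
  then show ?thesis using reducedD[OF assms(1), of "x # xs" ys c] assms(2) by simp
qed

lemma reduced_Cons: "reduced F \<Longrightarrow> snd x \<in> grade A (fst x) \<Longrightarrow> reduced (\<lambda>u. F (x # u))"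
  using reducedD[of F "x # _"] by (auto simp: reduced_def)

lemma unit_grade: "smul A c 1 \<in> grade A 0" by (intro grade_scale grade_one)

text \<open>The two products of a scalar with its neighbours cancel, and every other face keeps the
  scalar in a later place. In the last place there is only a left neighbour, and its product
  remains.\<close>

lemma bet_unit: assumes "multilin F" "reduced F" "tens xs" "tens ys" "xs \<noteq> []"
  shows "bet F (xs @ (0, smul A c 1) # ys) = (if ys = [] then sgn_pow (length xs - 1) (fscale c (F xs)) else 0)" using assms
proof (induction xs arbitrary: F)
  case (Cons x xs)
  obtain n a where x: "x = (n, a)" by (cases x)
  let ?u = "(0, smul A c 1)"
  show ?case proof (cases xs)
    case Nil
    have xu: "tmul x ?u = (n, smul A c a)" by (simp add: x tmul_def smul_mult_right)
    show ?thesis proof (cases ys)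
      case Nil
      then show ?thesis using multilin_scale_hd[OF Cons.prems(1), of "[]" a n c] Cons.prems \<open>xs = []\<close>
        by (simp add: xu[unfolded x] x)
    next
      case (Cons z r)
      obtain m b where z: "z = (m, b)" by (cases z)
      have uz: "tmul ?u z = (m, smul A c b)" by (simp add: z tmul_def smul_mult_left)
      have "bet (\<lambda>v. F (x # ?u # v)) (z # r) = bet (\<lambda>v. 0) (z # r)"
        using Cons.prems Cons reducedD[OF Cons.prems(2), of "[x]" _ c] by (intro bet_cong_tens) auto
      also have "\<dots> = 0" by (simp add: bet_nth)
      finally show ?thesis using multilin_scale_hd[OF Cons.prems(1), of "z # r" a n c]
          multilin_scale[OF Cons.prems(1), of "[x]" r b m c] Cons.prems Cons \<open>xs = []\<close>
        by (simp add: xu[unfolded x] uz[unfolded z] x z)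
    qed
  next
    case (Cons x' xs')
    have "bet (\<lambda>u. F (x # u)) (xs @ ?u # ys) = (if ys = [] then sgn_pow (length xs - 1) (fscale c (F (x # xs))) else 0)"
      using Cons.prems Cons by (intro Cons.IH multilin_Cons reduced_Cons) auto
    moreover have "F (tmul x x' # xs' @ ?u # ys) = 0"
      using reducedD[OF Cons.prems(2), of "tmul x x' # xs'" ys c] Cons.prems Cons by (simp add: grade_mult)
    ultimately show ?thesis using Cons by (simp add: sgn_pow_Suc)
  qed
qed simp

text \<open>The term that \<open>bet_unit\<close> leaves for a scalar in the last place is cancelled
  by the cyclic face, in which the scalar multiplies the first factor.\<close>

lemma reduced_hb: assumes "multilin F" "reduced F" shows "reduced (hb F)" unfolding reduced_def
proof (intro allI impI)
  fix xs c ys assume xs: "xs \<noteq> []" "tens xs" "tens ys"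
  then obtain x s where x: "xs = x # s" by (cases xs) auto
  obtain n a where xa: "x = (n, a)" by (cases x)
  have b: "bet F (xs @ (0, smul A c 1) # ys) = (if ys = [] then sgn_pow (length xs - 1) (fscale c (F xs)) else 0)"
    by (rule bet_unit[OF assms xs(2,3,1)])
  show "hb F (xs @ (0, smul A c 1) # ys) = 0" proof (cases ys rule: rev_cases)
    case Nil
    have "cyc F (x # s @ [(0, smul A c 1)]) = sgn_pow (length s + 1) (F ((n, smul A c a) # s))"
      unfolding cyc_snoc by (simp add: xa tmul_def smul_mult_left)
    then show ?thesis using b Nil x xa multilin_scale_hd[OF assms(1), of s a n c] xs by (simp add: hb_def sgn_pow_Suc)
  next
    case (snoc zs z)
    have "cyc F (x # (s @ (0, smul A c 1) # zs) @ [z]) = 0"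
      unfolding cyc_snoc using reducedD[OF assms(2), of "tmul z x # s" zs c] xs by (simp add: x snoc grade_mult)
    then show ?thesis using b snoc x by (simp add: hb_def)
  qed
qed

lemma reduced_bd: assumes "reduced F" shows "reduced (bd A F)" unfolding reduced_def
proof (intro allI impI)
  fix xs c ys assume xs: "xs \<noteq> []" "tens xs" "tens ys"
  let ?u = "(0, smul A c 1)"
  have 1: "bd A (\<lambda>v. F (v @ ?u # ys)) xs = bd A (\<lambda>v. 0) xs" proof (rule bd_cong_tens)
    show "F (v @ ?u # ys) = 0" if "tens v" "length v = length xs" for v using reducedD[OF assms, of v ys c] that xs by force
  qed (rule xs)
  have 2: "bd A (\<lambda>v. F (xs @ ?u # v)) ys = bd A (\<lambda>v. 0) ys" by (rule bd_cong_tens) (use xs reducedD[OF assms] in auto)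
  show "bd A F (xs @ ?u # ys) = 0" unfolding bd_append 1 using 2 by simp
qed

lemma nrm_ones_unit: assumes "reduced F" "tens w" "(0, smul A c 1) \<in> set w" shows "nrm (ones F) w = 0" unfolding nrm_def
proof (intro sum.neutral ballI)
  fix i assume i: "i \<in> {..<length w}"
  have w: "set (drop i w @ take i w) = set w" by (metis append_take_drop_id set_append sup_commute)
  have "F (tone # drop i w @ take i w) = 0" by (rule reduced_mem[OF assms(1), where c = c]) (use w assms(2,3) in \<open>auto simp: grade_one\<close>)
  then show "(rot ^^ i) (ones F) w = 0" using i by (simp add: rot_pow ones_def)
qed

lemma reduced_connes: "reduced F \<Longrightarrow> reduced (nrm (ones F))"
  unfolding reduced_def[of "nrm (ones F)"] by (intro allI impI nrm_ones_unit) (auto simp: grade_one unit_grade)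

text \<open>The first application puts a unit into every tensor; after the second one it stands in a
  later place, where \<open>F\<close> vanishes.\<close>

lemma connes_connes: assumes "reduced F" "tens w" shows "nrm (ones (nrm (ones F))) w = 0"
proof -
  have "nrm (ones (nrm (ones F))) w = nrm (\<lambda>v. 0) w" unfolding nrm_def[of _ w] by (intro sum.cong refl rot_pow_cong_tens)
      (use assms nrm_ones_unit[OF assms(1), of "tone # _" 1] in \<open>auto simp: ones_def grade_one\<close>)
  also have "\<dots> = 0" using nrm_sum[of "\<lambda>_ _. 0" "{}" w] by simp
  finally show ?thesis .
qed

lemma multilin_bd: assumes "multilin F" shows "multilin (bd A F)"
proof (rule multilinI)
  fix xs n a b c ys assume *: "tens xs" "tens ys" "a \<in> grade A n" "b \<in> grade A n"
  let ?v = "smul A c a + b"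
  have v: "?v \<in> grade A n" using * grade_add sm.subspace_scale[OF grade_subspace] by blast
  have sc: "bd A (\<lambda>u. fscale c (G u)) w = fscale c (bd A G w)" for G :: "'a tensor \<Rightarrow> 'c \<Rightarrow>\<^sub>0 'k" and w
    unfolding bd_nth fs.scale_sum_right by (intro sum.cong) (auto simp: fscale_sgn_pow)
  have 1: "bd A (\<lambda>u. F (u @ (n, ?v) # ys)) xs = bd A (\<lambda>u. fscale c (F (u @ (n, a) # ys)) + F (u @ (n, b) # ys)) xs"
    by (rule bd_cong_tens) (use * multilin_lin[OF assms] in auto)
  have 2: "bd A (\<lambda>u. F (xs @ (n, ?v) # u)) ys = bd A (\<lambda>u. fscale c (F (xs @ (n, a) # u)) + F (xs @ (n, b) # u)) ys"
    by (rule bd_cong_tens) (use * multilin_lin[OF assms] in auto)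
  have 3: "F (xs @ (n - 1, bdry A ?v) # ys) = fscale c (F (xs @ (n - 1, bdry A a) # ys)) + F (xs @ (n - 1, bdry A b) # ys)" if "n > 0"
    using * that bdry_grade[of _ "n - 1"] by (simp add: bdry_add bdry_scale multilin_lin[OF assms])
  show "bd A F (xs @ (n, ?v) # ys) = fscale c (bd A F (xs @ (n, a) # ys)) + bd A F (xs @ (n, b) # ys)"
    unfolding bd_append bd.simps 1 using 2 3 by (simp add: bd_add sc fs.scale_right_distrib fscale_sgn_pow sgn_pow_add)
qed

end

section \<open>The monomial basis\<close>

type_synonym 'x mono = "'x \<Rightarrow>\<^sub>0 nat"

context free_chain_algebra
begin

abbreviation mons :: "'x mono set" where "mons \<equiv> monomials X dg"
abbreviation mn :: "'x mono \<Rightarrow> 'l" where "mn \<equiv> monomial gen"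
abbreviation mdeg :: "'x mono \<Rightarrow> nat" where "mdeg \<equiv> gamma_internal dg"

definition val :: "('x mono \<Rightarrow>\<^sub>0 'k) \<Rightarrow> 'l" where
  "val p = (\<Sum>e\<in>keys p. smul L (lookup p e) (mn e))"

lemma val_superset:
  "finite S \<Longrightarrow> keys p \<subseteq> S \<Longrightarrow> val p = (\<Sum>e\<in>S. smul L (lookup p e) (mn e))"
  unfolding val_def by (rule sum.mono_neutral_left) (auto simp: in_keys_iff)

lemma val_add: "val (p + q) = val p + val q"
proof -
  let ?S = "keys p \<union> keys q"
  have "keys (p + q) \<subseteq> ?S" by (rule Poly_Mapping.keys_add)
  then show ?thesis by (simp add: val_superset[of ?S] lookup_add sm.scale_left_distrib sum.distrib)
qed

lemma val_scale: "val (fscale c p) = smul L c (val p)"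
proof -
  have "keys (fscale c p) \<subseteq> keys p" by (auto simp: in_keys_iff)
  then have "val (fscale c p) = (\<Sum>e\<in>keys p. smul L (c * lookup p e) (mn e))" by (subst val_superset[of "keys p"]) auto
  then show ?thesis by (simp add: val_def sm.scale_sum_right)
qed

lemma val_diff: "val (p - q) = val p - val q" using val_add[of "p - q" q] by (simp add: eq_diff_eq)

lemma val_single: "val (single e c) = smul L c (mn e)" by (simp add: val_def)

text \<open>Independence is a statement about the set of values; as monomials are injective in the
  exponent, coefficients indexed by exponents transfer to it.\<close>

lemma val_inj: assumes "keys p \<subseteq> mons" "val p = 0" shows "p = 0"
proof (rule ccontr)
  assume "p \<noteq> 0"
  then obtain e where e: "e \<in> keys p" by (metis keys_eq_empty all_not_in_conv)
  have inj: "inj_on mn (keys p)" using monomials_inj assms(1) inj_on_subset by blast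
  let ?u = "\<lambda>v. lookup p (the_inv_into (keys p) mn v)"
  have *: "(\<Sum>v\<in>mn ` keys p. smul L (?u v) v) = val p" unfolding val_def by (subst sum.reindex[OF inj]) (simp add: the_inv_into_f_f[OF inj])
  have "?u (mn e) = 0" proof (rule sm.independentD[OF monomials_independent])
    show "(\<Sum>v\<in>mn ` keys p. smul L (?u v) v) = 0" using * assms(2) by simp
  qed (use assms(1) e in auto)
  then show False using e by (simp add: the_inv_into_f_f[OF inj] in_keys_iff)
qed

lemma val_surj: "\<exists>p. keys p \<subseteq> mons \<and> val p = a"
proof -
  have "a \<in> sm.span (mn ` mons)" using monomials_span by simp
  then show ?thesis proof (induction rule: sm.span_induct_alt)
    case base
    show ?case by (intro exI[of _ 0]) (simp add: val_def)
  next
    case (step c x y)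
    then obtain e p where "x = mn e" "e \<in> mons" "keys p \<subseteq> mons" "val p = y" by auto
    then show ?case using Poly_Mapping.keys_add[of "single e c" p]
      by (intro exI[of _ "single e c + p"]) (auto simp: val_add val_single split: if_splits)
  qed
qed

definition co :: "'l \<Rightarrow> ('x mono \<Rightarrow>\<^sub>0 'k)" where
  "co a = (THE p. keys p \<subseteq> mons \<and> val p = a)"

lemma co_unique: "keys p \<subseteq> mons \<Longrightarrow> val p = a \<Longrightarrow> co a = p" unfolding co_def
proof (rule the_equality)
  fix q assume "keys p \<subseteq> mons" "val p = a" "keys q \<subseteq> mons \<and> val q = a"
  moreover have "keys (q - p) \<subseteq> keys q \<union> keys p" by (rule keys_diff)
  ultimately show "q = p" using val_inj[of "q - p"] by (auto simp: val_diff)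
qed simp

lemma co: "keys (co a) \<subseteq> mons" "val (co a) = a" using val_surj[of a] co_unique by auto

lemma co_add: "co (a + b) = co a + co b"
  by (rule co_unique[OF subset_trans[OF Poly_Mapping.keys_add Un_least[OF co(1) co(1)]]]) (simp add: val_add co)

lemma keys_fscale: "keys (fscale c p) \<subseteq> keys p" by (auto simp: in_keys_iff)

lemma co_scale: "co (smul L c a) = fscale c (co a)" by (rule co_unique[OF subset_trans[OF keys_fscale co(1)]]) (simp add: val_scale co)

lemma co_mn: "e \<in> mons \<Longrightarrow> co (mn e) = single e 1" by (rule co_unique) (auto simp: val_single)

lemma mn_0: "mn 0 = 1" by (simp add: monomial_def)

lemma zero_mons: "0 \<in> mons" by (simp add: monomials_def)

lemma co_unit: "co (smul L c 1) = single 0 c" by (simp only: co_scale mn_0[symmetric] co_mn[OF zero_mons] fscale_single mult_1_right)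

lemma power_grade: "a \<in> grade L n \<Longrightarrow> a ^ k \<in> grade L (k * n)" by (induction k) (auto simp: grade_one intro: grade_mult)

lemma prod_list_grade:
  "(\<And>x. x \<in> set xs \<Longrightarrow> f x \<in> grade L (g x)) \<Longrightarrow> prod_list (map f xs) \<in> grade L (sum_list (map g xs))"
  by (induction xs) (auto simp: grade_one intro: grade_mult)

lemma mn_grade: "e \<in> mons \<Longrightarrow> mn e \<in> grade L (mdeg e)"
proof -
  assume "e \<in> mons"
  then have "mn e \<in> grade L (sum_list (map (\<lambda>x. lookup e x * dg x) (sorted_list_of_set (keys e))))"
    unfolding monomial_def by (intro prod_list_grade power_grade gen_grade) (auto simp: monomials_def)
  then show ?thesis by (simp add: gamma_internal_def sum_list_distinct_conv_sum_set)
qed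

lemma grade_unique: "f n = a \<Longrightarrow> (\<And>m. m \<noteq> n \<Longrightarrow> f m = 0) \<Longrightarrow> a \<in> grade L n \<Longrightarrow> is_decomposition L a f"
  unfolding is_decomposition_def
proof (intro conjI allI)
  assume *: "f n = a" "\<And>m. m \<noteq> n \<Longrightarrow> f m = 0" "a \<in> grade L n"
  then have "{m. f m \<noteq> 0} \<subseteq> {n}" by auto
  then show "finite {m. f m \<noteq> 0}" and "a = (\<Sum>m | f m \<noteq> 0. f m)" using * by (auto simp: finite_subset dest!: subset_singletonD)
  fix m show "f m \<in> grade L m" using * grade_0 by (cases "m = n") auto
qed

text \<open>Sorting the coordinates of \<open>a\<close> by degree yields a decomposition into
  homogeneous parts, which by uniqueness is the trivial one. Hence only monomials of degree
  \<open>n\<close> occur.\<close>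

lemma co_grade: assumes "a \<in> grade L n" shows "keys (co a) \<subseteq> {e. mdeg e = n}"
proof
  define r where "r m = Poly_Mapping.mapp (\<lambda>e c. c when mdeg e = m) (co a)" for m
  have lr: "lookup (r m) e = (lookup (co a) e when mdeg e = m)" for m e by (simp add: r_def mapp.rep_eq when_def in_keys_iff)
  have kr: "keys (r m) \<subseteq> keys (co a) \<inter> {e. mdeg e = m}" for m by (auto simp: in_keys_iff lr when_def split: if_splits)
  let ?M = "mdeg ` keys (co a)"
  have z: "r m = 0" if "m \<notin> ?M" for m using kr[of m] that by (force simp flip: keys_eq_empty)
  have "val (r m) = 0" if "m \<notin> ?M" for m using z[OF that] by (simp add: val_def)
  then have fin: "{m. val (r m) \<noteq> 0} \<subseteq> ?M" by blast
  have "is_decomposition L a (\<lambda>m. val (r m))" unfolding is_decomposition_def proof (intro conjI allI)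
    show "val (r m) \<in> grade L m" for m unfolding val_def using kr[of m] co(1)[of a] mn_grade by (intro grade_sum grade_scale) auto
    show "finite {m. val (r m) \<noteq> 0}" by (rule finite_subset[OF fin]) simp
    have s: "(\<Sum>m | val (r m) \<noteq> 0. val (r m)) = (\<Sum>m\<in>?M. val (r m))" by (rule sum.mono_neutral_left) (use fin in auto)
    have "(\<Sum>m\<in>?M. r m) = co a" by (rule poly_mapping_eqI) (auto simp: lookup_sum lr when_def in_keys_iff)
    moreover have "val (\<Sum>m\<in>M. r m) = (\<Sum>m\<in>M. val (r m))" for M
      by (induction M rule: infinite_finite_induct) (auto simp: val_add val_def[of 0])
    ultimately show "a = (\<Sum>m | val (r m) \<noteq> 0. val (r m))" using co(2)[of a] s by metis
  qed
  moreover have "is_decomposition L a (\<lambda>m. if m = n then a else 0)" by (rule grade_unique[where n = n]) (use assms in auto)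
  ultimately have "(\<lambda>m. val (r m)) = (\<lambda>m. if m = n then a else 0)" using grade_direct by blast
  then have "val (r n) = a" by metis
  then have "co a = r n" using co_unique[of "r n" a] kr[of n] co(1)[of a] by auto
  then show "e \<in> {e. mdeg e = n}" if "e \<in> keys (co a)" for e using kr[of n] that by auto
qed

end

section \<open>The normal form of chains\<close>

context free_chain_algebra
begin

fun nfu :: "'l tensor \<Rightarrow> ('x mono list \<Rightarrow>\<^sub>0 'k)" where
  "nfu [] = single [] 1"
| "nfu (x # r) = lin_extend (\<lambda>e. lin_extend (\<lambda>w. single (e # w) 1) (nfu r)) (co (snd x))"

text \<open>The universal multilinear and reduced functional. By \<open>relations_iff\<close> its
  kernel consists of the relations, so it identifies \<open>C(p,q)\<close> with the free module on
  \<open>words p q\<close>.\<close>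

definition nf :: "'l tensor \<Rightarrow> ('x mono list \<Rightarrow>\<^sub>0 'k)" where
  "nf t = lin_extend (\<lambda>w. if 0 \<in> set (tl w) then 0 else single w 1) (nfu t)"

definition wd :: "'x mono list \<Rightarrow> 'l tensor" where
  "wd = map (\<lambda>e. (mdeg e, mn e))"

definition words :: "nat \<Rightarrow> nat \<Rightarrow> 'x mono list set" where
  "words p q = {w. length w = Suc q \<and> sum_list (map mdeg w) = p \<and> set w \<subseteq> mons \<and> 0 \<notin> set (tl w)}"

lemma lin_extend_fun_scale: "lin_extend (\<lambda>x. fscale c (\<phi> x)) f = fscale c (lin_extend \<phi> f)" for c :: "'c::comm_ring_1"
  by (simp add: lin_extend_def fs.scale_sum_right mult.commute)

lemma nfu_multilin: "nfu (xs @ (n, a + b) # ys) = nfu (xs @ (n, a) # ys) + nfu (xs @ (n, b) # ys)"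
  "nfu (xs @ (n, smul L c a) # ys) = fscale c (nfu (xs @ (n, a) # ys))" by (induction xs)
    (simp_all add: co_add co_scale lin_extend_add lin_extend_scale lin_extend_fun_add lin_extend_fun_scale)

lemma nf_multilin: "multilin nf" unfolding multilin_def nf_def by (simp add: nfu_multilin lin_extend_add lin_extend_scale)

lemma keys_nfu: "w \<in> keys (nfu t) \<Longrightarrow> list_all2 (\<lambda>e x. e \<in> keys (co (snd x))) w t"
proof (induction t arbitrary: w)
  case (Cons x r)
  then obtain e where e: "e \<in> keys (co (snd x))" and "w \<in> keys (lin_extend (\<lambda>w. single (e # w) (1::'k)) (nfu r))"
    using keys_lin_extend by fastforce
  then obtain v where "v \<in> keys (nfu r)" "w \<in> keys (single (e # v) (1::'k))" using keys_lin_extend by fastforce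
  then show ?case using Cons.IH e by (auto split: if_splits)
qed (simp split: if_splits)

lemma nf_reduced: "reduced nf" unfolding reduced_def
proof (intro allI impI)
  fix xs ys :: "'l tensor" and c assume xs: "xs \<noteq> []"
  show "nf (xs @ (0, smul L c 1) # ys) = 0" unfolding nf_def proof (rule lin_extend_eq_0)
    fix w assume "w \<in> keys (nfu (xs @ (0, smul L c 1) # ys))"
    then have "list_all2 (\<lambda>e x. e \<in> keys (co (snd x))) w (xs @ (0, smul L c 1) # ys)" by (rule keys_nfu)
    then obtain us e vs where w: "w = us @ e # vs" "length us = length xs" "e \<in> keys (co (smul L c 1))"
      by (auto simp: list_all2_append2 list_all2_Cons2 dest: list_all2_lengthD)
    then have "e = 0" by (auto simp: co_unit split: if_splits)
    moreover have "us \<noteq> []" using w xs by auto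
    ultimately have "0 \<in> set (tl w)" using w by (cases us) auto
    then show "(if 0 \<in> set (tl w) then 0 else single w 1) = 0" by simp
  qed
qed

lemma nfu_wd: "set w \<subseteq> mons \<Longrightarrow> nfu (wd w) = single w 1" by (induction w) (auto simp: wd_def co_mn)

lemma nf_wd: "set w \<subseteq> mons \<Longrightarrow> 0 \<notin> set (tl w) \<Longrightarrow> nf (wd w) = single w 1" by (simp add: nf_def nfu_wd)

lemma tens_wd: "set w \<subseteq> mons \<Longrightarrow> tens (wd w)" using mn_grade by (auto simp: wd_def)

lemma tensors_iff: "t \<in> tensors L p q \<longleftrightarrow> length t = Suc q \<and> tdeg t = p \<and> tens t" by (auto simp: tensors_def)

lemma wd_tensors: "w \<in> words p q \<Longrightarrow> wd w \<in> tensors L p q"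
  using tens_wd[of w] by (auto simp: words_def tensors_iff wd_def tdeg_def comp_def)

lemma keys_nfu_words: assumes "tens t" "w \<in> keys (nfu t)" shows "length w = length t" "sum_list (map mdeg w) = tdeg t" "set w \<subseteq> mons"
proof -
  have "list_all2 (\<lambda>e x. e \<in> keys (co (snd x))) w t" using assms keys_nfu by blast
  then have *: "list_all2 (\<lambda>e x. e \<in> mons \<and> mdeg e = fst x) w t"
    by (rule list.rel_mono_strong) (use assms(1) co_grade co(1) in blast)
  then show "length w = length t" by (rule list_all2_lengthD)
  from * show "sum_list (map mdeg w) = tdeg t" by (induction rule: list_all2_induct) auto
  from * show "set w \<subseteq> mons" by (induction rule: list_all2_induct) auto
qed

lemma keys_nf: "t \<in> tensors L p q \<Longrightarrow> keys (nf t) \<subseteq> words p q"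
proof
  fix w assume t: "t \<in> tensors L p q" and "w \<in> keys (nf t)"
  then obtain v where v: "v \<in> keys (nfu t)"
     "w \<in> keys (if 0 \<in> set (tl v) then 0 else single v (1::'k))" unfolding nf_def using keys_lin_extend by fastforce
  then have "w = v" "0 \<notin> set (tl v)" by (auto split: if_splits)
  then show "w \<in> words p q" using keys_nfu_words[OF _ v(1)] t by (auto simp: words_def tensors_iff)
qed

lemma multilin_co: assumes "multilin F" "tens r" "a \<in> grade L n" shows "F ((n, a) # r) = lin_extend (\<lambda>e. F ((mdeg e, mn e) # r)) (co a)"
proof -
  have k: "\<And>e. e \<in> keys (co a) \<Longrightarrow> mn e \<in> grade L n \<and> mdeg e = n"
    using co_grade[OF assms(3)] co(1)[of a] mn_grade by blast
  have "F ((n, \<Sum>e\<in>I. smul L (c e) (mn e)) # r) = (\<Sum>e\<in>I. fscale (c e) (F ((n, mn e) # r)))" if "I \<subseteq> keys (co a)" for I c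
    using that proof (induction I rule: infinite_finite_induct)
    case (insert e I)
    have "F ((n, smul L (c e) (mn e) + (\<Sum>e\<in>I. smul L (c e) (mn e))) # r)
        = F ((n, smul L (c e) (mn e)) # r) + F ((n, \<Sum>e\<in>I. smul L (c e) (mn e)) # r)"
      using insert k by (intro multilin_add_hd[OF assms(1,2)] grade_scale grade_sum) auto
    then show ?case using insert k multilin_scale_hd[OF assms(1,2)] by simp
  qed (auto simp: multilin_zero_hd[OF assms(1,2)])
  from this[OF order_refl, of "lookup (co a)"] show ?thesis using k co(2)[of a] by (simp add: lin_extend_def val_def)
qed

lemma multilin_nfu: "multilin F \<Longrightarrow> tens t \<Longrightarrow> F t = lin_extend (\<lambda>w. F (wd w)) (nfu t)"
proof (induction t arbitrary: F)
  case Nil then show ?case by (simp add: wd_def)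
next
  case (Cons x r)
  obtain n a where x: "x = (n, a)" by (cases x)
  have a: "a \<in> grade L n" "tens r" using Cons.prems by (auto simp: x)
  have "F (x # r) = lin_extend (\<lambda>e. F ((mdeg e, mn e) # r)) (co a)" using multilin_co[OF Cons.prems(1) a(2,1)] x by simp
  also have "\<dots> = lin_extend (\<lambda>e. lin_extend (\<lambda>w. F (wd (e # w))) (nfu r)) (co a)" proof (rule lin_extend_cong)
    fix e assume "e \<in> keys (co a)"
    then have "multilin (\<lambda>u. F ((mdeg e, mn e) # u))" using co(1)[of a] mn_grade by (intro multilin_Cons Cons.prems) auto
    from Cons.IH[OF this a(2)] show "F ((mdeg e, mn e) # r) = lin_extend (\<lambda>w. F (wd (e # w))) (nfu r)" by (simp add: wd_def)
  qed
  finally show ?case by (simp add: lin_extend_lin_extend x)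
qed

text \<open>Words with the monomial 1 in a later place are dropped by \<open>nf\<close>, and a
  reduced functional vanishes on them. Such a functional is thus determined by its values on
  words.\<close>

theorem multilin_nf: assumes F: "multilin F" "reduced F" and t: "tens t" shows "F t = lin_extend (\<lambda>w. F (wd w)) (nf t)"
proof -
  have "F t = lin_extend (\<lambda>w. F (wd w)) (nfu t)" by (rule multilin_nfu[OF F(1) t])
  also have "\<dots> = lin_extend (\<lambda>w. lin_extend (\<lambda>w. F (wd w)) (if 0 \<in> set (tl w) then 0 else single w 1)) (nfu t)"
  proof (rule lin_extend_cong)
    fix w assume w: "w \<in> keys (nfu t)"
    have "F (wd w) = 0" if z: "0 \<in> set (tl w)" proof -
      obtain e v where v: "w = e # v" "0 \<in> set v" using z by (cases w) auto
      have "(0, smul L 1 1) \<in> set (wd v)" using v by (force simp: wd_def mn_0 gamma_internal_def)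
      then show ?thesis using reduced_mem[OF F(2), of "(mdeg e, mn e)" "wd v" 1] tens_wd[of w] keys_nfu_words(3)[OF t w] v by (simp add: wd_def)
    qed
    then show "F (wd w) = lin_extend (\<lambda>w. F (wd w)) (if 0 \<in> set (tl w) then 0 else single w 1)" by simp
  qed
  finally show ?thesis by (simp add: nf_def lin_extend_lin_extend)
qed

lemma rel_keys_eval: assumes "multilin F" "reduced F" "f \<in> fs.span (tensor_relations L p q)"
  shows "lin_extend F f = 0 \<and> keys f \<subseteq> tensors L p q" using assms(3)
proof (induction rule: fs.span_induct_alt)
  case (step c x y)
  have 1: "keys x \<subseteq> tensors L p q" proof -
    have k: "keys (single t c) \<subseteq> tensors L p q" if "t \<in> tensors L p q" for t and c :: 'k using that by simp
    have d: "keys (u - v) \<subseteq> tensors L p q" if "keys u \<subseteq> tensors L p q" "keys v \<subseteq> tensors L p q"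
      for u v :: "'l tensor \<Rightarrow>\<^sub>0 'k" using keys_diff[of u v] that by blast
    from step(1) consider xs ys n u v where "x = single (xs @ (n, u + v) # ys) 1 - single (xs @ (n, u) # ys) 1
          - single (xs @ (n, v) # ys) 1" "xs @ (n, u) # ys \<in> tensors L p q" "xs @ (n, v) # ys \<in> tensors L p q"
      | xs ys n u c where "x = single (xs @ (n, smul L c u) # ys) 1 - single (xs @ (n, u) # ys) c"
          "xs @ (n, u) # ys \<in> tensors L p q"
      | xs ys c where "x = single (xs @ (0, smul L c 1) # ys) 1" "xs @ (0, smul L c 1) # ys \<in> tensors L p q"
      unfolding tensor_relations_def by blast
    then show ?thesis proof cases
      case (1 xs ys n u v)
      moreover have "xs @ (n, u + v) # ys \<in> tensors L p q" using 1 by (auto simp: tensors_iff grade_add)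
      ultimately show ?thesis by (simp only:) (intro d k)
    next
      case (2 xs ys n u c)
      moreover have "xs @ (n, smul L c u) # ys \<in> tensors L p q" using 2 by (auto simp: tensors_iff grade_scale)
      ultimately show ?thesis by (simp only:) (intro d k)
    next
      case 3
      then show ?thesis by (simp only:) (intro k)
    qed
  qed
  have 2: "lin_extend F x = 0" using step(1) unfolding tensor_relations_def
    by (auto simp: lin_extend_diff tensors_iff multilin_add[OF assms(1)] multilin_scale[OF assms(1)] reducedD[OF assms(2)])
  have "keys (fscale c x + y) \<subseteq> tensors L p q" using Poly_Mapping.keys_add[of "fscale c x" y] keys_fscale[of c x] 1 step by blast
  then show ?case using step 2 by (simp add: lin_extend_add lin_extend_scale)
qed simp

text \<open>Additivity and scaling relations are used one summand at a time. The empty sum needs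
  scaling by 0, which makes a tensor with a factor 0 a relation.\<close>

lemma rel_multilin:
  fixes p q :: nat
  defines "S \<equiv> fs.span (tensor_relations L p q)"
  assumes "\<And>e. e \<in> I \<Longrightarrow> g e \<in> grade L n" "us @ (n, 0) # r \<in> tensors L p q" "finite I"
  shows "single (us @ (n, \<Sum>e\<in>I. smul L (c e) (g e)) # r) 1
    - (\<Sum>e\<in>I. single (us @ (n, g e) # r) (c e)) \<in> S" using assms(4,2)
proof (induction I rule: finite_induct)
  have T: "us @ (n, a) # r \<in> tensors L p q" if "a \<in> grade L n" for a using assms(3) that by (auto simp: tensors_iff)
  {
    case empty
    have "single (us @ (n, smul L 0 0) # r) 1 - single (us @ (n, 0) # r) 0 \<in> tensor_relations L p q"
      unfolding tensor_relations_def using assms(3) by blast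
    then show ?case unfolding S_def using fs.span_base by fastforce
  next
    case (insert e I)
    let ?s = "\<Sum>e\<in>I. smul L (c e) (g e)" and ?t = "smul L (c e) (g e)"
    have g: "?s \<in> grade L n" "?t \<in> grade L n" "g e \<in> grade L n" using insert.prems by (auto intro: grade_sum grade_scale)
    have 1: "single (us @ (n, ?t + ?s) # r) 1 - single (us @ (n, ?t) # r) 1
        - single (us @ (n, ?s) # r) 1 \<in> S" unfolding S_def tensor_relations_def using T[OF g(1)] T[OF g(2)] by (intro fs.span_base) blast
    have 2: "single (us @ (n, ?t) # r) 1 - single (us @ (n, g e) # r) (c e) \<in> S"
      unfolding S_def tensor_relations_def using T[OF g(3)] by (intro fs.span_base) blast
    have 3: "single (us @ (n, ?s) # r) 1 - (\<Sum>e\<in>I. single (us @ (n, g e) # r) (c e)) \<in> S" using insert by simp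
    have "single (us @ (n, ?t + ?s) # r) 1 - (single (us @ (n, g e) # r) (c e) + (\<Sum>e\<in>I. single (us @ (n, g e) # r) (c e))) \<in> S"
      using fs.span_add[OF fs.span_add[OF 1[unfolded S_def] 2[unfolded S_def]] 3[unfolded S_def]] by (simp add: S_def diff_diff_eq)
    then show ?case using insert by simp
  }
qed

text \<open>The prefix \<open>us\<close> holds the factors treated already, so that the factors can
  be expanded one after the other from the left.\<close>

lemma rel_nfu:
  "us @ t \<in> tensors L p q \<Longrightarrow> single (us @ t) 1 - lin_extend (\<lambda>w. single (us @ wd w) 1) (nfu t)
    \<in> fs.span (tensor_relations L p q)"
proof (induction t arbitrary: us)
  case Nil then show ?case by (simp add: wd_def fs.span_zero)
next
  case (Cons x r)
  obtain n a where x: "x = (n, a)" by (cases x)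
  have a: "a \<in> grade L n" and t0: "us @ (n, 0) # r \<in> tensors L p q" using Cons.prems grade_0 by (auto simp: x tensors_iff)
  have k: "\<And>e. e \<in> keys (co a) \<Longrightarrow> mn e \<in> grade L n \<and> mdeg e = n" using co_grade[OF a] co(1)[of a] mn_grade by blast
  have 1: "single (us @ (n, val (co a)) # r) 1 - (\<Sum>e\<in>keys (co a).
      single (us @ (n, mn e) # r) (lookup (co a) e)) \<in> fs.span (tensor_relations L p q)"
    unfolding val_def by (rule rel_multilin) (use k t0 in auto)
  have "single ((us @ [(n, mn e)]) @ r) 1 - lin_extend (\<lambda>w. single ((us @ [(n, mn e)]) @ wd w) 1) (nfu r)
      \<in> fs.span (tensor_relations L p q)" if "e \<in> keys (co a)" for e using t0 k[OF that] by (intro Cons.IH) (auto simp: tensors_iff)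
  then have "(\<Sum>e\<in>keys (co a). fscale (lookup (co a) e) (single (us @ (n, mn e) # r) 1
      - lin_extend (\<lambda>w. single (us @ wd (e # w)) 1) (nfu r))) \<in> fs.span (tensor_relations L p q)"
    using k by (intro fs.span_sum fs.span_scale) (simp add: wd_def)
  note 2 = fs.span_add[OF 1 this]
  have "lin_extend (\<lambda>w. single (us @ wd w) 1) (nfu (x # r))
      = lin_extend (\<lambda>e. lin_extend (\<lambda>w. single (us @ wd (e # w)) 1) (nfu r)) (co a)" by (simp add: x lin_extend_lin_extend)
  also have "\<dots> = (\<Sum>e\<in>keys (co a). fscale (lookup (co a) e)
      (lin_extend (\<lambda>w. single (us @ wd (e # w)) 1) (nfu r)))" by (simp add: lin_extend_def[of _ "co a"])
  finally show ?case using 2 by (simp add: x co fs.scale_right_diff_distrib sum_subtractf del: nfu.simps)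
qed

lemma rel_nf: assumes t: "t \<in> tensors L p q"
  shows "single t 1 - lin_extend (\<lambda>w. single (wd w) 1) (nf t) \<in> fs.span (tensor_relations L p q)"
proof -
  let ?S = "fs.span (tensor_relations L p q)"
  have "single (wd w) 1 - lin_extend (\<lambda>w. single (wd w) 1)
      (if 0 \<in> set (tl w) then 0 else single w 1) \<in> ?S" if w: "w \<in> keys (nfu t)" for w proof (cases "0 \<in> set (tl w)")
    case True
    have tw: "wd w \<in> tensors L p q" using keys_nfu_words[OF _ w] t tens_wd[of w] by (auto simp: tensors_iff wd_def tdeg_def comp_def)
    obtain us vs where "w = us @ 0 # vs" "us \<noteq> []" using True by (cases w) (auto dest!: split_list, metis append_Cons list.distinct(1))
    then have "wd w = wd us @ (0, smul L 1 1) # wd vs" "wd us \<noteq> []" by (auto simp: wd_def mn_0 gamma_internal_def)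
    then have "single (wd w) 1 \<in> {single (xs @ (0, smul L c 1) # ys) 1
        | xs ys c. xs \<noteq> [] \<and> xs @ (0, smul L c 1) # ys \<in> tensors L p q}"
      using tw by (intro CollectI exI[of _ "wd us"] exI[of _ "wd vs"] exI[of _ "1"]) simp
    then have "single (wd w) 1 \<in> tensor_relations L p q" unfolding tensor_relations_def by (rule UnI2)
    then show ?thesis using True fs.span_base by simp
  qed (simp add: fs.span_zero)
  then have "(\<Sum>w\<in>keys (nfu t). fscale (lookup (nfu t) w) (single (wd w) 1
      - lin_extend (\<lambda>w. single (wd w) 1) (if 0 \<in> set (tl w) then 0 else single w 1))) \<in> ?S" by (intro fs.span_sum fs.span_scale)
  note 2 = fs.span_add[OF rel_nfu[of "[]", simplified, OF t] this]
  let ?g = "\<lambda>w. lin_extend (\<lambda>w. single (wd w) (1::'k)) (if 0 \<in> set (tl w) then 0 else single w 1)"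
  have "lin_extend (\<lambda>w. single (wd w) 1) (nf t) = lin_extend ?g (nfu t)" by (simp only: nf_def lin_extend_lin_extend)
  moreover have "lin_extend ?g (nfu t) = (\<Sum>w\<in>keys (nfu t). fscale (lookup (nfu t) w) (?g w))" by (simp only: lin_extend_def[of _ "nfu t"])
  moreover have "lin_extend (\<lambda>w. single (wd w) 1) (nfu t)
      = (\<Sum>w\<in>keys (nfu t). fscale (lookup (nfu t) w) (single (wd w) 1))" by (simp only: lin_extend_def[of _ "nfu t"])
  ultimately show ?thesis using 2 by (simp only: fs.scale_right_diff_distrib sum_subtractf) simp
qed

text \<open>Multilinear reduced functionals kill relations, and each tensor is congruent to its
  expansion in words, so a chain with zero expansion is a relation. Computations modulo relations
  rest on this criterion.\<close>

theorem relations_iff: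
  "f \<in> fs.span (tensor_relations L p q) \<longleftrightarrow> keys f \<subseteq> tensors L p q \<and> lin_extend nf f = 0"
proof
  assume "f \<in> fs.span (tensor_relations L p q)"
  then show "keys f \<subseteq> tensors L p q \<and> lin_extend nf f = 0" using rel_keys_eval[OF nf_multilin nf_reduced] by blast
next
  assume f: "keys f \<subseteq> tensors L p q \<and> lin_extend nf f = 0"
  have "(\<Sum>t\<in>keys f. fscale (lookup f t)
      (single t 1 - lin_extend (\<lambda>w. single (wd w) 1) (nf t))) \<in> fs.span (tensor_relations L p q)"
    using f rel_nf by (intro fs.span_sum fs.span_scale) blast
  moreover have "(\<Sum>t\<in>keys f. fscale (lookup f t) (single t 1 - lin_extend (\<lambda>w. single (wd w) 1) (nf t)))
    = lin_extend (\<lambda>t. single t 1) f - lin_extend (\<lambda>w. single (wd w) 1) (lin_extend nf f)"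
    unfolding lin_extend_lin_extend by (simp add: lin_extend_def fs.scale_right_diff_distrib sum_subtractf)
  ultimately show "f \<in> fs.span (tensor_relations L p q)" using f by (simp add: lin_extend_single_id)
qed

end

section \<open>The cyclic complex of a free chain algebra is a double mixed complex\<close>

context free_chain_algebra
begin

lemma keys_single_subset: "x \<in> S \<Longrightarrow> keys (single x c) \<subseteq> S" by simp

lemma keys_sum_subset: "(\<And>i. i \<in> I \<Longrightarrow> keys (f i) \<subseteq> S) \<Longrightarrow> keys (\<Sum>i\<in>I. f i) \<subseteq> S"
  using Poly_Mapping.keys_sum[of f I] by blast

lemma keys_add_subset: "keys f \<subseteq> S \<Longrightarrow> keys g \<subseteq> S \<Longrightarrow> keys (f + g) \<subseteq> S"
  using Poly_Mapping.keys_add[of f g] by blast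

lemma keys_lin_extend_subset:
  "(\<And>x. x \<in> keys f \<Longrightarrow> keys (\<phi> x) \<subseteq> S) \<Longrightarrow> keys (lin_extend \<phi> f) \<subseteq> S"
  using keys_lin_extend[of \<phi> f] by blast

lemma keys_hochschild_b: assumes "t \<in> tensors L p (Suc q)" shows "keys (hochschild_b t :: _ \<Rightarrow>\<^sub>0 'k) \<subseteq> tensors L p q"
proof -
  have t: "length t = Suc (Suc q)" "tdeg t = p" "tens t" using assms by (auto simp: tensors_iff)
  have 1: "take i t @ (fst (t ! i) + fst (t ! Suc i), snd (t ! i) * snd (t ! Suc i)) # drop (i + 2) t \<in> tensors L p q" if i: "i < Suc q" for i
  proof -
    define a b xs ys where "a = t ! i" and "b = t ! Suc i" and "xs = take i t" and "ys = drop (i + 2) t"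
    have "t = xs @ a # b # ys" using i t by (simp add: a_def b_def xs_def ys_def Cons_nth_drop_Suc)
    moreover have "length xs = i" using i t by (simp add: xs_def)
    ultimately have "xs @ (fst a + fst b, snd a * snd b) # ys \<in> tensors L p q" using t by (auto simp: tensors_iff grade_mult)
    then show ?thesis by (simp only: a_def b_def xs_def ys_def)
  qed
  obtain x s z where w: "t = x # s @ [z]" using t by (cases t; cases "tl t" rule: rev_cases) auto
  have l: "t ! Suc q = z" "t ! 0 = x" "butlast (tl t) = s" using t by (auto simp: w nth_append butlast_append)
  have 2: "(fst z + fst x, snd z * snd x) # s \<in> tensors L p q" using t by (auto simp: w tensors_iff grade_mult)
  have "hochschild_b t = (\<Sum>i<Suc q. single
      (take i t @ (fst (t ! i) + fst (t ! Suc i), snd (t ! i) * snd (t ! Suc i)) # drop (i + 2) t) ((- 1) ^ i))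
     + single ((fst z + fst x, snd z * snd x) # s) ((- 1) ^ (Suc q + fst z * tdeg (take (Suc q) t)) :: 'k)"
    using t(1) by (simp add: hochschild_b_def l del: sum.lessThan_Suc)
  then show ?thesis by (simp only:) (intro keys_add_subset keys_sum_subset keys_single_subset 1 2, auto)
qed

lemma keys_connes_B: assumes "t \<in> tensors L p q" shows "keys (connes_B t :: _ \<Rightarrow>\<^sub>0 'k) \<subseteq> tensors L p (Suc q)"
proof -
  have t: "length t = Suc q" "tdeg t = p" "tens t" using assms by (auto simp: tensors_iff)
  have "tone # drop i t @ take i t \<in> tensors L p (Suc q)" for i proof -
    have "tdeg (drop i t) + tdeg (take i t) = tdeg t" by (metis append_take_drop_id tdeg_simps(3) add.commute)
    moreover have "tens (drop i t @ take i t)" using t(3) by (auto dest: in_set_dropD in_set_takeD)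
    ultimately show ?thesis using t by (auto simp: tensors_iff grade_one)
  qed
  then show ?thesis unfolding connes_B_def Let_def by (intro keys_sum_subset keys_single_subset)
qed

lemma keys_tensor_bdry: assumes "t \<in> tensors L (Suc p) q" shows "keys (tensor_bdry L t :: _ \<Rightarrow>\<^sub>0 'k) \<subseteq> tensors L p q"
proof -
  have t: "length t = Suc q" "tdeg t = Suc p" "tens t" using assms by (auto simp: tensors_iff)
  have "t[i := (fst (t ! i) - 1, bdry L (snd (t ! i)))] \<in> tensors L p q" if i: "i \<le> q" "fst (t ! i) > 0" for i proof -
    define a xs ys where "a = t ! i" and "xs = take i t" and "ys = drop (Suc i) t"
    have tx: "t = xs @ a # ys" using i t by (simp add: a_def xs_def ys_def id_take_nth_drop)
    moreover have li: "length xs = i" using i t by (simp add: xs_def)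
    ultimately have "t[i := (fst (t ! i) - 1, bdry L (snd (t ! i)))] = xs @ (fst a - 1, bdry L (snd a)) # ys"
      using i by (auto simp: list_update_append nth_append)
    moreover have "bdry L (snd a) \<in> grade L (fst a - 1)" "fst a > 0" using i t tx bdry_grade[of "snd a" "fst a - 1"] li by auto
    ultimately show ?thesis using t tx by (auto simp: tensors_iff)
  qed
  then show ?thesis unfolding tensor_bdry_def Let_def using t(1) by (intro keys_sum_subset keys_single_subset) auto
qed

abbreviation Cyc :: "('k, 'l tensor \<Rightarrow>\<^sub>0 'k) mixed_complex" where "Cyc \<equiv> cyclic_complex L"

lemma Cyc_simps:
  "mx_scale Cyc = fscale" "mx_D Cyc = lin_extend hochschild_b" "mx_del Cyc = lin_extend (tensor_bdry L)"
  "mx_B Cyc = lin_extend connes_B"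
  "f \<in> mxZ Cyc p q \<longleftrightarrow> keys f \<subseteq> tensors L p q"
  "f \<in> mxN Cyc p q \<longleftrightarrow> f \<in> fs.span (tensor_relations L p q)" by (simp_all add: cyclic_complex_def)

text \<open>Composing with a functional replaces an operator on chains by its action on functionals;
  this serves for \<open>nf\<close>, which detects relations, and for functionals derived from
  it.\<close>

lemma ev_D: "keys f \<subseteq> tensors L p q \<Longrightarrow> lin_extend F (lin_extend hochschild_b f) = lin_extend (hb F) f"
  unfolding lin_extend_lin_extend by (intro lin_extend_cong lin_extend_hochschild_b) (auto simp: tensors_def)

lemma ev_B: "keys f \<subseteq> tensors L p q \<Longrightarrow> lin_extend F (lin_extend connes_B f) = lin_extend (nrm (ones F)) f"
  unfolding lin_extend_lin_extend by (intro lin_extend_cong lin_extend_connes_B) (auto simp: tensors_def)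

lemma ev_del: "keys f \<subseteq> tensors L p q \<Longrightarrow> lin_extend F (lin_extend (tensor_bdry L) f) = sgn_pow q (lin_extend (bd L F) f)"
proof -
  assume f: "keys f \<subseteq> tensors L p q"
  have "lin_extend F (lin_extend (tensor_bdry L) f) = lin_extend (\<lambda>t. sgn_pow q (bd L F t)) f" unfolding lin_extend_lin_extend
  proof (rule lin_extend_cong)
    fix t assume "t \<in> keys f"
    then have "length t = Suc q" using f by (auto simp: tensors_def)
    moreover from this have "t \<noteq> []" by auto
    ultimately show "lin_extend F (tensor_bdry L t) = sgn_pow q (bd L F t)" by (simp add: lin_extend_tensor_bdry)
  qed
  then show ?thesis by (simp add: lin_extend_fun_sgn_pow)
qed

lemma chain_D: "keys (f :: _ \<Rightarrow>\<^sub>0 'k) \<subseteq> tensors L p (Suc q) \<Longrightarrow> keys (lin_extend hochschild_b f) \<subseteq> tensors L p q"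
  by (rule keys_lin_extend_subset) (rule keys_hochschild_b, auto)

lemma chain_B: "keys (f :: _ \<Rightarrow>\<^sub>0 'k) \<subseteq> tensors L p q \<Longrightarrow> keys (lin_extend connes_B f) \<subseteq> tensors L p (Suc q)"
  by (rule keys_lin_extend_subset) (rule keys_connes_B, auto)

lemma chain_del: "keys (f :: _ \<Rightarrow>\<^sub>0 'k) \<subseteq> tensors L (Suc p) q \<Longrightarrow> keys (lin_extend (tensor_bdry L) f) \<subseteq> tensors L p q"
  by (rule keys_lin_extend_subset) (rule keys_tensor_bdry, auto)

lemma chain_tens: "keys f \<subseteq> tensors L p q \<Longrightarrow> t \<in> keys f \<Longrightarrow>
    tens t \<and> length t = Suc q \<and> tdeg t = p" using tensors_iff by blast

text \<open>Every identity modulo relations is tested with \<open>nf\<close> and becomes an identity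
  of functionals. The operators preserve relations because \<open>hb nf\<close>,
  \<open>nrm (ones nf)\<close> and \<open>bd L nf\<close> are again multilinear and reduced.\<close>

lemma cyclic_linear_mixed_complex: "linear_mixed_complex Cyc"
proof
  show "subquotient (mx_scale Cyc) (mx_obj Cyc p q)" for p q proof -
    have "fs.subspace (mxZ Cyc p q)" by (rule fs.subspaceI) (simp_all add: Cyc_simps keys_add_subset order_trans[OF keys_fscale])
    moreover have "fs.subspace (mxN Cyc p q)" by (simp add: cyclic_complex_def)
    moreover have "mxN Cyc p q \<subseteq> mxZ Cyc p q" using Cyc_simps(5,6) relations_iff by blast
    ultimately show ?thesis unfolding subquotient_def Cyc_simps(1) by blast
  qed
next
  fix x y :: "'l tensor \<Rightarrow>\<^sub>0 'k" and p q c
  show "mx_D Cyc (x + y) = mx_D Cyc x + mx_D Cyc y" "mx_D Cyc (mx_scale Cyc c x) = mx_scale Cyc c (mx_D Cyc x)"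
    "mx_B Cyc (x + y) = mx_B Cyc x + mx_B Cyc y" "mx_B Cyc (mx_scale Cyc c x) = mx_scale Cyc c (mx_B Cyc x)"
    "mx_del Cyc (x + y) = mx_del Cyc x + mx_del Cyc y" "mx_del Cyc (mx_scale Cyc c x) = mx_scale Cyc c (mx_del Cyc x)"
    by (simp_all add: Cyc_simps lin_extend_add lin_extend_scale)
  {
    assume x: "x \<in> mxZ Cyc p (Suc q)"
    then show "mx_D Cyc x \<in> mxZ Cyc p q" unfolding Cyc_simps by (rule chain_D)
  }
  {
    assume x: "x \<in> mxZ Cyc p q"
    then show "mx_B Cyc x \<in> mxZ Cyc p (Suc q)" unfolding Cyc_simps by (rule chain_B)
  }
  {
    assume x: "x \<in> mxZ Cyc (Suc p) q"
    then show "mx_del Cyc x \<in> mxZ Cyc p q" unfolding Cyc_simps by (rule chain_del)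
  }
  {
    assume x: "x \<in> mxN Cyc p (Suc q)"
    then have k: "keys x \<subseteq> tensors L p (Suc q)" unfolding Cyc_simps relations_iff by simp
    from x show "mx_D Cyc x \<in> mxN Cyc p q"
      using rel_keys_eval[OF multilin_hb[OF nf_multilin] reduced_hb[OF nf_multilin nf_reduced]] chain_D[OF k] ev_D[OF k]
      unfolding Cyc_simps relations_iff by metis
  }
  {
    assume x: "x \<in> mxN Cyc p q"
    then have k: "keys x \<subseteq> tensors L p q" unfolding Cyc_simps relations_iff by simp
    from x show "mx_B Cyc x \<in> mxN Cyc p (Suc q)"
      using rel_keys_eval[OF multilin_nrm[OF multilin_ones[OF nf_multilin]] reduced_connes[OF nf_reduced]] chain_B[OF k] ev_B[OF k]
      unfolding Cyc_simps relations_iff by metis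
  }
  {
    assume x: "x \<in> mxN Cyc (Suc p) q"
    then have k: "keys x \<subseteq> tensors L (Suc p) q" unfolding Cyc_simps relations_iff by simp
    have "lin_extend (bd L nf) x = 0" using rel_keys_eval[OF multilin_bd[OF nf_multilin] reduced_bd[OF nf_reduced]] x unfolding Cyc_simps by blast
    then show "mx_del Cyc x \<in> mxN Cyc p q" using chain_del[OF k] unfolding Cyc_simps relations_iff by (simp add: ev_del[OF k])
  }
  {
    assume x: "x \<in> mxZ Cyc p (Suc (Suc q))"
    then have k: "keys x \<subseteq> tensors L p (Suc (Suc q))" unfolding Cyc_simps .
    have "lin_extend (hb (hb nf)) x = 0" by (rule lin_extend_eq_0, rule hb_hb[OF nf_multilin]) (use chain_tens[OF k] in \<open>fastforce+\<close>)
    then show "mx_D Cyc (mx_D Cyc x) \<in> mxN Cyc p q"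
      unfolding Cyc_simps relations_iff using k chain_D[OF chain_D[OF k]] by (simp add: ev_D[OF chain_D[OF k], of nf] ev_D[OF k, of "hb nf"])
  }
  {
    assume x: "x \<in> mxZ Cyc (Suc (Suc p)) q"
    then have k: "keys x \<subseteq> tensors L (Suc (Suc p)) q" unfolding Cyc_simps .
    have "lin_extend (bd L (bd L nf)) x = 0" by (rule lin_extend_eq_0, rule bd_bd[OF nf_multilin]) (use chain_tens[OF k] in \<open>fastforce+\<close>)
    then show "mx_del Cyc (mx_del Cyc x) \<in> mxN Cyc p q"
      unfolding Cyc_simps relations_iff using chain_del[OF chain_del[OF k]] by (simp add: ev_del[OF chain_del[OF k], of nf] ev_del[OF k, of "bd L nf"])
  }
  {
    assume x: "x \<in> mxZ Cyc p q"
    then have k: "keys x \<subseteq> tensors L p q" unfolding Cyc_simps .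
    have "lin_extend (nrm (ones (nrm (ones nf)))) x = 0"
      by (rule lin_extend_eq_0, rule connes_connes[OF nf_reduced]) (use chain_tens[OF k] in \<open>fastforce+\<close>)
    then show "mx_B Cyc (mx_B Cyc x) \<in> mxN Cyc p (Suc (Suc q))"
      unfolding Cyc_simps relations_iff using chain_B[OF chain_B[OF k]] by (simp add: ev_B[OF chain_B[OF k], of nf] ev_B[OF k, of "nrm (ones nf)"])
  }
  {
    assume x: "x \<in> mxZ Cyc (Suc p) (Suc q)"
    then have k: "keys x \<subseteq> tensors L (Suc p) (Suc q)" unfolding Cyc_simps .
    have "lin_extend (bd L (hb nf)) x = lin_extend (hb (bd L nf)) x"
      by (rule lin_extend_cong, rule bd_hb[OF nf_multilin]) (use chain_tens[OF k] in \<open>fastforce+\<close>)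
    then show "mx_D Cyc (mx_del Cyc x) + mx_del Cyc (mx_D Cyc x) \<in> mxN Cyc p q"
      unfolding Cyc_simps relations_iff using chain_del[OF chain_D[OF k]] chain_D[OF chain_del[OF k]]
      by (simp add: keys_add_subset lin_extend_add ev_del[OF chain_D[OF k], of nf] ev_D[OF chain_del[OF k], of nf] ev_del[OF k, of "hb nf"] ev_D[OF k, of "bd L nf"] sgn_pow_Suc)
  }
  {
    assume x: "x \<in> mxZ Cyc (Suc p) q"
    then have k: "keys x \<subseteq> tensors L (Suc p) q" unfolding Cyc_simps .
    have "lin_extend (bd L (nrm (ones nf))) x = lin_extend (nrm (ones (bd L nf))) x"
      by (rule lin_extend_cong, rule bd_connes) (use chain_tens[OF k] in \<open>fastforce+\<close>)
    then show "mx_B Cyc (mx_del Cyc x) + mx_del Cyc (mx_B Cyc x) \<in> mxN Cyc p (Suc q)"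
      unfolding Cyc_simps relations_iff using chain_del[OF chain_B[OF k]] chain_B[OF chain_del[OF k]]
      by (simp add: keys_add_subset lin_extend_add ev_del[OF chain_B[OF k], of nf] ev_B[OF chain_del[OF k], of nf] ev_del[OF k, of "nrm (ones nf)"] ev_B[OF k, of "bd L nf"] sgn_pow_Suc)
  }
  {
    assume x: "x \<in> mxZ Cyc p (Suc q)"
    then have k: "keys x \<subseteq> tensors L p (Suc q)" unfolding Cyc_simps .
    have "lin_extend (nrm (ones (hb nf))) x + lin_extend (hb (nrm (ones nf))) x = lin_extend (\<lambda>t. nrm (ones (hb nf)) t + hb (nrm (ones nf)) t) x"
      by (rule lin_extend_fun_add[symmetric])
    also have "\<dots> = 0" proof (rule lin_extend_eq_0)
      fix t assume "t \<in> keys x"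
      then have t: "length t = Suc (Suc q)" using k by (auto simp: tensors_def)
      moreover from t have "t \<noteq> []" by auto
      ultimately show "nrm (ones (hb nf)) t + hb (nrm (ones nf)) t = 0" using nrm_ones_hb[of t nf] hb_nrm[OF t, of "ones nf"] by simp
    qed
    finally show "mx_D Cyc (mx_B Cyc x) + mx_B Cyc (mx_D Cyc x) \<in> mxN Cyc p (Suc q)"
      unfolding Cyc_simps relations_iff using chain_D[OF chain_B[OF k]] chain_B[OF chain_D[OF k]]
      by (simp add: keys_add_subset lin_extend_add ev_D[OF chain_B[OF k], of nf] ev_B[OF chain_D[OF k], of nf] ev_D[OF k, of "nrm (ones nf)"] ev_B[OF k, of "hb nf"])
  }
  {
    assume x: "x \<in> mxZ Cyc p 0"
    then have k: "keys x \<subseteq> tensors L p 0" unfolding Cyc_simps .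
    have "lin_extend (nrm (ones (hb nf))) x = 0" proof (rule lin_extend_eq_0)
      fix t assume "t \<in> keys x"
      then obtain y where t: "t = [y]" using k by (fastforce simp: tensors_def length_Suc_conv)
      show "nrm (ones (hb nf)) t = 0" using nrm_ones_hb[of t nf] by (simp add: t nrm_def)
    qed
    then show "mx_D Cyc (mx_B Cyc x) \<in> mxN Cyc p 0"
      unfolding Cyc_simps relations_iff using chain_D[OF chain_B[OF k]] by (simp add: ev_D[OF chain_B[OF k], of nf] ev_B[OF k, of "hb nf"])
  }
qed (simp_all add: Cyc_simps fs.scale_right_distrib fs.scale_left_distrib)

sublocale cyclic: linear_mixed_complex Cyc by (rule cyclic_linear_mixed_complex)

end

section \<open>Products of monomials\<close>

definition sing :: "'x \<Rightarrow> 'x mono" where "sing x = single x 1"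

lemma keys_sing [simp]: "keys (sing x) = {x}" and lookup_sing [simp]: "lookup (sing x) y = (if x = y then 1 else 0)"
  by (auto simp: sing_def lookup_single when_def)

definition lm :: "'x::linorder mono \<Rightarrow> 'x" where "lm m = Min (keys m)"

lemma keys_add_nat: "keys (e + f) = keys e \<union> keys f" for e f :: "'x mono" by (auto simp: in_keys_iff lookup_add)

lemma lm_in: "m \<noteq> 0 \<Longrightarrow> lm m \<in> keys m" by (simp add: lm_def)

lemma lm_le: "x \<in> keys m \<Longrightarrow> lm m \<le> x" by (simp add: lm_def)

lemma lm_eqI: "x \<in> keys m \<Longrightarrow> (\<And>y. y \<in> keys m \<Longrightarrow> x \<le> y) \<Longrightarrow> lm m = x"
  unfolding lm_def by (rule Min_eqI) auto

lemma lm_sing [simp]: "lm (sing x) = x" by (simp add: lm_def)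

lemma sum_superset_weight: assumes "finite S" "keys e \<subseteq> S" shows "wt e = (\<Sum>x\<in>S. lookup e x)"
    "gamma_internal dg e = (\<Sum>x\<in>S. lookup e x * dg x)" unfolding gamma_weight_def gamma_internal_def
  by (rule sum.mono_neutral_left; use assms in \<open>auto simp: in_keys_iff\<close>)+

lemma wt_add: "wt (e + f) = wt e + wt f"
  and mdeg_add: "gamma_internal dg (e + f) = gamma_internal dg e + gamma_internal dg f"
  using sum_superset_weight[of "keys e \<union> keys f"] by (simp_all add: keys_add_nat lookup_add sum.distrib algebra_simps)

lemma wt_sing [simp]: "wt (sing x) = 1" "gamma_internal dg (sing x) = dg x"
  and wt_0 [simp]: "wt 0 = 0" "gamma_internal dg 0 = 0" by (simp_all add: gamma_weight_def gamma_internal_def)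

lemma wt_eq_0: "wt e = 0 \<longleftrightarrow> e = 0" by (auto simp: gamma_weight_def in_keys_iff simp flip: keys_eq_empty)

lemma sing_diff: "x \<in> keys e \<Longrightarrow> sing x + (e - sing x) = e"
  by (rule poly_mapping_eqI) (auto simp: lookup_add lookup_minus in_keys_iff)

lemma weight_induct [consumes 0, case_names 0 sing]:
  fixes e :: "'x::linorder mono" assumes "P 0" "\<And>e. e \<noteq> 0 \<Longrightarrow> P (e - sing (lm e)) \<Longrightarrow> P e" shows "P e"
proof (induction "wt e" arbitrary: e)
  case (Suc n)
  then have e: "e \<noteq> 0" by auto
  then have "wt (sing (lm e) + (e - sing (lm e))) = Suc n" using Suc(2) by (simp add: sing_diff lm_in)
  then have "wt (e - sing (lm e)) = n" unfolding wt_add by simp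
  then show ?case using Suc(1) assms(2) e by blast
qed (simp add: wt_eq_0 assms(1))

context free_chain_algebra
begin

lemma mons_iff: "e \<in> mons \<longleftrightarrow> keys e \<subseteq> X \<and> (\<forall>x. odd (dg x) \<longrightarrow> lookup e x \<le> 1)"
  by (simp add: monomials_def)

lemma mons_add_left: "e + f \<in> mons \<Longrightarrow> e \<in> mons" and mons_add_right: "e + f \<in> mons \<Longrightarrow> f \<in> mons"
  unfolding mons_iff keys_add_nat lookup_add by (auto dest: add_leD1 add_leD2)

lemma mons_diff: "e \<in> mons \<Longrightarrow> x \<in> keys e \<Longrightarrow> e - sing x \<in> mons"
  using mons_add_right[of "sing x" "e - sing x"] by (simp add: sing_diff)

lemma mons_sing: "x \<in> X \<Longrightarrow> sing x \<in> mons" by (auto simp: mons_iff )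

lemma mn_sing: "mn (sing x) = gen x" by (simp add: monomial_def sing_def)

lemma mn_peel: assumes "\<And>y. y \<in> keys e \<Longrightarrow> x \<le> y" shows "mn (sing x + e) = gen x * mn e"
proof -
  let ?K = "keys e - {x}"
  let ?p = "\<lambda>e. prod_list (map (\<lambda>y. gen y ^ lookup e y) (sorted_list_of_set ?K))"
  have 1: "sorted_list_of_set (insert x ?K) = x # sorted_list_of_set ?K"
    using assms by (subst sorted_list_of_set_insert_remove) (auto intro!: insort_is_Cons)
  have 2: "map (\<lambda>y. gen y ^ lookup (sing x + e) y) (sorted_list_of_set ?K)
      = map (\<lambda>y. gen y ^ lookup e y) (sorted_list_of_set ?K)" by (auto simp: lookup_add)
  have 3: "keys (sing x + e) = insert x ?K" by (auto simp: keys_add_nat)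
  have s: "mn (sing x + e) = gen x ^ Suc (lookup e x) * ?p e" by (simp only: monomial_def 3 1 list.map 2 prod_list.Cons) (simp add: lookup_add)
  have "mn e = gen x ^ lookup e x * ?p e" proof (cases "x \<in> keys e")
    case True
    then have 4: "keys e = insert x ?K" by auto
    have "mn e = prod_list (map (\<lambda>y. gen y ^ lookup e y) (sorted_list_of_set (insert x ?K)))"
      unfolding monomial_def by (simp only: 4[symmetric])
    then show ?thesis by (simp only: 1 list.map prod_list.Cons)
  next
    case False
    then show ?thesis unfolding monomial_def by (simp add: in_keys_iff)
  qed
  then show ?thesis using s by (simp add: mult.assoc)
qed

lemma mn_lm: "e \<noteq> 0 \<Longrightarrow> mn e = gen (lm e) * mn (e - sing (lm e))"
proof -
  assume e: "e \<noteq> 0"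
  have "lm e \<le> y" if "y \<in> keys (e - sing (lm e))" for y using that lm_le[of y e] by (auto simp: in_keys_iff lookup_minus split: if_splits)
  from mn_peel[of "e - sing (lm e)" "lm e", OF this] show ?thesis by (simp add: sing_diff lm_in[OF e])
qed

text \<open>The new letter moves to its place in the sorted product: it passes smaller letters with
  a sign, and if it meets an equal letter of odd degree the product is zero. So only one monomial
  can occur.\<close>

lemma gen_mn_mult: assumes "x \<in> X" "f \<in> mons"
  shows "\<exists>c. gen x * mn f = smul L c (mn (sing x + f)) \<and> (sing x + f \<notin> mons \<longrightarrow> c = 0)" using assms(2)
proof (induction f rule: weight_induct)
  case 0
  then show ?case using mons_sing[OF assms(1)] by (intro exI[of _ 1]) (simp add: mn_0 mn_sing)
next
  case (sing f)
  let ?u = "lm f" and ?f = "f - sing (lm f)"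
  have u: "?u \<in> X" using sing lm_in by (auto simp: mons_iff)
  consider "x < ?u \<or> x = ?u \<and> even (dg x)" | "x = ?u" "odd (dg x)" | "?u < x" by force
  then show ?case proof cases
    case 1
    have "x < ?u \<Longrightarrow> lookup f x = 0" using lm_le[of x f] by (fastforce simp: in_keys_iff)
    then have "sing x + f \<in> mons" using 1 sing.prems assms(1) lm_le[of x f] by (auto simp: mons_iff keys_add_nat lookup_add in_keys_iff)
    moreover have "mn (sing x + f) = gen x * mn f" by (rule mn_peel) (use 1 lm_le in force)
    ultimately show ?thesis by (intro exI[of _ 1]) simp
  next
    case 2
    have "gen x * mn f = gen x * gen x * mn ?f" using mn_lm[OF sing(1)] 2 by (simp add: mult.assoc)
    also have "\<dots> = 0" using odd_square[OF 2(2) gen_grade[OF assms(1)]] by simp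
    finally show ?thesis by (intro exI[of _ 0]) simp
  next
    case 3
    obtain c where c: "gen x * mn ?f = smul L c (mn (sing x + ?f))" "sing x + ?f \<notin> mons \<Longrightarrow> c = 0"
      using sing mons_diff lm_in by blast
    have "gen x * mn f = gen x * gen ?u * mn ?f" using mn_lm[OF sing(1)] by (simp add: mult.assoc)
    also have "\<dots> = sgn_pow (dg ?u * dg x) (gen ?u * (gen x * mn ?f))"
      using graded_commute[OF gen_grade[OF u] gen_grade[OF assms(1)]] by (auto simp: sgn_pow_def mult.assoc)
    also have "gen ?u * (gen x * mn ?f) = smul L c (gen ?u * mn (sing x + ?f))" unfolding c by (simp add: smul_mult_right)
    also have "gen ?u * mn (sing x + ?f) = mn (sing ?u + (sing x + ?f))" proof (rule mn_peel[symmetric])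
      fix y assume "y \<in> keys (sing x + ?f)"
      then have "y = x \<or> y \<in> keys f" by (auto simp: keys_add_nat in_keys_iff lookup_minus)
      then show "?u \<le> y" using 3 lm_le[of y f] by auto
    qed
    also have "sing ?u + (sing x + ?f) = sing x + f" using sing_diff[OF lm_in[OF sing(1)]] by (metis add.left_commute)
    finally have *: "gen x * mn f = sgn_pow (dg ?u * dg x) (smul L c (mn (sing x + f)))" .
    have "sing x + f \<notin> mons \<longrightarrow> c = 0" proof
      assume "sing x + f \<notin> mons"
      moreover have "lookup ?f x = lookup f x" using 3 by (auto simp: lookup_minus)
      moreover have "sing x + f \<in> mons" if m: "sing x + ?f \<in> mons" unfolding mons_iff proof (intro conjI allI impI)
        show "keys (sing x + f) \<subseteq> X" using assms(1) sing.prems by (auto simp: mons_iff keys_add_nat)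
        fix y assume y: "odd (dg y)"
        have "lookup (sing x + ?f) y \<le> 1" "lookup f y \<le> 1" using m sing.prems y unfolding mons_iff by blast+
        then show "lookup (sing x + f) y \<le> 1" using \<open>lookup ?f x = lookup f x\<close> by (auto simp: lookup_add split: if_splits)
      qed
      ultimately have "sing x + ?f \<notin> mons" by blast
      then show "c = 0" by (rule c(2))
    qed
    then show ?thesis using * by (intro exI[of _ "sgn_pow (dg ?u * dg x) c"]) (auto simp: sgn_pow_def)
  qed
qed

lemma mn_mult: assumes "e \<in> mons" "f \<in> mons"
  shows "\<exists>c. mn e * mn f = smul L c (mn (e + f)) \<and> (e + f \<notin> mons \<longrightarrow> c = 0)" using assms(1)
proof (induction e rule: weight_induct)
  case 0
  then show ?case using assms(2) by (intro exI[of _ 1]) (simp add: mn_0)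
next
  case (sing e)
  let ?u = "lm e" and ?e = "e - sing (lm e)"
  have u: "?u \<in> X" using sing lm_in by (auto simp: mons_iff)
  obtain c where c: "mn ?e * mn f = smul L c (mn (?e + f))" "?e + f \<notin> mons \<Longrightarrow> c = 0" using sing mons_diff lm_in by blast
  have e: "sing ?u + (?e + f) = e + f" using sing_diff[OF lm_in[OF sing(1)]] by (metis add.assoc)
  have *: "mn e * mn f = smul L c (gen ?u * mn (?e + f))" using mn_lm[OF sing(1)] c by (simp add: mult.assoc smul_mult_right)
  show ?case proof (cases "?e + f \<in> mons")
    case True
    obtain c' where c': "gen ?u * mn (?e + f) = smul L c' (mn (e + f))" "e + f \<notin> mons \<longrightarrow> c' = 0"
      using gen_mn_mult[OF u True] e by metis
    then show ?thesis using * by (intro exI[of _ "c * c'"]) simp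
  next
    case False
    then show ?thesis using * c by (intro exI[of _ 0]) simp
  qed
qed

text \<open>The structure constant of a product of monomials, normalised to 0 when the sum of the
  exponents violates the exterior condition.\<close>

definition mc :: "'x mono \<Rightarrow> 'x mono \<Rightarrow> 'k" where
  "mc e f = (SOME c. mn e * mn f = smul L c (mn (e + f)) \<and> (e + f \<notin> mons \<longrightarrow> c = 0))"

lemma mc: "e \<in> mons \<Longrightarrow> f \<in> mons \<Longrightarrow> mn e * mn f = smul L (mc e f) (mn (e + f))"
  "e \<in> mons \<Longrightarrow> f \<in> mons \<Longrightarrow> e + f \<notin> mons \<Longrightarrow> mc e f = 0"
  unfolding mc_def using someI_ex[OF mn_mult] by blast+

abbreviation wl :: "'x mono \<Rightarrow> nat \<times> 'l" where "wl e \<equiv> (mdeg e, mn e)"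

lemma wd_simps [simp]: "wd [] = []" "wd (e # w) = wl e # wd w" "wd (v @ w) = wd v @ wd w" "length (wd w) = length w"
  "wd w ! i = (if i < length w then wl (w ! i) else wd w ! i)" "take i (wd w) = wd (take i w)" "drop i (wd w) = wd (drop i w)"
  by (auto simp: wd_def take_map drop_map)

declare wd_simps(5) [simp del]

lemma mono_add_eq_0: "e + f = 0 \<longleftrightarrow> e = 0 \<and> f = 0" for e f :: "'x mono" by (metis add_is_0 wt_add wt_eq_0)

lemma nf_merge: assumes "set (xs @ e # f # ys) \<subseteq> mons" "0 \<notin> set (tl (xs @ (e + f) # ys))"
  shows "nf (wd xs @ tmul (wl e) (wl f) # wd ys) = single (xs @ (e + f) # ys) (mc e f)"
proof -
  have t: "tens (wd xs)" "tens (wd ys)" and ef: "e \<in> mons" "f \<in> mons" using assms(1) tens_wd by auto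
  have m: "tmul (wl e) (wl f) = (mdeg (e + f), smul L (mc e f) (mn (e + f)))" using mc(1)[OF ef] by (simp add: tmul_def mdeg_add)
  show ?thesis proof (cases "e + f \<in> mons")
    case True
    have "nf (wd (xs @ (e + f) # ys)) = single (xs @ (e + f) # ys) 1" using assms True by (intro nf_wd) auto
    then show ?thesis unfolding m using multilin_scale[OF nf_multilin t mn_grade[OF True], of "mc e f"] by simp
  next
    case False
    then show ?thesis unfolding m using mc(2)[OF ef False] multilin_zero[OF nf_multilin t] by simp
  qed
qed

definition mrg :: "nat \<Rightarrow> 'x mono list \<Rightarrow> 'x mono list" where
  "mrg i d = take i d @ (d ! i + d ! Suc i) # drop (i + 2) d"

definition cmrg :: "'x mono list \<Rightarrow> 'x mono list" where
  "cmrg d = (last d + hd d) # tl (butlast d)"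

lemma hb_nf_wd: assumes "set d \<subseteq> mons" "0 \<notin> set (tl d)" "length d = Suc q" "q > 0"
  shows "hb nf (wd d) = (\<Sum>i<q. single (mrg i d) (sgn_pow i (mc (d ! i) (d ! Suc i))))
    + single (cmrg d) (sgn_pow (q + mdeg (last d) * tdeg (wd (butlast d))) (mc (last d) (hd d)))"
proof -
  have sgn: "sgn_pow n (single w c) = single w (sgn_pow n c)" for n and w :: "'x mono list" and c :: 'k by (auto simp: sgn_pow_def single_uminus)
  have "nf (take i (wd d) @ tmul (wd d ! i) (wd d ! Suc i) # drop (i + 2) (wd d)) = single (mrg i d) (mc (d ! i) (d ! Suc i))" if i: "i < q" for i
  proof -
    have d: "take i d @ d ! i # d ! Suc i # drop (i + 2) d = d" using i assms(3) by (simp add: Cons_nth_drop_Suc)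
    have "nf (wd (take i d) @ tmul (wl (d ! i)) (wl (d ! Suc i)) # wd (drop (i + 2) d))
        = single (mrg i d) (mc (d ! i) (d ! Suc i))" unfolding mrg_def proof (rule nf_merge)
      show "set (take i d @ d ! i # d ! Suc i # drop (i + 2) d) \<subseteq> mons" unfolding d by (rule assms)
      have "0 \<notin> set (tl (take i d @ d ! i # d ! Suc i # drop (i + 2) d))" unfolding d by (rule assms)
      then show "0 \<notin> set (tl (take i d @ (d ! i + d ! Suc i) # drop (i + 2) d))" by (cases "take i d") (auto simp: mono_add_eq_0)
    qed
    then show ?thesis using i assms(3) by (simp add: wd_simps(5))
  qed
  then have 1: "bet nf (wd d) = (\<Sum>i<q. single (mrg i d) (sgn_pow i (mc (d ! i) (d ! Suc i))))"
    unfolding bet_nth using assms(3) by (intro sum.cong) (auto simp: sgn simp flip: sgn)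
  obtain x s z where d: "d = x # s @ [z]" using assms(3,4) by (cases d; cases "tl d" rule: rev_cases) auto
  have "nf (wd [] @ tmul (wl z) (wl x) # wd s) = single ([] @ (z + x) # s) (mc z x)" by (rule nf_merge) (use assms d in auto)
  then have "cyc nf (wd d) = single (cmrg d) (sgn_pow (q + mdeg (last d) * tdeg (wd (butlast d))) (mc (last d) (hd d)))"
    using assms(3) by (simp add: d cyc_snoc cmrg_def butlast_append sgn)
  then show ?thesis by (simp add: hb_def 1)
qed

text \<open>The Hochschild boundary transported to the free module on words; \<open>hb_nf\<close> is
  the compatibility with \<open>nf\<close>.\<close>

definition bw :: "('x mono list \<Rightarrow>\<^sub>0 'k) \<Rightarrow> ('x mono list \<Rightarrow>\<^sub>0 'k)" where
  "bw = lin_extend (\<lambda>w. hb nf (wd w))"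

end

section \<open>Reduction of chains to critical words\<close>

text \<open>The order inside a decreasing run of letters. Letters of odd degree may be repeated,
  since \<open>dx\<close> is then even and has divided powers.\<close>

definition follows :: "('x::linorder \<Rightarrow> nat) \<Rightarrow> 'x \<Rightarrow> 'x \<Rightarrow> bool" where
  "follows dg x y \<longleftrightarrow> y < x \<or> y = x \<and> odd (dg x)"

lemma transp_follows: "transp (follows dg)" by (auto simp: transp_def follows_def)

text \<open>Turns the order of the finitely many letters in play into a numerical one, so that
  comparison is well founded for an arbitrary linear order of letters.\<close>

definition rank :: "'x::linorder set \<Rightarrow> 'x \<Rightarrow> nat" where
  "rank S x = card {y \<in> S. y < x}"

lemma rank_less: "finite S \<Longrightarrow> x \<in> S \<Longrightarrow> x < y \<Longrightarrow> rank S x < rank S y"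
  unfolding rank_def by (rule psubset_card_mono) auto

definition letters :: "'x mono list \<Rightarrow> 'x set" where
  "letters w = (\<Union>e\<in>set w. keys e)"

definition wkey :: "'x::linorder set \<Rightarrow> 'x mono \<Rightarrow> nat \<times> nat" where
  "wkey S m = (rank S (lm m), wt m)"

definition weight :: "'x mono list \<Rightarrow> nat" where
  "weight ws = sum_list (map wt ws)"

lemma weight_simps [simp]: "weight [] = 0" "weight (e # w) = wt e + weight w"
  "weight (v @ w) = weight v + weight w" by (auto simp: weight_def)

text \<open>The first factor of a word is not compared. Faces that multiply into it lower the weight
  of the tail; inner faces preserve that weight, and then the first changed factor decides, by its
  smallest letter and next by its weight.\<close>

definition word_rel :: "'x::linorder set \<Rightarrow> ('x mono list \<times> 'x mono list) set" where
  "word_rel S = inv_image (less_than <*lex*> lex (less_than <*lex*> less_than)) (\<lambda>w. (weight (tl w), map (wkey S) (tl w)))"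

lemma wf_word_rel: "wf (word_rel S)" unfolding word_rel_def by (intro wf_inv_image wf_lex_prod wf_lex wf_less_than)

text \<open>
  Words are matched in pairs: in a splittable word the first letter \<open>m\<close> of degree at least two can be
  replaced by its smallest factor followed by the rest.  The words that are not matched are those of
  single letters in decreasing order; they are a basis of the differential forms.
\<close>

definition splittable :: "('x::linorder \<Rightarrow> nat) \<Rightarrow> 'x mono list \<Rightarrow> bool" where
  "splittable dg ws \<longleftrightarrow> (\<exists>xs m rest. ws = map sing xs @ m # rest \<and> m \<noteq> sing (lm m) \<and> sorted_wrt (follows dg) (xs @ [lm m]))"

definition critical :: "('x::linorder \<Rightarrow> nat) \<Rightarrow> 'x mono list \<Rightarrow> bool" where
  "critical dg ws \<longleftrightarrow> (\<exists>xs. ws = map sing xs \<and> sorted_wrt (follows dg) xs)"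

definition split_off :: "('x::linorder \<Rightarrow> nat) \<Rightarrow> 'x mono list \<Rightarrow> 'x mono list \<Rightarrow> bool" where
  "split_off dg ws ds \<longleftrightarrow> (\<exists>xs m rest. ws = map sing xs @ m # rest \<and> m \<noteq> sing (lm m) \<and>
     sorted_wrt (follows dg) (xs @ [lm m]) \<and> ds = map sing xs @ sing (lm m) # (m - sing (lm m)) # rest)"

lemma splittable_iff: "splittable dg ws \<longleftrightarrow> (\<exists>ds. split_off dg ws ds)" unfolding splittable_def split_off_def by blast

lemma follows_snoc:
  "sorted_wrt (follows dg) xs \<Longrightarrow> xs \<noteq> [] \<Longrightarrow> follows dg (last xs) y \<Longrightarrow> sorted_wrt (follows dg) (xs @ [y])"
  using transp_follows[of dg] by (cases xs rule: rev_cases) (auto simp: sorted_wrt_append dest: transpD)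

lemma sing_neq_0: "sing x \<noteq> 0" by (metis wt_sing(1) wt_0(1) zero_neq_one)

lemma sing_add_lm: "e \<noteq> 0 \<Longrightarrow> \<not> lm e < u \<Longrightarrow> lm (sing u + e) = u"
  by (rule lm_eqI) (use lm_le[of _ e] in \<open>force simp: keys_add_nat not_less\<close>)+

text \<open>The word is read from the left, with \<open>pre\<close> the decreasing run so far. A
  factor whose smallest letter does not continue the run merges with the last letter of the run, so
  the word is a split one; a continuing factor is either a single letter that prolongs the run or a
  longer one that can be split.\<close>

lemma word_cases: assumes "0 \<notin> set ws" "\<forall>e\<in>set ws. \<forall>x. odd (dg x) \<longrightarrow> lookup e x \<le> 1"
  shows "splittable dg ws \<or> critical dg ws \<or> (\<exists>vs. split_off dg vs ws \<and> letters vs \<subseteq> letters ws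
    \<and> (\<forall>e\<in>set vs. \<forall>x. odd (dg x) \<longrightarrow> lookup e x \<le> 1))"
proof -
  have "sorted_wrt (follows dg) pre \<Longrightarrow> 0 \<notin> set ws \<Longrightarrow> \<forall>e\<in>set ws. \<forall>x. odd (dg x) \<longrightarrow> lookup e x \<le> 1 \<Longrightarrow>
      splittable dg (map sing pre @ ws) \<or> critical dg (map sing pre @ ws)
     \<or> (\<exists>vs. split_off dg vs (map sing pre @ ws) \<and> letters vs \<subseteq> letters (map sing pre @ ws)
       \<and> (\<forall>e\<in>set vs. \<forall>x. odd (dg x) \<longrightarrow> lookup e x \<le> 1))" for pre proof (induction ws arbitrary: pre)
    case Nil
    then show ?case by (auto simp: critical_def)
  next
    case (Cons m ws)
    show ?case proof (cases "pre \<noteq> [] \<and> \<not> follows dg (last pre) (lm m)")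
      case True
      then obtain xs u where pre: "pre = xs @ [u]" by (cases pre rule: rev_cases) auto
      have u: "\<not> lm m < u" "m \<noteq> 0" using True Cons.prems by (auto simp: pre follows_def)
      have l: "lm (sing u + m) = u" using sing_add_lm u by blast
      have "wt (sing u + m) \<noteq> wt (sing u)" using u by (simp add: wt_add wt_eq_0)
      then have ns: "sing u + m \<noteq> sing u" by metis
      have "split_off dg (map sing xs @ (sing u + m) # ws) (map sing pre @ m # ws)" unfolding split_off_def using Cons.prems(1) l ns
        by (intro exI[of _ xs] exI[of _ "sing u + m"] exI[of _ ws]) (simp add: pre)
      moreover have "letters (map sing xs @ (sing u + m) # ws) \<subseteq> letters (map sing pre @ m # ws)"
        by (auto simp: letters_def pre keys_add_nat)
      \<comment> \<open>For \<open>u\<close> of odd degree the failure of \<open>follows\<close>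
        excludes equality with \<open>lm m\<close>, so \<open>u\<close> does not occur in
        \<open>m\<close> and the exterior condition survives the merging.\<close>
      moreover have "lookup (sing u + m) x \<le> 1" if "odd (dg x)" for x proof -
        have "lookup m x = 0" if "x = u" using True lm_le[of x m] that \<open>odd (dg x)\<close> by (fastforce simp: pre follows_def in_keys_iff)
        then show ?thesis using Cons.prems(3) that by (auto simp: lookup_add)
      qed
      then have "\<forall>e\<in>set (map sing xs @ (sing u + m) # ws). \<forall>x. odd (dg x) \<longrightarrow> lookup e x \<le> 1"
        using Cons.prems(3) by auto
      ultimately show ?thesis by blast
    next
      case False
      then have c: "sorted_wrt (follows dg) (pre @ [lm m])" using Cons.prems(1) follows_snoc by (cases "pre = []") auto
      show ?thesis proof (cases "m = sing (lm m)")
        case True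
        have eq: "map sing (pre @ [lm m]) @ ws = map sing pre @ m # ws" using arg_cong[OF True, of "\<lambda>e. map sing pre @ e # ws"] by simp
        show ?thesis using Cons.IH[OF c] Cons.prems unfolding eq by simp
      next
        case False
        then show ?thesis unfolding splittable_def using c by blast
      qed
    qed
  qed
  from this[of "[]"] show ?thesis using assms by simp
qed

text \<open>The factor to be split is the first one that is not a single letter, so the run before
  it, the factor and the rest are determined.\<close>

lemma split_off_unique: assumes "split_off dg ws ds" "split_off dg ws ds'" shows "ds = ds'"
proof -
  have "map sing xs @ m # rest = map sing xs' @ m' # rest' \<Longrightarrow> m \<noteq> sing (lm m) \<Longrightarrow> m' \<noteq> sing (lm m') \<Longrightarrow>
    xs = xs' \<and> m = m' \<and> rest = rest'" for xs m rest xs' m' and rest' :: "'a mono list" proof (induction xs arbitrary: xs')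
    case Nil then show ?case by (cases xs') auto
  next
    case (Cons x xs)
    show ?case proof (cases xs')
      case Nil then show ?thesis using Cons.prems by auto
    next
      case (Cons x' ys)
      then have "sing x = sing x'" "map sing xs @ m # rest = map sing ys @ m' # rest'" using Cons.prems by auto
      moreover have "x = x'" using \<open>sing x = sing x'\<close> by (metis lm_sing)
      ultimately show ?thesis using Cons.IH[of ys] Cons.prems Cons by auto
    qed
  qed
  then show ?thesis using assms unfolding split_off_def by blast
qed

context free_chain_algebra
begin

text \<open>Monomials are products in increasing order, so the smallest letter stands in front
  without a sign. Splitting off this letter thus makes the leading coefficient of the boundary a
  unit.\<close>

lemma mc_lm: assumes "m \<in> mons" "m \<noteq> 0" shows "mc (sing (lm m)) (m - sing (lm m)) = 1"
proof -
  let ?u = "lm m"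
  have k: "?u \<in> keys m" using assms lm_in by blast
  then have "?u \<in> X" using assms by (auto simp: mons_iff)
  then have "mn (sing ?u) * mn (m - sing ?u) = smul L (mc (sing ?u) (m - sing ?u)) (mn m)"
    using mc(1)[OF mons_sing mons_diff[OF assms(1) k]] sing_diff[OF k] by simp
  then have "co (smul L (mc (sing ?u) (m - sing ?u)) (mn m)) = co (mn m)" using mn_lm[OF assms(2)] by (simp add: mn_sing)
  then have "lookup (single m (mc (sing ?u) (m - sing ?u))) m = lookup (single m (1::'k)) m"
    by (simp only: co_scale co_mn[OF assms(1)] fscale_single mult_1_right)
  then show ?thesis by simp
qed

lemma merge_words: assumes "A @ a # b # B \<in> words p (Suc q)" "a + b \<in> mons" shows "A @ (a + b) # B \<in> words p q"
  using assms by (cases A) (auto simp: words_def mdeg_add mono_add_eq_0)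

lemma cmerge_words: assumes "x # s @ [z] \<in> words p (Suc q)" "z + x \<in> mons" shows "(z + x) # s \<in> words p q"
  using assms by (auto simp: words_def mdeg_add)

text \<open>The face that undoes the splitting returns the word up to sign. The other faces give
  smaller words: multiplying into the first factor lowers the weight of the tail, a product inside
  the run brings a smaller letter forward, and a product behind the split letter leaves that letter
  alone in the place of \<open>m\<close>.\<close>

theorem split_boundary: assumes w: "m0 # ws \<in> words p q" and S: "finite S" "letters (m0 # ws) \<subseteq> S" and ds: "split_off dg ws ds"
  shows "m0 # ds \<in> words p (Suc q)" "letters (m0 # ds) \<subseteq> S"
    "\<exists>k. keys (hb nf (wd (m0 # ds)) - sgn_pow k (single (m0 # ws) 1))
      \<subseteq> {v \<in> words p q. letters v \<subseteq> S \<and> (v, m0 # ws) \<in> word_rel S}"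
proof -
  obtain xs m rest where ws: "ws = map sing xs @ m # rest" and m: "m \<noteq> sing (lm m)"
    and c: "sorted_wrt (follows dg) (xs @ [lm m])" and ds': "ds = map sing xs @ sing (lm m) # (m - sing (lm m)) # rest"
    using ds unfolding split_off_def by blast
  define u where "u = lm m"
  define m' where "m' = m - sing u"
  have ds: "ds = map sing xs @ sing u # m' # rest" using ds' by (simp add: u_def m'_def)
  have m0: "m \<noteq> 0" "m \<in> mons" using w by (auto simp: words_def ws)
  have u: "u \<in> keys m" using lm_in m0 by (simp add: u_def)
  have mm: "sing u + m' = m" using sing_diff[OF u] by (simp add: m'_def)
  have m': "m' \<noteq> 0" "m' \<in> mons" "sing u \<in> mons"
    using m mm m0 mons_add_left[of "sing u" m'] mons_add_right[of "sing u" m'] by (auto simp: u_def)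
  have wt: "weight ds = weight ws" using mm by (simp add: ds ws flip: mm) (simp add: wt_add)
  show dw: "m0 # ds \<in> words p (Suc q)" using w m' by (auto simp: sing_neq_0 words_def ds ws mdeg_add simp flip: mm)
  show dl: "letters (m0 # ds) \<subseteq> S" using S(2) by (auto simp: letters_def ds ws keys_add_nat simp flip: mm)
  let ?T = "{v \<in> words p q. letters v \<subseteq> S \<and> (v, m0 # ws) \<in> word_rel S}"
  define d where "d = m0 # ds"
  have d: "set d \<subseteq> mons" "0 \<notin> set (tl d)" "length d = Suc (Suc q)" using dw by (auto simp: words_def d_def)
  have wpos: "0 < wt e" if "e \<in> set ds" for e using that d(2) wt_eq_0[of e] by (cases "wt e") (auto simp: d_def)
  \<comment> \<open>Position of the face that multiplies the split letter back, shifted by one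
    because of the first factor \<open>m0\<close>.\<close>
  let ?j = "Suc (length xs)"
  have j: "?j < Suc q" using w by (simp add: words_def ws)
  define t where "t i = single (mrg i d) (sgn_pow i (mc (d ! i) (d ! Suc i)))" for i
  have tj: "t ?j = sgn_pow ?j (single (m0 # ws) 1)" proof -
    have "d ! ?j = sing u" "d ! Suc ?j = m'" "mrg ?j d = m0 # ws" by (auto simp: d_def ds ws mrg_def nth_append mm)
    then show ?thesis using mc_lm[OF m0(2,1)] by (auto simp: t_def u_def m'_def sgn_pow_def single_uminus)
  qed
  have ti: "keys (t i) \<subseteq> ?T" if i: "i < Suc q" "i \<noteq> ?j" for i proof (cases "d ! i + d ! Suc i \<in> mons")
    case False
    have "d ! i \<in> mons" "d ! Suc i \<in> mons" using d i by (auto simp: subset_eq)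
    then show ?thesis using mc(2) False by (simp add: t_def)
  next
    case True
    define A a b B where "A = take i d" and "a = d ! i" and "b = d ! Suc i" and "B = drop (i + 2) d"
    have dA: "d = A @ a # b # B" "length A = i" using d(3) i by (simp_all add: A_def a_def b_def B_def Cons_nth_drop_Suc)
    have ab: "a + b \<in> mons" using True by (simp add: a_def b_def)
    have v: "mrg i d = A @ (a + b) # B" by (simp add: mrg_def A_def a_def b_def B_def)
    have 1: "A @ (a + b) # B \<in> words p q" using merge_words[of A a b B p q] dw ab dA d_def by simp
    have 2: "letters (A @ (a + b) # B) \<subseteq> S" using dl by (auto simp: letters_def keys_add_nat dA simp flip: d_def)
    have "(A @ (a + b) # B, m0 # ws) \<in> word_rel S" proof (cases A)
      case Nil
      then have "ds = b # B" using dA d_def by simp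
      then show ?thesis using wt wpos[of b] Nil by (simp add: word_rel_def)
    next
      case (Cons _ A')
      then have dsA: "ds = A' @ a # b # B" and A: "A = m0 # A'" and lA: "i = Suc (length A')" using dA d_def by auto
      have wv: "weight (A' @ (a + b) # B) = weight ws" using wt by (simp add: dsA wt_add)
      have "(map (wkey S) (A' @ (a + b) # B), map (wkey S) ws) \<in> lex (less_than <*lex*> less_than)" proof (cases "length A' < length xs")
        case True
        define ys x zs where "ys = take (length A') xs" and "x = xs ! length A'" and "zs = drop (Suc (length A')) xs"
        have xs: "xs = ys @ x # zs" "length ys = length A'" using True by (simp_all add: ys_def x_def zs_def id_take_nth_drop)
        have eq: "A' @ a # b # B = map sing ys @ sing x # map sing zs @ sing u # m' # rest" using dsA by (simp add: ds xs)
        then have 3: "A' = map sing ys" "a = sing x" "b # B = map sing zs @ sing u # m' # rest" using xs(2) by (auto simp: append_eq_append_conv)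
        obtain y where y: "b = sing y" "y \<in> set (zs @ [u])" using 3(3) by (cases zs) auto
        have "follows dg x y" using c y(2) unfolding xs by (auto simp: sorted_wrt_append u_def)
        \<comment> \<open>Equal neighbours in the run have odd degree, and then their product is not
          a monomial; so the second letter is strictly smaller and becomes the smallest letter of
          the product.\<close>
        moreover have "y \<noteq> x \<or> even (dg x)" using ab by (auto simp: mons_iff 3 y lookup_add)
        ultimately have yx: "y < x" by (auto simp: follows_def)
        have "lm (a + b) = y" unfolding 3 y by (rule lm_eqI) (use yx in \<open>auto simp: keys_add_nat\<close>)
        moreover have "y \<in> S" using dl y by (auto simp: letters_def dsA)
        ultimately have "(wkey S (a + b), wkey S (sing x)) \<in> less_than <*lex*> less_than" using rank_less[OF S(1) _ yx] by (simp add: wkey_def)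
        moreover have "length B = length (map sing zs @ m # rest)" using arg_cong[OF 3(3), of length] by simp
        ultimately show ?thesis unfolding ws xs 3(1) by (auto intro!: lex_append_leftI)
      next
        case False
        then have "length A' > length xs" using i lA by simp
        moreover from this have "take (length xs) A' = map sing xs" using arg_cong[OF dsA, of "take (length xs)"] by (simp add: ds)
        ultimately obtain z A'' where A': "A' = map sing xs @ z # A''" using id_take_nth_drop by metis
        then have 3: "z = sing u" "m' # rest = A'' @ a # b # B" using dsA unfolding ds by auto
        \<comment> \<open>The place of \<open>m\<close> is now taken by \<open>u\<close> alone, with
          the same smallest letter but smaller weight.\<close>
        have "wt m = wt (sing u) + wt m'" unfolding mm[symmetric] by (rule wt_add)
        then have "wt (sing u) < wt m" using m'(1) wt_eq_0[of m'] by simp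
        then have "(wkey S (sing u), wkey S m) \<in> less_than <*lex*> less_than" by (simp add: wkey_def u_def)
        moreover have "length (A'' @ (a + b) # B) = length rest" using arg_cong[OF 3(2), of length] by simp
        ultimately show ?thesis unfolding ws A' 3(1) by (auto intro!: lex_append_leftI)
      qed
      then show ?thesis using wv A by (simp add: word_rel_def)
    qed
    then show ?thesis using 1 2 by (auto simp: t_def v)
  qed
  let ?c = "single (cmrg d) (sgn_pow (Suc q + mdeg (last d) * tdeg (wd (butlast d))) (mc (last d) (hd d)))"
  \<comment> \<open>The cyclic face removes the last factor from the tail, which has positive
    weight.\<close>
  have cy: "keys ?c \<subseteq> ?T" proof -
    obtain s z where s: "ds = s @ [z]" by (cases ds rule: rev_cases) (auto simp: ds)
    have lh: "last d = z" "hd d = m0" "cmrg d = (z + m0) # s" by (simp_all add: d_def s cmrg_def butlast_append)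
    show ?thesis proof (cases "z + m0 \<in> mons")
      case False
      then show ?thesis using mc(2)[of z m0] d(1) by (simp add: lh) (simp add: d_def s)
    next
      case True
      have "(z + m0) # s \<in> words p q" using cmerge_words[of m0 s z p q] dw True by (simp add: s)
      moreover have "letters ((z + m0) # s) \<subseteq> S" using dl by (auto simp: letters_def keys_add_nat s)
      moreover have "((z + m0) # s, m0 # ws) \<in> word_rel S" using wt wpos[of z] by (simp add: word_rel_def s)
      ultimately show ?thesis by (simp add: lh)
    qed
  qed
  have "hb nf (wd d) = (\<Sum>i<Suc q. t i) + ?c" unfolding t_def by (rule hb_nf_wd[OF d]) simp
  also have "(\<Sum>i<Suc q. t i) = t ?j + (\<Sum>i\<in>{..<Suc q} - {?j}. t i)" using j by (subst sum.remove[of _ ?j]) auto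
  finally have "hb nf (wd d) - sgn_pow ?j (single (m0 # ws) 1) = (\<Sum>i\<in>{..<Suc q} - {?j}. t i) + ?c" unfolding tj by simp
  moreover have "keys ((\<Sum>i\<in>{..<Suc q} - {?j}. t i) + ?c) \<subseteq> ?T" by (intro keys_add_subset keys_sum_subset cy ti) auto
  ultimately show "\<exists>k. keys (hb nf (wd (m0 # ds)) - sgn_pow k (single (m0 # ws) 1)) \<subseteq> ?T" unfolding d_def by metis
qed

end

section \<open>Reduction to unsplittable words, and rigidity of what remains\<close>

context free_chain_algebra
begin

lemma bw_simps: "bw 0 = 0" "bw (f + g) = bw f + bw g" "bw (f - g) = bw f - bw g" "bw (fscale c f) = fscale c (bw f)"
  "bw (sgn_pow n f) = sgn_pow n (bw f)" "bw (single w c) = fscale c (hb nf (wd w))"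
  "bw (\<Sum>i\<in>I. h i) = (\<Sum>i\<in>I. bw (h i))"
  by (simp_all add: bw_def lin_extend_add lin_extend_diff lin_extend_scale lin_extend_sgn_pow lin_extend_sum)

lemma keys_sgn_pow [simp]: "keys (sgn_pow n f) = keys f" for f :: "'b \<Rightarrow>\<^sub>0 'k" by (simp add: sgn_pow_def)

lemma poly_mapping_sum_single: "f = (\<Sum>x\<in>keys f. fscale (lookup f x) (single x 1))" for f :: "'b \<Rightarrow>\<^sub>0 'k"
  using lin_extend_single_id[of f] by (simp add: lin_extend_def)

lemma keys_diff_subset: "keys f \<subseteq> S \<Longrightarrow> keys g \<subseteq> S \<Longrightarrow> keys (f - g) \<subseteq> S"
  for f g :: "'b \<Rightarrow>\<^sub>0 'k" using keys_diff[of f g] by blast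

definition free_words :: "nat \<Rightarrow> nat \<Rightarrow> 'x mono list set" where
  "free_words p q = {v \<in> words p q. \<not> splittable dg (tl v)}"

lemma reduce_chain: assumes "\<And>w. w \<in> keys z \<Longrightarrow> \<exists>u. keys u \<subseteq> words p (Suc q) \<and>
      keys (single w 1 - bw u) \<subseteq> free_words p q"
  shows "\<exists>u. keys u \<subseteq> words p (Suc q) \<and> keys (z - bw u) \<subseteq> free_words p q"
proof -
  obtain U where U: "\<And>w. w \<in> keys z \<Longrightarrow> keys (U w) \<subseteq> words p (Suc q) \<and>
      keys (single w 1 - bw (U w)) \<subseteq> free_words p q" using assms by metis
  let ?u = "\<Sum>w\<in>keys z. fscale (lookup z w) (U w)"
  have 1: "z - bw ?u = (\<Sum>w\<in>keys z. fscale (lookup z w) (single w 1 - bw (U w)))"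
    by (subst poly_mapping_sum_single[of z]) (simp only: bw_simps fs.scale_right_diff_distrib sum_subtractf)
  have "keys (z - bw ?u) \<subseteq> free_words p q" unfolding 1 using U by (intro keys_sum_subset order_trans[OF keys_fscale]) blast
  moreover have "keys ?u \<subseteq> words p (Suc q)" using U by (intro keys_sum_subset order_trans[OF keys_fscale]) blast
  ultimately show ?thesis by blast
qed

text \<open>Subtracting the boundary of the split word replaces \<open>w\<close> by smaller words
  over the same letters. The set \<open>S\<close> is fixed in advance because the well-founded
  relation depends on it.\<close>

lemma reduce_word: assumes S: "finite S"
  shows "w \<in> words p q \<Longrightarrow> letters w \<subseteq> S \<Longrightarrow> \<exists>u. keys u \<subseteq> words p (Suc q) \<and>
      keys (single w 1 - bw u) \<subseteq> free_words p q"
proof (induction w rule: wf_induct_rule[OF wf_word_rel[of S]])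
  case (1 w)
  obtain m0 ws where w: "w = m0 # ws" using 1(2) by (cases w) (auto simp: words_def)
  show ?case proof (cases "splittable dg ws")
    case False
    then show ?thesis using 1(2) w by (intro exI[of _ 0]) (simp add: bw_simps free_words_def)
  next
    case True
    then obtain ds where ds: "split_off dg ws ds" using splittable_iff by blast
    let ?T = "{v \<in> words p q. letters v \<subseteq> S \<and> (v, m0 # ws) \<in> word_rel S}"
    have sb: "m0 # ds \<in> words p (Suc q)" and "\<exists>k. keys (hb nf (wd (m0 # ds)) - sgn_pow k (single (m0 # ws) 1)) \<subseteq> ?T"
      using split_boundary[of m0 ws p q S ds] 1(2,3) w S ds by auto
    then obtain k where k: "keys (hb nf (wd (m0 # ds)) - sgn_pow k (single w 1)) \<subseteq> ?T" unfolding w by blast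
    let ?r = "hb nf (wd (m0 # ds)) - sgn_pow k (single w 1)"
    have "\<exists>u. keys u \<subseteq> words p (Suc q) \<and> keys (?r - bw u) \<subseteq> free_words p q"
      by (rule reduce_chain, rule 1(1)) (use k w in auto)
    then obtain u where u: "keys u \<subseteq> words p (Suc q)" "keys (?r - bw u) \<subseteq> free_words p q" by blast
    let ?u = "sgn_pow k (single (m0 # ds) 1 - u)"
    have "single w 1 - bw ?u = sgn_pow k (- (?r - bw u))" by (auto simp: bw_simps sgn_pow_def)
    then have "keys (single w 1 - bw ?u) \<subseteq> free_words p q" using u(2) by (simp only: keys_sgn_pow keys_minus)
    moreover have "keys ?u \<subseteq> words p (Suc q)" using u sb by (simp add: keys_diff_subset)
    ultimately show ?thesis by blast
  qed
qed

theorem split_free_reduction: assumes "keys z \<subseteq> words p q"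
  shows "\<exists>u. keys u \<subseteq> words p (Suc q) \<and> keys (z - bw u) \<subseteq> free_words p q"
  by (rule reduce_chain, rule reduce_word[of "letters _"]) (use assms in \<open>auto simp: letters_def\<close>)

text \<open>Only the third alternative of \<open>word_cases\<close> is left; it remains to see that
  the unsplit word has the right degree, one factor less and no new letters.\<close>

lemma free_word_split_off: assumes v: "v \<in> free_words p (Suc q)" and c: "\<not> critical dg (tl v)"
  shows "\<exists>vs. split_off dg vs (tl v) \<and> hd v # vs \<in> words p q \<and> letters (hd v # vs) \<subseteq> letters v"
proof -
  obtain m0 ds where d: "v = m0 # ds" using v by (cases v) (auto simp: words_def free_words_def)
  have w: "m0 # ds \<in> words p (Suc q)" "\<not> splittable dg ds" using v by (auto simp: free_words_def d)
  have "0 \<notin> set ds" "\<forall>e\<in>set ds. \<forall>x. odd (dg x) \<longrightarrow> lookup e x \<le> 1" using w by (auto simp: words_def mons_iff)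
  from word_cases[OF this] obtain vs where vs: "split_off dg vs ds" "letters vs \<subseteq> letters ds"
    and o: "\<forall>e\<in>set vs. \<forall>x. odd (dg x) \<longrightarrow> lookup e x \<le> 1" using w(2) c by (auto simp: d)
  obtain xs m rest where 1: "vs = map sing xs @ m # rest" "m \<noteq> sing (lm m)"
    "ds = map sing xs @ sing (lm m) # (m - sing (lm m)) # rest" using vs(1) unfolding split_off_def by blast
  have m0: "m \<noteq> 0" proof
    assume "m = 0"
    then have "m - sing (lm m) = 0" by (intro poly_mapping_eqI) (simp add: lookup_minus)
    then show False using w(1) by (auto simp: words_def 1)
  qed
  have m: "mdeg m = mdeg (sing (lm m)) + mdeg (m - sing (lm m))"
    using mdeg_add[of dg "sing (lm m)" "m - sing (lm m)"] sing_diff[OF lm_in[OF m0]] by simp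
  have "keys e \<subseteq> X" if "e \<in> set ds" for e proof -
    have "e \<in> mons" using w(1) that by (auto simp: words_def)
    then show ?thesis by (simp add: mons_iff)
  qed
  then have "letters ds \<subseteq> X" unfolding letters_def by (rule UN_least)
  then have "keys e \<subseteq> X" if "e \<in> set vs" for e using vs(2) that unfolding letters_def by blast
  then have "set vs \<subseteq> mons" using o by (intro subsetI) (simp add: mons_iff)
  then have "m0 # vs \<in> words p q" using w(1) m m0 by (auto simp: words_def 1)
  moreover have "letters (m0 # vs) \<subseteq> letters v" using vs(2) by (auto simp: letters_def d)
  ultimately show ?thesis using vs(1) by (auto simp: d)
qed

text \<open>Each word \<open>v\<close> of \<open>z\<close> comes from its own splittable word
  \<open>g v\<close>, which has a unit coefficient in the boundary of \<open>v\<close>. For maximal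
  \<open>g v\<close> no other word of \<open>z\<close> contributes to this coefficient, so a
  splittable word survives in \<open>bw z\<close>.\<close>

theorem split_free_eq_0: assumes z: "keys z \<subseteq> {v \<in> free_words p (Suc q). \<not> critical dg (tl v)}"
    and b: "keys (bw z) \<subseteq> free_words p q" shows "z = 0"
proof (rule ccontr)
  assume "z \<noteq> 0"
  define K where "K = keys z"
  have K: "finite K" "K \<noteq> {}" using \<open>z \<noteq> 0\<close> by (auto simp: K_def)
  define S where "S = (\<Union>v\<in>K. letters v)"
  have S: "finite S" using K by (auto simp: S_def letters_def)
  have "\<forall>v\<in>K. \<exists>vs. split_off dg vs (tl v) \<and> hd v # vs \<in> words p q \<and> letters (hd v # vs) \<subseteq> letters v"
    using z free_word_split_off by (auto simp: K_def)
  then obtain h where h: "\<And>v. v \<in> K \<Longrightarrow> split_off dg (h v) (tl v) \<and> hd v # h v \<in> words p q \<and> letters (hd v # h v) \<subseteq> letters v"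
    by metis
  define g where "g v = hd v # h v" for v
  have ne: "v = hd v # tl v" if "v \<in> K" for v proof -
    have "v \<in> words p (Suc q)" using that z by (auto simp: K_def free_words_def)
    then show ?thesis by (cases v) (auto simp: words_def)
  qed
  have inj: "v = v'" if "v \<in> K" "v' \<in> K" "g v = g v'" for v v'
    using split_off_unique[of dg "h v" "tl v" "tl v'"] h ne that by (metis g_def list.inject)
  have gS: "letters (g v) \<subseteq> S" if "v \<in> K" for v using h[OF that] that by (auto simp: S_def g_def)
  let ?R = "word_rel S"
  let ?r = "?R \<inter> (g ` K \<times> g ` K)"
  \<comment> \<open>On a finite set of words the converse of the relation is well founded too, which
    provides the maximal element.\<close>
  have "acyclic ?r" using wf_acyclic[OF wf_word_rel[of S]] by (rule acyclic_subset) simp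
  moreover have "finite ?r" using K by simp
  ultimately have "wf (?r\<inverse>)" by (rule finite_acyclic_wf_converse[rotated])
  then obtain w where w: "w \<in> g ` K" "\<And>y. (y, w) \<in> ?r\<inverse> \<Longrightarrow> y \<notin> g ` K"
    using wfE_min[of "?r\<inverse>" _ "g ` K"] K by blast
  then obtain v where v: "v \<in> K" "w = g v" by blast
  have max: "(g v, g v') \<notin> ?R" if "v' \<in> K" for v' using w(2)[of "g v'"] w(1) v that by auto
  have irr: "(g v, g v) \<notin> ?R" using max v by blast
  have bd: "\<exists>k. keys (hb nf (wd v') - sgn_pow k (single (g v') 1)) \<subseteq> {x. (x, g v') \<in> ?R}" if v': "v' \<in> K" for v' proof -
    have 1: "hd v' # h v' \<in> words p q" "letters (hd v' # h v') \<subseteq> S" "split_off dg (h v') (tl v')"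
      using h[OF v'] gS[OF v'] by (auto simp: g_def)
    from split_boundary(3)[OF 1(1) S 1(2,3)] show ?thesis unfolding ne[OF v', symmetric] g_def by blast
  qed
  have l0: "lookup (hb nf (wd v')) (g v) = 0" if v': "v' \<in> K" "v' \<noteq> v" for v' proof -
    obtain k where "keys (hb nf (wd v') - sgn_pow k (single (g v') 1)) \<subseteq> {x. (x, g v') \<in> ?R}" using bd v' by blast
    then have "lookup (hb nf (wd v') - sgn_pow k (single (g v') 1)) (g v) = 0" using max[OF v'(1)] by (auto simp: in_keys_iff)
    moreover have "g v' \<noteq> g v" using inj v v' by blast
    ultimately show ?thesis by (auto simp: lookup_minus sgn_pow_def lookup_single)
  qed
  have l1: "lookup (hb nf (wd v)) (g v) \<in> {1, - 1}" proof -
    obtain k where "keys (hb nf (wd v) - sgn_pow k (single (g v) 1)) \<subseteq> {x. (x, g v) \<in> ?R}" using bd v by blast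
    then have "lookup (hb nf (wd v) - sgn_pow k (single (g v) 1)) (g v) = 0" using irr by (auto simp: in_keys_iff)
    then show ?thesis by (auto simp: lookup_minus sgn_pow_def split: if_splits)
  qed
  have "lookup (bw z) (g v) = (\<Sum>v'\<in>K. lookup z v' * lookup (hb nf (wd v')) (g v))" by (simp add: bw_def lin_extend_def lookup_sum K_def)
  also have "\<dots> = (\<Sum>v'\<in>{v}. lookup z v' * lookup (hb nf (wd v')) (g v))" by (rule sum.mono_neutral_right) (use K v l0 in auto)
  finally have "lookup (bw z) (g v) \<noteq> 0" using l1 v(1) by (auto simp: K_def in_keys_iff)
  then have "g v \<in> free_words p q" using b by (auto simp: in_keys_iff)
  then show False using h[OF v(1)] splittable_iff[of dg "h v"] by (auto simp: free_words_def g_def)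
qed

text \<open>The functional \<open>hb nf\<close> is multilinear and reduced, hence determined by its
  values on words.\<close>

lemma hb_nf: "tens t \<Longrightarrow> hb nf t = bw (nf t)"
  unfolding bw_def using multilin_nf[OF multilin_hb[OF nf_multilin] reduced_hb[OF nf_multilin nf_reduced]] .

lemma ev_hb: "keys f \<subseteq> tensors L p q \<Longrightarrow> lin_extend (hb nf) f = bw (lin_extend nf f)"
proof -
  assume k: "keys f \<subseteq> tensors L p q"
  have "lin_extend (hb nf) f = lin_extend (\<lambda>t. bw (nf t)) f" by (rule lin_extend_cong) (use chain_tens[OF k] hb_nf in blast)
  then show ?thesis by (simp add: bw_def lin_extend_lin_extend)
qed

definition bounds :: "nat \<Rightarrow> nat \<Rightarrow> ('x mono list \<Rightarrow>\<^sub>0 'k) set" where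
  "bounds p q = bw ` {u. keys u \<subseteq> words p (Suc q)}"

lemma lin_extend_nf_wd: "keys u \<subseteq> words p q \<Longrightarrow> lin_extend nf (lin_extend (\<lambda>w. single (wd w) 1) u) = u"
proof -
  assume u: "keys u \<subseteq> words p q"
  have "lin_extend nf (lin_extend (\<lambda>w. single (wd w) 1) u) = lin_extend (\<lambda>w. single w 1) u"
    unfolding lin_extend_lin_extend by (rule lin_extend_cong) (use u nf_wd in \<open>force simp: words_def\<close>)
  then show ?thesis by (simp add: lin_extend_single_id)
qed

text \<open>Together with \<open>vcyc_iff\<close> this moves vertical homology to the free module on
  words, where no relations are left.\<close>

lemma vbd_iff: assumes "keys f \<subseteq> tensors L p q" shows "f \<in> cyclic.HH.vbd p q \<longleftrightarrow> lin_extend nf f \<in> bounds p q"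
proof
  assume "f \<in> cyclic.HH.vbd p q"
  then obtain z where z: "keys z \<subseteq> tensors L p (Suc q)" "lin_extend nf (f - lin_extend hochschild_b z) = 0"
    unfolding cyclic.HH_vbd Bex_def Cyc_simps relations_iff by blast
  then have "lin_extend nf f = bw (lin_extend nf z)" using ev_D[OF z(1), of nf] ev_hb[OF z(1)] by (simp add: lin_extend_diff)
  moreover have "keys (lin_extend nf z) \<subseteq> words p (Suc q)" by (rule keys_lin_extend_subset) (use z keys_nf in blast)
  ultimately show "lin_extend nf f \<in> bounds p q" unfolding bounds_def by blast
next
  assume "lin_extend nf f \<in> bounds p q"
  then obtain u where u: "keys u \<subseteq> words p (Suc q)" "lin_extend nf f = bw u" unfolding bounds_def by blast
  let ?z = "lin_extend (\<lambda>w. single (wd w) 1) u"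
  have z: "keys ?z \<subseteq> tensors L p (Suc q)" by (rule keys_lin_extend_subset) (use u wd_tensors in force)
  have "lin_extend nf (lin_extend hochschild_b ?z) = bw u" using ev_D[OF z, of nf] ev_hb[OF z] lin_extend_nf_wd[OF u(1)] by simp
  then have "f - lin_extend hochschild_b ?z \<in> fs.span (tensor_relations L p q)"
    unfolding relations_iff using assms chain_D[OF z] u(2) by (simp add: keys_diff_subset lin_extend_diff)
  then show "f \<in> cyclic.HH.vbd p q" unfolding cyclic.HH_vbd Bex_def Cyc_simps using assms z by blast
qed

lemma vcyc_iff:
  "f \<in> cyclic.HH.vcyc p q \<longleftrightarrow> keys f \<subseteq> tensors L p q \<and> bw (lin_extend nf f) = 0"
proof (cases "keys f \<subseteq> tensors L p q")
  case f: True
  have e: "lin_extend nf (lin_extend hochschild_b f) = bw (lin_extend nf f)" using ev_D[OF f, of nf] ev_hb[OF f] by simp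
  show ?thesis proof (cases q)
    case 0
    have "lin_extend (hb nf) f = 0" by (rule lin_extend_eq_0) (use f 0 in \<open>fastforce simp: tensors_def length_Suc_conv\<close>)
    then show ?thesis using f 0 ev_hb[OF f] unfolding cyclic.HH_vcyc Cyc_simps by simp
  next
    case (Suc q')
    then show ?thesis using f chain_D[of f p q'] e unfolding cyclic.HH_vcyc Cyc_simps relations_iff by auto
  qed
qed (auto simp: cyclic.HH_vcyc Cyc_simps)

end

section \<open>Insertion of one or two factors\<close>

text \<open>
  \<open>insv a\<close> is the shuffle product with the factor \<open>a\<close>, and \<open>ins2 a c\<close> with \<open>a \<otimes> c\<close>, again acting on
  functionals.
\<close>

fun insv :: "nat \<times> 'a \<Rightarrow> ('a tensor \<Rightarrow> 'v::ab_group_add) \<Rightarrow> 'a tensor \<Rightarrow> 'v" where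
  "insv a F [] = F [a]"
| "insv a F (x # r) = F (a # x # r) - sgn_pow (fst a * fst x) (insv a (\<lambda>u. F (x # u)) r)"

fun ins2 :: "nat \<times> 'a \<Rightarrow> nat \<times> 'a \<Rightarrow> ('a tensor \<Rightarrow> 'v::ab_group_add) \<Rightarrow> 'a tensor \<Rightarrow> 'v" where
  "ins2 a c F [] = F [a, c]"
| "ins2 a c F (x # r) = insv c (\<lambda>u. F (a # u)) (x # r) + sgn_pow ((fst a + fst c) * fst x) (ins2 a c (\<lambda>u. F (x # u)) r)"

lemma sgn_pow_double [simp]: "sgn_pow (n + n) a = a" by (simp add: sgn_pow_def)

lemma insv_diff: "insv a (\<lambda>u. F u - G u) w = insv a F w - insv a G w" by (induction w arbitrary: F G) (auto simp: sgn_pow_diff)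

lemma insv_add: "insv a (\<lambda>u. F u + G u) w = insv a F w + insv a G w" by (induction w arbitrary: F G) (auto simp: sgn_pow_add)

lemma insv_sgn_pow: "insv a (\<lambda>u. sgn_pow n (F u)) w = sgn_pow n (insv a F w)"
  by (induction w arbitrary: F) (auto simp: sgn_pow_diff add.commute)

lemma insv_cong: "(\<And>u. length u = Suc (length w) \<Longrightarrow> F u = G u) \<Longrightarrow> insv a F w = insv a G w"
proof (induction w arbitrary: F G)
  case (Cons x r)
  have "F (a # x # r) = G (a # x # r)" by (rule Cons.prems) simp
  moreover have "insv a (\<lambda>u. F (x # u)) r = insv a (\<lambda>u. G (x # u)) r" by (rule Cons.IH, rule Cons.prems) simp
  ultimately show ?case by simp
qed simp

lemma ins2_cong: "(\<And>u. length u = Suc (Suc (length w)) \<Longrightarrow> F u = G u) \<Longrightarrow> ins2 a c F w = ins2 a c G w"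
proof (induction w arbitrary: F G)
  case (Cons x r)
  have "insv c (\<lambda>u. F (a # u)) (x # r) = insv c (\<lambda>u. G (a # u)) (x # r)" by (rule insv_cong, rule Cons.prems) simp
  moreover have "ins2 a c (\<lambda>u. F (x # u)) r = ins2 a c (\<lambda>u. G (x # u)) r" by (rule Cons.IH, rule Cons.prems) simp
  ultimately show ?case by (simp del: insv.simps)
qed simp

lemma ins2_diff: "ins2 a c (\<lambda>u. F u - G u) w = ins2 a c F w - ins2 a c G w"
  by (induction w arbitrary: F G) (auto simp: sgn_pow_diff insv_diff simp del: insv.simps)

lemma ins2_add: "ins2 a c (\<lambda>u. F u + G u) w = ins2 a c F w + ins2 a c G w"
  by (induction w arbitrary: F G) (auto simp: sgn_pow_add insv_add simp del: insv.simps)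

lemma ins2_sgn_pow: "ins2 a c (\<lambda>u. sgn_pow n (F u)) w = sgn_pow n (ins2 a c F w)"
  by (induction w arbitrary: F) (auto simp: sgn_pow_add insv_sgn_pow add.commute simp del: insv.simps)

lemma insv_nth: "insv a F w = (\<Sum>i\<le>length w. sgn_pow (i + fst a * tdeg (take i w)) (F (take i w @ a # drop i w)))"
proof (induction w arbitrary: F)
  case (Cons x r)
  have "insv a F (x # r) = F (a # x # r) + (\<Sum>i\<le>length r. - sgn_pow (fst a * fst x + (i + fst a * tdeg (take i r))) (F (x # take i r @ a # drop i r)))"
    by (simp add: Cons sgn_pow_sum sum_negf)
  also have "\<dots> = F (a # x # r) + (\<Sum>i\<le>length r. sgn_pow (Suc i + fst a * tdeg (take (Suc i) (x # r))) (F (take (Suc i) (x # r) @ a # drop (Suc i) (x # r))))"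
    by (intro arg_cong2[where f = "(+)"] sum.cong refl) (auto simp: sgn_pow_def)
  finally show ?case by (simp add: sum.atMost_Suc_shift del: sum.atMost_Suc)
qed simp

text \<open>The definition recurses at the left end; this formula and \<open>ins2_snoc\<close> split
  off the right end, where the cyclic face acts.\<close>

lemma insv_snoc: "insv a F (r @ [x]) = insv a (\<lambda>u. F (u @ [x])) r + sgn_pow (Suc (length r) + fst a * (tdeg r + fst x)) (F (r @ [x, a]))"
proof (induction r arbitrary: F)
  case Nil
  show ?case by (simp add: sgn_pow_def)
next
  case (Cons y r)
  let ?T = "F (y # r @ [x, a])"
  have 2: "sgn_pow (fst a * fst y) (sgn_pow (Suc (length r) + fst a * (tdeg r + fst x)) ?T)
     = - sgn_pow (Suc (Suc (length r)) + fst a * (fst y + tdeg r + fst x)) ?T" unfolding sgn_pow_pow by (rule sgn_pow_cong') auto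
  have "insv a F ((y # r) @ [x]) = F (a # y # r @ [x]) - sgn_pow (fst a * fst y) (insv a (\<lambda>u. F (y # u @ [x])) r
      + sgn_pow (Suc (length r) + fst a * (tdeg r + fst x)) ?T)" using Cons[of "\<lambda>u. F (y # u)"] by simp
  then show ?case unfolding sgn_pow_add 2 by (simp add: algebra_simps)
qed

lemma ins2_snoc: "ins2 a c F (r @ [x]) = ins2 a c (\<lambda>u. F (u @ [x])) r
    + sgn_pow (Suc (length r) + fst c * (tdeg r + fst x)) (insv a (\<lambda>u. F (u @ [c])) (r @ [x]))"
proof (induction r arbitrary: F)
  case Nil
  then show ?case by (simp add: sgn_pow_def)
next
  case (Cons y r)
  have 1: "insv c (\<lambda>u. F (a # u)) (y # r @ [x]) = insv c (\<lambda>u. F (a # u @ [x])) (y # r)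
     + sgn_pow (Suc (Suc (length r)) + fst c * (fst y + tdeg r + fst x)) (F (a # y # r @ [x, c]))"
    using insv_snoc[of c "\<lambda>u. F (a # u)" "y # r" x] by simp
  let ?I = "insv a (\<lambda>u. F (y # u @ [c])) (r @ [x])" and ?J = "ins2 a c (\<lambda>u. F (y # u @ [x])) r"
  have 2: "sgn_pow ((fst a + fst c) * fst y) (sgn_pow (Suc (length r) + fst c * (tdeg r + fst x)) ?I)
     = - sgn_pow (Suc (Suc (length r)) + fst c * (fst y + tdeg r + fst x)) (sgn_pow (fst a * fst y) ?I)"
    unfolding sgn_pow_pow by (rule sgn_pow_cong') auto
  have "ins2 a c F ((y # r) @ [x]) = insv c (\<lambda>u. F (a # u @ [x])) (y # r)
     + sgn_pow (Suc (Suc (length r)) + fst c * (fst y + tdeg r + fst x)) (F (a # y # r @ [x, c]))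
     + sgn_pow ((fst a + fst c) * fst y) (?J + sgn_pow (Suc (length r) + fst c * (tdeg r + fst x)) ?I)"
    using 1 Cons[of "\<lambda>u. F (y # u)"] by (simp del: insv.simps)
  then show ?case unfolding sgn_pow_add 2 by (simp add: sgn_pow_diff algebra_simps)
qed

lemma bet_Cons: "u \<noteq> [] \<Longrightarrow> bet F (x # u) = F (tmul x (hd u) # tl u) - bet (\<lambda>v. F (x # v)) u" by (cases u) auto

lemma insv_bet_Cons: "insv a (\<lambda>u. bet F (x # u)) (z # r) = F (tmul x a # z # r)
    - sgn_pow (fst a * fst z) (insv a (\<lambda>u. F (tmul x z # u)) r) - insv a (bet (\<lambda>v. F (x # v))) (z # r)"
proof -
  have "insv a (\<lambda>u. bet F (x # u)) (z # r) = insv a (\<lambda>u. F (tmul x (hd u) # tl u) - bet (\<lambda>v. F (x # v)) u) (z # r)"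
    by (rule insv_cong) (auto intro!: bet_Cons)
  then show ?thesis unfolding insv_diff by simp
qed

lemma ins2_bet_Cons: "ins2 a c (\<lambda>u. bet F (x # u)) (z # r) = insv c (\<lambda>u. F (tmul x a # u)) (z # r)
    + sgn_pow ((fst a + fst c) * fst z) (ins2 a c (\<lambda>u. F (tmul x z # u)) r) - ins2 a c (bet (\<lambda>v. F (x # v))) (z # r)"
proof -
  have "ins2 a c (\<lambda>u. bet F (x # u)) (z # r) = ins2 a c (\<lambda>u. F (tmul x (hd u) # tl u) - bet (\<lambda>v. F (x # v)) u) (z # r)"
    by (rule ins2_cong) (auto intro!: bet_Cons)
  then show ?thesis unfolding ins2_diff by simp
qed

lemma bet_add: "bet (\<lambda>w. F w + G w) w = bet F w + bet G w" unfolding bet_nth by (simp add: sgn_pow_add sum.distrib)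

lemma bet_sgn_pow: "bet (\<lambda>w. sgn_pow n (F w)) w = sgn_pow n (bet F w)" unfolding bet_nth sgn_pow_sum by (simp add: add.commute)

context chain_algebra
begin

lemma insv_cong_tens:
  "(\<And>u. tens u \<Longrightarrow> length u = Suc (length w) \<Longrightarrow> tdeg u = fst a + tdeg w \<Longrightarrow> F u = G u) \<Longrightarrow> tens w \<Longrightarrow> snd a \<in> grade A (fst a) \<Longrightarrow>
    insv a F w = insv a G w"
proof (induction w arbitrary: F G)
  case (Cons x r)
  have "F (a # x # r) = G (a # x # r)" using Cons.prems by (intro Cons.prems(1)) auto
  moreover have "insv a (\<lambda>u. F (x # u)) r = insv a (\<lambda>u. G (x # u)) r" using Cons.prems by (intro Cons.IH) auto
  ultimately show ?case by simp
qed simp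

lemma ins2_cong_tens:
  "(\<And>u. tens u \<Longrightarrow> length u = Suc (Suc (length w)) \<Longrightarrow> tdeg u = fst a + fst c + tdeg w \<Longrightarrow> F u = G u) \<Longrightarrow> tens w \<Longrightarrow>
    snd a \<in> grade A (fst a) \<Longrightarrow> snd c \<in> grade A (fst c) \<Longrightarrow> ins2 a c F w = ins2 a c G w"
proof (induction w arbitrary: F G)
  case (Cons x r)
  have "insv c (\<lambda>u. F (a # u)) (x # r) = insv c (\<lambda>u. G (a # u)) (x # r)" by (rule insv_cong_tens) (use Cons.prems in auto)
  moreover have "ins2 a c (\<lambda>u. F (x # u)) r = ins2 a c (\<lambda>u. G (x # u)) r" using Cons.prems by (intro Cons.IH) auto
  ultimately show ?case by (simp del: insv.simps)
qed simp

lemma tmul_commute: assumes "multilin F" "snd a \<in> grade A (fst a)" "snd x \<in> grade A (fst x)" "tens r"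
  shows "F (tmul x a # r) = sgn_pow (fst a * fst x) (F (tmul a x # r))"
  using multilin_sgn_pow_hd[OF assms(1,4), of "snd a * snd x" "fst a + fst x" "fst a * fst x"] assms
  by (simp add: graded_commute[of "snd a" "fst a" "snd x" "fst x"] grade_mult tmul_def add.commute)

lemma tmul_commute_Cons: assumes "multilin F" "snd a \<in> grade A (fst a)" "snd x \<in> grade A (fst x)" "tens r" "snd y \<in> grade A (fst y)"
  shows "F (y # tmul x a # r) = sgn_pow (fst a * fst x) (F (y # tmul a x # r))" by (rule tmul_commute[OF multilin_Cons[OF assms(1,5)] assms(2-4)])

text \<open>A product of \<open>a\<close> with a neighbour arises twice, from the insertions on
  either side of it, and these cancel by graded commutativity. Only insertions into the faces of
  \<open>w\<close> are left.\<close>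

theorem insv_bet: assumes "multilin F" "tens w" "snd a \<in> grade A (fst a)" shows "insv a (bet F) w = - bet (insv a F) w" using assms
proof (induction w arbitrary: F)
  case (Cons x w)
  note a = \<open>snd a \<in> grade A (fst a)\<close>
  show ?case proof (cases w)
    case Nil
    then show ?thesis using tmul_commute[of F a x "[]"] Cons.prems by (simp add: sgn_pow_diff)
  next
    case w: (Cons z r)
    have g: "snd x \<in> grade A (fst x)" "tens (z # r)" using Cons.prems w by auto
    have IH: "insv a (bet (\<lambda>u. F (x # u))) (z # r) = - bet (insv a (\<lambda>u. F (x # u))) (z # r)"
      unfolding w[symmetric] by (rule Cons.IH[OF multilin_Cons[OF Cons.prems(1) g(1)] _ a]) (use Cons.prems in auto)
    have c: "F (tmul x a # z # r) = sgn_pow (fst a * fst x) (F (tmul a x # z # r))" by (rule tmul_commute[OF Cons.prems(1) a g])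
    have l: "insv a (bet F) (x # z # r) = F (tmul a x # z # r) - (F (a # tmul x z # r) - bet (\<lambda>u. F (a # x # u)) (z # r))
        - sgn_pow (fst a * fst x) (F (tmul x a # z # r) - sgn_pow (fst a * fst z) (insv a (\<lambda>u. F (tmul x z # u)) r)
          - insv a (bet (\<lambda>v. F (x # v))) (z # r))" by (subst insv.simps) (simp only: insv_bet_Cons bet.simps)
    have r: "bet (insv a F) (x # z # r) = (F (a # tmul x z # r) - sgn_pow (fst a * (fst x + fst z)) (insv a (\<lambda>u. F (tmul x z # u)) r))
        - (bet (\<lambda>u. F (a # x # u)) (z # r) - sgn_pow (fst a * fst x) (bet (insv a (\<lambda>u. F (x # u))) (z # r)))"
      by (simp add: bet_diff bet_sgn_pow)
    let ?T = "insv a (\<lambda>u. F (tmul x z # u)) r"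
    have s: "sgn_pow (fst a * fst x) (sgn_pow (fst a * fst z) ?T) = sgn_pow (fst a * (fst x + fst z)) ?T"
      "sgn_pow (fst a * fst x) (sgn_pow (fst a * fst x) (F (tmul a x # z # r))) = F (tmul a x # z # r)" by (simp_all add: algebra_simps)
    show ?thesis unfolding w l r IH c sgn_pow_diff sgn_pow_minus s by simp
  qed
qed simp

text \<open>Now \<open>a\<close> and \<open>c\<close> can be neighbours of each other, and their
  product is the extra term. Both formulas say that the boundary without cyclic face is a derivation
  for shuffle products.\<close>

theorem ins2_bet: assumes "multilin F" "tens w" "snd a \<in> grade A (fst a)" "snd c \<in> grade A (fst c)"
  shows "ins2 a c (bet F) w = bet (ins2 a c F) w + insv (tmul a c) F w" using assms
proof (induction w arbitrary: F)
  case (Cons x w)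
  note ac = \<open>snd a \<in> grade A (fst a)\<close> \<open>snd c \<in> grade A (fst c)\<close> and F = \<open>multilin F\<close>
  have x: "snd x \<in> grade A (fst x)" "tens w" using Cons.prems by auto
  show ?case proof (cases w)
    case Nil
    have 1: "F [tmul x a, c] = sgn_pow (fst a * fst x) (F [tmul a x, c])" by (rule tmul_commute[OF F ac(1) x(1)]) (use ac in auto)
    have 2: "F [a, tmul x c] = sgn_pow (fst c * fst x) (F [a, tmul c x])" by (rule tmul_commute_Cons[OF F ac(2) x(1) _ ac(1)]) simp
    show ?thesis by (simp add: Nil 1 2 sgn_pow_diff sgn_pow_add) (auto simp: sgn_pow_def)
  next
    case w: (Cons z r)
    have g: "tens (z # r)" "snd z \<in> grade A (fst z)" "tens r" using Cons.prems w by auto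
    have IH: "ins2 a c (bet (\<lambda>u. F (x # u))) (z # r) = bet (ins2 a c (\<lambda>u. F (x # u))) (z # r) + insv (tmul a c) (\<lambda>u. F (x # u)) (z # r)"
      unfolding w[symmetric] by (rule Cons.IH[OF multilin_Cons[OF F x(1)] x(2) ac])
    have b: "insv c (bet (\<lambda>v. F (a # v))) (x # z # r) = - bet (insv c (\<lambda>v. F (a # v))) (x # z # r)"
      by (rule insv_bet[OF multilin_Cons[OF F ac(1)] _ ac(2)]) (use x g in auto)
    have xa: "insv c (\<lambda>u. F (tmul x a # u)) (z # r) = sgn_pow (fst a * fst x) (insv c (\<lambda>u. F (tmul a x # u)) (z # r))"
      unfolding insv_sgn_pow[symmetric] by (rule insv_cong_tens) (use tmul_commute[OF F ac(1) x(1)] g ac in auto)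
    let ?T = "ins2 a c (\<lambda>u. F (tmul x z # u)) r" and ?I = "insv c (\<lambda>v. F (a # v))"
      and ?K = "insv c (\<lambda>u. F (tmul a x # u)) (z # r)" and ?J = "insv (tmul a c) (\<lambda>u. F (x # u)) (z # r)"
      and ?L = "bet (ins2 a c (\<lambda>u. F (x # u))) (z # r)"
    let ?M = "bet (\<lambda>u. ?I (x # u)) (z # r)"
    have l1: "insv c (\<lambda>u. bet F (a # u)) (x # z # r) = F (tmul a c # x # z # r) - sgn_pow (fst c * fst x) ?K
        + (?I (tmul x z # r) - ?M)" unfolding insv_bet_Cons b by simp
    have l: "ins2 a c (bet F) (x # z # r) = F (tmul a c # x # z # r) - sgn_pow (fst c * fst x) ?K
        + (?I (tmul x z # r) - ?M) + sgn_pow ((fst a + fst c) * fst x)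
        (sgn_pow (fst a * fst x) ?K + sgn_pow ((fst a + fst c) * fst z) ?T - (?L + ?J))" by (subst ins2.simps) (simp only: l1 ins2_bet_Cons xa IH)
    have r: "bet (ins2 a c F) (x # z # r) = (?I (tmul x z # r) + sgn_pow ((fst a + fst c) * (fst x + fst z)) ?T)
        - (?M + sgn_pow ((fst a + fst c) * fst x) ?L)" by (simp add: bet_add bet_sgn_pow del: insv.simps)
    have q: "insv (tmul a c) F (x # z # r) = F (tmul a c # x # z # r) - sgn_pow ((fst a + fst c) * fst x) ?J" by simp
    have s: "sgn_pow ((fst a + fst c) * fst x) (sgn_pow (fst a * fst x) ?K) = sgn_pow (fst c * fst x) ?K"
      "sgn_pow ((fst a + fst c) * fst x) (sgn_pow ((fst a + fst c) * fst z) ?T) = sgn_pow ((fst a + fst c) * (fst x + fst z)) ?T"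
      unfolding sgn_pow_pow by (rule sgn_pow_cong; auto)+
    show ?thesis unfolding w l r q sgn_pow_diff sgn_pow_add s by simp
  qed
qed simp

end

section \<open>Signed sums over the orderings of a monomial\<close>

context free_chain_algebra
begin

abbreviation gl :: "'x \<Rightarrow> nat \<times> 'l" where "gl x \<equiv> (dg x, gen x)"
abbreviation gams :: "'x mono set" where "gams \<equiv> gamma_monomials X dg"

definition ecnt :: "'x mono \<Rightarrow> 'x \<Rightarrow> nat" where
  "ecnt e x = card {y \<in> keys e. even (dg y) \<and> y < x}"

text \<open>Exponent of the sign for drawing \<open>x\<close> to the front of \<open>n\<close>
  further letters. The term \<open>n * dg x\<close> accounts for the degree shift between
  \<open>x\<close> and \<open>dx\<close>; \<open>ecnt\<close> counts the smaller exterior letters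
  that an exterior \<open>dx\<close> has to pass.\<close>

definition sg :: "nat \<Rightarrow> 'x mono \<Rightarrow> 'x \<Rightarrow> nat" where
  "sg n e x = n * dg x + (if even (dg x) then ecnt e x else 0)"

text \<open>
  \<open>ysum n e F\<close> is the value of \<open>F\<close> on the sum of all distinct orderings of the \<open>n\<close> letters of \<open>e\<close>, with signs
  such that the sum is a shuffle product of divided powers of letters.
\<close>

primrec ysum :: "nat \<Rightarrow> 'x mono \<Rightarrow> ('l tensor \<Rightarrow> 'v::ab_group_add) \<Rightarrow> 'v" where
  "ysum 0 e F = F []"
| "ysum (Suc n) e F = (\<Sum>x\<in>keys e. sgn_pow (sg n e x) (ysum n (e - sing x) (\<lambda>u. F (gl x # u))))"

lemma gams_iff: "e \<in> gams \<longleftrightarrow> keys e \<subseteq> X \<and> (\<forall>x. even (dg x) \<longrightarrow> lookup e x \<le> 1)"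
  by (simp add: gamma_monomials_def)

lemma keys_diff_sing: "z \<in> keys (e - sing x) \<longleftrightarrow> (if z = x then lookup e x \<ge> 2 else z \<in> keys e)"
  by (auto simp: in_keys_iff lookup_minus)

lemma keys_diff_sing_subset: "keys (e - sing x) \<subseteq> keys e" by (auto simp: in_keys_iff lookup_minus)

lemma gams_diff: assumes "e \<in> gams" shows "e - sing x \<in> gams"
proof -
  have "lookup (e - sing x) y \<le> lookup e y" for y by (simp add: lookup_minus)
  then show ?thesis using assms keys_diff_sing_subset[of e x] unfolding gams_iff by (meson order_trans)
qed

lemma odd_key: "e \<in> gams \<Longrightarrow> x \<in> keys (e - sing x) \<Longrightarrow> odd (dg x)"
  using keys_diff_sing[of x e x] unfolding gams_iff by fastforce

lemma gl_grade: "x \<in> X \<Longrightarrow> snd (gl x) \<in> grade L (fst (gl x))" by (simp add: gen_grade)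

lemma gams_key: "e \<in> gams \<Longrightarrow> x \<in> keys e \<Longrightarrow> x \<in> X" by (auto simp: gams_iff)

lemma wt_diff_sing: "x \<in> keys e \<Longrightarrow> wt e = Suc (wt (e - sing x))"
  and mdeg_diff_sing: "x \<in> keys e \<Longrightarrow> mdeg e = dg x + mdeg (e - sing x)"
  using wt_add[of "sing x" "e - sing x"] mdeg_add[of dg "sing x" "e - sing x"] by (simp_all add: sing_diff)

lemma ysum_cong:
  "(\<And>u. tens u \<Longrightarrow> length u = n \<Longrightarrow> tdeg u = mdeg e \<Longrightarrow> F u = G u) \<Longrightarrow> e \<in> gams \<Longrightarrow> wt e = n \<Longrightarrow>
    ysum n e F = ysum n e G"
proof (induction n arbitrary: e F G)
  case 0
  then have "e = 0" by (simp add: wt_eq_0)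
  then show ?case using 0(1)[of "[]"] by simp
next
  case (Suc n)
  have "ysum n (e - sing x) (\<lambda>u. F (gl x # u)) = ysum n (e - sing x) (\<lambda>u. G (gl x # u))" if x: "x \<in> keys e" for x
  proof (rule Suc.IH)
    show "e - sing x \<in> gams" using Suc.prems gams_diff by blast
    show "wt (e - sing x) = n" using wt_diff_sing[OF x] Suc.prems by simp
    fix u assume "tens u" "length u = n" "tdeg u = mdeg (e - sing x)"
    then show "F (gl x # u) = G (gl x # u)" using gen_grade[OF gams_key[OF Suc.prems(2) x]] mdeg_diff_sing[OF x] by (intro Suc.prems(1)) auto
  qed
  then show ?case by simp
qed

lemma ysum_sum: "ysum n e (\<lambda>u. \<Sum>i\<in>I. F i u) = (\<Sum>i\<in>I. ysum n e (F i))"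
proof (induction n arbitrary: e F)
  case (Suc n)
  then show ?case by (simp add: sgn_pow_sum) (rule sum.swap)
qed simp

lemma ysum_add: "ysum n e (\<lambda>u. F u + G u) = ysum n e F + ysum n e G" by (induction n arbitrary: e F G) (simp_all add: sgn_pow_add sum.distrib)

lemma ysum_diff: "ysum n e (\<lambda>u. F u - G u) = ysum n e F - ysum n e G"
  by (induction n arbitrary: e F G) (simp_all add: sgn_pow_diff sum_subtractf)

lemma ysum_sgn_pow: "ysum n e (\<lambda>u. sgn_pow k (F u)) = sgn_pow k (ysum n e F)"
  by (induction n arbitrary: e F) (simp_all add: sgn_pow_sum add.commute)

lemma ysum_zero [simp]: "ysum n e (\<lambda>u. 0) = 0" using ysum_sum[of n e _ "{}"] by simp

lemma sum_pair_swap: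
  "(\<Sum>x\<in>keys e. \<Sum>z\<in>keys (e - sing x). H x z) = (\<Sum>z\<in>keys e. \<Sum>x\<in>keys (e - sing z). H x z)"
proof -
  let ?R = "\<lambda>x z. z \<in> keys (e - sing x)"
  have "{z. z \<in> keys e \<and> ?R x z} = keys (e - sing x)" for x using keys_diff_sing_subset[of e x] by blast
  moreover have "{x. x \<in> keys e \<and> ?R x z} = keys (e - sing z)" if "z \<in> keys e" for z
    using that by (intro set_eqI) (metis (mono_tags, lifting) mem_Collect_eq keys_diff_sing)
  ultimately show ?thesis using sum.swap_restrict[of "keys e" "keys e" H ?R] by simp
qed

lemma sum_pair_antisym:
  fixes H :: "'x \<Rightarrow> 'x \<Rightarrow> 'v::ab_group_add"
  assumes "\<And>x z. x \<in> keys e \<Longrightarrow> z \<in> keys (e - sing x) \<Longrightarrow> x \<noteq> z \<Longrightarrow> H x z = - H z x"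
    and "\<And>x. x \<in> keys e \<Longrightarrow> x \<in> keys (e - sing x) \<Longrightarrow> H x x = 0"
  shows "(\<Sum>x\<in>keys e. \<Sum>z\<in>keys (e - sing x). H x z) = 0"
proof -
  let ?K = "keys e"
  have "(\<Sum>z\<in>keys (e - sing x). H x z) = (\<Sum>z | z \<in> ?K \<and> z < x. H x z) + (\<Sum>z | z \<in> ?K \<and> x < z. H x z)"
    if x: "x \<in> ?K" for x proof -
    have k: "keys (e - sing x) - {x} = {z. z \<in> ?K \<and> z < x} \<union> {z. z \<in> ?K \<and> x < z}" by (auto simp: keys_diff_sing)
    have "(\<Sum>z\<in>keys (e - sing x). H x z) = (\<Sum>z\<in>keys (e - sing x) - {x}. H x z)"
      using assms(2)[OF x] by (cases "x \<in> keys (e - sing x)") (auto simp: sum.remove)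
    then show ?thesis unfolding k by (subst (asm) sum.union_disjoint) auto
  qed
  then have "(\<Sum>x\<in>?K. \<Sum>z\<in>keys (e - sing x). H x z)
      = (\<Sum>x\<in>?K. \<Sum>z | z \<in> ?K \<and> z < x. H x z) + (\<Sum>x\<in>?K. \<Sum>z | z \<in> ?K \<and> x < z. H x z)"
    by (simp add: sum.distrib)
  also have "(\<Sum>x\<in>?K. \<Sum>z | z \<in> ?K \<and> x < z. H x z) = (\<Sum>z\<in>?K. \<Sum>x | x \<in> ?K \<and> x < z. H x z)"
    by (rule sum.swap_restrict) auto
  also have "\<dots> = (\<Sum>z\<in>?K. \<Sum>x | x \<in> ?K \<and> x < z. - H z x)"
    using assms(1) by (intro sum.cong refl) (auto simp: keys_diff_sing)
  finally show ?thesis by (simp add: sum_negf)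
qed

lemma ecnt_diff: assumes "e \<in> gams" "x \<in> keys e" shows "ecnt e z = ecnt (e - sing x) z + (if even (dg x) \<and> x < z then 1 else 0)"
proof -
  have l: "lookup e x \<le> 1" if "even (dg x)" using assms that by (simp add: gams_iff)
  let ?A = "{y \<in> keys e. even (dg y) \<and> y < z}"
  show ?thesis proof (cases "even (dg x)")
    case True
    have "{y \<in> keys (e - sing x). even (dg y) \<and> y < z} = ?A - {x}" using l[OF True] by (auto simp: keys_diff_sing)
    moreover have "card ?A = card (?A - {x}) + (if x < z then 1 else 0)"
      using assms(2) True by (cases "x < z") (auto simp: card_Suc_Diff1[symmetric] simp del: card_Diff_insert)
    ultimately show ?thesis using True by (simp add: ecnt_def)
  next
    case False
    have "{y \<in> keys (e - sing x). even (dg y) \<and> y < z} = ?A" using False by (auto simp: keys_diff_sing split: if_splits)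
    then show ?thesis using False by (simp add: ecnt_def)
  qed
qed

text \<open>Drawing out \<open>x\<close> and \<open>z\<close> in either order differs by the Koszul
  sign of the generators and one further minus. Cancellations between orderings come down to this
  parity.\<close>

lemma sg_swap: assumes "e \<in> gams" "x \<in> keys e" "z \<in> keys e" "x \<noteq> z"
  shows "odd (sg (Suc n) e x + sg n (e - sing x) z + (dg x * dg z + sg (Suc n) e z + sg n (e - sing z) x))"
proof -
  have "x < z \<or> z < x" using assms(4) by auto
  then show ?thesis using ecnt_diff[OF assms(1,2), of z] ecnt_diff[OF assms(1,3), of x] unfolding sg_def by auto
qed

text \<open>Orderings that differ by exchanging the first two letters give opposite products, by
  \<open>sg_swap\<close>; two equal letters have odd degree and product zero. The remaining faces
  vanish by induction.\<close>

theorem ysum_bet: "multilin F \<Longrightarrow> e \<in> gams \<Longrightarrow> wt e = n \<Longrightarrow> ysum n e (bet F) = 0"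
proof (induction n arbitrary: e F)
  case (Suc n)
  note e = \<open>e \<in> gams\<close>
  show ?case proof (cases n)
    case 0 then show ?thesis by simp
  next
    case (Suc m)
    \<comment> \<open>The share of the first face in the orderings that begin with \<open>x\<close>
      and then \<open>z\<close>.\<close>
    define H where "H x z = sgn_pow (sg n e x) (sgn_pow (sg m (e - sing x) z) (ysum m (e - sing x - sing z) (\<lambda>r. F (tmul (gl x) (gl z) # r))))" for x z
    have 1: "sgn_pow (sg n e x) (ysum n (e - sing x) (\<lambda>u. bet F (gl x # u))) = (\<Sum>z\<in>keys (e - sing x). H x z)"
      if x: "x \<in> keys e" for x proof -
      have w: "wt (e - sing x) = n" using wt_diff_sing[OF x] Suc.prems by simp
      have g: "snd (gl x) \<in> grade L (fst (gl x))" by (rule gl_grade[OF gams_key[OF e x]])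
      have "ysum n (e - sing x) (\<lambda>u. bet F (gl x # u)) = ysum n (e - sing x) (\<lambda>u. F (tmul (gl x) (hd u) # tl u) - bet (\<lambda>v. F (gl x # v)) u)"
        using Suc by (intro ysum_cong bet_Cons gams_diff e w) auto
      also have "\<dots> = ysum n (e - sing x) (\<lambda>u. F (tmul (gl x) (hd u) # tl u))"
        unfolding ysum_diff using Suc.IH[OF multilin_Cons[OF Suc.prems(1) g] gams_diff[OF e] w] by simp
      finally show ?thesis by (simp add: H_def Suc sgn_pow_sum)
    qed
    have "ysum (Suc n) e (bet F) = (\<Sum>x\<in>keys e. \<Sum>z\<in>keys (e - sing x). H x z)" using 1 by simp
    also have "\<dots> = 0" proof (rule sum_pair_antisym)
      fix x z assume xz: "x \<in> keys e" "z \<in> keys (e - sing x)" "x \<noteq> z"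
      then have z: "z \<in> keys e" by (simp add: keys_diff_sing)
      have w: "wt (e - sing x - sing z) = m" using wt_diff_sing[OF xz(1)] wt_diff_sing[OF xz(2)] Suc.prems Suc by simp
      let ?Y = "ysum m (e - sing x - sing z) (\<lambda>r. F (tmul (gl z) (gl x) # r))"
      have "ysum m (e - sing x - sing z) (\<lambda>r. F (tmul (gl x) (gl z) # r)) = ysum m (e - sing x - sing z) (\<lambda>r. sgn_pow (dg x * dg z) (F (tmul (gl z) (gl x) # r)))"
        using tmul_commute[OF Suc.prems(1) gl_grade gl_grade, OF gams_key[OF e z] gams_key[OF e xz(1)]]
        by (intro ysum_cong gams_diff e w) (auto simp: mult.commute)
      then have "H x z = sgn_pow (sg n e x) (sgn_pow (sg m (e - sing x) z) (sgn_pow (dg x * dg z) ?Y))" unfolding H_def ysum_sgn_pow by simp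
      also have "\<dots> = - sgn_pow (sg n e z + sg m (e - sing z) x) ?Y"
        unfolding sgn_pow_pow by (rule sgn_pow_cong') (use sg_swap[OF e xz(1) z xz(3), of m] Suc in \<open>auto simp: ac_simps\<close>)
      also have "\<dots> = - H z x" by (simp add: H_def diff_right_commute)
      finally show "H x z = - H z x" .
    next
      fix x assume x: "x \<in> keys e" "x \<in> keys (e - sing x)"
      then have "odd (dg x)" by (metis e odd_key)
      then have z: "gen x * gen x = 0" using odd_square gen_grade gams_key[OF e x(1)] by blast
      have w: "wt (e - sing x - sing x) = m" using wt_diff_sing[OF x(1)] wt_diff_sing[OF x(2)] Suc.prems Suc by simp
      have "ysum m (e - sing x - sing x) (\<lambda>r. F (tmul (gl x) (gl x) # r)) = ysum m (e - sing x - sing x) (\<lambda>r. 0)"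
        by (intro ysum_cong gams_diff e w) (auto simp: tmul_def z multilin_zero_hd[OF Suc.prems(1)])
      then show "H x x = 0" by (simp add: H_def)
    qed
    finally show ?thesis .
  qed
qed simp

text \<open>The signed orderings can be generated from the last letter as well. Exchanging the two
  outermost letters in the induction is \<open>sg_swap\<close>, or for equal letters a parity check
  using their odd degree.\<close>

theorem ysum_right:
  "e \<in> gams \<Longrightarrow> wt e = Suc n \<Longrightarrow> ysum (Suc n) e F = (\<Sum>x\<in>keys e.
    sgn_pow (sg n e x + (n + dg x * mdeg (e - sing x))) (ysum n (e - sing x) (\<lambda>r. F (r @ [gl x]))))"
proof (induction n arbitrary: e F)
  case 0
  have "e - sing x = 0" if "x \<in> keys e" for x using wt_diff_sing[OF that] 0 by (simp add: wt_eq_0)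
  then show ?case by simp
next
  case (Suc n)
  note e = \<open>e \<in> gams\<close>
  define Y where "Y x z = ysum n (e - sing x - sing z) (\<lambda>r. F (gl x # r @ [gl z]))" for x z
  have "ysum (Suc (Suc n)) e F = (\<Sum>x\<in>keys e. \<Sum>z\<in>keys (e - sing x).
      sgn_pow (sg (Suc n) e x) (sgn_pow (sg n (e - sing x) z + (n + dg z * mdeg (e - sing x - sing z))) (Y x z)))" proof -
    have "ysum (Suc n) (e - sing x) (\<lambda>u. F (gl x # u)) = (\<Sum>z\<in>keys (e - sing x).
      sgn_pow (sg n (e - sing x) z + (n + dg z * mdeg (e - sing x - sing z))) (Y x z))" if x: "x \<in> keys e" for x
      unfolding Y_def by (rule Suc.IH[of "e - sing x" "\<lambda>u. F (gl x # u)", OF gams_diff[OF e], unfolded append_Cons]) (use wt_diff_sing[OF x] Suc.prems in simp)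
    then show ?thesis by (simp add: sgn_pow_sum del: ysum.simps(2) sgn_pow_pow add: ysum.simps(2)[of "Suc n"])
  qed
  also have "\<dots> = (\<Sum>z\<in>keys e. \<Sum>x\<in>keys (e - sing z).
      sgn_pow (sg (Suc n) e x) (sgn_pow (sg n (e - sing x) z + (n + dg z * mdeg (e - sing x - sing z))) (Y x z)))" by (rule sum_pair_swap)
  also have "\<dots> = (\<Sum>z\<in>keys e. sgn_pow (sg (Suc n) e z + (Suc n + dg z * mdeg (e - sing z)))
      (ysum (Suc n) (e - sing z) (\<lambda>r. F (r @ [gl z]))))" proof (rule sum.cong[OF refl])
    fix z assume z: "z \<in> keys e"
    have "sgn_pow (sg (Suc n) e x) (sgn_pow (sg n (e - sing x) z + (n + dg z * mdeg (e - sing x - sing z))) (Y x z))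
       = sgn_pow (sg (Suc n) e z + (Suc n + dg z * mdeg (e - sing z))) (sgn_pow (sg n (e - sing z) x) (Y x z))"
      if x: "x \<in> keys (e - sing z)" for x proof -
      have m: "mdeg (e - sing z) = dg x + mdeg (e - sing x - sing z)" using mdeg_diff_sing[OF x] by (simp add: diff_right_commute)
      show ?thesis proof (cases "x = z")
        case True
        then have "odd (dg x)" by (metis e x odd_key)
        then show ?thesis unfolding sgn_pow_pow m using True by (intro sgn_pow_cong) auto
      next
        case False
        then have "x \<in> keys e" using x by (simp add: keys_diff_sing)
        from sg_swap[OF e this z False, of n] show ?thesis unfolding sgn_pow_pow m by (intro sgn_pow_cong) auto
      qed
    qed
    then show "(\<Sum>x\<in>keys (e - sing z). sgn_pow (sg (Suc n) e x)
        (sgn_pow (sg n (e - sing x) z + (n + dg z * mdeg (e - sing x - sing z))) (Y x z)))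
      = sgn_pow (sg (Suc n) e z + (Suc n + dg z * mdeg (e - sing z))) (ysum (Suc n) (e - sing z) (\<lambda>r. F (r @ [gl z])))"
      by (simp add: sgn_pow_sum Y_def diff_right_commute[of e "sing z"] del: sgn_pow_pow)
  qed
  finally show ?case .
qed

text \<open>Rotation turns the recursion at the left end into the one at the right end.\<close>

lemma ysum_rot: assumes "e \<in> gams" "wt e = n" shows "ysum n e (rot F) = ysum n e F"
proof (cases n)
  case (Suc m)
  have "ysum m (e - sing x) (\<lambda>u. rot F (gl x # u)) = sgn_pow (m + dg x * mdeg (e - sing x)) (ysum m (e - sing x) (\<lambda>r. F (r @ [gl x])))"
    if x: "x \<in> keys e" for x unfolding ysum_sgn_pow[symmetric] using wt_diff_sing[OF x] assms Suc by (intro ysum_cong gams_diff assms) auto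
  then show ?thesis unfolding Suc using ysum_right[OF assms(1), of m F] assms Suc by simp
qed simp

lemma ysum_rot_pow: "e \<in> gams \<Longrightarrow> wt e = n \<Longrightarrow> ysum n e ((rot ^^ k) F) = ysum n e F"
  by (induction k) (auto simp: ysum_rot)

end

context chain_algebra
begin

lemma insv_scale: "insv a (\<lambda>u. fscale c (F u)) w = fscale c (insv a F w)"
  by (induction w arbitrary: F) (simp_all add: fs.scale_right_diff_distrib fscale_sgn_pow)

lemma ins2_scale: "ins2 a c (\<lambda>u. fscale k (F u)) w = fscale k (ins2 a c F w)"
  by (induction w arbitrary: F) (simp_all add: fs.scale_right_distrib fscale_sgn_pow insv_scale del: insv.simps)

lemma multilin_insv: assumes "multilin F" "snd a \<in> grade A (fst a)" shows "multilin (insv a F)"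
proof (rule multilinI)
  fix xs n x y c ys assume "tens xs" "tens ys" "x \<in> grade A n" "y \<in> grade A n"
  then show "insv a F (xs @ (n, smul A c x + y) # ys) = fscale c (insv a F (xs @ (n, x) # ys)) + insv a F (xs @ (n, y) # ys)" using assms
  proof (induction xs arbitrary: F)
    case Nil
    have "insv a (\<lambda>u. F ((n, smul A c x + y) # u)) ys = insv a (\<lambda>u. fscale c (F ((n, x) # u)) + F ((n, y) # u)) ys"
      using Nil sm.subspace_add[OF grade_subspace sm.subspace_scale[OF grade_subspace]] by (intro insv_cong_tens multilin_lin_hd) auto
    then show ?case using multilin_lin[of F "[a]" ys x n y c] Nil
      by (simp add: insv_add insv_scale sgn_pow_add fs.scale_right_diff_distrib fscale_sgn_pow)
  next
    case (Cons z xs)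
    have "insv a (\<lambda>u. F (z # u)) (xs @ (n, smul A c x + y) # ys)
        = fscale c (insv a (\<lambda>u. F (z # u)) (xs @ (n, x) # ys)) + insv a (\<lambda>u. F (z # u)) (xs @ (n, y) # ys)"
      using Cons.prems by (intro Cons.IH multilin_Cons) auto
    then show ?case using multilin_lin[of F "a # z # xs" ys x n y c] Cons.prems by (simp add: sgn_pow_add fs.scale_right_diff_distrib fscale_sgn_pow)
  qed
qed

lemma multilin_ins2: assumes "multilin F" "snd a \<in> grade A (fst a)" "snd c \<in> grade A (fst c)" shows "multilin (ins2 a c F)"
proof (rule multilinI)
  fix xs n x y k ys assume "tens xs" "tens ys" "x \<in> grade A n" "y \<in> grade A n"
  then show "ins2 a c F (xs @ (n, smul A k x + y) # ys) = fscale k (ins2 a c F (xs @ (n, x) # ys)) + ins2 a c F (xs @ (n, y) # ys)" using assms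
  proof (induction xs arbitrary: F)
    case Nil
    have "ins2 a c (\<lambda>u. F ((n, smul A k x + y) # u)) ys = ins2 a c (\<lambda>u. fscale k (F ((n, x) # u)) + F ((n, y) # u)) ys"
      using Nil by (intro ins2_cong_tens multilin_lin_hd) auto
    then show ?case using multilin_lin_hd[OF multilin_insv[OF multilin_Cons[OF Nil(5,6)] Nil(7)], of ys x n y k] Nil
      by (simp add: ins2_add ins2_scale sgn_pow_add fs.scale_right_distrib fscale_sgn_pow del: insv.simps)
  next
    case (Cons z xs)
    have "ins2 a c (\<lambda>u. F (z # u)) (xs @ (n, smul A k x + y) # ys)
        = fscale k (ins2 a c (\<lambda>u. F (z # u)) (xs @ (n, x) # ys)) + ins2 a c (\<lambda>u. F (z # u)) (xs @ (n, y) # ys)"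
      using Cons.prems by (intro Cons.IH multilin_Cons) auto
    then show ?case using multilin_lin[OF multilin_insv[OF multilin_Cons[OF Cons.prems(5,6)] Cons.prems(7)], of "z # xs" ys x n y k] Cons.prems
      by (simp add: sgn_pow_add fs.scale_right_distrib fscale_sgn_pow del: insv.simps)
  qed
qed

end

section \<open>The three differentials on signed sums of orderings\<close>

context free_chain_algebra
begin

text \<open>The pattern by which the first face cancels the cyclic face: both move one letter into
  the coefficient, from the left or from the right end, and the two recursions of
  \<open>ysum\<close> match them letter by letter.\<close>

lemma ysum_ends: assumes e: "e \<in> gams" "wt e = Suc m"
    and G: "\<And>x r. x \<in> keys e \<Longrightarrow> tens r \<Longrightarrow> length r = m \<Longrightarrow> G (gl x # r) = sgn_pow (k * dg x) (P x r)"
    and H: "\<And>x r. x \<in> keys e \<Longrightarrow> tens r \<Longrightarrow> length r = m \<Longrightarrow>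
      H (r @ [gl x]) = sgn_pow (Suc m + dg x * (k + tdeg r)) (P x r)" shows "ysum (Suc m) e G + ysum (Suc m) e H = 0"
proof -
  have "ysum (Suc m) e H = (\<Sum>x\<in>keys e. - sgn_pow (sg m e x) (ysum m (e - sing x) (\<lambda>r. G (gl x # r))))" unfolding ysum_right[OF e]
  proof (rule sum.cong[OF refl])
    fix x assume x: "x \<in> keys e"
    have w: "wt (e - sing x) = m" using wt_diff_sing[OF x] e(2) by simp
    have g: "ysum m (e - sing x) (\<lambda>r. G (gl x # r)) = sgn_pow (k * dg x) (ysum m (e - sing x) (P x))"
      unfolding ysum_sgn_pow[symmetric] by (intro ysum_cong gams_diff e w G x)
    have h: "ysum m (e - sing x) (\<lambda>r. H (r @ [gl x])) = sgn_pow (Suc m + dg x * (k + mdeg (e - sing x))) (ysum m (e - sing x) (P x))"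
      unfolding ysum_sgn_pow[symmetric] by (intro ysum_cong gams_diff e w) (use H[OF x] in auto)
    show "sgn_pow (sg m e x + (m + dg x * mdeg (e - sing x))) (ysum m (e - sing x) (\<lambda>r. H (r @ [gl x])))
       = - sgn_pow (sg m e x) (ysum m (e - sing x) (\<lambda>r. G (gl x # r)))" unfolding g h sgn_pow_pow by (rule sgn_pow_cong') auto
  qed
  then show ?thesis by (simp add: sum_negf)
qed

lemma tmul_commute': assumes "multilin F" "snd a \<in> grade L (fst a)" "snd x \<in> grade L (fst x)" "tens r" "even (k + l + fst a * fst x)"
  shows "sgn_pow k (F (tmul x a # r)) = sgn_pow l (F (tmul a x # r))"
  unfolding tmul_commute[OF assms(1-4)] sgn_pow_pow by (rule sgn_pow_cong) (use assms(5) in \<open>auto simp: ac_simps\<close>)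

lemma hb_Cons_nonempty: "u \<noteq> [] \<Longrightarrow> hb F (x # u) = F (tmul x (hd u) # tl u) - bet (\<lambda>v. F (x # v)) u + cyc F (x # u)"
  by (simp add: hb_def bet_Cons)

text \<open>Inner faces cancel by \<open>ysum_bet\<close>, the first face and the cyclic face
  against each other. So forms give Hochschild cycles.\<close>

theorem ysum_hb: assumes F: "multilin F" and e: "e \<in> gams" "wt e = n" and a: "snd a \<in> grade L (fst a)"
  shows "ysum n e (\<lambda>u. hb F (a # u)) = 0"
proof (cases n)
  case (Suc m)
  have "ysum n e (\<lambda>u. hb F (a # u)) = ysum n e (\<lambda>u. F (tmul a (hd u) # tl u) - bet (\<lambda>v. F (a # v)) u + cyc F (a # u))"
    using Suc by (intro ysum_cong e hb_Cons_nonempty) auto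
  also have "\<dots> = ysum n e (\<lambda>u. F (tmul a (hd u) # tl u)) + ysum n e (\<lambda>u. cyc F (a # u))"
    unfolding ysum_add ysum_diff using ysum_bet[OF multilin_Cons[OF F a] e] by simp
  also have "\<dots> = 0" unfolding Suc by (rule ysum_ends[where k = 0 and P = "\<lambda>x r. F (tmul a (gl x) # r)"])
      (use e Suc in \<open>auto simp: cyc_snoc intro!: tmul_commute'[OF F a] gen_grade gams_key\<close>)
  finally show ?thesis .
qed simp

text \<open>The chain inserting \<open>a\<close> and \<open>c\<close>, in this order, has a boundary
  that compares the insertion of the product with the insertions of \<open>c\<close> and of
  \<open>a\<close> alone, the other factor being multiplied into \<open>b\<close>. So insertion is a
  derivation up to boundaries.\<close>

theorem ysum_ins2_hb:
  assumes F: "multilin F" and e: "e \<in> gams" "wt e = n" and g: "snd b \<in> grade L (fst b)" "snd a \<in> grade L (fst a)" "snd c \<in> grade L (fst c)"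
  shows "ysum n e (ins2 a c (\<lambda>u. hb F (b # u))) = ysum n e (insv c (\<lambda>u. F (tmul b a # u)))
    - ysum n e (insv (tmul a c) (\<lambda>u. F (b # u))) + sgn_pow (fst a * fst c) (ysum n e (insv a (\<lambda>u. F (tmul b c # u))))"
proof -
  let ?h = "\<lambda>u. F (tmul b (hd u) # tl u)" and ?F = "\<lambda>u. F (b # u)" and ?P = "\<lambda>x. ins2 a c (\<lambda>u. F (tmul b (gl x) # u))"
  have Fb: "multilin ?F" by (rule multilin_Cons[OF F g(1)])
  \<comment> \<open>\<open>H\<close> comes from the first face and \<open>K\<close> from the cyclic
    face, each without the term in which an inserted factor is multiplied into \<open>b\<close>.
    These remainders cancel as in \<open>ysum_ends\<close>.\<close>
  define H where "H w = ins2 a c ?h w - insv c (\<lambda>u. F (tmul b a # u)) w" for w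
  define K where "K w = ins2 a c (\<lambda>u. cyc F (b # u)) w - sgn_pow (fst a * fst c) (insv a (\<lambda>u. F (tmul b c # u)) w)" for w
  have "ins2 a c (\<lambda>u. hb F (b # u)) w = H w + insv c (\<lambda>u. F (tmul b a # u)) w - (bet (ins2 a c ?F) w + insv (tmul a c) ?F w)
      + (K w + sgn_pow (fst a * fst c) (insv a (\<lambda>u. F (tmul b c # u)) w))" if "tens w" for w proof -
    have "ins2 a c (\<lambda>u. hb F (b # u)) w = ins2 a c (\<lambda>u. ?h u - bet ?F u + cyc F (b # u)) w" by (intro ins2_cong hb_Cons_nonempty) auto
    then show ?thesis unfolding ins2_add ins2_diff ins2_bet[OF Fb that g(2,3)] by (simp add: H_def K_def)
  qed
  then have "ysum n e (ins2 a c (\<lambda>u. hb F (b # u))) = ysum n e (\<lambda>w. H w + insv c (\<lambda>u. F (tmul b a # u)) w - (bet (ins2 a c ?F) w + insv (tmul a c) ?F w)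
      + (K w + sgn_pow (fst a * fst c) (insv a (\<lambda>u. F (tmul b c # u)) w)))" by (intro ysum_cong e)
  also have "\<dots> = ysum n e (insv c (\<lambda>u. F (tmul b a # u)))
    - ysum n e (insv (tmul a c) ?F) + sgn_pow (fst a * fst c) (ysum n e (insv a (\<lambda>u. F (tmul b c # u)))) + (ysum n e H + ysum n e K)"
    unfolding ysum_add ysum_diff ysum_sgn_pow using ysum_bet[OF multilin_ins2[OF Fb g(2,3)] e] by simp
  also have "ysum n e H + ysum n e K = 0" proof (cases n)
    case 0
    have "sgn_pow (Suc (Suc (fst c * (fst b + fst a)))) (F [tmul c b, a]) = sgn_pow (fst a * fst c) (F [tmul b c, a])"
      by (rule tmul_commute'[OF F]) (use g in \<open>auto simp: algebra_simps\<close>)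
    then show ?thesis using 0 cyc_snoc[of F b "[a]" c] by (simp add: H_def K_def)
  next
    case (Suc m)
    show ?thesis unfolding Suc proof (rule ysum_ends[where k = "fst a + fst c" and P = ?P])
      fix x r assume x: "x \<in> keys e" and r: "tens r" "length r = m"
      have gx: "snd (gl x) \<in> grade L (fst (gl x))" by (rule gl_grade[OF gams_key[OF e(1) x]])
      show "H (gl x # r) = sgn_pow ((fst a + fst c) * dg x) (?P x r)" by (simp add: H_def)
      have 1: "ins2 a c (\<lambda>u. cyc F (b # u @ [gl x])) r = sgn_pow (Suc m + dg x * (fst a + fst c + tdeg r)) (?P x r)"
        unfolding ins2_sgn_pow[symmetric] by (rule ins2_cong_tens) (use g gx r in \<open>auto simp: cyc_snoc intro!: tmul_commute'[OF F]\<close>)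
      have 2: "insv a (\<lambda>u. cyc F (b # u @ [c])) (r @ [gl x])
          = sgn_pow (fst c * fst b + (Suc m + fst c * (fst b + (fst a + (tdeg r + dg x))))) (insv a (\<lambda>u. F (tmul b c # u)) (r @ [gl x]))"
        unfolding insv_sgn_pow[symmetric] by (rule insv_cong_tens) (use g gx r in \<open>auto simp: cyc_snoc intro!: tmul_commute'[OF F]\<close>)
      have 3: "sgn_pow (Suc m + fst c * (tdeg r + dg x)) (sgn_pow (fst c * fst b + (Suc m + fst c * (fst b + (fst a + (tdeg r + dg x))))) v)
         = sgn_pow (fst a * fst c) v" for v :: "'b \<Rightarrow>\<^sub>0 'k" unfolding sgn_pow_pow by (rule sgn_pow_cong) auto
      show "K (r @ [gl x]) = sgn_pow (Suc m + dg x * (fst a + fst c + tdeg r)) (?P x r)" unfolding K_def ins2_snoc 1 r(2) fst_conv 2 3 by simp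
    qed (use e Suc in auto)
  qed
  finally show ?thesis by simp
qed

text \<open>Rotating puts \<open>a\<close> into each position, with the letters rotated around it.
  The sum over orderings is invariant under rotation, so only the position of \<open>a\<close> and
  its sign matter.\<close>

theorem ysum_nrm: assumes e: "e \<in> gams" "wt e = n" shows "ysum n e (\<lambda>u. nrm G (a # u)) = ysum n e (insv a G)"
proof -
  define K where "K j w = sgn_pow (j + fst a * tdeg (take j w)) (G (take j w @ a # drop j w))" for j w
  have "nrm G (a # u) = K 0 u + (\<Sum>k<n. (rot ^^ k) (K (n - k)) u)" if u: "length u = n" for u proof -
    have "(rot ^^ Suc k) G (a # u) = (rot ^^ k) (K (n - k)) u" if k: "k < n" for k proof -
      have "(rot ^^ k) (K (n - k)) u = sgn_pow (k * (n - 1) + tdeg (take k u) * tdeg (drop k u)) (K (n - k) (drop k u @ take k u))"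
        using rot_pow[of k u "K (n - k)"] k u by simp
      also have "K (n - k) (drop k u @ take k u) = sgn_pow (n - k + fst a * tdeg (drop k u)) (G (drop k u @ a # take k u))"
        using k u by (simp add: K_def)
      finally have 1: "(rot ^^ k) (K (n - k)) u = sgn_pow (k * (n - 1) + tdeg (take k u) * tdeg (drop k u) + (n - k + fst a * tdeg (drop k u))) (G (drop k u @ a # take k u))"
        by simp
      have 2: "(rot ^^ Suc k) G (a # u) = sgn_pow (Suc k * n + (fst a + tdeg (take k u)) * tdeg (drop k u)) (G (drop k u @ a # take k u))"
        using rot_pow[of "Suc k" "a # u" G] k u by simp
      obtain l where l: "n = Suc (k + l)" using less_imp_Suc_add[OF k] by blast
      then have "n - k = Suc l" "n - 1 = k + l" by auto
      then show ?thesis unfolding 1 2 by (intro sgn_pow_cong refl) (auto simp: l)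
    qed
    then show ?thesis by (simp add: nrm_def u sum.lessThan_Suc_shift K_def del: sum.lessThan_Suc funpow.simps(2))
  qed
  then have "ysum n e (\<lambda>u. nrm G (a # u)) = ysum n e (\<lambda>u. K 0 u + (\<Sum>k<n. (rot ^^ k) (K (n - k)) u))" by (intro ysum_cong e)
  also have "\<dots> = ysum n e (K 0) + (\<Sum>k<n. ysum n e (K (n - k)))" unfolding ysum_add ysum_sum ysum_rot_pow[OF e] ..
  also have "(\<Sum>k<n. ysum n e (K (n - k))) = (\<Sum>k<n. ysum n e (K (Suc k)))"
    by (subst sum.nat_diff_reindex[symmetric]) (simp add: Suc_diff_Suc)
  also have "ysum n e (K 0) + \<dots> = ysum n e (\<lambda>u. \<Sum>k<Suc n. K k u)" unfolding ysum_sum by (simp only: sum.lessThan_Suc_shift)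
  also have "\<dots> = ysum n e (insv a G)" by (intro ysum_cong e) (auto simp: insv_nth K_def lessThan_Suc_atMost simp del: sum.lessThan_Suc)
  finally show ?thesis .
qed

text \<open>One letter, in any position, is replaced by its boundary. Drawing out this letter
  instead of the first one rewrites the sum as insertions of the boundary into the orderings of the
  rest.\<close>

theorem ysum_bd: "e \<in> gams \<Longrightarrow> wt e = n \<Longrightarrow> ysum n e (bd L F) = (\<Sum>x\<in>keys e.
    if dg x > 0 then sgn_pow (sg (n - 1) e x) (ysum (n - 1) (e - sing x) (insv (dg x - 1, bdry L (gen x)) F)) else 0)"
proof (induction n arbitrary: e F)
  case 0
  then show ?case by (simp add: wt_eq_0)
next
  case (Suc n)
  note e = \<open>e \<in> gams\<close>
  let ?d = "\<lambda>x. (dg x - 1, bdry L (gen x))"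
  define A where "A x = (if dg x > 0 then sgn_pow (sg n e x) (ysum n (e - sing x) (\<lambda>u. F (?d x # u))) else 0)" for x
  have L: "ysum (Suc n) e (bd L F) = (\<Sum>x\<in>keys e. A x) + (\<Sum>x\<in>keys e. sgn_pow (sg n e x + dg x) (ysum n (e - sing x) (bd L (\<lambda>u. F (gl x # u)))))"
    unfolding sum.distrib[symmetric] ysum.simps by (intro sum.cong refl) (simp add: A_def ysum_add ysum_sgn_pow sgn_pow_add)
  show ?case proof (cases n)
    case 0
    have "e - sing x = 0" if "x \<in> keys e" for x using wt_diff_sing[OF that] 0 Suc.prems by (simp add: wt_eq_0)
    then show ?thesis unfolding L using 0 by (auto simp: A_def intro!: sum.cong)
  next
    case (Suc m)
    define Y where "Y x z = (if dg z > 0 then ysum m (e - sing x - sing z) (insv (?d z) (\<lambda>u. F (gl x # u))) else 0)" for x z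
    have 1: "sgn_pow (sg n e x + dg x) (ysum n (e - sing x) (bd L (\<lambda>u. F (gl x # u))))
      = (\<Sum>z\<in>keys (e - sing x). sgn_pow (sg n e x + dg x + sg m (e - sing x) z) (Y x z))" if x: "x \<in> keys e" for x proof -
      have "wt (e - sing x) = n" using wt_diff_sing[OF x] Suc.prems by simp
      from Suc.IH[OF gams_diff[OF e] this] show ?thesis by (simp del: ysum.simps) (auto simp: Y_def sgn_pow_sum Suc intro!: sum.cong)
    qed
    have "ysum (Suc n) e (bd L F) = (\<Sum>x\<in>keys e. A x)
      + (\<Sum>z\<in>keys e. \<Sum>x\<in>keys (e - sing z). sgn_pow (sg n e x + dg x + sg m (e - sing x) z) (Y x z))"
      unfolding L by (subst sum_pair_swap) (rule arg_cong2[where f = "(+)", OF refl sum.cong[OF refl]], rule 1)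
    also have "\<dots> = (\<Sum>z\<in>keys e. if dg z > 0 then sgn_pow (sg n e z) (ysum n (e - sing z) (insv (?d z) F)) else 0)"
      unfolding sum.distrib[symmetric] proof (rule sum.cong[OF refl])
      fix z assume z: "z \<in> keys e"
      show "A z + (\<Sum>x\<in>keys (e - sing z). sgn_pow (sg n e x + dg x + sg m (e - sing x) z) (Y x z))
        = (if dg z > 0 then sgn_pow (sg n e z) (ysum n (e - sing z) (insv (?d z) F)) else 0)" proof (cases "dg z > 0")
        case True
        \<comment> \<open>The exponent \<open>dg x\<close> for passing \<open>bd\<close> over
          \<open>x\<close> completes \<open>(dg z - 1) * dg x\<close> to \<open>dg z * dg x\<close>,
          the term that appears in \<open>sg_swap\<close>.\<close>
        have "sgn_pow (sg n e x + dg x + sg m (e - sing x) z) (Y x z)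
          = - sgn_pow (sg n e z + (sg m (e - sing z) x + (dg z - 1) * dg x)) (Y x z)" if x: "x \<in> keys (e - sing z)" for x
        proof (rule sgn_pow_cong'[OF _ refl])
          obtain k where k: "dg z = Suc k" using True gr0_implies_Suc by blast
          show "odd (sg n e x + dg x + sg m (e - sing x) z + (sg n e z + (sg m (e - sing z) x + (dg z - 1) * dg x)))" proof (cases "x = z")
            case True
            then have "odd (dg x)" by (metis e x odd_key)
            then show ?thesis using True k by auto
          next
            case False
            then have "x \<in> keys e" using x by (simp add: keys_diff_sing)
            from sg_swap[OF e this z False, of m] show ?thesis using k Suc by auto
          qed
        qed
        then have "(\<Sum>x\<in>keys (e - sing z). sgn_pow (sg n e x + dg x + sg m (e - sing x) z) (Y x z))
           = - sgn_pow (sg n e z) (\<Sum>x\<in>keys (e - sing z). sgn_pow (sg m (e - sing z) x + (dg z - 1) * dg x) (Y x z))"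
          by (simp add: sum_negf sgn_pow_sum)
        moreover have "ysum n (e - sing z) (insv (?d z) F) = ysum n (e - sing z) (\<lambda>u. F (?d z # u))
           - (\<Sum>x\<in>keys (e - sing z). sgn_pow (sg m (e - sing z) x + (dg z - 1) * dg x) (Y x z))"
          using True by (simp add: Suc ysum_diff ysum_sgn_pow sgn_pow_diff sum_subtractf Y_def diff_right_commute[of e "sing z"])
        ultimately show ?thesis using True by (simp add: A_def sgn_pow_diff)
      qed (simp add: A_def Y_def)
    qed
    finally show ?thesis unfolding diff_Suc_1 .
  qed
qed

end

section \<open>Insertion of a generator as multiplication in divided powers\<close>

context free_chain_algebra
begin

lemma gamma_coeff_sing: assumes "e \<in> gams" shows "gamma_coeff dg (sing z) e =
    (if even (dg z) then if z \<in> keys e then 0 else (- 1) ^ ecnt e z else int (lookup e z) + 1)"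
proof -
  have 1: "(\<exists>x. even (dg x) \<and> lookup (sing z) x + lookup e x > 1) \<longleftrightarrow> even (dg z) \<and> z \<in> keys e"
    using assms by (auto simp: gams_iff in_keys_iff intro!: exI[of _ z] split: if_splits)
  let ?C = "{(x, y). x \<in> keys (sing z) \<and> y \<in> keys e \<and> even (dg x) \<and> even (dg y) \<and> y < x}"
  have "?C = (if even (dg z) then (\<lambda>y. (z, y)) ` {y \<in> keys e. even (dg y) \<and> y < z} else {})" by auto
  then have 2: "card ?C = (if even (dg z) then ecnt e z else 0)" by (auto simp: ecnt_def card_image inj_on_def)
  have "(\<Prod>x\<in>keys (sing z) \<union> keys e. int ((lookup (sing z) x + lookup e x) choose lookup (sing z) x))
    = (\<Prod>x\<in>insert z (keys e). if x = z then int (Suc (lookup e z)) else 1)" by (intro prod.cong) auto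
  also have "\<dots> = int (lookup e z) + 1" by (simp add: prod.delta)
  finally show ?thesis unfolding gamma_coeff_def 1 2 by (auto simp: in_keys_iff)
qed

lemma fscale_of_int_sgn_pow: "fscale (of_int (sgn_pow k c)) v = sgn_pow k (fscale (of_int c) v)" by (simp add: sgn_pow_def)

text \<open>Inserting \<open>z\<close> into all orderings of \<open>e\<close> produces each ordering
  of \<open>e + sing z\<close> as often as \<open>z\<close> occurs in it, which is the product rule
  of divided powers. For exterior \<open>z\<close> there is only a sign, or zero if \<open>z\<close>
  occurs already.\<close>

theorem ysum_insv_gen:
  fixes F :: "'l tensor \<Rightarrow> 'c \<Rightarrow>\<^sub>0 'k"
  shows "e \<in> gams \<Longrightarrow> wt e = n \<Longrightarrow> z \<in> X \<Longrightarrow> ysum n e (insv (gl z) F)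
    = sgn_pow (n * dg z) (fscale (of_int (gamma_coeff dg (sing z) e)) (ysum (Suc n) (e + sing z) F))"
proof (induction n arbitrary: e F)
  case 0
  then have "e = 0" by (simp add: wt_eq_0)
  then show ?case using gamma_coeff_sing[OF 0(1), of z] by (auto simp: sg_def ecnt_def conj_commute[of "_ = z"] cong: conj_cong)
next
  case (Suc n)
  note e = \<open>e \<in> gams\<close>
  let ?K = "keys e"
  let ?c = "\<lambda>e. gamma_coeff dg (sing z) e"
  define T where "T x = ysum (Suc n) (e + sing z - sing x) (\<lambda>u. F (gl x # u))" for x
  \<comment> \<open>Coefficients of the orderings that start with \<open>x\<close>:
    \<open>\<alpha>\<close> from insertions behind \<open>x\<close>, \<open>\<beta>\<close> on the
    right-hand side. Insertion in front contributes 1 for \<open>x = z\<close>.\<close>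
  define \<alpha> :: "'x \<Rightarrow> int" where "\<alpha> x = sgn_pow (sg n e x + dg z * dg x + n * dg z) (?c (e - sing x))" for x
  define \<beta> :: "'x \<Rightarrow> int" where "\<beta> x = sgn_pow (Suc n * dg z + sg (Suc n) (e + sing z) x) (?c e)" for x
  have k: "keys (e + sing z) = insert z ?K" by (auto simp: in_keys_iff lookup_add split: if_splits)
  have "sgn_pow (sg n e x) (ysum n (e - sing x) (\<lambda>u. insv (gl z) F (gl x # u)))
     = sgn_pow (sg n e x) (ysum n (e - sing x) (\<lambda>u. F (gl z # gl x # u))) - fscale (of_int (\<alpha> x)) (T x)" if x: "x \<in> ?K" for x
  proof -
    have w: "wt (e - sing x) = n" using wt_diff_sing[OF x] Suc.prems by simp
    have "e - sing x + sing z = e + sing z - sing x"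
      by (rule poly_mapping_eqI) (use x in \<open>auto simp: lookup_add lookup_minus in_keys_iff\<close>)
    then show ?thesis using Suc.IH[OF gams_diff[OF e] w \<open>z \<in> X\<close>, of "\<lambda>u. F (gl x # u)"]
      by (simp add: ysum_diff ysum_sgn_pow sgn_pow_diff T_def \<alpha>_def fscale_of_int_sgn_pow add.assoc del: ysum.simps(2))
  qed
  then have "ysum (Suc n) e (insv (gl z) F) = ysum (Suc n) e (\<lambda>u. F (gl z # u)) - (\<Sum>x\<in>?K. fscale (of_int (\<alpha> x)) (T x))"
    by (simp add: sum_subtractf)
  also have "\<dots> = (\<Sum>x\<in>insert z ?K. fscale (of_int ((if x = z then 1 else 0) - (if x \<in> ?K then \<alpha> x else 0))) (T x))" proof -
    have "(\<Sum>x\<in>insert z ?K. fscale (of_int (if x = z then 1 else 0)) (T x)) = (\<Sum>x\<in>insert z ?K. if x = z then T x else 0)"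
      by (intro sum.cong) auto
    moreover have "(\<Sum>x\<in>insert z ?K. fscale (of_int (if x \<in> ?K then \<alpha> x else 0)) (T x)) = (\<Sum>x\<in>?K. fscale (of_int (\<alpha> x)) (T x))"
      by (cases "z \<in> ?K") (auto simp: insert_absorb intro!: sum.cong)
    ultimately show ?thesis by (simp add: fs.scale_left_diff_distrib sum_subtractf T_def del: ysum.simps(2))
  qed
  also have "\<dots> = (\<Sum>x\<in>insert z ?K. fscale (of_int (\<beta> x)) (T x))"
  proof (intro sum.cong refl arg_cong2[where f = fscale] arg_cong[where f = of_int])
    fix x assume x: "x \<in> insert z ?K"
    show "(if x = z then 1 else 0) - (if x \<in> ?K then \<alpha> x else 0) = \<beta> x" proof (cases "even (dg z)")
      case z: True
      show ?thesis proof (cases "z \<in> ?K")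
        case True
        then have "lookup e z = 1" using e z by (auto simp: gams_iff in_keys_iff le_Suc_eq)
        then have k0: "z \<notin> keys (e - sing z)" by (simp add: in_keys_iff lookup_minus)
        then show ?thesis using z True x gamma_coeff_sing[OF e, of z] gamma_coeff_sing[OF gams_diff[OF e], of z x] ecnt_diff[OF e True, of z]
          by (cases "x = z") (auto simp: \<alpha>_def \<beta>_def sg_def keys_diff_sing sgn_pow_def)
      next
        case False
        have ez: "e + sing z \<in> gams" using e False Suc.prems(3) unfolding gams_iff k by (auto simp: in_keys_iff lookup_add)
        have kz: "z \<in> keys (e + sing z)" using k by simp
        show ?thesis proof (cases "x = z")
          case True
          then show ?thesis using False z gamma_coeff_sing[OF e, of z] ecnt_diff[OF ez kz, of z] by (auto simp: \<beta>_def sg_def sgn_pow_def)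
        next
          case neq: False
          then have xk: "x \<in> ?K" using x by simp
          then have "x < z \<or> z < x" using neq by auto
          then show ?thesis
            using z neq False xk gamma_coeff_sing[OF e, of z] gamma_coeff_sing[OF gams_diff[OF e], of z x] ecnt_diff[OF e xk, of z] ecnt_diff[OF ez kz, of x]
            by (auto simp: \<alpha>_def \<beta>_def sg_def sgn_pow_def keys_diff_sing)
        qed
      qed
    next
      case z: False
      have ec: "ecnt (e + sing z) x = ecnt e x" unfolding ecnt_def k using z by (intro arg_cong[where f = card]) auto
      show ?thesis proof (cases "x = z")
        case True
        then show ?thesis using z gamma_coeff_sing[OF e, of z] gamma_coeff_sing[OF gams_diff[OF e], of z z]
          by (auto simp: \<alpha>_def \<beta>_def sg_def sgn_pow_def in_keys_iff lookup_minus)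
      next
        case neq: False
        then show ?thesis using x z gamma_coeff_sing[OF e, of z] gamma_coeff_sing[OF gams_diff[OF e], of z x]
          by (auto simp: \<alpha>_def \<beta>_def sg_def sgn_pow_def ec lookup_minus)
      qed
    qed
  qed
  also have "\<dots> = sgn_pow (Suc n * dg z) (fscale (of_int (?c e)) (ysum (Suc (Suc n)) (e + sing z) F))"
    unfolding ysum.simps(2)[of "Suc n"] k fs.scale_sum_right sgn_pow_sum T_def[symmetric]
    by (intro sum.cong refl) (simp add: \<beta>_def fscale_of_int_sgn_pow fscale_sgn_pow)
  finally show ?case .
qed

end

section \<open>The algebra of forms\<close>

lemma gamma_coeff_superset: assumes "finite S" "keys e \<union> keys f \<subseteq> S" shows "gamma_coeff dg e f =
     (if \<exists>x. even (dg x) \<and> lookup e x + lookup f x > 1 then 0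
      else (- 1) ^ card {(x, y). x \<in> keys e \<and> y \<in> keys f \<and> even (dg x) \<and> even (dg y) \<and> y < x}
         * (\<Prod>x\<in>S. int ((lookup e x + lookup f x) choose lookup e x)))"
proof -
  have "(\<Prod>x\<in>keys e \<union> keys f. int ((lookup e x + lookup f x) choose lookup e x))
    = (\<Prod>x\<in>S. int ((lookup e x + lookup f x) choose lookup e x))"
    by (rule prod.mono_neutral_left) (use assms in \<open>auto simp: in_keys_iff\<close>)
  then show ?thesis unfolding gamma_coeff_def by (simp only:)
qed

lemma single_sgn_pow: "single e (sgn_pow n a) = sgn_pow n (single e a)" by (simp add: sgn_pow_def single_uminus)

lemma finite_key_pairs: "finite {(x, y). x \<in> keys e \<and> y \<in> keys f \<and> P x y}"
  by (rule finite_subset[of _ "keys e \<times> keys f"]) auto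

text \<open>Inversions of exterior letters add up over the pairs among three monomials, and the
  binomial coefficients agree as trinomial ones. If an exterior letter occurs twice in total, both
  sides are zero.\<close>

theorem gamma_coeff_assoc:
  "gamma_coeff dg e f * gamma_coeff dg (e + f) g = gamma_coeff dg e (f + g) * gamma_coeff dg f g"
proof (cases "\<exists>x. even (dg x) \<and> lookup e x + lookup f x + lookup g x > 1")
  case True
  then have "gamma_coeff dg (e + f) g = 0" "gamma_coeff dg e (f + g) = 0" unfolding gamma_coeff_def by (auto simp: lookup_add add.assoc)
  then show ?thesis by simp
next
  case False
  then have le: "lookup e x + lookup f x + lookup g x \<le> 1" if "even (dg x)" for x using that by (meson not_le)
  define S where "S = keys e \<union> keys f \<union> keys g"
  define I where "I e f = {(x, y). x \<in> keys e \<and> y \<in> keys f \<and> even (dg x) \<and> even (dg y) \<and> y < x}"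
    for e f :: "'a \<Rightarrow>\<^sub>0 nat"
  have fin: "finite (I a b)" for a b unfolding I_def by (rule finite_key_pairs)
  have d: "x \<notin> keys e \<or> x \<notin> keys f" "x \<notin> keys g \<or> x \<notin> keys f" if "even (dg x)" for x
    using le[OF that] by (auto simp: in_keys_iff)
  have "I (e + f) g = I e g \<union> I f g" "I e (f + g) = I e f \<union> I e g" by (auto simp: I_def keys_add_nat)
  moreover have "I e g \<inter> I f g = {}" "I e f \<inter> I e g = {}" using d by (auto simp: I_def)
  ultimately have I: "card (I (e + f) g) = card (I e g) + card (I f g)" "card (I e (f + g)) = card (I e f) + card (I e g)"
    by (simp_all add: card_Un_disjoint fin)
  have S: "finite S" "keys (e + f) \<subseteq> S" "keys (f + g) \<subseteq> S"
    "keys e \<subseteq> S" "keys f \<subseteq> S" "keys g \<subseteq> S" by (auto simp: S_def keys_add_nat)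
  define \<pi> where "\<pi> e f = (\<Prod>x\<in>S. int ((lookup e x + lookup f x) choose lookup e x))" for e f
  have g: "gamma_coeff dg a b = (- 1) ^ card (I a b) * \<pi> a b"
    if "keys a \<subseteq> S" "keys b \<subseteq> S" "\<And>x. even (dg x) \<Longrightarrow> lookup a x + lookup b x \<le> 1" for a b proof -
    have "\<not> (\<exists>x. even (dg x) \<and> lookup a x + lookup b x > 1)" using that(3) by (meson not_le)
    moreover have "keys a \<union> keys b \<subseteq> S" using that(1,2) by simp
    ultimately show ?thesis unfolding I_def \<pi>_def using gamma_coeff_superset[OF S(1), of a b dg] by (simp only: if_not_P simp_thms if_False)
  qed
  have "\<pi> e f * \<pi> (e + f) g = \<pi> e (f + g) * \<pi> f g" unfolding \<pi>_def prod.distrib[symmetric] proof (rule prod.cong[OF refl])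
    fix x
    let ?e = "lookup e x" and ?f = "lookup f x" and ?g = "lookup g x"
    have "((?f + ?g + ?e) choose (?f + ?e)) * ((?f + ?e) choose ?e) = ((?f + ?g + ?e) choose ?e) * ((?f + ?g) choose ?f)" by (rule choose_mult_lemma)
    then have "int (((?f + ?g + ?e) choose (?f + ?e)) * ((?f + ?e) choose ?e)) = int (((?f + ?g + ?e) choose ?e) * ((?f + ?g) choose ?f))" by simp
    then show "int ((?e + ?f) choose ?e) * int ((lookup (e + f) x + ?g) choose (lookup (e + f) x))
      = int ((?e + lookup (f + g) x) choose ?e) * int ((?f + ?g) choose ?f)" by (simp add: lookup_add ac_simps)
  qed
  moreover have "gamma_coeff dg e f = (- 1) ^ card (I e f) * \<pi> e f" by (rule g[OF S(4,5)]) (drule le, simp)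
  moreover have "gamma_coeff dg (e + f) g = (- 1) ^ card (I (e + f) g) * \<pi> (e + f) g" by (rule g[OF S(2,6)]) (drule le, simp add: lookup_add)
  moreover have "gamma_coeff dg e (f + g) = (- 1) ^ card (I e (f + g)) * \<pi> e (f + g)" by (rule g[OF S(4,3)]) (drule le, simp add: lookup_add)
  moreover have "gamma_coeff dg f g = (- 1) ^ card (I f g) * \<pi> f g" by (rule g[OF S(5,6)]) (drule le, simp)
  ultimately show ?thesis unfolding I by (simp add: power_add ac_simps)
qed

text \<open>A pair of exterior letters, one from each monomial, is an inversion for exactly one
  order of the two factors.\<close>

theorem gamma_coeff_commute:
  "gamma_coeff dg e f = (- 1) ^ (card {x \<in> keys e. even (dg x)} * card {x \<in> keys f. even (dg x)}) * gamma_coeff dg f e"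
proof (cases "\<exists>x. even (dg x) \<and> lookup e x + lookup f x > 1")
  case True
  then show ?thesis unfolding gamma_coeff_def by (simp add: add.commute)
next
  case False
  then have le: "lookup e x + lookup f x \<le> 1" if "even (dg x)" for x using that by (meson not_le)
  let ?I = "\<lambda>e f. {(x, y). x \<in> keys e \<and> y \<in> keys f \<and> even (dg x) \<and> even (dg y) \<and> y < x}"
  let ?P = "\<lambda>e f. \<Prod>x\<in>keys e \<union> keys f. int ((lookup e x + lookup f x) choose lookup e x)"
  have d: "x \<notin> keys e \<or> x \<notin> keys f" if "even (dg x)" for x using le[OF that] by (auto simp: in_keys_iff)
  have "{x \<in> keys e. even (dg x)} \<times> {x \<in> keys f. even (dg x)} = ?I e f \<union> prod.swap ` ?I f e" proof (intro set_eqI)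
    fix p :: "'a \<times> 'a"
    obtain x y where p: "p = (x, y)" by fastforce
    have "p \<in> prod.swap ` ?I f e \<longleftrightarrow> (y, x) \<in> ?I f e" unfolding p by force
    then show "p \<in> {x \<in> keys e. even (dg x)} \<times> {x \<in> keys f. even (dg x)} \<longleftrightarrow> p \<in> ?I e f \<union> prod.swap ` ?I f e"
      using d[of x] p by (cases x y rule: linorder_cases) auto
  qed
  moreover have "?I e f \<inter> prod.swap ` ?I f e = {}" by auto
  moreover have "card (prod.swap ` ?I f e) = card (?I f e)" by (rule card_image) (auto simp: inj_on_def)
  moreover have "finite (?I e f)" "finite (prod.swap ` ?I f e)" by (intro finite_imageI finite_key_pairs)+
  ultimately have c: "card {x \<in> keys e. even (dg x)} * card {x \<in> keys f. even (dg x)} = card (?I e f) + card (?I f e)"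
    unfolding card_cartesian_product[symmetric] by (simp only: card_Un_disjoint)
  have "?P e f = ?P f e" by (rule prod.cong) (auto simp: Un_commute add.commute binomial_symmetric[of "lookup e _"])
  then show ?thesis unfolding c using False by (simp add: gamma_coeff_def add.commute power_add mult.assoc[symmetric])
qed

context free_chain_algebra
begin

text \<open>The module of admissible coefficients at the exponent \<open>e\<close>, zero if the
  degrees do not fit. Membership in \<open>forms\<close> becomes a condition on each coefficient,
  which makes its closure properties immediate.\<close>

definition cell :: "nat \<Rightarrow> nat \<Rightarrow> 'x mono \<Rightarrow> 'l set" where
  "cell p q e = (if e \<in> gams \<and> wt e = q \<and> mdeg e \<le> p then grade L (p - mdeg e) else {0})"

abbreviation fm :: "nat \<Rightarrow> nat \<Rightarrow> ('x, 'l) forms set" where "fm \<equiv> forms L X dg"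
abbreviation FM (infixl "\<odot>" 70) where "u \<odot> v \<equiv> forms_mult L dg u v"
abbreviation tw where "tw \<equiv> koszul_twist L"

lemma cell_subspace: "sm.subspace (cell p q e)" by (simp add: cell_def grade_subspace sm.subspace_single_0)

lemma fm_iff: "\<omega> \<in> fm p q \<longleftrightarrow> (\<forall>e. lookup \<omega> e \<in> cell p q e)"
proof -
  have "(e \<in> gams \<and> wt e = q \<and> (\<exists>n. n + mdeg e = p \<and> a \<in> grade L n)) \<longleftrightarrow> a \<in> cell p q e" if "a \<noteq> 0" for a e
    using that by (auto simp: cell_def intro: exI[of _ "p - mdeg e"])
  then show ?thesis unfolding forms_def using sm.subspace_0[OF cell_subspace] by (auto simp: in_keys_iff)
qed

lemma fm_0: "0 \<in> fm p q" and fm_add: "u \<in> fm p q \<Longrightarrow> v \<in> fm p q \<Longrightarrow> u + v \<in> fm p q"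
  and fm_minus: "u \<in> fm p q \<Longrightarrow> - u \<in> fm p q"
  unfolding fm_iff using sm.subspace_0[OF cell_subspace] sm.subspace_add[OF cell_subspace] sm.subspace_neg[OF cell_subspace]
  by (auto simp: lookup_add)

lemma fm_sum: "(\<And>i. i \<in> I \<Longrightarrow> u i \<in> fm p q) \<Longrightarrow> (\<Sum>i\<in>I. u i) \<in> fm p q"
  by (induction I rule: infinite_finite_induct) (auto intro: fm_0 fm_add)

lemma fm_sgn_pow: "u \<in> fm p q \<Longrightarrow> sgn_pow n u \<in> fm p q" by (simp add: sgn_pow_def fm_minus)

lemma lookup_forms_scale [simp]: "lookup (forms_scale L k \<omega>) e = smul L k (lookup \<omega> e)"
  by (simp add: forms_scale_def map.rep_eq when_def)

lemma fm_scale: "u \<in> fm p q \<Longrightarrow> forms_scale L k u \<in> fm p q" unfolding fm_iff using sm.subspace_scale[OF cell_subspace] by auto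

lemma fm_single: "e \<in> gams \<Longrightarrow> a \<in> grade L m \<Longrightarrow> p = m + mdeg e \<Longrightarrow> q = wt e \<Longrightarrow> single e a \<in> fm p q"
  unfolding fm_iff using grade_0 by (auto simp: cell_def lookup_single when_def)

lemma cell_cases: assumes "a \<in> cell p q e" obtains "a = 0" | m where "e \<in> gams" "a \<in> grade L m" "p = m + mdeg e" "q = wt e"
proof (cases "e \<in> gams \<and> wt e = q \<and> mdeg e \<le> p")
  case True
  then show ?thesis using assms that(2)[of "p - mdeg e"] by (auto simp: cell_def)
next
  case False
  then have "a = 0" using assms by (auto simp: cell_def split: if_splits)
  then show ?thesis by (rule that(1))
qed

lemma fm_total: "u \<in> fm p q \<Longrightarrow> u \<in> forms_total L X dg (p + q)" unfolding forms_def forms_total_def by fastforce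

lemma fm_all: "u \<in> fm p q \<Longrightarrow> u \<in> all_forms X dg" unfolding forms_def all_forms_def by auto

lemma fm_induct [consumes 1, case_names 0 single]: assumes "u \<in> fm p q" and "P 0"
    and "\<And>e a m v. e \<in> gams \<Longrightarrow> a \<in> grade L m \<Longrightarrow> p = m + mdeg e \<Longrightarrow> q = wt e \<Longrightarrow> v \<in> fm p q \<Longrightarrow> P v \<Longrightarrow>
      P (single e a + v)" shows "P u"
proof -
  have "finite S \<Longrightarrow> P (\<Sum>e\<in>S. single e (lookup u e)) \<and> (\<Sum>e\<in>S. single e (lookup u e)) \<in> fm p q" for S
  proof (induction S rule: finite_induct)
    case empty
    then show ?case by (simp add: assms(2) fm_0)
  next
    case (insert e S)
    have c: "lookup u e \<in> cell p q e" using assms(1) fm_iff by blast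
    from this show ?case proof (cases rule: cell_cases)
      case 1
      then show ?thesis using insert by simp
    next
      case (2 m)
      then show ?thesis using insert assms(3) fm_add[OF fm_single[OF 2]] by auto
    qed
  qed
  moreover have "(\<Sum>e\<in>keys u. single e (lookup u e)) = u" by (rule poly_mapping_eqI) (simp add: lookup_sum lookup_single when_def in_keys_iff)
  ultimately show ?thesis by (metis finite_keys)
qed

lemma tw_grade: assumes "a \<in> grade L m" shows "tw n a = sgn_pow (n * m) a"
proof -
  let ?f = "\<lambda>i. if i = m then a else 0"
  have f: "{i. ?f i \<noteq> 0} = (if a = 0 then {} else {m})" by auto
  have "is_decomposition L a ?f" unfolding is_decomposition_def f using assms grade_0 by auto
  then have "(THE f. is_decomposition L a f) = ?f" using grade_direct[of a] by (rule the1_equality[rotated])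
  then show ?thesis unfolding koszul_twist_def Let_def by (simp only: f) (auto simp: sgn_pow_def)
qed

lemma tw_0 [simp]: "tw n 0 = 0" using tw_grade[of 0 0 n] grade_0 by simp

lemma tw_add: assumes "a \<in> cell p q e" "b \<in> cell p q e" shows "tw n (a + b) = tw n a + tw n b"
proof (cases "e \<in> gams \<and> wt e = q \<and> mdeg e \<le> p")
  case True
  then show ?thesis using assms tw_grade[OF sm.subspace_add[OF grade_subspace]] by (simp add: cell_def tw_grade sgn_pow_add)
next
  case False
  then have "a = 0" "b = 0" using assms by (auto simp: cell_def split: if_splits)
  then show ?thesis by simp
qed

definition edeg :: "'x mono \<Rightarrow> nat" where "edeg e = mdeg e + wt e"

lemma FM_superset: assumes "finite S" "keys u \<subseteq> S" "finite T" "keys v \<subseteq> T"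
  shows "u \<odot> v = (\<Sum>e\<in>S. \<Sum>f\<in>T. single (e + f)
    (smul L (of_int (gamma_coeff dg e f)) (lookup u e * tw (edeg e) (lookup v f))))"
proof -
  let ?s = "\<lambda>e f. single (e + f) (smul L (of_int (gamma_coeff dg e f)) (lookup u e * tw (edeg e) (lookup v f)))"
  have "u \<odot> v = (\<Sum>e\<in>keys u. \<Sum>f\<in>keys v. ?s e f)" by (simp add: forms_mult_def edeg_def)
  also have "\<dots> = (\<Sum>e\<in>keys u. \<Sum>f\<in>T. ?s e f)"
    using assms by (intro sum.cong refl sum.mono_neutral_left) (auto simp: in_keys_iff)
  also have "\<dots> = (\<Sum>e\<in>S. \<Sum>f\<in>T. ?s e f)" using assms by (intro sum.mono_neutral_left) (auto simp: in_keys_iff)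
  finally show ?thesis .
qed

lemma FM_single: "single e a \<odot> single f b
    = single (e + f) (smul L (of_int (gamma_coeff dg e f)) (a * tw (edeg e) b))" using FM_superset[of "{e}" "single e a" "{f}" "single f b"] by simp

lemma FM_0 [simp]: "0 \<odot> v = 0" "u \<odot> 0 = 0" by (simp_all add: forms_mult_def)

lemma FM_add_left: "(u + u') \<odot> v = u \<odot> v + u' \<odot> v"
proof -
  let ?S = "keys u \<union> keys u'"
  have "finite ?S" "keys (u + u') \<subseteq> ?S" by (simp, rule keys_add)
  then show ?thesis by (simp add: FM_superset[of ?S _ "keys v" v] lookup_add distrib_right sm.scale_right_distrib single_add sum.distrib)
qed

lemma FM_add_right: assumes "v \<in> fm p q" "v' \<in> fm p q" shows "u \<odot> (v + v') = u \<odot> v + u \<odot> v'"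
proof -
  let ?S = "keys v \<union> keys v'"
  have "finite ?S" "keys (v + v') \<subseteq> ?S" by (simp, rule keys_add)
  moreover have "tw n (lookup v f + lookup v' f) = tw n (lookup v f) + tw n (lookup v' f)" for n f using assms unfolding fm_iff by (intro tw_add) auto
  ultimately show ?thesis by (simp add: FM_superset[of "keys u" u ?S] lookup_add distrib_left sm.scale_right_distrib single_add sum.distrib)
qed

lemma gamma_coeff_gams: "e \<in> gams \<Longrightarrow> f \<in> gams \<Longrightarrow> gamma_coeff dg e f \<noteq> 0 \<Longrightarrow> e + f \<in> gams"
  unfolding gamma_coeff_def gams_iff using keys_add[of e f] by (auto simp: lookup_add not_less split: if_splits)

lemma FM_single_fm: assumes "e \<in> gams" "a \<in> grade L m" "f \<in> gams" "b \<in> grade L n"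
  shows "single e a \<odot> single f b = single (e + f) (smul L (of_int (gamma_coeff dg e f)) (sgn_pow (edeg e * n) (a * b)))"
    and "smul L (of_int (gamma_coeff dg e f)) (sgn_pow (edeg e * n) (a * b)) \<in> grade L (m + n)"
  using assms sm.subspace_scale[OF grade_subspace grade_mult[OF assms(2,4)]] sm.subspace_neg[OF grade_subspace]
  by (auto simp: FM_single tw_grade sgn_pow_def)

lemma FM_fm: "u \<in> fm p q \<Longrightarrow> v \<in> fm p' q' \<Longrightarrow> u \<odot> v \<in> fm (p + p') (q + q')"
proof (induction rule: fm_induct)
  case (single e a m u)
  from single(7) have "single e a \<odot> v \<in> fm (p + p') (q + q')" proof (induction rule: fm_induct)
    case s: (single f b n w)
    have "single e a \<odot> single f b \<in> fm (p + p') (q + q')" proof (cases "gamma_coeff dg e f = 0")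
      case True
      then show ?thesis using FM_single_fm(1)[OF single(1,2) s(1,2)] fm_0 by simp
    next
      case False
      then show ?thesis unfolding FM_single_fm(1)[OF single(1,2) s(1,2)]
        using single s by (intro fm_single[OF gamma_coeff_gams FM_single_fm(2)]) (auto simp: wt_add mdeg_add)
    qed
    then show ?case using s FM_add_right[OF fm_single[OF s(1-4)] s(5)] fm_add by simp
  qed (simp add: fm_0)
  then show ?case using single by (simp add: FM_add_left fm_add)
qed (simp add: fm_0)

theorem FM_assoc: "u \<in> fm p q \<Longrightarrow> v \<in> fm p' q' \<Longrightarrow> w \<in> fm p'' q'' \<Longrightarrow> u \<odot> v \<odot> w = u \<odot> (v \<odot> w)"
proof (induction rule: fm_induct)
  case (single e a m u)
  let ?a = "single e a"
  from single(7,8) have "?a \<odot> v \<odot> w = ?a \<odot> (v \<odot> w)" proof (induction rule: fm_induct)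
    case s: (single f b n v)
    let ?b = "single f b"
    from s(7) have "?a \<odot> ?b \<odot> w = ?a \<odot> (?b \<odot> w)" proof (induction rule: fm_induct)
      case t: (single g c k w)
      let ?c = "single g c"
      have tb: "tw (edeg e) b = sgn_pow (edeg e * n) b" "tw (edeg f) c = sgn_pow (edeg f * k) c" "tw (edeg (e + f)) c = sgn_pow (edeg (e + f) * k) c"
        using s t by (simp_all add: tw_grade)
      have ml: "x * sgn_pow i y = sgn_pow i (x * y)" "sgn_pow i x * y = sgn_pow i (x * y)" "smul L r (sgn_pow i x) = sgn_pow i (smul L r x)" for x y i r
        by (auto simp: sgn_pow_def sm.scale_minus_right)
      have tbc: "tw (edeg e) (sgn_pow (edeg f * k) (smul L (of_int (gamma_coeff dg f g)) (b * c)))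
         = sgn_pow (edeg e * (n + k)) (sgn_pow (edeg f * k) (smul L (of_int (gamma_coeff dg f g)) (b * c)))"
        using tw_grade[OF FM_single_fm(2)[OF s(1,2) t(1,2)]] unfolding ml .
      have "of_int (gamma_coeff dg (e + f) g) * of_int (gamma_coeff dg e f) = (of_int (gamma_coeff dg e (f + g)) * of_int (gamma_coeff dg f g) :: 'k)"
        unfolding of_int_mult[symmetric] using gamma_coeff_assoc[of dg e f g] by (simp add: mult.commute)
      moreover have "edeg (e + f) = edeg e + edeg f" by (simp add: edeg_def wt_add mdeg_add)
      ultimately have "?a \<odot> ?b \<odot> ?c = ?a \<odot> (?b \<odot> ?c)" unfolding FM_single tb ml tbc
        by (simp add: ml add.assoc add.commute add.left_commute distrib_left distrib_right smul_mult_left smul_mult_right mult.assoc)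
      then show ?case using t FM_add_right[OF fm_single[OF t(1-4)] t(5)]
        FM_add_right[OF FM_fm[OF fm_single[OF s(1-4)] fm_single[OF t(1-4)]] FM_fm[OF fm_single[OF s(1-4)] t(5)]] by simp
    qed simp
    then show ?case using s FM_add_right[OF fm_single[OF s(1-4)] s(5)]
      FM_add_right[OF FM_fm[OF fm_single[OF s(1-4)] s(7)] FM_fm[OF s(5) s(7)]] by (simp add: FM_add_left)
  qed simp
  then show ?case using single by (simp add: FM_add_left)
qed simp

text \<open>An exterior letter \<open>dx\<close> has odd total degree, a divided power of the other
  letters an even one.\<close>

lemma edeg_parity: "e \<in> gams \<Longrightarrow> even (edeg e + card {x \<in> keys e. even (dg x)})"
proof -
  assume e: "e \<in> gams"
  have "edeg e = (\<Sum>x\<in>keys e. lookup e x * (dg x + 1))" by (simp add: edeg_def gamma_internal_def gamma_weight_def distrib_left sum.distrib)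
  moreover have "card {x \<in> keys e. even (dg x)} = (\<Sum>x\<in>keys e. if even (dg x) then 1 else 0)" by (simp add: sum.If_cases Int_def)
  ultimately have "edeg e + card {x \<in> keys e. even (dg x)}
     = (\<Sum>x\<in>keys e. lookup e x * (dg x + 1) + (if even (dg x) then 1 else 0))" by (simp add: sum.distrib)
  also have "even \<dots>" proof (rule dvd_sum)
    fix x assume "x \<in> keys e"
    then show "even (lookup e x * (dg x + 1) + (if even (dg x) then 1 else 0))"
      using e by (auto simp: gams_iff in_keys_iff) (metis One_nat_def dvd_0_right less_one nat_less_le odd_one)
  qed
  finally show ?thesis .
qed

theorem FM_commute: "u \<in> fm p q \<Longrightarrow> v \<in> fm p' q' \<Longrightarrow> u \<odot> v = sgn_pow ((p + q) * (p' + q')) (v \<odot> u)"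
proof (induction rule: fm_induct)
  case (single e a m u)
  let ?a = "single e a" and ?s = "(p + q) * (p' + q')"
  from single(7) have *: "?a \<odot> v = sgn_pow ?s (v \<odot> ?a)" proof (induction rule: fm_induct)
    case s: (single f b n v)
    let ?b = "single f b"
    define k where "k = card {x \<in> keys e. even (dg x)} * card {x \<in> keys f. even (dg x)}"
    have k: "even (edeg e * edeg f + k)" using edeg_parity[OF single(1)] edeg_parity[OF s(1)] unfolding k_def by auto
    have pq: "p + q = m + edeg e" "p' + q' = n + edeg f" using single s by (auto simp: edeg_def)
    have g: "smul L (of_int (gamma_coeff dg e f)) x = sgn_pow k (smul L (of_int (gamma_coeff dg f e)) x)" for x
      using gamma_coeff_commute[of dg e f] by (simp add: k_def[symmetric] sgn_pow_def minus_one_power_iff)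
    have sc: "smul L c (sgn_pow i x) = sgn_pow i (smul L c x)" for c i x by (simp add: sgn_pow_def sm.scale_minus_right)
    have ab: "?a \<odot> ?b = sgn_pow ?s (?b \<odot> ?a)"
      unfolding FM_single_fm(1)[OF single(1,2) s(1,2)] FM_single_fm(1)[OF s(1,2) single(1,2)] graded_commute[OF single(2) s(2)] g sc sgn_pow_pow
        add.commute[of f e] single_sgn_pow by (rule sgn_pow_cong) (use k in \<open>auto simp: pq\<close>)
    show ?case unfolding FM_add_left FM_add_right[OF fm_single[OF s(1-4)] s(5)] sgn_pow_add ab s(6) ..
  qed simp
  show ?case unfolding FM_add_left FM_add_right[OF fm_single[OF single(1-4)] single(5)] sgn_pow_add * single(6)[OF single(7)] ..
qed simp

end

section \<open>The differentials on forms\<close>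

context free_chain_algebra
begin

text \<open>The degree is an argument of \<open>Q\<close> because 0 has every degree; linear
  combinations stay within one degree, and products add degrees.\<close>

lemma grade_induct [consumes 1, case_names zero one gen mult lin]:
  assumes "a \<in> grade L m" and "\<And>m. Q m 0" and "Q 0 1" and "\<And>x. x \<in> X \<Longrightarrow> Q (dg x) (gen x)"
    and "\<And>m n a b. a \<in> grade L m \<Longrightarrow> b \<in> grade L n \<Longrightarrow> Q m a \<Longrightarrow> Q n b \<Longrightarrow> Q (m + n) (a * b)"
    and "\<And>m k a b. a \<in> grade L m \<Longrightarrow> b \<in> grade L m \<Longrightarrow> Q m a \<Longrightarrow> Q m b \<Longrightarrow> Q m (smul L k a + b)"
  shows "Q m a"
proof -
  have mn: "e \<in> mons \<Longrightarrow> Q (mdeg e) (mn e)" for e proof (induction e rule: weight_induct)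
    case 0
    show ?case using assms(3) by (simp add: mn_0)
  next
    case (sing e)
    have x: "lm e \<in> keys e" "lm e \<in> X" "e - sing (lm e) \<in> mons" using lm_in[OF sing(1)] sing(3) mons_diff by (auto simp: mons_iff)
    then show ?case using assms(5)[OF gen_grade mn_grade[OF x(3)] assms(4)] sing mdeg_add[of dg "sing (lm e)" "e - sing (lm e)"]
      by (simp add: mn_lm sing_diff)
  qed
  let ?t = "\<lambda>e. smul L (lookup (co a) e) (mn e)"
  have "S \<subseteq> keys (co a) \<Longrightarrow> Q m (\<Sum>e\<in>S. ?t e) \<and> (\<Sum>e\<in>S. ?t e) \<in> grade L m" if "finite S" for S
    using that proof (induction S rule: finite_induct)
    case empty
    show ?case using assms(2) grade_0 by simp
  next
    case (insert e S)
    then have e: "e \<in> mons" "mdeg e = m" using co(1)[of a] co_grade[OF assms(1)] by auto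
    then have "mn e \<in> grade L m" "Q m (mn e)" using mn_grade mn by auto
    then show ?case using insert assms(6) sm.subspace_add[OF grade_subspace] sm.subspace_scale[OF grade_subspace] by simp
  qed
  from this[OF finite_keys subset_refl] show ?thesis using co(2)[of a] by (simp add: val_def)
qed

lemma gamma_coeff_0 [simp]: "e \<in> gams \<Longrightarrow> gamma_coeff dg e 0 = 1" "e \<in> gams \<Longrightarrow> gamma_coeff dg 0 e = 1"
  unfolding gamma_coeff_def gams_iff by (auto simp: not_less)

abbreviation fo :: "'l \<Rightarrow> ('x, 'l) forms" where "fo \<equiv> form_of"
definition gam :: "'x mono \<Rightarrow> ('x, 'l) forms" where "gam e = single e 1"

lemma gams_0: "0 \<in> gams" by (simp add: gams_iff)
lemma gams_sing: "x \<in> X \<Longrightarrow> sing x \<in> gams" by (simp add: gams_iff)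

lemma fm_fo: "a \<in> grade L m \<Longrightarrow> fo a \<in> fm m 0" unfolding form_of_def by (rule fm_single[OF gams_0]) auto

lemma fm_gam: "e \<in> gams \<Longrightarrow> gam e \<in> fm (mdeg e) (wt e)" unfolding gam_def by (rule fm_single[OF _ grade_one]) auto

lemma fo_FM_single: "a \<in> grade L k \<Longrightarrow> e \<in> gams \<Longrightarrow> b \<in> grade L m \<Longrightarrow> fo a \<odot> single e b = single e (a * b)"
  unfolding form_of_def using FM_single_fm(1)[OF gams_0] by (simp add: edeg_def)

lemma sum_single: "(\<Sum>e\<in>keys u. single e (lookup u e)) = u"
  by (rule poly_mapping_eqI) (simp add: lookup_sum lookup_single when_def in_keys_iff)

lemma FM_gam_0: assumes "u \<in> forms_total L X dg n" shows "u \<odot> gam 0 = u" "gam 0 \<odot> u = u"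
proof -
  have u: "e \<in> gams \<and> (\<exists>m. lookup u e \<in> grade L m)" if "e \<in> keys u" for e using assms that unfolding forms_total_def by blast
  have k: "keys (gam 0 :: ('x, 'l) forms) \<subseteq> {0}" by (simp add: gam_def)
  have "u \<odot> gam 0 = (\<Sum>e\<in>keys u. single e (lookup u e))" unfolding FM_superset[OF finite_keys[of u] subset_refl _ k, simplified]
    by (rule sum.cong) (use u in \<open>auto simp: gam_def tw_grade[OF grade_one]\<close>)
  then show "u \<odot> gam 0 = u" by (simp only: sum_single)
  have "gam 0 \<odot> u = (\<Sum>e\<in>keys u. single e (lookup u e))" unfolding FM_superset[OF _ k finite_keys[of u] subset_refl, simplified]
  proof (rule sum.cong[OF refl])
    fix e assume "e \<in> keys u"
    with u obtain m where "e \<in> gams" "lookup u e \<in> grade L m" by blast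
    then show "single e (smul L (of_int (gamma_coeff dg 0 e)) (lookup (gam 0 :: ('x, 'l) forms) 0 * tw (edeg 0) (lookup u e)))
      = single e (lookup u e)" by (simp add: gam_def tw_grade edeg_def)
  qed
  then show "gam 0 \<odot> u = u" by (simp only: sum_single)
qed

lemma single_split: "e \<in> gams \<Longrightarrow> a \<in> grade L m \<Longrightarrow> fo a \<odot> gam e = single e a"
  using fo_FM_single[OF _ _ grade_one] by (simp add: gam_def)

lemma FM_minus_right: "v \<in> fm p q \<Longrightarrow> u \<odot> (- v) = - (u \<odot> v)"
  using FM_add_right[of v p q "- v" u] fm_minus by (simp add: eq_neg_iff_add_eq_0 add.commute)

lemma FM_sgn_pow_right: "v \<in> fm p q \<Longrightarrow> u \<odot> sgn_pow n v = sgn_pow n (u \<odot> v)" by (simp add: sgn_pow_def FM_minus_right)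

lemma FM_sgn_pow_left: "sgn_pow n u \<odot> v = sgn_pow n (u \<odot> v)"
  using FM_add_left[of u "- u" v] by (simp add: sgn_pow_def eq_neg_iff_add_eq_0 add.commute)

lemma FM_sum_right: "(\<And>i. i \<in> I \<Longrightarrow> v i \<in> fm p q) \<Longrightarrow> u \<odot> (\<Sum>i\<in>I. v i) = (\<Sum>i\<in>I. u \<odot> v i)"
proof (induction I rule: infinite_finite_induct)
  case (insert i I)
  then show ?case using FM_add_right[of "v i" p q "\<Sum>i\<in>I. v i" u] fm_sum[of I v p q] by simp
qed auto

lemma FM_scale_left: "forms_scale L k u \<odot> v = forms_scale L k (u \<odot> v)"
proof -
  have s: "forms_scale L k (\<Sum>i\<in>I. w i) = (\<Sum>i\<in>I. forms_scale L k (w i))" for I and w :: "'i \<Rightarrow> ('x, 'l) forms"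
    by (rule poly_mapping_eqI) (simp add: lookup_sum sm.scale_sum_right)
  have t: "forms_scale L k (single e a) = single e (smul L k a)" for e a by (rule poly_mapping_eqI) (simp add: lookup_single when_def)
  have k: "keys (forms_scale L k u) \<subseteq> keys u" by (auto simp: in_keys_iff)
  then show ?thesis unfolding FM_superset[OF finite_keys subset_refl finite_keys subset_refl, of u v]
      FM_superset[OF finite_keys[of u] k finite_keys subset_refl] s t by (simp add: smul_mult_left mult.commute)
qed

lemma gam_FM: assumes "single x k + f \<in> gams" "\<And>y. y \<in> keys f \<Longrightarrow> x < y"
  shows "gam (single x k) \<odot> gam f = gam (single x k + f)"
proof -
  let ?s = "single x k"
  have l: "lookup ?s y = (if y = x then k else 0)" for y by (simp add: lookup_single when_def)
  have f: "lookup f x = 0" using assms(2)[of x] by (auto simp: in_keys_iff)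
  have "{(x', y). x' \<in> keys ?s \<and> y \<in> keys f \<and> even (dg x') \<and> even (dg y) \<and> y < x'} = {}"
    using assms(2) by (fastforce split: if_splits)
  moreover have "(\<Prod>y\<in>keys ?s \<union> keys f. int ((lookup ?s y + lookup f y) choose lookup ?s y)) = 1"
    by (rule prod.neutral) (auto simp: l f)
  moreover have "\<not> (\<exists>x. even (dg x) \<and> lookup ?s x + lookup f x > 1)" using assms(1) by (auto simp: gams_iff lookup_add not_less)
  ultimately have "gamma_coeff dg ?s f = 1" unfolding gamma_coeff_def by (simp only: if_False card.empty power_0 mult_1)
  then show ?thesis by (simp add: gam_def FM_single tw_grade[OF grade_one])
qed

text \<open>The whole divided power of the smallest letter is removed at once, since a divided power
  is in general not a product of letters.\<close>

lemma gams_peel: assumes "e \<in> gams" "e \<noteq> 0" defines "x \<equiv> lm e" and "k \<equiv> lookup e (lm e)" defines "f \<equiv> e - single x k"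
  shows "x \<in> keys e" "k > 0" "even (dg x) \<Longrightarrow> k = 1" "f \<in> gams" "single x k + f = e" "single x k \<in> gams"
    "\<And>y. y \<in> keys f \<Longrightarrow> x < y" "keys e = insert x (keys f)" "wt f < wt e"
proof -
  show x: "x \<in> keys e" and k: "k > 0" using lm_in[OF assms(2)] by (auto simp: x_def k_def in_keys_iff)
  show k1: "even (dg x) \<Longrightarrow> k = 1" using assms(1) k unfolding gams_iff x_def k_def by (metis One_nat_def Suc_leI le_antisym)
  have lf: "lookup f y = (if y = x then 0 else lookup e y)" for y by (simp add: f_def lookup_minus lookup_single when_def k_def x_def)
  show e: "single x k + f = e" by (rule poly_mapping_eqI) (simp add: lookup_add lf lookup_single when_def k_def x_def)
  show kf: "keys e = insert x (keys f)" using x by (auto simp: in_keys_iff lf split: if_splits)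
  show f: "f \<in> gams" using assms(1) kf by (auto simp: gams_iff lf)
  show "single x k \<in> gams" using assms(1) kf k1 by (auto simp: gams_iff lookup_single when_def)
  show "x < y" if "y \<in> keys f" for y using that lm_le[of y e] kf lf[of y] by (auto simp: x_def[symmetric] in_keys_iff le_less split: if_splits)
  have "wt e = wt (single x k) + wt f" by (subst e[symmetric]) (rule wt_add)
  moreover have "wt (single x k) = k" using k by (simp add: gamma_weight_def)
  ultimately show "wt f < wt e" using k by simp
qed

end

locale gamma_forms = free_chain_algebra L X dg gen for L :: "('k::comm_ring_1, 'l::{ring, monoid_mult}) chain_alg"
    and X :: "'x::linorder set" and dg and gen :: "'x \<Rightarrow> 'l" +
  fixes d \<delta> :: "('x, 'l) forms \<Rightarrow> ('x, 'l) forms"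
  assumes d: "is_forms_d L X dg gen d" and delta: "is_forms_delta L X dg gen d \<delta>"
begin

lemmas d_deriv = d[unfolded is_forms_d_def gamma_derivation_def, THEN conjunct1]
  and delta_deriv = delta[unfolded is_forms_delta_def gamma_derivation_def, THEN conjunct1]

lemma d_add: "u \<in> fm p q \<Longrightarrow> v \<in> fm p' q' \<Longrightarrow> d (u + v) = d u + d v"
  by (rule d_deriv[THEN conjunct1, rule_format]) (rule fm_all, assumption)+

lemma d_scale: "u \<in> fm p q \<Longrightarrow> d (forms_scale L k u) = forms_scale L k (d u)"
  by (rule d_deriv[THEN conjunct2, THEN conjunct1, rule_format]) (rule fm_all)

lemma d_FM: "u \<in> fm p q \<Longrightarrow> v \<in> fm p' q' \<Longrightarrow> d (u \<odot> v) = d u \<odot> v + sgn_pow (p + q) (u \<odot> d v)"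
  using d_deriv[THEN conjunct2, THEN conjunct2, THEN conjunct2, THEN conjunct1, rule_format, OF fm_total fm_all] by simp

lemma delta_add: "u \<in> fm p q \<Longrightarrow> v \<in> fm p' q' \<Longrightarrow> \<delta> (u + v) = \<delta> u + \<delta> v"
  by (rule delta_deriv[THEN conjunct1, rule_format]) (rule fm_all, assumption)+

lemma delta_scale: "u \<in> fm p q \<Longrightarrow> \<delta> (forms_scale L k u) = forms_scale L k (\<delta> u)"
  by (rule delta_deriv[THEN conjunct2, THEN conjunct1, rule_format]) (rule fm_all)

lemma delta_FM: "u \<in> fm p q \<Longrightarrow> v \<in> fm p' q' \<Longrightarrow> \<delta> (u \<odot> v) = \<delta> u \<odot> v + sgn_pow (p + q) (u \<odot> \<delta> v)"
  using delta_deriv[THEN conjunct2, THEN conjunct2, THEN conjunct2, THEN conjunct1, rule_format, OF fm_total fm_all] by simp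

lemma d_fo_gen: "x \<in> X \<Longrightarrow> d (fo (gen x)) = gam (sing x)" and d_gam_sing: "x \<in> X \<Longrightarrow> d (gam (sing x)) = 0"
  using d unfolding is_forms_d_def gam_def gamma_d_def sing_def by simp_all

lemma d_gam_single: "x \<in> X \<Longrightarrow> odd (dg x) \<Longrightarrow> k \<ge> 1 \<Longrightarrow> d (gam (single x k)) = 0"
  using d_deriv[THEN conjunct2, THEN conjunct2, THEN conjunct2, THEN conjunct2, rule_format, of x k] d_gam_sing[of x]
  by (simp add: gam_def gamma_d_def sing_def)

lemma delta_fo: "\<delta> (fo a) = fo (bdry L a)" using delta unfolding is_forms_delta_def by simp

lemma d_0: "d 0 = 0" using d_add[OF fm_0 fm_0] by simp

lemma delta_0: "\<delta> 0 = 0" using delta_add[OF fm_0 fm_0] by simp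

lemma fo_add: "fo (a + b) = fo a + fo b" and fo_0: "fo 0 = 0" and fo_scale: "fo (smul L k a) = forms_scale L k (fo a)"
  by (simp_all add: form_of_def single_add) (rule poly_mapping_eqI, simp add: lookup_single when_def)

lemma fo_mult: "a \<in> grade L m \<Longrightarrow> b \<in> grade L n \<Longrightarrow> fo (a * b) = fo a \<odot> fo b"
  using fo_FM_single[OF _ gams_0] by (simp add: form_of_def)

lemma fo_1: "fo 1 = gam 0" by (simp add: form_of_def gam_def)

text \<open>From \<open>1 * 1 = 1\<close> the derivation rule yields
  \<open>d 1 = d 1 + d 1\<close>.\<close>

lemma d_1: "d (fo 1) = 0"
proof -
  have "d (fo 1) \<in> forms_total L X dg 1"
    using d_deriv[THEN conjunct2, THEN conjunct2, THEN conjunct1, rule_format, OF fm_total[OF fm_fo[OF grade_one]]] by simp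
  from FM_gam_0[OF this] show ?thesis using d_FM[OF fm_fo[OF grade_one] fm_fo[OF grade_one]] fo_mult[OF grade_one grade_one] by (simp add: fo_1)
qed

lemma d_fo_lin: "a \<in> grade L m \<Longrightarrow> b \<in> grade L m \<Longrightarrow> d (fo (smul L k a + b)) = forms_scale L k (d (fo a)) + d (fo b)"
  unfolding fo_add fo_scale by (simp add: d_add[OF fm_scale[OF fm_fo] fm_fo] d_scale[OF fm_fo])

lemma fm_d_fo: "a \<in> grade L m \<Longrightarrow> d (fo a) \<in> fm m 1"
proof (induction rule: grade_induct)
  case (gen x)
  then show ?case using fm_gam[OF gams_sing] by (simp add: d_fo_gen)
next
  case (mult m n a b)
  then show ?case unfolding fo_mult[OF mult(1,2)] d_FM[OF fm_fo[OF mult(1)] fm_fo[OF mult(2)]]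
    using FM_fm[OF mult(3) fm_fo[OF mult(2)]] FM_fm[OF fm_fo[OF mult(1)] mult(4)] by (simp add: fm_add fm_sgn_pow)
qed (simp_all add: fo_0 d_0 fm_0 d_1 d_fo_lin fm_add fm_scale)

text \<open>The rule for \<open>\<gamma>\<close>-derivations reduces a divided power to
  \<open>d (dx) = 0\<close>; products follow by peeling off the smallest letter.\<close>

lemma d_gam: "e \<in> gams \<Longrightarrow> d (gam e) = 0"
proof (induction e rule: measure_induct_rule[where f = wt])
  case (less e)
  show ?case proof (cases "e = 0")
    case True
    then show ?thesis using d_1 by (simp add: fo_1)
  next
    case False
    note p = gams_peel[OF less.prems False]
    let ?s = "single (lm e) (lookup e (lm e))"
    have "lm e \<in> X" using gams_key[OF less.prems p(1)] .
    then have "d (gam ?s) = 0" using p(2,3) d_gam_sing d_gam_single by (cases "even (dg (lm e))") (auto simp: sing_def)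
    then have "d (gam ?s \<odot> gam (e - ?s)) = 0" using d_FM[OF fm_gam[OF p(6)] fm_gam[OF p(4)]] less.IH[OF p(9,4)] by simp
    then show ?thesis using gam_FM[of "lm e" _ "e - ?s"] p(5,7) less.prems by simp
  qed
qed

lemma d_single: "e \<in> gams \<Longrightarrow> a \<in> grade L m \<Longrightarrow> d (single e a) = d (fo a) \<odot> gam e"
  using d_FM[OF fm_fo fm_gam, of a m e] d_gam[of e] single_split[of e a m] by simp

text \<open>The value prescribed for \<open>\<delta>\<close> on \<open>dx\<close>; it vanishes for
  letters of degree 0.\<close>

definition eta :: "'x \<Rightarrow> ('x, 'l) forms" where "eta x = - d (fo (bdry L (gen x)))"

lemma eta_0: "x \<in> X \<Longrightarrow> dg x = 0 \<Longrightarrow> eta x = 0" using bdry_grade_0 gen_grade by (fastforce simp: eta_def fo_0 d_0)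

lemma bdry_gen: "x \<in> X \<Longrightarrow> bdry L (gen x) \<in> grade L (dg x - 1)"
  using bdry_grade[of "gen x" "dg x - 1"] bdry_grade_0[of "gen x"] gen_grade[of x] grade_0 by (cases "dg x") auto

lemma fm_eta: "x \<in> X \<Longrightarrow> eta x \<in> fm (dg x - 1) 1" unfolding eta_def by (intro fm_minus fm_d_fo bdry_gen)

text \<open>The total degree of \<open>eta x\<close> is that of \<open>x\<close>, although its
  bidegree contains the truncated \<open>dg x - 1\<close>; for \<open>dg x = 0\<close> both sides
  are zero.\<close>

lemma eta_commute: "x \<in> X \<Longrightarrow> u \<in> fm p q \<Longrightarrow> u \<odot> eta x = sgn_pow (dg x * (p + q)) (eta x \<odot> u)"
  using FM_commute[OF _ fm_eta, of u p q x] eta_0[of x] by (cases "dg x") (auto simp: mult.commute)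

lemma delta_gam_single: assumes "x \<in> X" "k > 0" "even (dg x) \<Longrightarrow> k = 1"
  shows "\<delta> (gam (single x k)) = eta x \<odot> gam (single x (k - 1))"
proof -
  have g: "single x (k - 1) \<in> gams" using assms by (auto simp: gams_iff lookup_single when_def)
  have w: "mdeg (single x (k - 1)) + wt (single x (k - 1)) = (k - 1) * (dg x + 1)"
    by (cases "k - 1 = 0") (auto simp: gamma_internal_def gamma_weight_def)
  have "\<delta> (gam (sing x)) = eta x" using delta assms(1) unfolding is_forms_delta_def gam_def gamma_d_def sing_def eta_def by simp
  moreover have "\<delta> (gam (single x k)) = gam (single x (k - 1)) \<odot> \<delta> (gam (sing x))" if "odd (dg x)"
    using delta_deriv[THEN conjunct2, THEN conjunct2, THEN conjunct2, THEN conjunct2, rule_format, of x k] assms that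
    by (simp add: gam_def gamma_d_def sing_def)
  ultimately have "\<delta> (gam (single x k)) = gam (single x (k - 1)) \<odot> eta x"
    using assms FM_gam_0(2)[OF fm_total[OF fm_eta[OF assms(1)]]] by (cases "even (dg x)") (auto simp: sing_def)
  also have "\<dots> = sgn_pow (dg x * ((k - 1) * (dg x + 1))) (eta x \<odot> gam (single x (k - 1)))"
    using eta_commute[OF assms(1) fm_gam[OF g]] w by simp
  also have "\<dots> = eta x \<odot> gam (single x (k - 1))" proof -
    have "even (dg x * ((k - 1) * (dg x + 1)))" by auto
    then show ?thesis unfolding sgn_pow_def by (rule if_P)
  qed
  finally show ?thesis .
qed

text \<open>The derivation sign and the commutation of \<open>eta\<close> past a divided power
  together matter only if both letters involved are exterior, which is what \<open>sg 0\<close>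
  counts. The formula runs over letters like \<open>ysum_bd\<close>, so that the two can be compared
  term by term.\<close>

theorem delta_gam: "e \<in> gams \<Longrightarrow> \<delta> (gam e) = (\<Sum>x\<in>keys e. sgn_pow (sg 0 e x) (eta x \<odot> gam (e - sing x)))"
proof (induction e rule: measure_induct_rule[where f = wt])
  case (less e)
  show ?case proof (cases "e = 0")
    case True
    have "bdry L 1 = 0" by (rule bdry_grade_0[OF grade_one])
    then show ?thesis using delta_fo[of 1] True by (simp add: fo_1 fo_0)
  next
    case False
    note p = gams_peel[OF less.prems False]
    define x k where "x = lm e" and "k = lookup e (lm e)"
    define f where "f = e - single x k"
    let ?s = "single x k"
    note p = p[folded x_def k_def, folded f_def]
    have x: "x \<in> X" using gams_key[OF less.prems p(1)] .
    have s: "mdeg ?s + wt ?s = k * (dg x + 1)" using p(2) by (auto simp: gamma_internal_def gamma_weight_def)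
    have l: "lookup f z = (if z = x then 0 else lookup e z)" "lookup ?s z = (if z = x then k else 0)" for z
      by (simp_all add: f_def lookup_minus lookup_single when_def k_def x_def)
    have ds: "\<delta> (gam ?s) = eta x \<odot> gam (single x (k - 1))" by (rule delta_gam_single[OF x p(2)]) (rule p(3))
    have kx: "lookup e x = k" by (simp add: k_def x_def)
    have 1: "eta x \<odot> gam (single x (k - 1)) \<odot> gam f = sgn_pow (sg 0 e x) (eta x \<odot> gam (e - sing x))" proof -
      have s1: "single x (k - 1) \<in> gams" using p(3) x by (auto simp: gams_iff lookup_single when_def)
      have e1: "single x (k - 1) + f = e - sing x"
        by (rule poly_mapping_eqI) (simp add: lookup_add lookup_minus l lookup_single when_def, simp add: k_def x_def)
      have "{y \<in> keys e. even (dg y) \<and> y < x} = {}" using lm_le[of _ e] by (fastforce simp: x_def)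
      then have "ecnt e x = 0" unfolding ecnt_def by (simp only: card.empty)
      then have "even (sg 0 e x)" by (simp add: sg_def)
      moreover have "gam (single x (k - 1)) \<odot> gam f = gam (e - sing x)"
        using gam_FM[of x "k - 1" f] p(7) gams_diff[OF less.prems, of x] unfolding e1 by blast
      ultimately show ?thesis unfolding FM_assoc[OF fm_eta[OF x] fm_gam[OF s1] fm_gam[OF p(4)]] by (simp only: sgn_pow_def if_True)
    qed
    have 2: "sgn_pow (mdeg ?s + wt ?s) (gam ?s \<odot> sgn_pow (sg 0 f y) (eta y \<odot> gam (f - sing y))) = sgn_pow (sg 0 e y) (eta y \<odot> gam (e - sing y))"
      if y: "y \<in> keys f" for y proof -
      have yX: "y \<in> X" using gams_key[OF p(4) y] .
      note fy = gams_diff[OF p(4), of y]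
      have xy: "x < y" by (rule p(7)[OF y])
      have e2: "?s + (f - sing y) = e - sing y" by (rule poly_mapping_eqI) (use xy kx in \<open>auto simp: lookup_add lookup_minus l\<close>)
      have "gam ?s \<odot> (eta y \<odot> gam (f - sing y)) = sgn_pow (dg y * (k * (dg x + 1))) (eta y \<odot> (gam ?s \<odot> gam (f - sing y)))"
        unfolding FM_assoc[OF fm_gam[OF p(6)] fm_eta[OF yX] fm_gam[OF fy], symmetric] eta_commute[OF yX fm_gam[OF p(6)]] s FM_sgn_pow_left
          FM_assoc[OF fm_eta[OF yX] fm_gam[OF p(6)] fm_gam[OF fy]] ..
      also have "gam ?s \<odot> gam (f - sing y) = gam (e - sing y)"
        using gam_FM[of x k "f - sing y"] gams_diff[OF less.prems, of y] p(7) keys_diff_sing_subset[of f y] by (auto simp: e2)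
      finally have a: "gam ?s \<odot> (eta y \<odot> gam (f - sing y)) = sgn_pow (dg y * (k * (dg x + 1))) (eta y \<odot> gam (e - sing y))" .
      have c: "even (dg y) \<Longrightarrow> ecnt e y = ecnt f y + (if even (dg x) then 1 else 0)" proof -
        have "{z \<in> keys e. even (dg z) \<and> z < y} = {z \<in> keys f. even (dg z) \<and> z < y} \<union> (if even (dg x) then {x} else {})"
          using p(8) xy by auto
        moreover have "x \<notin> keys f" using p(7) by blast
        ultimately show ?thesis by (simp add: ecnt_def)
      qed
      show ?thesis unfolding FM_sgn_pow_right[OF FM_fm[OF fm_eta[OF yX] fm_gam[OF fy]]] a s sgn_pow_pow
        by (rule sgn_pow_cong) (use c p(3) in \<open>auto simp: sg_def\<close>)
    qed
    have fs: "sgn_pow (sg 0 f y) (eta y \<odot> gam (f - sing y)) \<in> fm (mdeg f - 1) (wt f)" if y: "y \<in> keys f" for y proof -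
      have yX: "y \<in> X" using gams_key[OF p(4) y] .
      show ?thesis using FM_fm[OF fm_eta[OF yX] fm_gam[OF gams_diff[OF p(4), of y]]] eta_0[OF yX] mdeg_diff_sing[OF y] wt_diff_sing[OF y]
        by (cases "dg y") (auto intro!: fm_sgn_pow simp: fm_0)
    qed
    have su: "gam ?s \<odot> (\<Sum>y\<in>keys f. sgn_pow (sg 0 f y) (eta y \<odot> gam (f - sing y)))
        = (\<Sum>y\<in>keys f. gam ?s \<odot> sgn_pow (sg 0 f y) (eta y \<odot> gam (f - sing y)))" by (rule FM_sum_right) (rule fs)
    have "\<delta> (gam e) = \<delta> (gam ?s \<odot> gam f)" using gam_FM[of x k f] p(5,7) less.prems by simp
    also have "\<dots> = eta x \<odot> gam (single x (k - 1)) \<odot> gam f + sgn_pow (mdeg ?s + wt ?s) (gam ?s \<odot> \<delta> (gam f))"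
      unfolding delta_FM[OF fm_gam[OF p(6)] fm_gam[OF p(4)]] ds ..
    also have "\<dots> = sgn_pow (sg 0 e x) (eta x \<odot> gam (e - sing x)) + (\<Sum>y\<in>keys f. sgn_pow (sg 0 e y) (eta y \<odot> gam (e - sing y)))"
      unfolding less.IH[OF p(9,4)] su 1 sgn_pow_sum by (intro arg_cong2[where f = "(+)"] refl sum.cong 2)
    also have "\<dots> = (\<Sum>y\<in>keys e. sgn_pow (sg 0 e y) (eta y \<odot> gam (e - sing y)))"
      unfolding p(8) using p(7) by (subst sum.insert) auto
    finally show ?thesis .
  qed
qed

lemma delta_single: "e \<in> gams \<Longrightarrow> a \<in> grade L m \<Longrightarrow> \<delta> (single e a) = single e (bdry L a) + sgn_pow m (fo a \<odot> \<delta> (gam e))"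
  using delta_FM[OF fm_fo fm_gam, of a m e] single_split[of e a m] delta_fo[of a]
    single_split[of e "bdry L a" "m - 1"] bdry_grade[of a "m - 1"] bdry_grade_0[of a] grade_0 by (cases m) auto

lemma fm_delta_gam: "e \<in> gams \<Longrightarrow> mdeg e = Suc p \<Longrightarrow> \<delta> (gam e) \<in> fm p (wt e)"
  and delta_gam_0: "e \<in> gams \<Longrightarrow> mdeg e = 0 \<Longrightarrow> \<delta> (gam e) = 0"
proof -
  show "\<delta> (gam e) \<in> fm p (wt e)" if e: "e \<in> gams" "mdeg e = Suc p" unfolding delta_gam[OF e(1)]
  proof (intro fm_sum fm_sgn_pow)
    fix y assume y: "y \<in> keys e"
    have yX: "y \<in> X" using gams_key[OF e(1) y] .
    show "eta y \<odot> gam (e - sing y) \<in> fm p (wt e)"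
      using FM_fm[OF fm_eta[OF yX] fm_gam[OF gams_diff[OF e(1), of y]]] eta_0[OF yX] mdeg_diff_sing[OF y] wt_diff_sing[OF y] e
      by (cases "dg y") (auto simp: fm_0)
  qed
  show "\<delta> (gam e) = 0" if e: "e \<in> gams" "mdeg e = 0" unfolding delta_gam[OF e(1)] proof (intro sum.neutral ballI)
    fix y assume y: "y \<in> keys e"
    show "sgn_pow (sg 0 e y) (eta y \<odot> gam (e - sing y)) = 0" using eta_0[OF gams_key[OF e(1) y]] mdeg_diff_sing[OF y] e by simp
  qed
qed

lemma fm_d: "u \<in> fm p q \<Longrightarrow> d u \<in> fm p (Suc q)"
proof (induction rule: fm_induct)
  case (single e a m v)
  show ?case unfolding d_add[OF fm_single[OF single(1-4)] single(5)] d_single[OF single(1,2)]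
    using FM_fm[OF fm_d_fo[OF single(2)] fm_gam[OF single(1)]] single by (simp add: fm_add)
qed (simp add: d_0 fm_0)

lemma fm_delta: "u \<in> fm (Suc p) q \<Longrightarrow> \<delta> u \<in> fm p q"
proof (induction rule: fm_induct)
  case (single e a m v)
  have "single e (bdry L a) \<in> fm p q" using single bdry_grade[of a "m - 1"] bdry_grade_0[of a] by (cases m) (auto simp: fm_0 intro!: fm_single)
  moreover have "fo a \<odot> \<delta> (gam e) \<in> fm p q"
    using single FM_fm[OF fm_fo[OF single(2)] fm_delta_gam[OF single(1)]] delta_gam_0[OF single(1)] by (cases "mdeg e") (auto simp: fm_0)
  ultimately show ?case unfolding delta_add[OF fm_single[OF single(1-4)] single(5)] delta_single[OF single(1,2)]
    using single(6) by (intro fm_add fm_sgn_pow)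
qed (simp add: delta_0 fm_0)

end

section \<open>Forms as cycles in the Hochschild complex of normal forms\<close>

context free_chain_algebra
begin

lemma bounds_subspace: "fs.subspace (bounds p q)"
proof -
  interpret bw: module_hom fscale fscale bw by unfold_locales (simp_all add: bw_simps)
  have "fs.subspace {u. keys u \<subseteq> words p (Suc q)}"
    by (rule fs.subspaceI) (auto dest!: subsetD[OF Poly_Mapping.keys_add] subsetD[OF keys_fscale])
  then show ?thesis unfolding bounds_def by (rule bw.subspace_image)
qed

lemmas bounds_0 = fs.subspace_0[OF bounds_subspace]
  and bounds_add = fs.subspace_add[OF bounds_subspace]
  and bounds_minus = fs.subspace_neg[OF bounds_subspace]
  and bounds_scale = fs.subspace_scale[OF bounds_subspace]

lemma bounds_sgn_pow: "u \<in> bounds p q \<Longrightarrow> sgn_pow n u \<in> bounds p q" by (simp add: sgn_pow_def bounds_minus)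

lemma bounds_sum: "(\<And>i. i \<in> I \<Longrightarrow> u i \<in> bounds p q) \<Longrightarrow> (\<Sum>i\<in>I. u i) \<in> bounds p q"
  by (induction I rule: infinite_finite_induct) (auto intro: bounds_0 bounds_add)

text \<open>Sets closed under sums and signs contain the signed sums of their elements; this is used
  for boundaries and for chains of given support.\<close>

lemma ysum_mem:
  assumes "0 \<in> S" "\<And>u v. u \<in> S \<Longrightarrow> v \<in> S \<Longrightarrow> u + v \<in> S" "\<And>n u. u \<in> S \<Longrightarrow> sgn_pow n u \<in> S"
  shows "(\<And>u. tens u \<Longrightarrow> length u = n \<Longrightarrow> tdeg u = mdeg e \<Longrightarrow> F u \<in> S) \<Longrightarrow> e \<in> gams \<Longrightarrow> wt e = n \<Longrightarrow> ysum n e F \<in> S"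
proof (induction n arbitrary: e F)
  case 0
  then have "e = 0" by (simp add: wt_eq_0)
  then show ?case using 0(1)[of "[]"] by simp
next
  case (Suc n)
  have "sgn_pow (sg n e x) (ysum n (e - sing x) (\<lambda>u. F (gl x # u))) \<in> S" if x: "x \<in> keys e" for x
    using wt_diff_sing[OF x] gen_grade[OF gams_key[OF Suc.prems(2) x]] mdeg_diff_sing[OF x] Suc.prems
    by (intro assms(3) Suc.IH Suc.prems(1) gams_diff) auto
  then show ?case unfolding ysum.simps using assms(1,2) by (induction rule: infinite_finite_induct[of _ "keys e"]) auto
qed

lemma insv_mem:
  assumes "\<And>u v. u \<in> S \<Longrightarrow> v \<in> S \<Longrightarrow> u + v \<in> S" "\<And>n u. u \<in> S \<Longrightarrow> sgn_pow n u \<in> S"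
  shows "(\<And>u. tens u \<Longrightarrow> length u = Suc (length w) \<Longrightarrow> tdeg u = fst a + tdeg w \<Longrightarrow> F u \<in> S) \<Longrightarrow> tens w \<Longrightarrow> snd a \<in> grade L (fst a) \<Longrightarrow> insv a F w \<in> S"
proof (induction w arbitrary: F)
  case (Cons x r)
  have "F (a # x # r) \<in> S" using Cons.prems by (intro Cons.prems(1)) auto
  moreover have "sgn_pow (Suc (fst a * fst x)) (insv a (\<lambda>u. F (x # u)) r) \<in> S" using Cons.prems by (intro assms(2) Cons.IH) auto
  ultimately show ?case using assms(1) by (fastforce simp: sgn_pow_Suc)
qed simp

lemma ins2_mem:
  assumes "\<And>u v. u \<in> S \<Longrightarrow> v \<in> S \<Longrightarrow> u + v \<in> S" "\<And>n u. u \<in> S \<Longrightarrow> sgn_pow n u \<in> S"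
  shows "(\<And>u. tens u \<Longrightarrow> length u = Suc (Suc (length w)) \<Longrightarrow> tdeg u = fst a + fst c + tdeg w \<Longrightarrow> F u \<in> S) \<Longrightarrow> tens w \<Longrightarrow>
    snd a \<in> grade L (fst a) \<Longrightarrow> snd c \<in> grade L (fst c) \<Longrightarrow> ins2 a c F w \<in> S"
proof (induction w arbitrary: F)
  case (Cons x r)
  have "insv c (\<lambda>u. F (a # u)) (x # r) \<in> S" by (rule insv_mem) (use Cons.prems assms in auto)
  moreover have "sgn_pow ((fst a + fst c) * fst x) (ins2 a c (\<lambda>u. F (x # u)) r) \<in> S" using Cons.prems by (intro assms(2) Cons.IH) auto
  ultimately show ?case using assms(1) by (simp del: insv.simps)
qed simp

lemma hb_nf_bounds: "tens t \<Longrightarrow> length t = Suc (Suc q) \<Longrightarrow> tdeg t = p \<Longrightarrow> hb nf t \<in> bounds p q"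
  unfolding hb_nf bounds_def using keys_nf[of t p "Suc q"] by (auto simp: tensors_iff)

text \<open>\<open>nform k a q f\<close> is the value of \<open>nf\<close> on \<open>a\<close> followed by the orderings of the monomial \<open>f\<close> of weight \<open>q\<close>.\<close>

definition nform :: "nat \<Rightarrow> 'l \<Rightarrow> nat \<Rightarrow> 'x mono \<Rightarrow> ('x mono list \<Rightarrow>\<^sub>0 'k)" where
  "nform k a q f = ysum q f (\<lambda>u. nf ((k, a) # u))"

text \<open>The comparison map in normal words. The exponent of the sign is the degree of the
  coefficient times the number of letters; it makes the map compatible with \<open>d\<close> and
  \<open>\<delta>\<close>, in view of the factor \<open>(-1)^q\<close> in the internal
  differential.\<close>

definition eps :: "nat \<Rightarrow> nat \<Rightarrow> ('x, 'l) forms \<Rightarrow> ('x mono list \<Rightarrow>\<^sub>0 'k)" where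
  "eps p q \<omega> = (\<Sum>f\<in>keys \<omega>. sgn_pow ((p - mdeg f) * q) (nform (p - mdeg f) (lookup \<omega> f) q f))"

lemma ysum_scale: "ysum n e (\<lambda>u. fscale c (F u)) = fscale c (ysum n e F)"
  by (induction n arbitrary: e F) (simp_all add: fscale_sgn_pow fs.scale_sum_right)

lemma nform_add: "a \<in> grade L k \<Longrightarrow> b \<in> grade L k \<Longrightarrow> f \<in> gams \<Longrightarrow> wt f = q \<Longrightarrow> nform k (a + b) q f = nform k a q f + nform k b q f"
  unfolding nform_def ysum_add[symmetric] by (intro ysum_cong multilin_add_hd[OF nf_multilin])

lemma nform_scale: "a \<in> grade L k \<Longrightarrow> f \<in> gams \<Longrightarrow> wt f = q \<Longrightarrow> nform k (smul L c a) q f = fscale c (nform k a q f)"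
  unfolding nform_def ysum_scale[symmetric] by (intro ysum_cong multilin_scale_hd[OF nf_multilin])

lemma nform_0: "f \<in> gams \<Longrightarrow> wt f = q \<Longrightarrow> nform k 0 q f = 0" using nform_scale[of 0 k f q 0] grade_0 by simp

lemma eps_superset: assumes "finite S" "keys \<omega> \<subseteq> S" "\<And>f. f \<in> S \<Longrightarrow> f \<in> gams \<and> wt f = q"
  shows "eps p q \<omega> = (\<Sum>f\<in>S. sgn_pow ((p - mdeg f) * q) (nform (p - mdeg f) (lookup \<omega> f) q f))"
  unfolding eps_def using assms by (intro sum.mono_neutral_left) (auto simp: in_keys_iff nform_0)

lemma fm_keys: "\<omega> \<in> fm p q \<Longrightarrow> f \<in> keys \<omega> \<Longrightarrow> f \<in> gams \<and> wt f = q \<and> mdeg f \<le> p"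
  unfolding forms_def by fastforce

lemma fm_lookup: "\<omega> \<in> fm p q \<Longrightarrow> lookup \<omega> f \<in> grade L (p - mdeg f)"
  using fm_iff[of \<omega> p q] grade_0 by (auto simp: cell_def split: if_splits dest: spec[of _ f])

lemma eps_add: assumes "u \<in> fm p q" "v \<in> fm p q" shows "eps p q (u + v) = eps p q u + eps p q v"
proof -
  let ?S = "keys u \<union> keys v"
  have S: "f \<in> gams \<and> wt f = q" if "f \<in> ?S" for f using that assms fm_keys by blast
  have k: "keys (u + v) \<subseteq> ?S" by (rule keys_add)
  have e: "eps p q w = (\<Sum>f\<in>?S. sgn_pow ((p - mdeg f) * q) (nform (p - mdeg f) (lookup w f) q f))"
    if "keys w \<subseteq> ?S" for w by (rule eps_superset[OF _ that S]) auto
  show ?thesis unfolding e[OF k] e[OF Un_upper1] e[OF Un_upper2] sum.distrib[symmetric]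
    by (intro sum.cong refl) (use S assms fm_lookup in \<open>simp add: lookup_add nform_add sgn_pow_add\<close>)
qed

lemma eps_scale: assumes "u \<in> fm p q" shows "eps p q (forms_scale L c u) = fscale c (eps p q u)"
proof -
  have S: "f \<in> gams \<and> wt f = q" if "f \<in> keys u" for f using that assms fm_keys by blast
  have k: "keys (forms_scale L c u) \<subseteq> keys u" by (auto simp: in_keys_iff)
  have "eps p q (forms_scale L c u) = (\<Sum>f\<in>keys u. sgn_pow ((p - mdeg f) * q) (nform (p - mdeg f) (lookup (forms_scale L c u) f) q f))"
    by (rule eps_superset[OF _ k S]) auto
  also have "\<dots> = fscale c (eps p q u)" unfolding eps_def fs.scale_sum_right
    by (intro sum.cong refl) (use S fm_lookup[OF assms] in \<open>simp add: nform_scale fscale_sgn_pow\<close>)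
  finally show ?thesis .
qed

lemma eps_0 [simp]: "eps p q 0 = 0" by (simp add: eps_def)

lemma eps_sgn_pow: "u \<in> fm p q \<Longrightarrow> eps p q (sgn_pow n u) = sgn_pow n (eps p q u)"
  using eps_add[of u p q "- u"] fm_minus by (auto simp: sgn_pow_def eq_neg_iff_add_eq_0 add.commute)

lemma eps_sum: "(\<And>i. i \<in> I \<Longrightarrow> u i \<in> fm p q) \<Longrightarrow> eps p q (\<Sum>i\<in>I. u i) = (\<Sum>i\<in>I. eps p q (u i))"
proof (induction I rule: infinite_finite_induct)
  case (insert i I)
  then show ?case using eps_add[of "u i" p q "\<Sum>i\<in>I. u i"] fm_sum[of I u p q] by simp
qed auto

lemma eps_single: "e \<in> gams \<Longrightarrow> p = k + mdeg e \<Longrightarrow> q = wt e \<Longrightarrow>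
    eps p q (single e a) = sgn_pow (k * q) (nform k a q e)" using eps_superset[of "{e}" "single e a" q p] by simp

end

section \<open>Insertion of an element is homologous to multiplication by its differential\<close>

context gamma_forms
begin

text \<open>With coefficient \<open>b\<close>, inserting \<open>a\<close> in all orderings of
  \<open>e\<close> represents, up to sign and boundaries, the form \<open>b da\<close> times the
  monomial of \<open>e\<close>. All \<open>b\<close> and \<open>e\<close> are taken together because
  the product rule changes the coefficient.\<close>

definition slides :: "nat \<Rightarrow> 'l \<Rightarrow> bool" where
  "slides m a \<longleftrightarrow> (\<forall>k b e n p. b \<in> grade L k \<longrightarrow> e \<in> gams \<longrightarrow> wt e = n \<longrightarrow> p = k + m + mdeg e \<longrightarrow>
     ysum n e (insv (m, a) (\<lambda>u. nf ((k, b) # u))) - sgn_pow (m + (k + m) * Suc n) (eps p (Suc n) (fo b \<odot> d (fo a) \<odot> gam e)) \<in> bounds p (Suc n))"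

lemma slidesD: "slides m a \<Longrightarrow> b \<in> grade L k \<Longrightarrow> e \<in> gams \<Longrightarrow> wt e = n \<Longrightarrow> p = k + m + mdeg e \<Longrightarrow>
   ysum n e (insv (m, a) (\<lambda>u. nf ((k, b) # u))) - sgn_pow (m + (k + m) * Suc n) (eps p (Suc n) (fo b \<odot> d (fo a) \<odot> gam e)) \<in> bounds p (Suc n)"
  unfolding slides_def by blast

lemma fm_slide: "b \<in> grade L k \<Longrightarrow> u \<in> fm m 1 \<Longrightarrow> e \<in> gams \<Longrightarrow> fo b \<odot> u \<odot> gam e \<in> fm (k + m + mdeg e) (Suc (wt e))"
  using FM_fm[OF FM_fm[OF fm_fo, of b k u m 1] fm_gam] by simp

lemma tens_take_drop: "tens w \<Longrightarrow> tens (take i w)" "tens w \<Longrightarrow> tens (drop i w)" by (auto dest: in_set_takeD in_set_dropD)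

lemma insv_lin_arg: "multilin F \<Longrightarrow> a \<in> grade L m \<Longrightarrow> b \<in> grade L m \<Longrightarrow> tens w \<Longrightarrow>
    insv (m, smul L c a + b) F w = fscale c (insv (m, a) F w) + insv (m, b) F w"
  unfolding insv_nth fs.scale_sum_right sum.distrib[symmetric] fst_conv fscale_sgn_pow sgn_pow_add[symmetric]
  by (intro sum.cong refl arg_cong[where f = "sgn_pow _"] multilin_lin[of F] tens_take_drop)

lemma insv_one: "b \<in> grade L k \<Longrightarrow> tens w \<Longrightarrow> insv (0, 1) (\<lambda>u. nf ((k, b) # u)) w = 0"
proof -
  assume h: "b \<in> grade L k" "tens w"
  have "nf ((k, b) # take i w @ (0, 1) # drop i w) = 0" for i proof -
    have "tens ((k, b) # take i w)" using h tens_take_drop(1)[of w i] by auto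
    from reducedD[OF nf_reduced _ this tens_take_drop(2)[OF h(2)], of 1] show ?thesis by simp
  qed
  then show ?thesis unfolding insv_nth by simp
qed

lemma multilin_nf_Cons: "b \<in> grade L k \<Longrightarrow> multilin (\<lambda>u. nf ((k, b) # u))" by (rule multilin_Cons[OF nf_multilin]) simp

lemma slides_lin: assumes a: "a \<in> grade L m" "a' \<in> grade L m" "slides m a" "slides m a'" shows "slides m (smul L c a + a')"
  unfolding slides_def
proof (intro allI impI)
  fix k b e n p assume h: "b \<in> grade L k" "e \<in> gams" "wt e = n" "p = k + m + mdeg e"
  let ?F = "\<lambda>u. nf ((k, b) # u)" and ?W = "\<lambda>a. fo b \<odot> d (fo a) \<odot> gam e"
  have "ysum n e (insv (m, smul L c a + a') ?F) = ysum n e (\<lambda>w. fscale c (insv (m, a) ?F w) + insv (m, a') ?F w)"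
    by (intro ysum_cong h insv_lin_arg multilin_nf_Cons a)
  moreover have "?W (smul L c a + a') = forms_scale L c (?W a) + ?W a'" proof -
    have 1: "forms_scale L c (d (fo a)) \<in> fm m 1" by (rule fm_scale[OF fm_d_fo[OF a(1)]])
    have s: "forms_scale L c (sgn_pow i u) = sgn_pow i (forms_scale L c u)" for i u by (rule poly_mapping_eqI) (simp add: sgn_pow_def)
    have "fo b \<odot> forms_scale L c (d (fo a)) = forms_scale L c (fo b \<odot> d (fo a))"
      unfolding FM_commute[OF fm_fo[OF h(1)] 1] FM_commute[OF fm_fo[OF h(1)] fm_d_fo[OF a(1)]] FM_scale_left s ..
    then show ?thesis by (simp add: d_fo_lin[OF a(1,2)] FM_add_right[OF 1 fm_d_fo[OF a(2)]] FM_add_left FM_scale_left)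
  qed
  moreover have "?W a \<in> fm p (Suc n)" "?W a' \<in> fm p (Suc n)"
    using fm_slide[OF h(1) fm_d_fo[OF a(1)] h(2)] fm_slide[OF h(1) fm_d_fo[OF a(2)] h(2)] h by auto
  ultimately show "ysum n e (insv (m, smul L c a + a') ?F) - sgn_pow (m + (k + m) * Suc n) (eps p (Suc n) (?W (smul L c a + a'))) \<in> bounds p (Suc n)"
    using bounds_add[OF bounds_scale[OF slidesD[OF a(3) h], of c] slidesD[OF a(4) h]]
    by (simp add: ysum_add ysum_scale eps_add fm_scale eps_scale sgn_pow_add fs.scale_right_diff_distrib fscale_sgn_pow algebra_simps)
qed

text \<open>By \<open>ysum_insv_gen\<close> insertion of a generator equals multiplication by
  \<open>dx\<close>, so the difference is zero here.\<close>

lemma slides_gen: assumes x: "x \<in> X" shows "slides (dg x) (gen x)" unfolding slides_def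
proof (intro allI impI)
  fix k b e n p assume h: "b \<in> grade L k" "e \<in> gams" "wt e = n" "p = k + dg x + mdeg e"
  let ?c = "gamma_coeff dg (sing x) e"
  have "fo b \<odot> d (fo (gen x)) \<odot> gam e = single (sing x + e) (smul L (of_int ?c) b)"
    using single_split[OF gams_sing[OF x] h(1)] FM_single_fm(1)[OF gams_sing[OF x] h(1) h(2) grade_one] by (simp add: d_fo_gen x gam_def)
  moreover have "eps p (Suc n) (single (sing x + e) (smul L (of_int ?c) b)) = sgn_pow (k * Suc n) (fscale (of_int ?c) (nform k b (Suc n) (sing x + e)))"
  proof (cases "?c = 0")
    case False
    then have g: "sing x + e \<in> gams" using gamma_coeff_gams[OF gams_sing[OF x] h(2)] by simp
    have w: "Suc n = wt (sing x + e)" "p = k + mdeg (sing x + e)" using h by (auto simp: wt_add mdeg_add)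
    show ?thesis unfolding eps_single[OF g w(2,1)] nform_scale[OF h(1) g w(1)[symmetric]] ..
  qed simp
  moreover have "sgn_pow (n * dg x) v = sgn_pow (dg x + (k + dg x) * Suc n + k * Suc n) v" for v :: "'x mono list \<Rightarrow>\<^sub>0 'k"
    by (rule sgn_pow_cong) auto
  ultimately show "ysum n e (insv (gl x) (\<lambda>u. nf ((k, b) # u))) - sgn_pow (dg x + (k + dg x) * Suc n) (eps p (Suc n) (fo b \<odot> d (fo (gen x)) \<odot> gam e)) \<in> bounds p (Suc n)"
    unfolding ysum_insv_gen[OF h(2,3) x] by (simp add: nform_def bounds_0 add.commute[of e] del: ysum.simps)
qed

text \<open>Both sides are derivations in the inserted element: \<open>d\<close> by definition,
  insertion up to the boundary from \<open>ysum_ins2_hb\<close>.\<close>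

lemma slides_mult: assumes a: "a \<in> grade L m" "slides m a" and c: "c \<in> grade L m'" "slides m' c" shows "slides (m + m') (a * c)"
  unfolding slides_def
proof (intro allI impI)
  fix k b e n p assume h: "b \<in> grade L k" "e \<in> gams" "wt e = n" "p = k + (m + m') + mdeg e"
  let ?F = "\<lambda>k b u. nf ((k, b) # u)"
  let ?A = "fo (b * c) \<odot> d (fo a) \<odot> gam e" and ?C = "fo (b * a) \<odot> d (fo c) \<odot> gam e"
  have ba: "b * a \<in> grade L (k + m)" "b * c \<in> grade L (k + m')" using grade_mult h a c by auto
  have sA: "ysum n e (insv (m, a) (?F (k + m') (b * c))) - sgn_pow (m + (k + m' + m) * Suc n) (eps p (Suc n) ?A) \<in> bounds p (Suc n)"
    by (rule slidesD[OF a(2) ba(2) h(2,3)]) (use h in simp)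
  have sC: "ysum n e (insv (m', c) (?F (k + m) (b * a))) - sgn_pow (m' + (k + m + m') * Suc n) (eps p (Suc n) ?C) \<in> bounds p (Suc n)"
    by (rule slidesD[OF c(2) ba(1) h(2,3)]) (use h in simp)
  have fA: "?A \<in> fm p (Suc n)" "?C \<in> fm p (Suc n)"
    using fm_slide[OF ba(2) fm_d_fo[OF a(1)] h(2)] fm_slide[OF ba(1) fm_d_fo[OF c(1)] h(2)] h by (simp_all add: ac_simps)
  have "ysum n e (ins2 (m, a) (m', c) (\<lambda>u. hb nf ((k, b) # u))) \<in> bounds p (Suc n)"
    by (intro ysum_mem ins2_mem hb_nf_bounds bounds_0 bounds_add bounds_sgn_pow h) (use h a c in auto)
  then have "ysum n e (insv (m', c) (?F (k + m) (b * a))) - ysum n e (insv (m + m', a * c) (?F k b))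
      + sgn_pow (m * m') (ysum n e (insv (m, a) (?F (k + m') (b * c)))) \<in> bounds p (Suc n)"
    using ysum_ins2_hb[OF nf_multilin h(2,3), of "(k, b)" "(m, a)" "(m', c)"] a c h by (simp add: tmul_def)
  from bounds_add[OF bounds_minus[OF this] bounds_add[OF sC bounds_sgn_pow[OF sA, of "m * m'"]]]
  have *: "ysum n e (insv (m + m', a * c) (?F k b)) - (sgn_pow (m' + (k + m + m') * Suc n) (eps p (Suc n) ?C)
      + sgn_pow (m * m') (sgn_pow (m + (k + m' + m) * Suc n) (eps p (Suc n) ?A))) \<in> bounds p (Suc n)" by (simp add: sgn_pow_diff algebra_simps)
  have "fo b \<odot> d (fo (a * c)) \<odot> gam e = sgn_pow ((m + 1) * m') ?A + sgn_pow m ?C" proof -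
    note fb = fm_fo[OF h(1)] and ga = fm_fo[OF a(1)] and gc = fm_fo[OF c(1)] and da = fm_d_fo[OF a(1)] and dc = fm_d_fo[OF c(1)]
    have "d (fo (a * c)) = sgn_pow ((m + 1) * (m' + 0)) (fo c \<odot> d (fo a)) + sgn_pow (m + 0) (fo a \<odot> d (fo c))"
      unfolding fo_mult[OF a(1) c(1)] d_FM[OF ga gc] FM_commute[OF da gc] ..
    moreover have "fo b \<odot> (fo c \<odot> d (fo a)) = fo (b * c) \<odot> d (fo a)" "fo b \<odot> (fo a \<odot> d (fo c)) = fo (b * a) \<odot> d (fo c)"
      unfolding FM_assoc[OF fb gc da, symmetric] FM_assoc[OF fb ga dc, symmetric] fo_mult[OF h(1) c(1)] fo_mult[OF h(1) a(1)] by simp_all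
    moreover have "fo c \<odot> d (fo a) \<in> fm (m + m') 1" "fo a \<odot> d (fo c) \<in> fm (m + m') 1"
      using FM_fm[OF gc da] FM_fm[OF ga dc] by (simp_all add: add.commute)
    ultimately show ?thesis by (simp add: FM_add_right[OF fm_sgn_pow fm_sgn_pow] FM_sgn_pow_right FM_sgn_pow_left FM_add_left)
  qed
  then have "sgn_pow (m + m' + (k + (m + m')) * Suc n) (eps p (Suc n) (fo b \<odot> d (fo (a * c)) \<odot> gam e))
     = sgn_pow (m + m' + (k + (m + m')) * Suc n) (sgn_pow ((m + 1) * m') (eps p (Suc n) ?A)) + sgn_pow (m + m' + (k + (m + m')) * Suc n) (sgn_pow m (eps p (Suc n) ?C))"
    using fA by (simp add: eps_add eps_sgn_pow fm_sgn_pow sgn_pow_add)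
  also have "sgn_pow (m + m' + (k + (m + m')) * Suc n) (sgn_pow ((m + 1) * m') (eps p (Suc n) ?A)) = sgn_pow (m * m') (sgn_pow (m + (k + m' + m) * Suc n) (eps p (Suc n) ?A))"
    unfolding sgn_pow_pow by (rule sgn_pow_cong) auto
  also have "sgn_pow (m + m' + (k + (m + m')) * Suc n) (sgn_pow m (eps p (Suc n) ?C)) = sgn_pow (m' + (k + m + m') * Suc n) (eps p (Suc n) ?C)"
    unfolding sgn_pow_pow by (rule sgn_pow_cong) auto
  finally show "ysum n e (insv (m + m', a * c) (?F k b)) - sgn_pow (m + m' + (k + (m + m')) * Suc n) (eps p (Suc n) (fo b \<odot> d (fo (a * c)) \<odot> gam e)) \<in> bounds p (Suc n)"
    using * by (simp add: add.commute)
qed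

text \<open>Products and linear combinations reduce the claim to letters and the unit. The unit is
  inserted in later places only, where normalisation kills it.\<close>

theorem slides: "a \<in> grade L m \<Longrightarrow> slides m a"
proof (induction rule: grade_induct)
  case one
  have "ysum n e (insv (0, 1) (\<lambda>u. nf ((k, b) # u))) = ysum n e (\<lambda>w. 0)" if "b \<in> grade L k" "e \<in> gams" "wt e = n" for k b e n
    by (intro ysum_cong that insv_one)
  then show ?case by (simp add: slides_def d_1 bounds_0)
next
  case (zero m)
  have "ysum n e (insv (m, 0) (\<lambda>u. nf ((k, b) # u))) = ysum n e (\<lambda>w. 0)" if "b \<in> grade L k" "e \<in> gams" "wt e = n" for k b e n
    using insv_lin_arg[OF multilin_nf_Cons[OF that(1)] grade_0 grade_0, of _ m "- 1"] by (intro ysum_cong that) simp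
  then show ?case by (simp add: slides_def fo_0 d_0 bounds_0)
qed (auto intro: slides_gen slides_mult slides_lin)

text \<open>Connes' operator leaves 1 as the coefficient and inserts the old coefficient
  \<open>a\<close> everywhere, by \<open>ysum_nrm\<close>; \<open>slides\<close> turns this
  insertion into \<open>da\<close>.\<close>

theorem ysum_nrm_d: assumes "a \<in> grade L k" "e \<in> gams" "wt e = n" "p = k + mdeg e"
  shows "sgn_pow (k * n) (ysum n e (\<lambda>u. nrm (ones nf) ((k, a) # u))) - eps p (Suc n) (d (single e a)) \<in> bounds p (Suc n)"
proof -
  have "sgn_pow (k * n + (k + (0 + k) * Suc n)) v = v" for v :: "'x mono list \<Rightarrow>\<^sub>0 'k" unfolding sgn_pow_def by (rule if_P) auto
  then have "sgn_pow (k * n) (sgn_pow (k + (0 + k) * Suc n) v) = v" for v :: "'x mono list \<Rightarrow>\<^sub>0 'k" by (simp only: sgn_pow_pow)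
  moreover have "fo 1 \<odot> d (fo a) = d (fo a)" using FM_gam_0(2)[OF fm_total[OF fm_d_fo[OF assms(1)]]] by (simp add: fo_1)
  moreover have "insv (k, a) (ones nf) = insv (k, a) (\<lambda>u. nf ((0, 1) # u))" by (simp add: ones_def[abs_def])
  ultimately show ?thesis using bounds_sgn_pow[OF slidesD[OF slides[OF assms(1)] grade_one assms(2,3), of p], of "k * n"] assms
    unfolding ysum_nrm[OF assms(2,3)] d_single[OF assms(2,1)] sgn_pow_diff by simp
qed

text \<open>The differential of the coefficient matches the first term of
  \<open>delta_single\<close>. On letters, \<open>ysum_bd\<close> inserts the boundary of a letter,
  and \<open>slides\<close> converts this into \<open>d\<close> of the boundary, which up to sign is
  the value of \<open>\<delta>\<close> on the letter.\<close>

theorem ysum_bd_delta: assumes a: "a \<in> grade L k" and e: "e \<in> gams" "wt e = n" and p: "Suc p = k + mdeg e"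
  shows "sgn_pow (k * n) (sgn_pow n (ysum n e (\<lambda>u. bd L nf ((k, a) # u)))) - eps p n (\<delta> (single e a)) \<in> bounds p n"
proof -
  let ?F = "\<lambda>u. nf ((k, a) # u)" and ?d = "\<lambda>x. (dg x - 1, bdry L (gen x))"
  define W where "W x = fo a \<odot> d (fo (bdry L (gen x))) \<odot> gam (e - sing x)" for x
  define T where "T x = (if dg x > 0 then sgn_pow (sg (n - 1) e x) (ysum (n - 1) (e - sing x) (insv (?d x) ?F)) else 0)" for x
  let ?K = "keys e"
  have W: "W x \<in> fm p n \<and> (dg x = 0 \<longrightarrow> W x = 0)" and "sgn_pow (k * n + n + k) (T x) - sgn_pow (Suc (k + sg 0 e x)) (eps p n (W x)) \<in> bounds p n"
    if x: "x \<in> ?K" for x proof -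
    have xX: "x \<in> X" by (rule gams_key[OF e(1) x])
    note ex = gams_diff[OF e(1), of x]
    have n: "wt (e - sing x) = n - 1" "n > 0" and md: "mdeg e = dg x + mdeg (e - sing x)" using wt_diff_sing[OF x] mdeg_diff_sing[OF x] e by auto
    have z: "dg x = 0 \<Longrightarrow> W x = 0" using eta_0[OF xX] by (simp add: W_def eta_def)
    show *: "W x \<in> fm p n \<and> (dg x = 0 \<longrightarrow> W x = 0)"
      using fm_slide[OF a fm_d_fo[OF bdry_gen[OF xX]] ex] z n md p by (cases "dg x") (auto simp: W_def fm_0 add.assoc)
    show "sgn_pow (k * n + n + k) (T x) - sgn_pow (Suc (k + sg 0 e x)) (eps p n (W x)) \<in> bounds p n" proof (cases "dg x > 0")
      case True
      then obtain j where j: "dg x = Suc j" using gr0_implies_Suc by blast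
      obtain n' where n': "n = Suc n'" using n(2) gr0_implies_Suc by blast
      have "ysum n' (e - sing x) (insv (?d x) ?F) - sgn_pow (dg x - 1 + (k + (dg x - 1)) * Suc n') (eps p (Suc n') (W x)) \<in> bounds p (Suc n')"
        unfolding W_def by (rule slidesD[OF slides[OF bdry_gen[OF xX]] a ex]) (use n n' True md p in simp_all)
      note V = bounds_sgn_pow[OF this, of "k * n + n + k + sg n' e x"]
      have "sgn_pow (k * n + n + k + sg n' e x + (dg x - 1 + (k + (dg x - 1)) * n)) v = sgn_pow (Suc (k + sg 0 e x)) v" for v :: "'x mono list \<Rightarrow>\<^sub>0 'k"
        by (rule sgn_pow_cong) (auto simp: sg_def j n')
      then have "sgn_pow (k * n + n + k + sg n' e x) (ysum n' (e - sing x) (insv (?d x) ?F) - sgn_pow (dg x - 1 + (k + (dg x - 1)) * n) (eps p n (W x)))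
        = sgn_pow (k * n + n + k) (T x) - sgn_pow (Suc (k + sg 0 e x)) (eps p n (W x))"
        unfolding sgn_pow_diff sgn_pow_pow using True by (simp add: T_def n' del: insv.simps)
      then show ?thesis using V unfolding n'[symmetric] by simp
    qed (use z in \<open>simp add: T_def bounds_0\<close>)
  qed
  note W = W[THEN conjunct1] and * = this(2)
  have fe: "eta x \<odot> gam (e - sing x) \<in> fm (mdeg e - 1) n" and We: "fo a \<odot> (eta x \<odot> gam (e - sing x)) = - W x" if x: "x \<in> ?K" for x
  proof -
    have xX: "x \<in> X" by (rule gams_key[OF e(1) x])
    note ex = gams_diff[OF e(1), of x]
    show "eta x \<odot> gam (e - sing x) \<in> fm (mdeg e - 1) n"
      using FM_fm[OF fm_eta[OF xX] fm_gam[OF ex]] eta_0[OF xX] mdeg_diff_sing[OF x] wt_diff_sing[OF x] e by (cases "dg x") (auto simp: fm_0)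
    have "fo a \<odot> (eta x \<odot> gam (e - sing x)) = (- (fo a \<odot> d (fo (bdry L (gen x))))) \<odot> gam (e - sing x)"
      unfolding FM_assoc[OF fm_fo[OF a] fm_eta[OF xX] fm_gam[OF ex], symmetric] unfolding eta_def FM_minus_right[OF fm_d_fo[OF bdry_gen[OF xX]]] ..
    then show "fo a \<odot> (eta x \<odot> gam (e - sing x)) = - W x"
      using FM_sgn_pow_left[of 1 "fo a \<odot> d (fo (bdry L (gen x)))" "gam (e - sing x)"] by (simp add: sgn_pow_def W_def)
  qed
  have 1: "fo a \<odot> \<delta> (gam e) = (\<Sum>x\<in>?K. sgn_pow (Suc (sg 0 e x)) (W x))" proof -
    have "fo a \<odot> \<delta> (gam e) = (\<Sum>x\<in>?K. fo a \<odot> sgn_pow (sg 0 e x) (eta x \<odot> gam (e - sing x)))"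
      unfolding delta_gam[OF e(1)] by (rule FM_sum_right) (rule fm_sgn_pow[OF fe])
    also have "\<dots> = (\<Sum>x\<in>?K. sgn_pow (Suc (sg 0 e x)) (W x))"
      by (intro sum.cong refl) (simp add: FM_sgn_pow_right[OF fe] We sgn_pow_Suc sgn_pow_minus)
    finally show ?thesis .
  qed
  have D: "\<delta> (single e a) = single e (bdry L a) + (\<Sum>x\<in>?K. sgn_pow (Suc (k + sg 0 e x)) (W x))"
    unfolding delta_single[OF e(1) a] 1 sgn_pow_sum sgn_pow_pow add_Suc_right ..
  have s: "single e (bdry L a) \<in> fm p n" using p e bdry_grade[of a "k - 1"] bdry_grade_0[of a] a by (cases k) (auto simp: fm_0 intro!: fm_single)
  have E: "eps p n (\<delta> (single e a)) = eps p n (single e (bdry L a)) + (\<Sum>x\<in>?K. sgn_pow (Suc (k + sg 0 e x)) (eps p n (W x)))"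
    unfolding D by (simp add: eps_add[OF s fm_sum] eps_sum eps_sgn_pow W fm_sgn_pow)
  have "ysum n e (\<lambda>u. bd L nf ((k, a) # u)) = (if k > 0 then nform (k - 1) (bdry L a) n e else 0) + sgn_pow k (\<Sum>x\<in>?K. T x)"
    unfolding T_def ysum_bd[OF e, of ?F, symmetric] by (simp add: ysum_add ysum_sgn_pow nform_def)
  moreover have "sgn_pow (k * n) (sgn_pow n (if k > 0 then nform (k - 1) (bdry L a) n e else 0)) = eps p n (single e (bdry L a))" proof (cases k)
    case 0
    then show ?thesis using bdry_grade_0 a by simp
  next
    case (Suc j)
    have "sgn_pow (k * n) (sgn_pow n v) = sgn_pow (j * n) v" for v :: "'x mono list \<Rightarrow>\<^sub>0 'k"
      unfolding sgn_pow_pow by (rule sgn_pow_cong) (auto simp: Suc)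
    then show ?thesis using Suc p eps_single[OF e(1), of p j n "bdry L a"] e by simp
  qed
  ultimately have "sgn_pow (k * n) (sgn_pow n (ysum n e (\<lambda>u. bd L nf ((k, a) # u)))) - eps p n (\<delta> (single e a))
     = (\<Sum>x\<in>?K. sgn_pow (k * n + n + k) (T x) - sgn_pow (Suc (k + sg 0 e x)) (eps p n (W x)))"
    unfolding E sum_subtractf by (simp add: sgn_pow_add sgn_pow_sum add.assoc)
  then show ?thesis using bounds_sum[of ?K, OF *] by simp
qed

end

context linear_mixed_complex
begin

text \<open>As \<open>mx_D\<close> and \<open>mx_B\<close> anticommute modulo relations,
  \<open>- mx_B M z\<close> bounds the image if \<open>z\<close> bounds \<open>x\<close>.\<close>

lemma B_vbd: assumes "x \<in> HH.vbd p q" shows "mx_B M x \<in> HH.vbd p (Suc q)"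
proof -
  obtain z where x: "x \<in> mxZ M p q" and z: "z \<in> mxZ M p (Suc q)" "x - mx_D M z \<in> mxN M p q" using assms unfolding HH_vbd by blast
  have Dz: "- mx_D M z \<in> mxZ M p q" by (rule scale.subspace_neg[OF obj_subspace(1) D_in[OF z(1)]])
  have Bz: "- mx_B M z \<in> mxZ M p (Suc (Suc q))" by (rule scale.subspace_neg[OF obj_subspace(1) B_in[OF z(1)]])
  have neg: "mx_B M (- mx_D M z) = - mx_B M (mx_D M z)" "mx_D M (- mx_B M z) = - mx_D M (mx_B M z)"
    using B_scale[OF D_in[OF z(1)], of "- 1"] D_scale[OF B_in[OF z(1)], of "- 1"] by simp_all
  have "mx_B M (x + - mx_D M z) + (mx_D M (mx_B M z) + mx_B M (mx_D M z)) \<in> mxN M p (Suc q)"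
    by (rule obj_add(2)[OF B_rel D_B[OF z(1)]]) (use z in simp)
  then have "mx_B M x - mx_D M (- mx_B M z) \<in> mxN M p (Suc q)" unfolding B_add[OF x Dz] neg by (simp add: algebra_simps)
  then show ?thesis unfolding HH_vbd using B_in[OF x] Bz by blast
qed

end

section \<open>The comparison map\<close>

context free_chain_algebra
begin

text \<open>Words are lifted to tensors by \<open>wd\<close>, and the identities of the cyclic
  complex are read back through \<open>nf\<close>. Words with a single factor have zero boundary,
  which covers the lowest degree.\<close>

lemma bw_bw: assumes "keys u \<subseteq> words p (Suc q)" shows "keys (bw u) \<subseteq> words p q" "bw (bw u) = 0"
proof -
  let ?z = "lin_extend (\<lambda>w. single (wd w) (1::'k)) u"
  have z: "keys ?z \<subseteq> tensors L p (Suc q)" by (rule keys_lin_extend_subset) (use assms wd_tensors in force)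
  have Dz: "keys (lin_extend hochschild_b ?z) \<subseteq> tensors L p q" by (rule chain_D[OF z])
  have b: "bw u = lin_extend nf (lin_extend hochschild_b ?z)" using ev_D[OF z, where F = nf] ev_hb[OF z] lin_extend_nf_wd[OF assms] by simp
  show k: "keys (bw u) \<subseteq> words p q" unfolding b by (rule keys_lin_extend_subset) (use Dz keys_nf in blast)
  show "bw (bw u) = 0" proof (cases q)
    case 0
    show ?thesis unfolding fun_cong[OF bw_def, of "bw u"] proof (rule lin_extend_eq_0)
      fix w assume "w \<in> keys (bw u)"
      then obtain m where "w = [m]" using k 0 by (auto simp: words_def length_Suc_conv)
      then show "hb nf (wd w) = 0" by (simp add: wd_def)
    qed
  next
    case (Suc r)
    have "lin_extend nf (lin_extend hochschild_b (lin_extend hochschild_b ?z)) = 0" proof -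
      have "?z \<in> mxZ Cyc p (Suc (Suc r))" using z Suc by (simp add: Cyc_simps)
      from cyclic.D_D[OF this] show ?thesis unfolding Cyc_simps relations_iff by blast
    qed
    then show ?thesis using ev_D[OF Dz, where F = nf] ev_hb[OF Dz] b by simp
  qed
qed

lemma nf_letters: "set xs \<subseteq> X \<Longrightarrow> nf ((k, a) # map gl xs) = lin_extend (\<lambda>m. single (m # map sing xs) 1) (co a)"
proof -
  assume xs: "set xs \<subseteq> X"
  have "co (gen x) = single (sing x) 1" if "x \<in> X" for x using co_mn[OF mons_sing[OF that]] by (simp add: mn_sing)
  then have "nfu (map gl xs) = single (map sing xs) 1" using xs by (induction xs) auto
  then show ?thesis by (auto simp: nf_def lin_extend_lin_extend image_iff sing_neq_0 intro!: lin_extend_cong)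
qed

lemma lookup_nf_letters: assumes "set xs \<subseteq> X"
  shows "lookup (nf ((k, a) # map gl xs)) (m # map sing ys) = (if xs = ys then lookup (co a) m else 0)"
proof -
  have "map sing xs = map sing ys \<longleftrightarrow> xs = ys" by (rule inj_map_eq_map) (metis injI keys_sing singleton_inject)
  then show ?thesis unfolding nf_letters[OF assms] lin_extend_def lookup_sum by (auto simp: lookup_single when_def in_keys_iff)
qed

text \<open>Stronger than \<open>ysum_cong\<close> in its use: functionals need to agree only on
  tensors of generators.\<close>

lemma ysum_cong_letters:
  "(\<And>xs. set xs \<subseteq> X \<Longrightarrow> length xs = n \<Longrightarrow> F (map gl xs) = G (map gl xs)) \<Longrightarrow> e \<in> gams \<Longrightarrow> ysum n e F = ysum n e G"
proof (induction n arbitrary: e F G)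
  case (Suc n)
  have "ysum n (e - sing x) (\<lambda>u. F (gl x # u)) = ysum n (e - sing x) (\<lambda>u. G (gl x # u))" if "x \<in> keys e" for x
    using Suc.prems(1)[of "x # _"] gams_key[OF Suc.prems(2) that] by (intro Suc.IH gams_diff Suc.prems(2)) simp
  then show ?case by simp
qed simp

lemma lookup_sgn_pow: "lookup (sgn_pow n f) w = sgn_pow n (lookup f w)" for f :: "'c \<Rightarrow>\<^sub>0 'k" by (simp add: sgn_pow_def)

lemma lookup_ysum:
  fixes F :: "'l tensor \<Rightarrow> 'c \<Rightarrow>\<^sub>0 'k" shows "lookup (ysum n e F) w = ysum n e (\<lambda>u. lookup (F u) w)"
proof (induction n arbitrary: e F)
  case (Suc n)
  then show ?case by (simp add: lookup_sum lookup_sgn_pow Suc)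
qed simp

abbreviation mono_of :: "'x list \<Rightarrow> 'x mono" where "mono_of ys \<equiv> sum_list (map sing ys)"

text \<open>Choosing different letters at some step leads to different orderings, so each one occurs
  once, with a sign independent of \<open>c\<close>. Letters are told apart by their generators
  because monomials are injective.\<close>

lemma ysum_single_ordering:
  "e \<in> gams \<Longrightarrow> wt e = n \<Longrightarrow> set ys \<subseteq> X \<Longrightarrow>
    \<exists>s. \<forall>c::'k. ysum n e (\<lambda>u. if u = map gl ys then c else 0) = (if mono_of ys = e then sgn_pow s c else 0)"
proof (induction n arbitrary: e ys)
  case 0
  then have e: "e = 0" by (simp add: wt_eq_0)
  have "mono_of (y # zs) \<noteq> 0" for y zs using wt_add[of "sing y" "mono_of zs"] by (metis add_is_0 wt_0(1) wt_sing(1) list.simps(9) one_neq_zero sum_list.Cons)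
  then show ?case using e by (cases ys) (auto intro: exI[of _ 0])
next
  case (Suc n)
  show ?case proof (cases ys)
    case Nil
    then show ?thesis using Suc.prems by auto
  next
    case (Cons y zs)
    have zs: "set zs \<subseteq> X" and yX: "y \<in> X" using Suc.prems(3) Cons by auto
    have inj: "gl x = gl y \<longleftrightarrow> x = y" if x: "x \<in> X" for x proof
      assume "gl x = gl y"
      then have "sing x = sing y" using inj_onD[OF monomials_inj, of "sing x" "sing y"] mons_sing x yX by (simp add: mn_sing)
      then show "x = y" by (metis keys_sing singleton_inject)
    qed simp
    have z: "sgn_pow (sg n e x) (ysum n (e - sing x) (\<lambda>u. if gl x # u = map gl ys then c else 0)) = 0"
      if "x \<in> keys e" "x \<noteq> y" for x and c :: 'k proof -
      have "(\<lambda>u. if gl x # u = map gl ys then c else 0) = (\<lambda>u. 0)"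
        using inj[OF gams_key[OF Suc.prems(1) that(1)]] that(2) Cons by (intro ext) auto
      then show ?thesis by simp
    qed
    show ?thesis proof (cases "y \<in> keys e")
      case True
      have "wt (e - sing y) = n" using wt_diff_sing[OF True] Suc.prems(2) by simp
      then obtain s where s: "\<forall>c::'k. ysum n (e - sing y) (\<lambda>u. if u = map gl zs then c else 0) = (if mono_of zs = e - sing y then sgn_pow s c else 0)"
        using Suc.IH[OF gams_diff[OF Suc.prems(1)] _ zs] by blast
      have "mono_of ys = e \<longleftrightarrow> mono_of zs = e - sing y" using sing_diff[OF True] Cons by auto
      moreover have "ysum (Suc n) e (\<lambda>u. if u = map gl ys then c else 0)
          = sgn_pow (sg n e y) (ysum n (e - sing y) (\<lambda>u. if u = map gl zs then c else 0))" for c :: 'k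
        using z True Cons by (simp add: sum.remove[of _ y])
      ultimately show ?thesis using s by (intro exI[of _ "sg n e y + s"]) simp
    next
      case False
      then have "mono_of ys \<noteq> e" using Cons by (auto simp: keys_add_nat)
      moreover have "ysum (Suc n) e (\<lambda>u. if u = map gl ys then c else 0) = 0" for c :: 'k
        unfolding ysum.simps by (intro sum.neutral ballI z) (use False in auto)
      ultimately show ?thesis by simp
    qed
  qed
qed

lemma lookup_nform: assumes "f \<in> gams" "wt f = q" "set ys \<subseteq> X"
  shows "\<exists>s. \<forall>k a m. lookup (nform k a q f) (m # map sing ys) = (if mono_of ys = f then sgn_pow s (lookup (co a) m) else 0)"
proof -
  obtain s where s: "\<And>c::'k. ysum q f (\<lambda>u. if u = map gl ys then c else 0) = (if mono_of ys = f then sgn_pow s c else 0)"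
    using ysum_single_ordering[OF assms] by blast
  have i: "inj_on gl X"
    using inj_onD[OF monomials_inj, of "sing _" "sing _"] mons_sing by (intro inj_onI) (metis keys_sing mn_sing singleton_inject snd_conv)
  have "lookup (nform k a q f) (m # map sing ys) = ysum q f (\<lambda>u. if u = map gl ys then lookup (co a) m else 0)" for k a m
    unfolding nform_def lookup_ysum
    by (rule ysum_cong_letters[OF _ assms(1)]) (use assms inj_on_map_eq_map[OF inj_on_subset[OF i], of _ ys] in \<open>simp add: lookup_nf_letters\<close>)
  then show ?thesis using s by auto
qed

lemma keys_nform: assumes "f \<in> gams" "wt f = q" "a \<in> grade L k"
  shows "keys (nform k a q f) \<subseteq> {m # map sing xs | m xs. True} \<inter> words (k + mdeg f) q"
proof -
  let ?S = "{v :: 'x mono list \<Rightarrow>\<^sub>0 'k. keys v \<subseteq> {m # map sing xs | m xs. True}}"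
  let ?T = "{v :: 'x mono list \<Rightarrow>\<^sub>0 'k. keys v \<subseteq> words (k + mdeg f) q}"
  have ex: "\<exists>ys. map sing xs = map sing ys" for xs :: "'x list" by blast
  have "ysum q f (\<lambda>u. if \<exists>xs. set xs \<subseteq> X \<and> u = map gl xs then nf ((k, a) # u) else 0) \<in> ?S"
    by (intro ysum_mem assms) (auto simp: nf_letters ex dest!: subsetD[OF keys_add] subsetD[OF keys_lin_extend] split: if_splits)
  moreover have "ysum q f (\<lambda>u. if \<exists>xs. set xs \<subseteq> X \<and> u = map gl xs then nf ((k, a) # u) else 0) = nform k a q f"
    unfolding nform_def by (rule ysum_cong_letters) (use assms in auto)
  moreover have "nform k a q f \<in> ?T" proof -
    have "keys (nf ((k, a) # u)) \<subseteq> words (k + mdeg f) q" if "tens u" "length u = q" "tdeg u = mdeg f" for u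
      by (rule keys_nf) (use assms that in \<open>simp add: tensors_iff\<close>)
    then show ?thesis unfolding nform_def by (intro ysum_mem assms) (auto dest!: subsetD[OF keys_add])
  qed
  ultimately show ?thesis by simp
qed

text \<open>On words of single letters a form can be read off up to sign: the letters determine the
  exponent, and the first factor picks a coordinate of its coefficient.\<close>

lemma lookup_eps: assumes "\<omega> \<in> fm p q" "set ys \<subseteq> X"
  shows "\<exists>s. \<forall>m. lookup (eps p q \<omega>) (m # map sing ys) = sgn_pow s (lookup (co (lookup \<omega> (mono_of ys))) m)"
proof -
  let ?f = "mono_of ys"
  have g: "f \<in> gams" "wt f = q" if "f \<in> keys \<omega>" for f using fm_keys[OF assms(1) that] by auto
  have z: "lookup (nform k a q f) (m # map sing ys) = 0" if "f \<in> keys \<omega>" "f \<noteq> ?f" for k a f m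
    using lookup_nform[OF g[OF that(1)] assms(2)] that(2) by auto
  show ?thesis proof (cases "?f \<in> keys \<omega>")
    case True
    obtain s where "\<forall>k a m. lookup (nform k a q ?f) (m # map sing ys) = sgn_pow s (lookup (co a) m)"
      using lookup_nform[OF g[OF True] assms(2)] by auto
    then show ?thesis unfolding eps_def lookup_sum lookup_sgn_pow using z True by (intro exI[of _ "(p - mdeg ?f) * q + s"]) (simp add: sum.remove[of _ ?f])
  next
    case False
    have "co 0 = 0" using co_scale[of 0 0] by simp
    moreover have "(\<Sum>f\<in>keys \<omega>. sgn_pow ((p - mdeg f) * q) (lookup (nform (p - mdeg f) (lookup \<omega> f) q f) (m # map sing ys))) = 0" for m
      by (rule sum.neutral) (use z False in \<open>metis sgn_pow_0(1)\<close>)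
    ultimately show ?thesis unfolding eps_def lookup_sum lookup_sgn_pow using False by (intro exI[of _ 0]) (simp add: in_keys_iff)
  qed
qed

text \<open>Behind the first factor there are only single letters, so nothing can be split.\<close>

lemma keys_eps: assumes "\<omega> \<in> fm p q" shows "keys (eps p q \<omega>) \<subseteq> free_words p q"
proof -
  have ns: "\<not> splittable dg (map sing xs)" for xs unfolding splittable_def by (auto simp: map_eq_append_conv)
  have "keys (nform (p - mdeg f) (lookup \<omega> f) q f) \<subseteq> free_words p q" if "f \<in> keys \<omega>" for f
    using keys_nform[of f q "lookup \<omega> f" "p - mdeg f"] fm_keys[OF assms that] fm_lookup[OF assms, of f] ns
    unfolding free_words_def by fastforce
  then show ?thesis unfolding eps_def by (intro keys_sum_subset) simp
qed

text \<open>
  A monomial of \<open>\<Gamma>(dV)\<close> has exactly one decreasing ordering, so that the forms correspond to the critical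
  words.
\<close>

lemma ex_sorted_ordering: "f \<in> gams \<Longrightarrow> \<exists>ys. sorted_wrt (follows dg) ys \<and> mono_of ys = f \<and> set ys = keys f"
proof (induction f rule: weight_induct)
  case 0
  show ?case by (intro exI[of _ "[]"]) simp
next
  case (sing f)
  let ?x = "lm f"
  have x: "?x \<in> keys f" by (rule lm_in[OF sing(1)])
  obtain ys where ys: "sorted_wrt (follows dg) ys" "mono_of ys = f - sing ?x" "set ys = keys (f - sing ?x)"
    using sing(2)[OF gams_diff[OF sing(3)]] by blast
  have "follows dg y ?x" if "y \<in> set ys" for y proof -
    have y: "y \<in> keys (f - sing ?x)" using that ys by simp
    then have "?x \<le> y" using keys_diff_sing_subset[of f ?x] lm_le by blast
    then show ?thesis using odd_key[OF sing(3), of y] y by (auto simp: follows_def)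
  qed
  moreover have "set (ys @ [?x]) = keys f" using ys(3) x keys_diff_sing_subset[of f ?x] by (auto simp: keys_diff_sing split: if_splits)
  ultimately show ?case using ys sing_diff[OF x] by (intro exI[of _ "ys @ [?x]"]) (auto simp: sorted_wrt_append add.commute)
qed

lemma keys_mono_of: "keys (mono_of zs) = set zs" by (induction zs) (auto simp: keys_add_nat)

text \<open>The last letter of a decreasing ordering is the smallest one, which the monomial
  determines; removing it reduces the length.\<close>

lemma sorted_ordering_unique:
  "sorted_wrt (follows dg) xs \<Longrightarrow> sorted_wrt (follows dg) ys \<Longrightarrow> mono_of xs = mono_of ys \<Longrightarrow> xs = ys"
proof (induction xs arbitrary: ys rule: rev_induct)
  case Nil
  then show ?case using keys_mono_of[of ys] by simp
next
  case (snoc x xs)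
  have st: "set ys = set (xs @ [x])" using keys_mono_of snoc.prems(3) by metis
  then obtain zs y where ys: "ys = zs @ [y]" by (cases ys rule: rev_cases) auto
  have "x \<le> z" if "z \<in> set (xs @ [x])" for z using snoc.prems(1) that by (auto simp: sorted_wrt_append follows_def)
  moreover have "y \<le> z" if "z \<in> set ys" for z using snoc.prems(2) that by (auto simp: ys sorted_wrt_append follows_def)
  ultimately have "x = y" using st ys by (intro order.antisym) auto
  then show ?case using snoc.IH[of zs] snoc.prems by (simp add: ys sorted_wrt_append)
qed

end

section \<open>Forms against critical words, and bijectivity of the comparison on homology\<close>

context free_chain_algebra
begin

lemma map_sing_eq: "map sing xs = map sing ys \<longleftrightarrow> xs = ys" by (rule inj_map_eq_map) (metis injI keys_sing singleton_inject)

text \<open>The form with the monomial of \<open>v\<close> and its first factor as coefficient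
  contains no critical word besides \<open>v\<close>, as the decreasing ordering is unique. The
  coefficient of \<open>v\<close> is a sign, which \<open>sgn_pow s\<close> removes.\<close>

lemma critical_form: assumes v: "v \<in> free_words p q" "critical dg (tl v)"
  shows "\<exists>y\<in>fm p q. keys (single v 1 - eps p q y) \<subseteq> {w \<in> free_words p q. \<not> critical dg (tl w)}"
proof -
  have crit: "\<exists>m zs. w = m # map sing zs \<and> sorted_wrt (follows dg) zs \<and> m \<in> mons \<and> set zs \<subseteq> X \<and> length zs = q \<and> mdeg m + mdeg (mono_of zs) = p"
    if w: "w \<in> free_words p q" "critical dg (tl w)" for w proof -
    obtain m ws where mw: "w = m # ws" using w(1) by (cases w) (auto simp: free_words_def words_def)
    obtain zs where zs: "ws = map sing zs" "sorted_wrt (follows dg) zs" using w(2) mw unfolding critical_def by auto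
    have "mdeg (mono_of zs) = sum_list (map mdeg (map sing zs))" by (induction zs) (auto simp: mdeg_add)
    moreover have "x \<in> X" if "x \<in> set zs" for x using w(1) that mons_iff[of "sing x"] unfolding mw zs free_words_def words_def by auto
    ultimately show ?thesis using w(1) zs unfolding mw free_words_def words_def by (auto simp: zs subset_iff)
  qed
  obtain m ys where ys: "v = m # map sing ys" "sorted_wrt (follows dg) ys" "m \<in> mons" "set ys \<subseteq> X" "length ys = q" "mdeg m + mdeg (mono_of ys) = p"
    using crit[OF v] by blast
  let ?f = "mono_of ys"
  \<comment> \<open>A decreasing run does not repeat letters of even degree, so its letters form a
    monomial of \<open>\<Gamma>\<close>.\<close>
  have "lookup ?f x \<le> 1" if "even (dg x)" for x using ys(2) proof (induction ys)
    case (Cons y ys)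
    have "x \<notin> keys (mono_of ys)" if "y = x" using Cons.prems that \<open>even (dg x)\<close> by (auto simp: keys_mono_of follows_def)
    then show ?case using Cons by (auto simp: lookup_add in_keys_iff)
  qed simp
  then have f: "?f \<in> gams" using ys(4) by (auto simp: gams_iff keys_mono_of)
  have w: "wt ?f = q" unfolding ys(5)[symmetric] by (induction ys) (auto simp: wt_add)
  let ?y = "single ?f (mn m)"
  have y: "?y \<in> fm p q" by (rule fm_single[OF f mn_grade[OF ys(3)]]) (use ys w in auto)
  obtain s where s: "\<And>n. lookup (eps p q ?y) (n # map sing ys) = sgn_pow s (lookup (single m 1) n)"
    using lookup_eps[OF y ys(4)] by (auto simp: co_mn[OF ys(3)])
  let ?D = "single v 1 - eps p q (sgn_pow s ?y)"
  have e: "eps p q (sgn_pow s ?y) = sgn_pow s (eps p q ?y)" by (rule eps_sgn_pow[OF y])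
  have "lookup ?D w = 0" if wf: "w \<in> free_words p q" "critical dg (tl w)" for w proof -
    obtain n zs where zs: "w = n # map sing zs" "sorted_wrt (follows dg) zs" "set zs \<subseteq> X" using crit[OF wf] by blast
    show ?thesis proof (cases "mono_of zs = ?f")
      case True
      then have "zs = ys" using sorted_ordering_unique ys(2) zs(2) by blast
      then show ?thesis unfolding e lookup_minus lookup_sgn_pow zs(1) ys(1) by (simp only: s) (simp add: lookup_single when_def)
    next
      case False
      then have "zs \<noteq> ys" by blast
      then have "w \<noteq> v" using zs(1) ys(1) by (simp add: map_sing_eq)
      moreover have "lookup (eps p q ?y) w = 0" using lookup_eps[OF y zs(3)] co_scale[of 0 0] False zs(1) by (auto simp: lookup_single)
      ultimately show ?thesis unfolding e lookup_minus lookup_sgn_pow by (simp add: lookup_single)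
    qed
  qed
  moreover have "keys ?D \<subseteq> free_words p q" using v(1) keys_eps[OF fm_sgn_pow[OF y]] by (intro keys_diff_subset keys_single_subset)
  ultimately have "keys ?D \<subseteq> {w \<in> free_words p q. \<not> critical dg (tl w)}" by (auto simp: in_keys_iff)
  then show ?thesis using fm_sgn_pow[OF y] by blast
qed

lemma critical_split: assumes z: "keys z \<subseteq> free_words p q"
  shows "\<exists>y\<in>fm p q. keys (z - eps p q y) \<subseteq> {w \<in> free_words p q. \<not> critical dg (tl w)}"
proof -
  let ?N = "{w \<in> free_words p q. \<not> critical dg (tl w)}"
  have "\<exists>y\<in>fm p q. keys (single v 1 - eps p q y) \<subseteq> ?N" if "v \<in> keys z" for v proof (cases "critical dg (tl v)")
    case True
    then show ?thesis using critical_form that z by blast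
  next
    case False
    then show ?thesis using that z fm_0 by (intro bexI[of _ 0]) auto
  qed
  then have "\<forall>v\<in>keys z. \<exists>y. y \<in> fm p q \<and> keys (single v 1 - eps p q y) \<subseteq> ?N" by blast
  from bchoice[OF this] obtain Y where Y: "\<And>v. v \<in> keys z \<Longrightarrow> Y v \<in> fm p q \<and> keys (single v 1 - eps p q (Y v)) \<subseteq> ?N"
    by blast
  let ?y = "\<Sum>v\<in>keys z. forms_scale L (lookup z v) (Y v)"
  have "eps p q ?y = (\<Sum>v\<in>keys z. fscale (lookup z v) (eps p q (Y v)))" using Y by (simp add: eps_sum fm_scale eps_scale)
  moreover have "z = (\<Sum>v\<in>keys z. fscale (lookup z v) (single v 1))" by (rule poly_mapping_sum_single)
  ultimately have 1: "z - eps p q ?y = (\<Sum>v\<in>keys z. fscale (lookup z v) (single v 1 - eps p q (Y v)))"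
    unfolding fs.scale_right_diff_distrib sum_subtractf by simp
  have "keys (z - eps p q ?y) \<subseteq> ?N" unfolding 1 using Y by (intro keys_sum_subset order_trans[OF keys_fscale]) blast
  moreover have "?y \<in> fm p q" using Y by (intro fm_sum fm_scale) blast
  ultimately show ?thesis by blast
qed

text \<open>Any ordering of the letters of a monomial displays its coefficient up to sign.\<close>

lemma eps_eq_0: assumes y: "y \<in> fm p q" "eps p q y = 0" shows "y = 0"
proof (rule ccontr)
  assume "y \<noteq> 0"
  then obtain f where f: "f \<in> keys y" by (metis keys_eq_empty all_not_in_conv)
  obtain ys where ys: "mono_of ys = f" "set ys = keys f" using ex_sorted_ordering fm_keys[OF y(1) f] by blast
  have "set ys \<subseteq> X" using ys(2) fm_keys[OF y(1) f] by (simp add: gams_iff)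
  from lookup_eps[OF y(1) this] have "lookup (co (lookup y f)) m = 0" for m unfolding y(2) ys(1) by (auto simp: sgn_pow_def split: if_splits)
  then have "co (lookup y f) = 0" by (intro poly_mapping_eqI) simp
  then have "lookup y f = 0" using co(2)[of "lookup y f"] by (simp add: val_def)
  then show False using f by (simp add: in_keys_iff)
qed

lemma bw_eps: assumes "y \<in> fm p q" shows "bw (eps p q y) = 0"
proof -
  have s: "bw (ysum n e F) = ysum n e (\<lambda>u. bw (F u))" for n e F by (induction n arbitrary: e F) (simp_all add: bw_simps)
  have "bw (nform (p - mdeg f) (lookup y f) q f) = 0" if "f \<in> keys y" for f proof -
    have f: "f \<in> gams" "wt f = q" and a: "lookup y f \<in> grade L (p - mdeg f)" using fm_keys[OF assms that] fm_lookup[OF assms] by auto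
    have "ysum q f (\<lambda>u. bw (nf ((p - mdeg f, lookup y f) # u))) = ysum q f (\<lambda>u. hb nf ((p - mdeg f, lookup y f) # u))"
      using a by (intro ysum_cong f hb_nf[symmetric]) auto
    then show ?thesis unfolding nform_def s using ysum_hb[OF nf_multilin f, of "(p - mdeg f, lookup y f)"] a by simp
  qed
  then show ?thesis by (simp add: eps_def bw_simps)
qed

text \<open>A boundary removes the splittable words and a form the critical ones. What is left is a
  cycle, so \<open>split_free_eq_0\<close> applies; for \<open>q = 0\<close> every word is critical
  and nothing is left.\<close>

theorem eps_surj: assumes z: "keys z \<subseteq> words p q" "bw z = 0" shows "\<exists>y\<in>fm p q. z - eps p q y \<in> bounds p q"
proof -
  obtain u where u: "keys u \<subseteq> words p (Suc q)" "keys (z - bw u) \<subseteq> free_words p q" using split_free_reduction[OF z(1)] by blast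
  obtain y where y: "y \<in> fm p q" "keys (z - bw u - eps p q y) \<subseteq> {w \<in> free_words p q. \<not> critical dg (tl w)}"
    using critical_split[OF u(2)] by blast
  have b: "bw (z - bw u - eps p q y) = 0" using bw_bw(2)[OF u(1)] bw_eps[OF y(1)] z(2) by (simp add: bw_simps)
  have "z - bw u - eps p q y = 0" proof (cases q)
    case 0
    have "critical dg (tl w)" if "w \<in> free_words p q" for w
      using that 0 unfolding critical_def by (auto simp: free_words_def words_def length_Suc_conv)
    then have "keys (z - bw u - eps p q y) = {}" using y(2) by blast
    then show ?thesis by simp
  next
    case (Suc r)
    show ?thesis by (rule split_free_eq_0[of _ p r]) (use y(2) b Suc in auto)
  qed
  then have "z - eps p q y = bw u" by (simp add: algebra_simps)
  then show ?thesis using y(1) u(1) unfolding bounds_def by blast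
qed

text \<open>Correcting the bounding chain \<open>u\<close> by a boundary and a form does not change
  its boundary, which is supported on unsplittable words. After the correction no critical words are
  left, so \<open>split_free_eq_0\<close> makes the chain zero.\<close>

theorem eps_inj: assumes y: "y \<in> fm p q" "eps p q y \<in> bounds p q" shows "y = 0"
proof -
  obtain u where u: "keys u \<subseteq> words p (Suc q)" "eps p q y = bw u" using y(2) unfolding bounds_def by blast
  obtain u' where u': "keys u' \<subseteq> words p (Suc (Suc q))" "keys (u - bw u') \<subseteq> free_words p (Suc q)"
    using split_free_reduction[OF u(1)] by blast
  obtain y' where y': "y' \<in> fm p (Suc q)" "keys (u - bw u' - eps p (Suc q) y') \<subseteq> {w \<in> free_words p (Suc q). \<not> critical dg (tl w)}"
    using critical_split[OF u'(2)] by blast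
  have b: "bw (u - bw u' - eps p (Suc q) y') = eps p q y" using bw_bw(2)[OF u'(1)] bw_eps[OF y'(1)] u(2) by (simp add: bw_simps)
  have "u - bw u' - eps p (Suc q) y' = 0" by (rule split_free_eq_0[OF y'(2)]) (use b keys_eps[OF y(1)] in simp)
  then have "eps p q y = 0" using b by (simp add: bw_simps)
  then show ?thesis by (rule eps_eq_0[OF y(1)])
qed

text \<open>The Hochschild-Kostant-Rosenberg map on representatives; its expansion in words is
  \<open>eps\<close>.\<close>

definition hkr :: "nat \<Rightarrow> nat \<Rightarrow> ('x, 'l) forms \<Rightarrow> ('l tensor \<Rightarrow>\<^sub>0 'k)" where
  "hkr p q \<omega> = (\<Sum>f\<in>keys \<omega>. sgn_pow ((p - mdeg f) * q) (ysum q f (\<lambda>u. single ((p - mdeg f, lookup \<omega> f) # u) 1)))"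

lemma lin_extend_hkr: "lin_extend F (hkr p q \<omega>) = (\<Sum>f\<in>keys \<omega>. sgn_pow ((p - mdeg f) * q)
     (ysum q f (\<lambda>u. F ((p - mdeg f, lookup \<omega> f) # u))))" for F :: "'l tensor \<Rightarrow> 'c \<Rightarrow>\<^sub>0 'k"
proof -
  have "lin_extend F (ysum n e G) = ysum n e (\<lambda>u. lin_extend F (G u))" for n e and G :: "'l tensor \<Rightarrow> 'l tensor \<Rightarrow>\<^sub>0 'k"
    by (induction n arbitrary: e G) (simp_all add: lin_extend_sum lin_extend_sgn_pow)
  then show ?thesis by (simp add: hkr_def lin_extend_sum lin_extend_sgn_pow)
qed

lemma nf_hkr: "lin_extend nf (hkr p q \<omega>) = eps p q \<omega>" unfolding lin_extend_hkr eps_def nform_def ..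

lemma keys_hkr: assumes "\<omega> \<in> fm p q" shows "keys (hkr p q \<omega>) \<subseteq> tensors L p q" unfolding hkr_def
proof (intro keys_sum_subset, unfold keys_sgn_pow)
  fix f assume f: "f \<in> keys \<omega>"
  let ?S = "{v :: 'l tensor \<Rightarrow>\<^sub>0 'k. keys v \<subseteq> tensors L p q}"
  have "ysum q f (\<lambda>u. single ((p - mdeg f, lookup \<omega> f) # u) 1) \<in> ?S"
    using fm_keys[OF assms f] fm_lookup[OF assms, of f] by (intro ysum_mem) (auto simp: tensors_iff dest!: subsetD[OF keys_add])
  then show "keys (ysum q f (\<lambda>u. single ((p - mdeg f, lookup \<omega> f) # u) (1::'k))) \<subseteq> tensors L p q" by simp
qed

end

section \<open>The comparison as an equivalence of mixed complexes\<close>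

context gamma_forms
begin

abbreviation vbd where "vbd \<equiv> cyclic.HH.vbd"

abbreviation Frm where "Frm \<equiv> forms_complex L X dg d \<delta>"

lemma d_sum: "(\<And>i. i \<in> I \<Longrightarrow> u i \<in> fm p q) \<Longrightarrow> d (\<Sum>i\<in>I. u i) = (\<Sum>i\<in>I. d (u i))"
  and delta_sum: "(\<And>i. i \<in> I \<Longrightarrow> u i \<in> fm p q) \<Longrightarrow> \<delta> (\<Sum>i\<in>I. u i) = (\<Sum>i\<in>I. \<delta> (u i))"
proof (induction I rule: infinite_finite_induct)
  case (insert i I)
  case 1
  then show ?case using insert d_add[of "u i" p q "\<Sum>i\<in>I. u i" p q] fm_sum[of I u p q] by simp
  case 2
  then show ?case using insert delta_add[of "u i" p q "\<Sum>i\<in>I. u i" p q] fm_sum[of I u p q] by simp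
qed (simp_all add: d_0 delta_0)

lemma hkr_delta: assumes y: "y \<in> fm (Suc p) q" shows "lin_extend (tensor_bdry L) (hkr (Suc p) q y) - hkr p q (\<delta> y) \<in> vbd p q"
proof -
  let ?a = "\<lambda>f. lookup y f" and ?k = "\<lambda>f. Suc p - mdeg f"
  have f: "f \<in> gams" "wt f = q" "mdeg f \<le> Suc p" "?a f \<in> grade L (?k f)" if "f \<in> keys y" for f
    using fm_keys[OF y that] fm_lookup[OF y] by auto
  have s: "single f (?a f) \<in> fm (Suc p) q" if "f \<in> keys y" for f using f[OF that] by (intro fm_single) auto
  have k: "keys (lin_extend (tensor_bdry L) (hkr (Suc p) q y) - hkr p q (\<delta> y)) \<subseteq> tensors L p q"
    by (intro keys_diff_subset chain_del keys_hkr fm_delta y)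
  have "\<delta> y = (\<Sum>f\<in>keys y. \<delta> (single f (?a f)))"
    using delta_sum[of "keys y" "\<lambda>f. single f (?a f)" "Suc p" q] s sum_single[of y] by simp
  then have 1: "eps p q (\<delta> y) = (\<Sum>f\<in>keys y. eps p q (\<delta> (single f (?a f))))" using s by (simp add: eps_sum fm_delta)
  have 2: "lin_extend nf (lin_extend (tensor_bdry L) (hkr (Suc p) q y)) = (\<Sum>f\<in>keys y.
      sgn_pow (?k f * q) (sgn_pow q (ysum q f (\<lambda>u. bd L nf ((?k f, ?a f) # u)))))" unfolding ev_del[OF keys_hkr[OF y]]
    unfolding lin_extend_hkr sgn_pow_sum sgn_pow_pow by (simp only: add.commute)
  have "lin_extend nf (lin_extend (tensor_bdry L) (hkr (Suc p) q y)) - eps p q (\<delta> y) \<in> bounds p q"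
    unfolding 1 2 sum_subtractf[symmetric] by (intro bounds_sum ysum_bd_delta f) (use f in force)+
  then show ?thesis unfolding vbd_iff[OF k] lin_extend_diff nf_hkr .
qed

lemma hkr_d: assumes y: "y \<in> fm p q" shows "lin_extend connes_B (hkr p q y) - hkr p (Suc q) (d y) \<in> vbd p (Suc q)"
proof -
  let ?a = "\<lambda>f. lookup y f" and ?k = "\<lambda>f. p - mdeg f"
  have f: "f \<in> gams" "wt f = q" "mdeg f \<le> p" "?a f \<in> grade L (?k f)" if "f \<in> keys y" for f
    using fm_keys[OF y that] fm_lookup[OF y] by auto
  have s: "single f (?a f) \<in> fm p q" if "f \<in> keys y" for f using f[OF that] by (intro fm_single) auto
  have k: "keys (lin_extend connes_B (hkr p q y) - hkr p (Suc q) (d y)) \<subseteq> tensors L p (Suc q)"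
    by (intro keys_diff_subset chain_B keys_hkr fm_d y)
  have "d y = (\<Sum>f\<in>keys y. d (single f (?a f)))" using d_sum[of "keys y" "\<lambda>f. single f (?a f)" p q] s sum_single[of y] by simp
  then have 1: "eps p (Suc q) (d y) = (\<Sum>f\<in>keys y. eps p (Suc q) (d (single f (?a f))))" using s by (simp add: eps_sum fm_d)
  have 2: "lin_extend nf (lin_extend connes_B (hkr p q y)) = (\<Sum>f\<in>keys y.
      sgn_pow (?k f * q) (ysum q f (\<lambda>u. nrm (ones nf) ((?k f, ?a f) # u))))" unfolding ev_B[OF keys_hkr[OF y]] unfolding lin_extend_hkr ..
  have "lin_extend nf (lin_extend connes_B (hkr p q y)) - eps p (Suc q) (d y) \<in> bounds p (Suc q)"
    unfolding 1 2 sum_subtractf[symmetric] by (intro bounds_sum ysum_nrm_d f) (use f in force)+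
  then show ?thesis unfolding vbd_iff[OF k] lin_extend_diff nf_hkr .
qed

lemma hkr_inj: "y \<in> fm p q \<Longrightarrow> hkr p q y \<in> vbd p q \<Longrightarrow> y = 0"
  unfolding vbd_iff[OF keys_hkr] nf_hkr by (rule eps_inj)

text \<open>
  As the comparison map is injective on homology, the identities between \<open>d\<close> and \<open>\<delta>\<close> follow from those
  between the operators of the cyclic complex.
\<close>

lemma d_d: assumes y: "y \<in> fm p q" shows "d (d y) = 0"
proof -
  let ?B = "lin_extend connes_B"
  have 1: "?B (?B (hkr p q y) - hkr p (Suc q) (d y)) \<in> vbd p (Suc (Suc q))" using cyclic.B_vbd[OF hkr_d[OF y]] by (simp add: Cyc_simps)
  have 2: "?B (?B (hkr p q y)) \<in> vbd p (Suc (Suc q))"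
    using cyclic.B_B[of "hkr p q y" p q] keys_hkr[OF y] cyclic.HH.rel_vbd[of _ p "Suc (Suc q)"] by (simp add: Cyc_simps HH_complex_def)
  have "hkr p (Suc (Suc q)) (d (d y)) \<in> vbd p (Suc (Suc q))"
    using cyclic.HH.vbd_diff[OF cyclic.HH.vbd_diff[OF 2 1] hkr_d[OF fm_d[OF y]]] by (simp add: lin_extend_diff)
  then show ?thesis by (rule hkr_inj[OF fm_d[OF fm_d[OF y]]])
qed

lemma delta_delta: assumes y: "y \<in> fm (Suc (Suc p)) q" shows "\<delta> (\<delta> y) = 0"
proof -
  let ?D = "lin_extend (tensor_bdry L)"
  have 1: "?D (?D (hkr (Suc (Suc p)) q y) - hkr (Suc p) q (\<delta> y)) \<in> vbd p q"
    using cyclic.HH.horiz_vbd[OF hkr_delta[OF y]] by (simp add: Cyc_simps HH_complex_def)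
  have 2: "?D (?D (hkr (Suc (Suc p)) q y)) \<in> vbd p q"
    using cyclic.del_del[of "hkr (Suc (Suc p)) q y" p q] keys_hkr[OF y] cyclic.HH.rel_vbd[of _ p q] by (simp add: Cyc_simps HH_complex_def)
  have "hkr p q (\<delta> (\<delta> y)) \<in> vbd p q"
    using cyclic.HH.vbd_diff[OF cyclic.HH.vbd_diff[OF 2 1] hkr_delta[OF fm_delta[OF y]]] by (simp add: lin_extend_diff)
  then show ?thesis by (rule hkr_inj[OF fm_delta[OF fm_delta[OF y]]])
qed

lemma d_delta: assumes y: "y \<in> fm (Suc p) q" shows "d (\<delta> y) + \<delta> (d y) = 0"
proof -
  let ?D = "lin_extend (tensor_bdry L)" and ?B = "lin_extend connes_B" and ?V = "vbd p (Suc q)"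
  let ?h = "hkr (Suc p) q y"
  have 1: "?B (?D ?h - hkr p q (\<delta> y)) \<in> ?V" using cyclic.B_vbd[OF hkr_delta[OF y]] by (simp add: Cyc_simps)
  have 2: "?D (?B ?h - hkr (Suc p) (Suc q) (d y)) \<in> ?V" using cyclic.HH.horiz_vbd[OF hkr_d[OF y]] by (simp add: Cyc_simps HH_complex_def)
  have 3: "?B (?D ?h) + ?D (?B ?h) \<in> ?V"
    using cyclic.B_del[of ?h p q] keys_hkr[OF y] cyclic.HH.rel_vbd[of _ p "Suc q"] by (simp add: Cyc_simps HH_complex_def)
  have "hkr p (Suc q) (d (\<delta> y)) + hkr p (Suc q) (\<delta> (d y)) \<in> ?V"
    using cyclic.HH.vbd_diff[OF cyclic.HH.vbd_diff[OF 3 cyclic.HH.vbd_add[OF 1 2]] cyclic.HH.vbd_add[OF hkr_d[OF fm_delta[OF y]] hkr_delta[OF fm_d[OF y]]]]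
    by (simp add: lin_extend_diff algebra_simps)
  moreover have m: "d (\<delta> y) \<in> fm p (Suc q)" "\<delta> (d y) \<in> fm p (Suc q)" using y by (auto intro: fm_d fm_delta)
  \<comment> \<open>\<open>hkr\<close> is additive only modulo relations, so the sum of the two
    forms is tested through \<open>eps\<close>, which is strictly additive.\<close>
  have "keys (hkr p (Suc q) (d (\<delta> y)) + hkr p (Suc q) (\<delta> (d y))) \<subseteq> tensors L p (Suc q)" by (intro keys_add_subset keys_hkr m)
  from vbd_iff[OF this] have "eps p (Suc q) (d (\<delta> y) + \<delta> (d y)) \<in> bounds p (Suc q)"
    using calculation by (simp add: lin_extend_add nf_hkr eps_add[OF m])
  then show ?thesis by (rule eps_inj[OF fm_add[OF m]])
qed

lemma forms_linear_mixed_complex: "linear_mixed_complex Frm"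
proof -
  have m: "module (forms_scale L)" by unfold_locales (auto intro!: poly_mapping_eqI simp: lookup_add sm.scale_right_distrib sm.scale_left_distrib)
  interpret fsc: module "forms_scale L" by (rule m)
  have sq: "subquotient (forms_scale L) (fm p q, {0})" for p q unfolding subquotient_def by (auto intro!: fsc.subspaceI simp: fm_0 fm_add fm_scale)
  show ?thesis by (rule linear_mixed_complex.intro; unfold forms_complex_def mixed_complex.simps fst_conv snd_conv singleton_iff;
      (rule m | rule sq | rule d_add delta_add d_scale delta_scale fm_d fm_delta d_d delta_delta d_delta; assumption
        | simp add: fm_0 d_0 delta_0))
qed

text \<open>\<open>vcyc_iff\<close> and \<open>vbd_iff\<close> translate vertical homology to words,
  where \<open>eps\<close> is linear and \<open>eps_surj\<close> and \<open>eps_inj\<close> give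
  bijectivity.\<close>

theorem hkr_equivalence: "mixed_equivalence Cyc Frm hkr"
proof -
  interpret N: linear_mixed_complex Frm by (rule forms_linear_mixed_complex)
  have N: "mxZ Frm p q = fm p q" "mxN Frm p q = {0}" "mx_D Frm y = 0" "mx_scale Frm = forms_scale L" "mx_del Frm = \<delta>" "mx_B Frm = d" for p q y
    by (simp_all add: forms_complex_def)
  show ?thesis proof (unfold_locales, unfold N Cyc_simps)
    fix p q y assume y: "y \<in> fm p q"
    show "hkr p q y \<in> cyclic.HH.vcyc p q" unfolding vcyc_iff nf_hkr using keys_hkr[OF y] bw_eps[OF y] by simp
    show "hkr p q (forms_scale L c y) - fscale c (hkr p q y) \<in> vbd p q" for c proof -
      have k: "keys (hkr p q (forms_scale L c y) - fscale c (hkr p q y)) \<subseteq> tensors L p q"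
        by (intro keys_diff_subset keys_hkr fm_scale y order_trans[OF keys_fscale])
      show ?thesis unfolding vbd_iff[OF k] by (simp add: lin_extend_diff lin_extend_scale nf_hkr eps_scale[OF y] bounds_0)
    qed
    show "hkr p q (y + y') - (hkr p q y + hkr p q y') \<in> vbd p q" if y': "y' \<in> fm p q" for y' proof -
      have k: "keys (hkr p q (y + y') - (hkr p q y + hkr p q y')) \<subseteq> tensors L p q"
        by (intro keys_diff_subset keys_add_subset keys_hkr fm_add y y')
      show ?thesis unfolding vbd_iff[OF k] by (simp add: lin_extend_diff lin_extend_add nf_hkr eps_add[OF y y'] bounds_0)
    qed
  next
    fix p q x assume "x \<in> cyclic.HH.vcyc p q"
    then have x: "keys x \<subseteq> tensors L p q" "bw (lin_extend nf x) = 0" unfolding vcyc_iff by auto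
    have "keys (lin_extend nf x) \<subseteq> words p q" by (rule keys_lin_extend_subset) (use x keys_nf in blast)
    from eps_surj[OF this x(2)] obtain y where y: "y \<in> fm p q" "lin_extend nf x - eps p q y \<in> bounds p q" by blast
    have k: "keys (x - hkr p q y) \<subseteq> tensors L p q" by (intro keys_diff_subset keys_hkr x y)
    have "x - hkr p q y \<in> vbd p q" unfolding vbd_iff[OF k] lin_extend_diff nf_hkr by (rule y)
    then show "\<exists>y\<in>fm p q. x - hkr p q y \<in> vbd p q" using y(1) by blast
  qed (auto intro: hkr_inj hkr_delta hkr_d)
qed

end

theorem corollary2p2:
  fixes A :: "('k::comm_ring_1, 'a::{ring, monoid_mult}) chain_alg" and L :: "('k, 'l::{ring, monoid_mult}) chain_alg"
    and X :: "'x::linorder set" and dg :: "'x \<Rightarrow> nat" and gen :: "'x \<Rightarrow> 'l" and \<pi> :: "'l \<Rightarrow> 'a"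
    and d \<delta> :: "('x, 'l) forms \<Rightarrow> ('x, 'l) forms" assumes A: "chain_algebra A" and model: "free_model L X dg gen A \<pi>"
    and d: "is_forms_d L X dg gen d" and \<delta>: "is_forms_delta L X dg gen d \<delta>"
  shows "(\<exists>(E :: nat \<Rightarrow> nat \<Rightarrow> nat \<Rightarrow> (nat \<Rightarrow> 'l tensor \<Rightarrow>\<^sub>0 'k) subquot) dE.
            spectral_sequence (HH_scale (cyclic_complex L)) 2 E dE \<and>
            (\<forall>p q. sq_isomorphic (HH_scale (cyclic_complex L)) (HH_scale (forms_complex L X dg d \<delta>))
                     (E 2 p q) (HH_layer (forms_complex L X dg d \<delta>) (p + q) q)) \<and> ss_converges (HH_scale (cyclic_complex L)) E
              (HH_scale (cyclic_complex L)) (Shukla_HH L) (Hodge_filtration_HH L) \<and>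
            (\<forall>p q. ss_infinity (HH_scale (cyclic_complex L)) E (HH_scale (cyclic_complex L)) p q (Shukla_HH_layer L (p + q) q)))
       \<and> (\<exists>(E' :: nat \<Rightarrow> nat \<Rightarrow> nat \<Rightarrow> (nat \<Rightarrow> nat \<Rightarrow> 'l tensor \<Rightarrow>\<^sub>0 'k) subquot) dE'.
            spectral_sequence (HC_scale (cyclic_complex L)) 2 E' dE' \<and>
            (\<forall>p q. sq_isomorphic (HC_scale (cyclic_complex L)) (HC_scale (forms_complex L X dg d \<delta>))
                     (E' 2 p q) (HC_layer (forms_complex L X dg d \<delta>) (p + q) q)) \<and> ss_converges (HC_scale (cyclic_complex L)) E'
              (HC_scale (cyclic_complex L)) (Shukla_HC L) (Hodge_filtration_HC L) \<and>
            (\<forall>p q. ss_infinity (HC_scale (cyclic_complex L)) E' (HC_scale (cyclic_complex L)) p q (Shukla_HC_layer L (p + q) q)))"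
proof -
  interpret model: free_model L X dg gen A \<pi> by (rule model)
  interpret gamma_forms L X dg gen d \<delta> by unfold_locales (rule d, rule \<delta>)
  interpret mixed_equivalence "cyclic_complex L" "forms_complex L X dg d \<delta>" model.hkr by (rule hkr_equivalence)
  have "Shukla_HH L = HH (cyclic_complex L)" "Shukla_HC L = HC (cyclic_complex L)" by (simp_all add: fun_eq_iff Shukla_HH_def Shukla_HC_def)
  then show ?thesis using second_pages by (simp only: Hodge_filtration_HH_def Hodge_filtration_HC_def Shukla_HH_layer_def Shukla_HC_layer_def)
qed

end
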